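(* Let $d\ge1$ and let $(k,\ell)$ be a pair of diagonal holomorphic kernels on a domain $\Omega\subseteq\mathbb{C}^d$ with $\mathbf{0}\in\Omega$. Then $(k,\ell)$ is a complete Pick pair if and only if it is a complete Carathéodory pair.
   Context: A kernel on a non-empty set $X$ is a function $k:X\times X\to\mathbb{C}$ such that $[k(z_i,z_j)]_{i,j=1}^n$ is positive semi-definite for all finite choices of points; $\mathcal{H}_k$ is the reproducing kernel Hilbert space. $\mathrm{Mult}(\mathcal{H}_k\otimes\mathbb{C}^N,\mathcal{H}_\ell\otimes\mathbb{C}^N)$ is the set of $\Phi:X\to\mathbb{M}_N$ (complex $N\times N$ matrices) with $\Phi f\in\mathcal{H}_\ell\otimes\mathbb{C}^N$ for all $f\in\mathcal{H}_k\otimes\mathbb{C}^N$, normed by the operator norm of $f\mapsto\Phi f$; $\Phi$ is a contractive multiplier if its norm is at most one. $(k,\ell)$ is a complete Pick pair if for all $n,N\ge1$, all $z_1,\dots,z_n\in X$ and all $W_1,\dots,W_n\in\mathbb{M}_N$ with $[\ell(z_i,z_j)I_{N\times N}-k(z_i,z_j)W_iW_j^*]_{i,j=1}^n$ positive semi-definite, there is a contractive multiplier $\Phi\in\mathrm{Mult}(\mathcal{H}_k\otimes\mathbb{C}^N,\mathcal{H}_\ell\otimes\mathbb{C}^N)$ with $\Phi(z_i)=W_i$ for all $i$. A domain is open, connected and non-empty. $\mathbb{N}$ includes $0$. A diagonal holomorphic kernel on a domain $\Omega\ni\mathbf{0}$ is a kernel $f$ on $\Omega$, holomorphic in $z$ and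 conjugate holomorphic in $w$, whose power series at $\mathbf{0}$ has the form $f(z,w)=\sum_{a\in\mathbb{N}^d}f_az^a\overline{w}^a$ with all $f_a>0$. For $a,b\in\mathbb{N}^d$, $a\le b$ means $a_i\le b_i$ for all $i$. A non-empty set $F\subseteq\mathbb{N}^d$ is co-invariant if $b\in F$ and $a\le b$ imply $a\in F$. A pair $(k,\ell)$ of diagonal holomorphic kernels is a complete Carathéodory pair if for every positive integer $J$, every finite co-invariant $\varnothing\ne F\subseteq\mathbb{N}^d$ and every collection $\{c_a:a\in F\}\subseteq\mathbb{M}_J$, the block matrix $C$ indexed by $F\times F$ with $J\times J$ blocks $$C_{a,b}=\begin{cases}c_{b-a}\sqrt{k_a/\ell_b},&b\ge a,\\ \mathbf{0},&\text{otherwise,}\end{cases}$$ is a contraction if and only if there exists a collection $\{c_a:a\in\mathbb{N}^d\setminus F\}\subseteq\mathbb{M}_J$ such that $\Phi(z)=\sum_{a\in\mathbb{N}^d}z^a\otimes c_a^*$ is a contractive multiplier from $\mathcal{H}_k\otimes\mathbb{C}^J$ to $\mathcal{H}_\ell\otimes\mathbb{C}^J$. *)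

theory Defs
  imports
    "HOL-Analysis.Analysis"
    "Jordan_Normal_Form.Schur_Decomposition"
begin

no_notation Matrix.vec_index (infixl "$" 100)

text \<open>Square matrices in M_N are elements of \<open>carrier_mat N N\<close>.  A matrix with rows and columns
  indexed by a finite set \<open>S\<close> is a function \<open>'s \<Rightarrow> 's \<Rightarrow> complex\<close>; only its values on \<open>S\<close> matter.
  The order on \<open>complex\<close> is that of \<open>Complex_Order\<close>: \<open>0 \<le> c\<close> means that \<open>c\<close> is real and
  nonnegative.\<close>

definition psd_on :: "'s set \<Rightarrow> ('s \<Rightarrow> 's \<Rightarrow> complex) \<Rightarrow> bool" where
  "psd_on S A \<longleftrightarrow> (\<forall>x :: 's \<Rightarrow> complex. 0 \<le> (\<Sum>p\<in>S. \<Sum>q\<in>S. cnj (x p) * A p q * x q))"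

definition contraction_on :: "'s set \<Rightarrow> ('s \<Rightarrow> 's \<Rightarrow> complex) \<Rightarrow> bool" where
  "contraction_on S A \<longleftrightarrow> (\<forall>x :: 's \<Rightarrow> complex.
     (\<Sum>p\<in>S. (cmod (\<Sum>q\<in>S. A p q * x q))\<^sup>2) \<le> (\<Sum>q\<in>S. (cmod (x q))\<^sup>2))"

text \<open>A block matrix with \<open>N \<times> N\<close> blocks \<open>B i j\<close>, \<open>i, j \<in> I\<close>, is flattened to a scalar matrix
  indexed by \<open>I \<times> {..<N}\<close>.\<close>

definition block_entry :: "('i \<Rightarrow> 'i \<Rightarrow> complex mat) \<Rightarrow> 'i \<times> nat \<Rightarrow> 'i \<times> nat \<Rightarrow> complex" where
  "block_entry B p q = B (fst p) (fst q) $$ (snd p, snd q)"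

definition block_psd :: "'i set \<Rightarrow> nat \<Rightarrow> ('i \<Rightarrow> 'i \<Rightarrow> complex mat) \<Rightarrow> bool" where
  "block_psd I N B \<longleftrightarrow> psd_on (I \<times> {..<N}) (block_entry B)"

definition block_contraction :: "'i set \<Rightarrow> nat \<Rightarrow> ('i \<Rightarrow> 'i \<Rightarrow> complex mat) \<Rightarrow> bool" where
  "block_contraction I N B \<longleftrightarrow> contraction_on (I \<times> {..<N}) (block_entry B)"

definition is_kernel :: "'a set \<Rightarrow> ('a \<Rightarrow> 'a \<Rightarrow> complex) \<Rightarrow> bool" where
  "is_kernel X k \<longleftrightarrow>
     (\<forall>n. \<forall>z :: nat \<Rightarrow> 'a. (\<forall>i<n. z i \<in> X) \<longrightarrow> psd_on {..<n} (\<lambda>i j. k (z i) (z j)))"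

text \<open>\<open>(H, ip)\<close> is a complex Hilbert space of functions on \<open>X\<close> with reproducing kernel \<open>k\<close>.
  Functions on \<open>X\<close> are extended by \<open>0\<close> to the whole type; \<open>ip\<close> is linear in its first argument and
  its values outside \<open>H \<times> H\<close> are irrelevant.\<close>

locale rkhs =
  fixes X :: "'a set" and k :: "'a \<Rightarrow> 'a \<Rightarrow> complex"
    and H :: "('a \<Rightarrow> complex) set" and ip :: "('a \<Rightarrow> complex) \<Rightarrow> ('a \<Rightarrow> complex) \<Rightarrow> complex"
  assumes supported: "\<And>f x. f \<in> H \<Longrightarrow> x \<notin> X \<Longrightarrow> f x = 0"
    and zero_mem: "(\<lambda>_. 0) \<in> H"
    and add_mem: "\<And>f g. f \<in> H \<Longrightarrow> g \<in> H \<Longrightarrow> (\<lambda>x. f x + g x) \<in> H"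
    and scale_mem: "\<And>c f. f \<in> H \<Longrightarrow> (\<lambda>x. c * f x) \<in> H"
    and ip_add: "\<And>f g h. f \<in> H \<Longrightarrow> g \<in> H \<Longrightarrow> h \<in> H \<Longrightarrow> ip (\<lambda>x. f x + g x) h = ip f h + ip g h"
    and ip_scale: "\<And>c f h. f \<in> H \<Longrightarrow> h \<in> H \<Longrightarrow> ip (\<lambda>x. c * f x) h = c * ip f h"
    and ip_cnj: "\<And>f g. f \<in> H \<Longrightarrow> g \<in> H \<Longrightarrow> ip g f = cnj (ip f g)"
    and ip_nonneg: "\<And>f. f \<in> H \<Longrightarrow> 0 \<le> ip f f"
    and ip_definite: "\<And>f. f \<in> H \<Longrightarrow> ip f f = 0 \<Longrightarrow> f = (\<lambda>_. 0)"
    and complete: "\<And>s :: nat \<Rightarrow> 'a \<Rightarrow> complex. (\<And>n. s n \<in> H) \<Longrightarrow>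
        (\<And>e. e > 0 \<Longrightarrow> \<exists>M. \<forall>m\<ge>M. \<forall>n\<ge>M.
            sqrt (Re (ip (\<lambda>x. s m x - s n x) (\<lambda>x. s m x - s n x))) < e) \<Longrightarrow>
        \<exists>f\<in>H. (\<lambda>n. sqrt (Re (ip (\<lambda>x. s n x - f x) (\<lambda>x. s n x - f x)))) \<longlonglongrightarrow> 0"
    and kernel_mem: "\<And>w. w \<in> X \<Longrightarrow> (\<lambda>z. if z \<in> X then k z w else 0) \<in> H"
    and reproducing: "\<And>f w. f \<in> H \<Longrightarrow> w \<in> X \<Longrightarrow> ip f (\<lambda>z. if z \<in> X then k z w else 0) = f w"

text \<open>By the Moore-Aronszajn theorem every kernel has an RKHS, and the space together with its inner
  product on \<open>H \<times> H\<close> is unique, so the choice below is immaterial.\<close>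

definition rkhs_of :: "'a set \<Rightarrow> ('a \<Rightarrow> 'a \<Rightarrow> complex) \<Rightarrow>
    ('a \<Rightarrow> complex) set \<times> (('a \<Rightarrow> complex) \<Rightarrow> ('a \<Rightarrow> complex) \<Rightarrow> complex)" where
  "rkhs_of X k = (SOME (H, ip). rkhs X k H ip)"

definition rkhs_carrier :: "'a set \<Rightarrow> ('a \<Rightarrow> 'a \<Rightarrow> complex) \<Rightarrow> ('a \<Rightarrow> complex) set" where
  "rkhs_carrier X k = fst (rkhs_of X k)"

definition rkhs_inner ::
    "'a set \<Rightarrow> ('a \<Rightarrow> 'a \<Rightarrow> complex) \<Rightarrow> ('a \<Rightarrow> complex) \<Rightarrow> ('a \<Rightarrow> complex) \<Rightarrow> complex" where
  "rkhs_inner X k = snd (rkhs_of X k)"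

text \<open>The Hilbert space tensor product of the RKHS with C^N, identified as usual with the C^N-valued
  functions whose components lie in the RKHS; such functions are \<open>0\<^sub>v N\<close> outside \<open>X\<close>.\<close>

definition rkhs_tensor :: "'a set \<Rightarrow> ('a \<Rightarrow> 'a \<Rightarrow> complex) \<Rightarrow> nat \<Rightarrow> ('a \<Rightarrow> complex Matrix.vec) set" where
  "rkhs_tensor X k N =
     {f. (\<forall>x. f x \<in> carrier_vec N) \<and> (\<forall>i<N. (\<lambda>x. vec_index (f x) i) \<in> rkhs_carrier X k)}"

definition tensor_norm ::
    "'a set \<Rightarrow> ('a \<Rightarrow> 'a \<Rightarrow> complex) \<Rightarrow> nat \<Rightarrow> ('a \<Rightarrow> complex Matrix.vec) \<Rightarrow> real" where
  "tensor_norm X k N f =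
     sqrt (\<Sum>i<N. Re (rkhs_inner X k (\<lambda>x. vec_index (f x) i) (\<lambda>x. vec_index (f x) i)))"

definition mult_op ::
    "'a set \<Rightarrow> nat \<Rightarrow> ('a \<Rightarrow> complex mat) \<Rightarrow> ('a \<Rightarrow> complex Matrix.vec) \<Rightarrow> 'a \<Rightarrow> complex Matrix.vec" where
  "mult_op X N \<Phi> f = (\<lambda>x. if x \<in> X then \<Phi> x *\<^sub>v f x else 0\<^sub>v N)"

definition multiplier :: "'a set \<Rightarrow> ('a \<Rightarrow> 'a \<Rightarrow> complex) \<Rightarrow> ('a \<Rightarrow> 'a \<Rightarrow> complex) \<Rightarrow> nat \<Rightarrow>
    ('a \<Rightarrow> complex mat) \<Rightarrow> bool" where
  "multiplier X k l N \<Phi> \<longleftrightarrow> (\<forall>x\<in>X. \<Phi> x \<in> carrier_mat N N) \<and>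
     (\<forall>f\<in>rkhs_tensor X k N. mult_op X N \<Phi> f \<in> rkhs_tensor X l N)"

text \<open>The operator norm, as an extended real so that the supremum is always meaningful.\<close>

definition multiplier_norm :: "'a set \<Rightarrow> ('a \<Rightarrow> 'a \<Rightarrow> complex) \<Rightarrow> ('a \<Rightarrow> 'a \<Rightarrow> complex) \<Rightarrow> nat \<Rightarrow>
    ('a \<Rightarrow> complex mat) \<Rightarrow> ereal" where
  "multiplier_norm X k l N \<Phi> =
     (SUP f\<in>{f \<in> rkhs_tensor X k N. tensor_norm X k N f \<le> 1}.
        ereal (tensor_norm X l N (mult_op X N \<Phi> f)))"

definition contractive_multiplier :: "'a set \<Rightarrow> ('a \<Rightarrow> 'a \<Rightarrow> complex) \<Rightarrow> ('a \<Rightarrow> 'a \<Rightarrow> complex) \<Rightarrow>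
    nat \<Rightarrow> ('a \<Rightarrow> complex mat) \<Rightarrow> bool" where
  "contractive_multiplier X k l N \<Phi> \<longleftrightarrow> multiplier X k l N \<Phi> \<and> multiplier_norm X k l N \<Phi> \<le> 1"

definition complete_pick_pair ::
    "'a set \<Rightarrow> ('a \<Rightarrow> 'a \<Rightarrow> complex) \<Rightarrow> ('a \<Rightarrow> 'a \<Rightarrow> complex) \<Rightarrow> bool" where
  "complete_pick_pair X k l \<longleftrightarrow>
     (\<forall>n N. \<forall>z :: nat \<Rightarrow> 'a. \<forall>W :: nat \<Rightarrow> complex mat.
        n \<ge> 1 \<longrightarrow> N \<ge> 1 \<longrightarrow> (\<forall>i<n. z i \<in> X) \<longrightarrow> (\<forall>i<n. W i \<in> carrier_mat N N) \<longrightarrow>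
        block_psd {..<n} N
          (\<lambda>i j. l (z i) (z j) \<cdot>\<^sub>m 1\<^sub>m N - k (z i) (z j) \<cdot>\<^sub>m (W i * mat_adjoint (W j))) \<longrightarrow>
        (\<exists>\<Phi>. contractive_multiplier X k l N \<Phi> \<and> (\<forall>i<n. \<Phi> (z i) = W i)))"

text \<open>Holomorphy in several variables: complex (Frechet) differentiability at every point.\<close>

definition holomorphic_several :: "(complex^'d \<Rightarrow> complex) \<Rightarrow> (complex^'d) set \<Rightarrow> bool" where
  "holomorphic_several f \<Omega> \<longleftrightarrow>
     (\<forall>z\<in>\<Omega>. \<exists>D. (f has_derivative D) (at z) \<and> (\<forall>c v. D (c *s v) = c * D v))"

definition monomial :: "complex^'d \<Rightarrow> nat^'d \<Rightarrow> complex" where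
  "monomial z a = (\<Prod>i\<in>UNIV. (z $ i) ^ (a $ i))"

text \<open>The coefficients \<open>fc\<close> of the power series at the origin are uniquely determined by \<open>f\<close>; they are
  carried as an argument.\<close>

definition diagonal_holomorphic_kernel :: "(complex^'d) set \<Rightarrow>
    (complex^'d \<Rightarrow> complex^'d \<Rightarrow> complex) \<Rightarrow> (nat^'d \<Rightarrow> real) \<Rightarrow> bool" where
  "diagonal_holomorphic_kernel \<Omega> f fc \<longleftrightarrow>
     is_kernel \<Omega> f \<and>
     (\<forall>w\<in>\<Omega>. holomorphic_several (\<lambda>z. f z w) \<Omega>) \<and>
     (\<forall>z\<in>\<Omega>. holomorphic_several (\<lambda>w. cnj (f z w)) \<Omega>) \<and>
     (\<forall>a. fc a > 0) \<and>
     (\<exists>r>0. ball 0 r \<subseteq> \<Omega> \<and> (\<forall>z\<in>ball 0 r. \<forall>w\<in>ball 0 r.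
        ((\<lambda>a. of_real (fc a) * monomial z a * cnj (monomial w a)) has_sum f z w) UNIV))"

text \<open>The order and the subtraction on \<open>nat^'d\<close> are componentwise.\<close>

definition co_invariant :: "(nat^'d) set \<Rightarrow> bool" where
  "co_invariant F \<longleftrightarrow> F \<noteq> {} \<and> (\<forall>b\<in>F. \<forall>a. a \<le> b \<longrightarrow> a \<in> F)"

definition caratheodory_block :: "nat \<Rightarrow> (nat^'d \<Rightarrow> real) \<Rightarrow> (nat^'d \<Rightarrow> real) \<Rightarrow>
    (nat^'d \<Rightarrow> complex mat) \<Rightarrow> nat^'d \<Rightarrow> nat^'d \<Rightarrow> complex mat" where
  "caratheodory_block J kc lc c a b =
     (if a \<le> b then of_real (sqrt (kc a / lc b)) \<cdot>\<^sub>m c (b - a) else 0\<^sub>m J J)"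

text \<open>The series is summed entrywise over all multi-indices, at every point of \<open>\<Omega>\<close>; \<open>has_sum\<close> is
  unconditional, i.e. absolute, convergence.\<close>

definition is_power_series :: "(complex^'d) set \<Rightarrow> nat \<Rightarrow> (nat^'d \<Rightarrow> complex mat) \<Rightarrow>
    (complex^'d \<Rightarrow> complex mat) \<Rightarrow> bool" where
  "is_power_series \<Omega> J c \<Phi> \<longleftrightarrow>
     (\<forall>z\<in>\<Omega>. \<forall>i<J. \<forall>j<J.
        ((\<lambda>a. (monomial z a \<cdot>\<^sub>m mat_adjoint (c a)) $$ (i, j)) has_sum \<Phi> z $$ (i, j)) UNIV)"

definition complete_caratheodory_pair :: "(complex^'d) set \<Rightarrow>
    (complex^'d \<Rightarrow> complex^'d \<Rightarrow> complex) \<Rightarrow> (complex^'d \<Rightarrow> complex^'d \<Rightarrow> complex) \<Rightarrow>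
    (nat^'d \<Rightarrow> real) \<Rightarrow> (nat^'d \<Rightarrow> real) \<Rightarrow> bool" where
  "complete_caratheodory_pair \<Omega> k l kc lc \<longleftrightarrow>
     (\<forall>J \<ge> 1. \<forall>F. \<forall>c :: nat^'d \<Rightarrow> complex mat.
        finite F \<longrightarrow> co_invariant F \<longrightarrow> (\<forall>a\<in>F. c a \<in> carrier_mat J J) \<longrightarrow>
        (block_contraction F J (caratheodory_block J kc lc c) \<longleftrightarrow>
         (\<exists>c' \<Phi>. (\<forall>a. c' a \<in> carrier_mat J J) \<and> (\<forall>a\<in>F. c' a = c a) \<and>
            is_power_series \<Omega> J c' \<Phi> \<and> contractive_multiplier \<Omega> k l J \<Phi>)))"

end

theory Submission
  imports Defs "HOL-Complex_Analysis.Complex_Analysis"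
begin

text \<open>Write \<open>k\<^sub>a\<close> and \<open>l\<^sub>a\<close> for the coefficients of the two kernels, which are \<open>kc a\<close> and \<open>lc a\<close> below.

Multipliers become operators on sequences.  Expressed in coefficients, the adjoint of multiplication
by \<open>\<Phi>(z) = \<Sum> z\<^sup>a c\<^sub>a\<^sup>*\<close> is the backward Toeplitz operator \<open>(T u)\<^sub>a = \<Sum>\<^sub>g c\<^sub>g u\<^sub>a\<^sub>+\<^sub>g\<close>, and \<open>\<Phi>\<close> is a
contractive multiplier iff \<open>\<Sum> k\<^sub>a |(T u)\<^sub>a|\<^sup>2 \<le> \<Sum> l\<^sub>b |u\<^sub>b|\<^sup>2\<close> for all finitely supported \<open>u\<close>
(\<open>contractive_symbol_imp_multiplier\<close>, \<open>contractive_multiplier_has_symbol\<close>,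
\<open>contractive_multiplier_imp_symbol\<close>).  This rests on two facts: the power series of a diagonal kernel
converges to the kernel on all of \<open>\<Omega> \<times> \<Omega>\<close> (\<open>diagonal_kernel_expansion\<close>), and therefore the Hilbert
space consists of the power series with finite weighted norm (\<open>mem_rkhs_carrier_iff\<close>,
\<open>rkhs_norm_ser\<close>).  From this point of view the Pick problem and the Caratheodory problem are one
problem.  A contraction that commutes with all backward shifts is given on a shift invariant space,
spanned in the first case by the sequences \<open>cnj (z\<^sub>i\<^sup>b) \<xi>\<close> and consisting in the second case of the
sequences supported in \<open>F\<close>, and it has to be extended to all sequences.

Both properties are equivalent to a numerical condition on the coefficients, \<open>row_condition\<close>: if
\<open>t \<ge> 0\<close> on the indices below \<open>b\<close> and \<open>\<Sum>\<^sub>a\<^sub>\<le>\<^sub>c t\<^sub>a k\<^sub>c\<^sub>-\<^sub>a \<le> l\<^sub>c\<close> for all \<open>c < b\<close>, then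
\<open>\<Sum>\<^sub>a\<^sub><\<^sub>b t\<^sub>a k\<^sub>b\<^sub>-\<^sub>a \<le> l\<^sub>b\<close>.

Sufficiency.  By linear programming duality the row condition provides weights \<open>g \<ge> 0\<close> with \<open>g\<^sub>0 = 0\<close>,
\<open>k\<^sub>b \<le> (g * k)\<^sub>b\<close> for \<open>b \<noteq> 0\<close> and \<open>g * l \<le> l\<close> (\<open>row_condition_imp_factor_weights\<close>).  Suppose that \<open>T\<close> is
already defined on all proper backward shifts of a vector \<open>u\<^sub>0\<close>.  Then all entries of \<open>T u\<^sub>0\<close> except the
one at \<open>0\<close> are forced, and adding up the contraction inequalities of the shifts with the weights \<open>g\<close>
bounds these entries (\<open>off_zero_bound\<close>).  A suitable entry at \<open>0\<close> then exists for the same reason as in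
Parrott's theorem (\<open>hilbert_extension_value\<close>, \<open>extend_one\<close>).  Zorn's lemma and induction along the
multi-indices define \<open>T\<close> on all unit sequences (\<open>admissible_extends_to_symbol\<close>).

Necessity.  Given \<open>t\<close>, the polynomial row with the entries \<open>sqrt t\<^sub>a z\<^sup>a\<close>, \<open>a < b\<close>, is Caratheodory data on
\<open>F = {a. a < b}\<close>.  The hypothesis on \<open>t\<close> says that the data is contractive, and the norm bound that any
solution satisfies at the index \<open>b\<close> (\<open>contractive_symbol_row\<close>) is the conclusion of the row condition.
For the Pick property the values of the same row are prescribed at the points \<open>\<epsilon> c\<close>, \<open>c \<in> F\<close>.  If the
inequalities for \<open>t\<close> are strict, then the Pick matrix is positive for small \<open>\<epsilon>\<close>, because its quadratic
form is governed by the coefficients with index in \<open>F\<close> (\<open>jet_positivity\<close>).  Finite differences show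
that the coefficients of the solutions tend to \<open>sqrt t\<^sub>a\<close> as \<open>\<epsilon>\<close> tends to \<open>0\<close>
(\<open>finite_difference_extracts_coefficient\<close>), which gives the same norm bound in the limit.\<close>

(* In what follows $ always denotes a vector component. *)
no_notation fps_nth (infixl "$" 75)

section \<open>Multi-indices and monomials\<close>

definition deg :: "nat^'d \<Rightarrow> nat" where "deg a = (\<Sum>i\<in>UNIV. a $ i)"

lemma power_deg: "q ^ deg a = (\<Prod>i\<in>UNIV. q ^ (a $ i))"
  for q :: "'a::comm_monoid_mult"
  by (simp add: deg_def power_sum)

lemma multi_le_iff: "(a::nat^'d) \<le> b \<longleftrightarrow> (\<forall>i. a $ i \<le> b $ i)"
  by (simp add: Finite_Cartesian_Product.less_eq_vec_def)

lemma zero_le_multi [simp]: "(0::nat^'d) \<le> a"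
  by (simp add: multi_le_iff)

lemma le_zero_multi [simp]: "(a::nat^'d) \<le> 0 \<longleftrightarrow> a = 0"
  by (auto simp: multi_le_iff Finite_Cartesian_Product.vec_eq_iff)

lemma multi_less_iff: "(a::nat^'d) < b \<longleftrightarrow> a \<le> b \<and> a \<noteq> b"
  by (rule less_le)

lemma multi_diff_add [simp]: "(a::nat^'d) \<le> b \<Longrightarrow> b - a + a = b"
  by (auto simp: multi_le_iff Finite_Cartesian_Product.vec_eq_iff)

lemma multi_add_diff [simp]: "(a::nat^'d) \<le> b \<Longrightarrow> a + (b - a) = b"
  by (auto simp: multi_le_iff Finite_Cartesian_Product.vec_eq_iff)

lemma multi_add_diff_cancel [simp]: "((a::nat^'d) + b) - a = b" "((a::nat^'d) + b) - b = a"
  by (auto simp: Finite_Cartesian_Product.vec_eq_iff)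

lemma multi_le_add [simp]: "(a::nat^'d) \<le> a + b" "(a::nat^'d) \<le> b + a"
  by (auto simp: multi_le_iff)

lemma multi_diff_le [simp]: "(b::nat^'d) - a \<le> b"
  by (auto simp: multi_le_iff)

lemma multi_diff_diff [simp]: "(a::nat^'d) \<le> b \<Longrightarrow> b - (b - a) = a"
  by (auto simp: multi_le_iff Finite_Cartesian_Product.vec_eq_iff)

lemma multi_diff_zero [simp]: "(b::nat^'d) - 0 = b" "(b::nat^'d) - b = 0"
  by (auto simp: Finite_Cartesian_Product.vec_eq_iff)

lemma multi_le_diff_iff: "(a::nat^'d) \<le> b \<Longrightarrow> c \<le> b - a \<longleftrightarrow> c + a \<le> b"
  unfolding multi_le_iff by (metis le_diff_conv2 vector_add_component vector_minus_component)

lemma multi_diff_add_eq: "(b::nat^'d) - a - c = b - (a + c)"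
  by (auto simp: Finite_Cartesian_Product.vec_eq_iff)

lemma multi_order: "(a::nat^'d) \<le> a" "(a::nat^'d) \<le> b \<Longrightarrow> b \<le> c \<Longrightarrow> a \<le> c"
  "(a::nat^'d) \<le> b \<Longrightarrow> b \<le> a \<Longrightarrow> a = b"
  by (auto simp: multi_le_iff Finite_Cartesian_Product.vec_eq_iff intro: antisym order_trans)

lemma deg_mono: "a \<le> b \<Longrightarrow> deg a \<le> deg b"
  by (auto simp: deg_def multi_le_iff intro: sum_mono)

lemma deg_add: "deg (a + b) = deg a + deg (b :: nat^'d)"
  by (simp add: deg_def sum.distrib)

lemma deg_eq_0_iff: "deg a = 0 \<longleftrightarrow> a = 0"
  by (auto simp: deg_def Finite_Cartesian_Product.vec_eq_iff)

lemma deg_less: "(a::nat^'d) < b \<Longrightarrow> deg a < deg b"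
proof -
  assume "a < b"
  then have le: "a \<le> b" and ne: "a \<noteq> b" unfolding multi_less_iff by blast+
  have nz: "b - a \<noteq> 0"
  proof
    assume "b - a = 0"
    then show False using multi_diff_add[OF le] ne by simp
  qed
  have "deg b = deg (b - a) + deg a" using deg_add[of "b - a" a] multi_diff_add[OF le] by simp
  moreover have "deg (b - a) \<noteq> 0" using deg_eq_0_iff nz by blast
  ultimately show ?thesis by linarith
qed

lemma multi_induct [case_names less]:
  fixes P :: "nat^'d \<Rightarrow> bool"
  assumes "\<And>b. (\<And>a. a < b \<Longrightarrow> P a) \<Longrightarrow> P b" shows "P b"
proof (induction "deg b" arbitrary: b rule: less_induct)
  case less
  show ?case by (rule assms, rule less, erule deg_less)
qed

lemma bij_vec_nth: "bij_betw vec_nth {a. a \<le> b} (Pi\<^sub>E UNIV (\<lambda>i. {..b $ i}))" for b :: "nat^'d"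
  by (rule bij_betwI[of _ _ _ vec_lambda]) (auto simp: multi_le_iff PiE_def)

lemma finite_multi_le [simp]: "finite {a :: nat^'d. a \<le> b}"
  using bij_vec_nth[of b] by (simp add: bij_betw_finite finite_PiE)

lemma finite_multi_less [simp]: "finite {a :: nat^'d. a < b}"
  by (rule finite_subset[OF _ finite_multi_le[of b]]) (auto simp: multi_less_iff)

lemma sum_prod_multi_le:
  fixes f :: "'d::finite \<Rightarrow> nat \<Rightarrow> 'a::comm_semiring_1"
  shows "(\<Sum>a | a \<le> b. \<Prod>i\<in>UNIV. f i (a $ i)) = (\<Prod>i\<in>UNIV. \<Sum>j\<le>b $ i. f i j)"
proof -
  have "(\<Sum>a | a \<le> b. \<Prod>i\<in>UNIV. f i (a $ i)) = (\<Sum>p\<in>Pi\<^sub>E UNIV (\<lambda>i. {..b $ i}). \<Prod>i\<in>UNIV. f i (p i))"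
    using sum.reindex_bij_betw[OF bij_vec_nth[of b], of "\<lambda>p. \<Prod>i\<in>UNIV. f i (p i)"] by simp
  also have "\<dots> = (\<Prod>i\<in>UNIV. \<Sum>j\<le>b $ i. f i j)"
    by (rule prod_sum_PiE[symmetric]) auto
  finally show ?thesis .
qed

lemma finite_imp_multi_bound:
  assumes "finite (F :: (nat^'d) set)" shows "\<exists>b. \<forall>a\<in>F. a \<le> b"
  using assms
proof (induction F)
  case (insert x F)
  then obtain b where "\<forall>a\<in>F. a \<le> b" by auto
  then have "\<forall>a\<in>insert x F. a \<le> x + b"
    by (auto intro: multi_order)
  then show ?case by blast
qed auto

lemma co_invariant_le: "co_invariant {a. a \<le> b}"
  unfolding co_invariant_def by (auto intro: multi_order exI[of _ 0] zero_le_multi)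

lemma co_invariant_zero: "co_invariant F \<Longrightarrow> 0 \<in> F"
  unfolding co_invariant_def by (metis all_not_in_conv zero_le_multi)

lemma co_invariant_less: "b \<noteq> 0 \<Longrightarrow> co_invariant {a. a < b}"
proof -
  assume "b \<noteq> 0"
  then have "0 \<in> {a. a < b}" by (auto simp: multi_less_iff)
  then show ?thesis unfolding co_invariant_def by (blast intro: le_less_trans)
qed

lemma summable_geometric_deg:
  fixes q :: real assumes "0 \<le> q" "q < 1"
  shows "(\<lambda>a :: nat^'d. q ^ deg a) summable_on UNIV"
proof (rule nonneg_bounded_partial_sums_imp_summable_on)
  have "(\<Sum>a\<in>F. q ^ deg a) \<le> (1 / (1 - q)) ^ CARD('d)" if fin: "finite F" for F :: "(nat^'d) set"
  proof -
    obtain b where b: "\<forall>a\<in>F. a \<le> b" using finite_imp_multi_bound[OF fin] by blast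
    have "(\<Sum>a\<in>F. q ^ deg a) \<le> (\<Sum>a | a \<le> b. q ^ deg a)"
      by (rule sum_mono2) (use b assms in auto)
    also have "\<dots> = (\<Sum>a | a \<le> b. \<Prod>i\<in>UNIV. q ^ (a $ i))" by (simp add: power_deg)
    also have "\<dots> = (\<Prod>i\<in>UNIV. \<Sum>j\<le>b $ i. q ^ j)" by (rule sum_prod_multi_le)
    also have "\<dots> \<le> (\<Prod>i\<in>(UNIV::'d set). 1 / (1 - q))"
    proof (rule prod_mono)
      fix i
      have "(\<Sum>j\<le>b $ i. q ^ j) \<le> (\<Sum>j. q ^ j)"
        by (rule sum_le_suminf) (use assms in \<open>auto intro: summable_geometric\<close>)
      also have "\<dots> = 1 / (1 - q)" using suminf_geometric[of q] assms by simp
      finally show "0 \<le> (\<Sum>j\<le>b $ i. q ^ j) \<and> (\<Sum>j\<le>b $ i. q ^ j) \<le> 1 / (1 - q)"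
        using assms by (auto intro: sum_nonneg)
    qed
    also have "\<dots> = (1 / (1 - q)) ^ CARD('d)" by simp
    finally show ?thesis .
  qed
  then show "\<forall>\<^sub>F F in finite_subsets_at_top UNIV. sum (\<lambda>a::nat^'d. q ^ deg a) F \<le> (1 / (1 - q)) ^ CARD('d)"
    by (auto intro: eventually_finite_subsets_at_top_weakI)
qed (use assms in auto)

lemma monomial_add: "monomial z (a + b) = monomial z a * monomial z b"
  by (simp add: monomial_def power_add prod.distrib)

lemma monomial_0 [simp]: "monomial z 0 = 1"
  by (simp add: monomial_def)

lemma norm_monomial: "cmod (monomial z a) = (\<Prod>i\<in>UNIV. cmod (z $ i) ^ (a $ i))"
  by (simp add: monomial_def prod_norm[symmetric] norm_power)

lemma monomial_scale: "monomial (c *s z) a = c ^ deg a * monomial z a"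
  by (simp add: monomial_def power_mult_distrib prod.distrib power_deg)

lemma norm_monomial_mono:
  assumes "\<And>i. cmod (z $ i) \<le> cmod (w $ i)"
  shows "cmod (monomial z a) \<le> cmod (monomial w a)"
  unfolding norm_monomial by (intro prod_mono) (auto intro: power_mono assms)

lemma has_sum_convolution:
  fixes f g :: "nat^'d \<Rightarrow> complex"
  assumes f: "(f has_sum A) UNIV" and g: "(g has_sum B) UNIV"
  shows "((\<lambda>b. \<Sum>a | a \<le> b. f a * g (b - a)) has_sum (A * B)) UNIV"
proof -
  have af: "(\<lambda>x. norm (f x)) summable_on UNIV" and ag: "(\<lambda>x. norm (g x)) summable_on UNIV"
    using f g by (auto simp: summable_on_iff_abs_summable_on_complex[symmetric] has_sum_imp_summable)
  have "((\<lambda>(x, y). f x * g y) has_sum (A * B)) (UNIV \<times> UNIV)"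
  proof (rule has_sum_SigmaI)
    show "((\<lambda>y. case (x, y) of (x, y) \<Rightarrow> f x * g y) has_sum f x * B) UNIV" for x
      using has_sum_cmult_right[OF g, of "f x"] by simp
    show "((\<lambda>x. f x * B) has_sum A * B) UNIV" by (rule has_sum_cmult_left[OF f])
    have "(\<lambda>(x, y). norm (f x) * norm (g y)) summable_on UNIV \<times> UNIV"
    proof (rule summable_on_SigmaI)
      show "((\<lambda>y. case (x, y) of (x, y) \<Rightarrow> norm (f x) * norm (g y)) has_sum
          norm (f x) * infsum (\<lambda>y. norm (g y)) UNIV) UNIV" for x
        using has_sum_cmult_right[OF has_sum_infsum[OF ag], of "norm (f x)"] by simp
      show "(\<lambda>x. norm (f x) * infsum (\<lambda>y. norm (g y)) UNIV) summable_on UNIV"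
        by (rule summable_on_cmult_left[OF af])
    qed auto
    then show "(\<lambda>(x, y). f x * g y) summable_on UNIV \<times> UNIV"
      unfolding case_prod_beta norm_mult[symmetric] by (rule abs_summable_summable)
  qed
  then have *: "((\<lambda>(b, a). f a * g (b - a)) has_sum (A * B)) (SIGMA b:UNIV. {a. a \<le> b})"
    by (subst has_sum_reindex_bij_witness[where T = "UNIV \<times> UNIV" and h = "\<lambda>(x, y). f x * g y"
          and i = "\<lambda>(x, y). (x + y, x)" and j = "\<lambda>(b, a). (a, b - a)" and s' = "A * B"]) auto
  show ?thesis
    by (rule has_sum_SigmaD[OF *, unfolded case_prod_conv]) (auto intro: has_sum_finiteI)
qed

section \<open>The row condition and its dual weights\<close>

definition conv :: "(nat^'d \<Rightarrow> real) \<Rightarrow> (nat^'d \<Rightarrow> real) \<Rightarrow> nat^'d \<Rightarrow> real" where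
  "conv f h b = (\<Sum>a | a \<le> b. f a * h (b - a))"

text \<open>The premise says that the row \<open>(sqrt (t a) z\<^sup>a)\<^sub>a\<^sub><\<^sub>b\<close> is contractive as far as it can be tested on the
indices below \<open>b\<close>; the conclusion is the first inequality that an extension of this row meets at \<open>b\<close>.\<close>

definition row_condition :: "(nat^'d \<Rightarrow> real) \<Rightarrow> (nat^'d \<Rightarrow> real) \<Rightarrow> bool" where
  "row_condition kc lc \<longleftrightarrow> (\<forall>b t. (\<forall>c<b. 0 \<le> t c \<and> conv t kc c \<le> lc c) \<longrightarrow>
     (\<Sum>a | a < b. t a * kc (b - a)) \<le> lc b)"

lemma conv_split_last: "conv f h b = (\<Sum>a | a < b. f a * h (b - a)) + f b * h 0"
proof -
  have *: "{a. a \<le> b} = insert b {a. a < b}" by (auto simp: multi_less_iff)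
  show ?thesis unfolding conv_def * by (subst sum.insert) (auto simp: add.commute)
qed

text \<open>Nonnegative weights \<open>g\<close> with \<open>g\<^sub>0 = 0\<close> and \<open>k\<^sub>b \<le> (g * k)\<^sub>b\<close> for \<open>b \<noteq> 0\<close>, each as small as the earlier
ones permit.\<close>

function greedy :: "(nat^'d \<Rightarrow> real) \<Rightarrow> nat^'d \<Rightarrow> real" where
  "greedy kc b = (if b = 0 then 0
     else max 0 ((kc b - (\<Sum>a | a < b. greedy kc a * kc (b - a))) / kc 0))"
  by pat_completeness auto
termination by (relation "Wellfounded.measure (\<lambda>(kc, b). deg b)") (auto simp del: sum_eq_0_iff intro: deg_less)

text \<open>The solution of the complementary slackness equations: \<open>t * k = l\<close> on the indices in \<open>A\<close>, and \<open>t = 0\<close>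
on the others.\<close>

function dual_weight :: "(nat^'d \<Rightarrow> bool) \<Rightarrow> (nat^'d \<Rightarrow> real) \<Rightarrow> (nat^'d \<Rightarrow> real) \<Rightarrow> nat^'d \<Rightarrow> real" where
  "dual_weight A kc lc c = (if A c
     then (lc c - (\<Sum>a | a < c. dual_weight A kc lc a * kc (c - a))) / kc 0 else 0)"
  by pat_completeness auto
termination by (relation "Wellfounded.measure (\<lambda>(A, kc, lc, b). deg b)") (auto intro: deg_less)

declare greedy.simps [simp del] dual_weight.simps [simp del]

lemma greedy_nonneg: "0 \<le> greedy kc b"
  by (subst greedy.simps) auto

lemma greedy_0 [simp]: "greedy kc 0 = 0"
  by (simp add: greedy.simps)

lemma greedy_ge:
  assumes "kc 0 > 0" "b \<noteq> 0" shows "kc b \<le> conv (greedy kc) kc b"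
proof -
  have "(kc b - (\<Sum>a | a < b. greedy kc a * kc (b - a))) / kc 0 \<le> greedy kc b"
    using assms by (subst (2) greedy.simps) auto
  then show ?thesis using assms by (simp add: conv_split_last field_simps)
qed

lemma greedy_tight:
  assumes "kc 0 > 0" "greedy kc b > 0" shows "conv (greedy kc) kc b = kc b"
proof -
  have "b \<noteq> 0" using assms by auto
  then have "greedy kc b = (kc b - (\<Sum>a | a < b. greedy kc a * kc (b - a))) / kc 0"
    using assms(2) by (subst greedy.simps, subst (asm) greedy.simps) (auto simp: max_def split: if_splits)
  then show ?thesis using assms by (simp add: conv_split_last field_simps)
qed

text \<open>Linear programming duality.  Let \<open>t\<close> solve the complementary slackness equations on the indices \<open>c\<close>
with \<open>g\<^sub>b\<^sub>-\<^sub>c > 0\<close>.  Then \<open>(g * l)\<^sub>b = (g * (t * k))\<^sub>b = (t * (g * k))\<^sub>b = \<Sum>\<^sub>a\<^sub><\<^sub>b t\<^sub>a k\<^sub>b\<^sub>-\<^sub>a \<le> l\<^sub>b\<close>: the first equality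
holds since \<open>t * k = l\<close> wherever \<open>g\<close> is positive, the third since \<open>g * k = k\<close> wherever \<open>t\<close> is nonzero.
The row condition gives the last inequality and, index by index, the feasibility of \<open>t\<close>.\<close>

lemma greedy_le:
  assumes k0: "kc 0 > 0" and row: "row_condition kc lc"
  shows "conv (greedy kc) lc b \<le> lc b"
proof -
  let ?g = "greedy kc"
  define t where "t = dual_weight (\<lambda>c. ?g (b - c) > 0) kc lc"
  have tight: "conv t kc c = lc c" if "?g (b - c) > 0" for c
    using that k0 unfolding conv_split_last t_def
    by (subst (2) dual_weight.simps) (simp add: field_simps)
  have zero: "t c = 0" if "\<not> ?g (b - c) > 0" for c
    using that unfolding t_def by (subst dual_weight.simps) simp
  have t: "0 \<le> t c \<and> conv t kc c \<le> lc c" for c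
  proof (induction c rule: multi_induct)
    case (less c)
    have r: "(\<Sum>a | a < c. t a * kc (c - a)) \<le> lc c"
      using row less unfolding row_condition_def by blast
    show ?case
    proof (cases "?g (b - c) > 0")
      case True
      have "t c * kc 0 = lc c - (\<Sum>a | a < c. t a * kc (c - a))"
        using tight[OF True] by (simp add: conv_split_last)
      then have "t c * kc 0 \<ge> 0" using r by simp
      then show ?thesis using tight[OF True] k0 by (simp add: zero_le_mult_iff)
    next
      case False
      then show ?thesis using r by (simp add: zero conv_split_last)
    qed
  qed
  have sw: "e \<le> b" "a \<le> b - e" if "a \<le> b" "e \<le> b - a" for a e
  proof -
    show "e \<le> b" using that(2) multi_diff_le by (rule multi_order)
    then show "a \<le> b - e" using that by (simp add: multi_le_diff_iff add.commute)
  qed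
  have "conv ?g lc b = (\<Sum>a | a \<le> b. ?g a * conv t kc (b - a))"
    unfolding conv_def[of ?g]
  proof (rule sum.cong)
    fix a assume "a \<in> {a. a \<le> b}"
    then show "?g a * lc (b - a) = ?g a * conv t kc (b - a)"
      using tight[of "b - a"] greedy_nonneg[of kc a] by (cases "?g a = 0") auto
  qed simp
  also have "\<dots> = (\<Sum>a | a \<le> b. \<Sum>e | e \<le> b - a. t e * (?g a * kc (b - a - e)))"
    by (simp add: conv_def sum_distrib_left mult_ac)
  also have "\<dots> = (\<Sum>e | e \<le> b. \<Sum>a | a \<le> b - e. t e * (?g a * kc (b - a - e)))"
    unfolding sum.Sigma[OF finite_multi_le ballI[OF finite_multi_le]]
    by (rule sum.reindex_bij_witness[where i = "\<lambda>(x, y). (y, x)" and j = "\<lambda>(x, y). (y, x)"])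
      (use sw in auto)
  also have "\<dots> = (\<Sum>e | e \<le> b. t e * conv ?g kc (b - e))"
    by (simp add: conv_def sum_distrib_left multi_diff_add_eq add.commute)
  also have "\<dots> = (\<Sum>e | e \<le> b. t e * (if e = b then 0 else kc (b - e)))"
  proof (rule sum.cong)
    fix e assume "e \<in> {e. e \<le> b}"
    show "t e * conv ?g kc (b - e) = t e * (if e = b then 0 else kc (b - e))"
    proof (cases "?g (b - e) > 0")
      case True
      then have "e \<noteq> b" by auto
      then show ?thesis using greedy_tight[OF k0 True] by simp
    qed (simp add: zero)
  qed simp
  also have "\<dots> = (\<Sum>a | a < b. t a * kc (b - a))"
    by (rule sum.mono_neutral_cong_right) (auto simp: multi_less_iff)
  also have "\<dots> \<le> lc b"
    using row t unfolding row_condition_def by blast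
  finally show ?thesis .
qed

text \<open>With the generating functions \<open>G\<close>, \<open>K\<close>, \<open>L\<close> of the three families, the conditions say that \<open>K (1 - G)\<close>
has coefficients \<open>\<le> 0\<close> off the origin and that \<open>L (1 - G)\<close> has coefficients \<open>\<ge> 0\<close>.  If \<open>K = L\<close> and
\<open>K\<^sub>0 = 1\<close>, then \<open>G = 1 - 1/K\<close> is the classical choice whenever its coefficients are nonnegative.\<close>

definition factor_weights :: "(nat^'d \<Rightarrow> real) \<Rightarrow> (nat^'d \<Rightarrow> real) \<Rightarrow> (nat^'d \<Rightarrow> real) \<Rightarrow> bool" where
  "factor_weights kc lc g \<longleftrightarrow> (\<forall>a. 0 \<le> g a) \<and> g 0 = 0 \<and>
     (\<forall>b. b \<noteq> 0 \<longrightarrow> kc b \<le> conv g kc b) \<and> (\<forall>b. conv g lc b \<le> lc b)"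

theorem row_condition_imp_factor_weights:
  assumes "kc 0 > 0" "row_condition kc lc" shows "factor_weights kc lc (greedy kc)"
  unfolding factor_weights_def using assms by (auto simp: greedy_nonneg greedy_ge greedy_le)

section \<open>Extending backward Toeplitz maps\<close>

definition vnorm2 :: "nat \<Rightarrow> (nat \<Rightarrow> complex) \<Rightarrow> real" where
  "vnorm2 N x = (\<Sum>j<N. (cmod (x j))\<^sup>2)"

lemma vnorm2_nonneg [simp]: "0 \<le> vnorm2 N x"
  by (simp add: vnorm2_def sum_nonneg)

lemma vnorm2_zero [simp]: "vnorm2 N (\<lambda>_. 0) = 0"
  by (simp add: vnorm2_def)

lemma vnorm2_scale: "vnorm2 N (\<lambda>j. c * x j) = (cmod c)\<^sup>2 * vnorm2 N x"
  by (simp add: vnorm2_def norm_mult power_mult_distrib sum_distrib_left)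

lemma vnorm2_component: "j < N \<Longrightarrow> (cmod (x j))\<^sup>2 \<le> vnorm2 N x"
  unfolding vnorm2_def by (rule member_le_sum) auto

lemma cmod_convex_identity:
  "(cmod (of_real (1 - s) * x + of_real s * y))\<^sup>2
    = (1 - s) * (cmod x)\<^sup>2 + s * (cmod y)\<^sup>2 - s * (1 - s) * (cmod (x - y))\<^sup>2"
  unfolding cmod_power2 by (simp add: power2_eq_square algebra_simps)

lemma vnorm2_convex:
  "vnorm2 N (\<lambda>j. of_real (1 - s) * x j + of_real s * y j)
    = (1 - s) * vnorm2 N x + s * vnorm2 N y - s * (1 - s) * vnorm2 N (\<lambda>j. x j - y j)"
  unfolding vnorm2_def cmod_convex_identity by (simp add: sum.distrib sum_subtractf sum_distrib_left)

lemma cmod_add_sq_le: "(cmod (x + y))\<^sup>2 \<le> 2 * (cmod x)\<^sup>2 + 2 * (cmod y)\<^sup>2"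
proof -
  have "(cmod (x + y))\<^sup>2 \<le> (cmod x + cmod y)\<^sup>2" by (simp add: norm_triangle_ineq power_mono)
  also have "\<dots> \<le> 2 * (cmod x)\<^sup>2 + 2 * (cmod y)\<^sup>2"
    using sum_squares_bound[of "cmod x" "cmod y"] by (simp add: power2_sum)
  finally show ?thesis .
qed

lemma vnorm2_add_le: "vnorm2 N (\<lambda>j. x j + y j) \<le> 2 * vnorm2 N x + 2 * vnorm2 N y"
  unfolding vnorm2_def sum_distrib_left sum.distrib[symmetric] by (intro sum_mono cmod_add_sq_le)

text \<open>The balls with centres \<open>L p\<close> and squared radii \<open>\<phi> p\<close> have a common point, namely the limit of \<open>L p\<^sub>n\<close>
along a minimising sequence of \<open>\<phi>\<close>.  The hypothesis \<open>cv\<close> is the parallelogram law, by which such a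
sequence is Cauchy for \<open>\<delta>\<close>.  This is the Hilbert space fact behind Parrott's theorem.\<close>

lemma hilbert_extension_value:
  fixes \<phi> :: "'p \<Rightarrow> real" and \<delta> :: "'p \<Rightarrow> 'p \<Rightarrow> real" and L :: "'p \<Rightarrow> nat \<Rightarrow> complex"
  assumes ne: "P \<noteq> {}" and pos: "\<And>p. p \<in> P \<Longrightarrow> 0 \<le> \<phi> p"
    and cv: "\<And>s p q. p \<in> P \<Longrightarrow> q \<in> P \<Longrightarrow>
      \<exists>r\<in>P. \<phi> r = (1 - s) * \<phi> p + s * \<phi> q - s * (1 - s) * \<delta> p q"
    and lip: "\<And>p q. p \<in> P \<Longrightarrow> q \<in> P \<Longrightarrow> vnorm2 N (\<lambda>j. L p j - L q j) \<le> \<delta> p q"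
  obtains x where "\<And>p. p \<in> P \<Longrightarrow> vnorm2 N (\<lambda>j. L p j - x j) \<le> \<phi> p"
proof -
  define d where "d = Inf (\<phi> ` P)"
  have bdd: "bdd_below (\<phi> ` P)" using pos by (auto intro: bdd_belowI[of _ 0])
  have d_le: "d \<le> \<phi> p" if "p \<in> P" for p unfolding d_def using bdd that by (auto intro: cInf_lower)
  have d0: "0 \<le> d" unfolding d_def using ne pos by (auto intro: cInf_greatest)
  have "\<exists>p\<in>P. \<phi> p < d + inverse (real (Suc n))" for n
  proof -
    have "Inf (\<phi> ` P) < d + inverse (real (Suc n))" by (simp add: d_def)
    then show ?thesis using cInf_less_iff[of "\<phi> ` P"] ne bdd by auto
  qed
  then obtain p where p: "\<And>n. p n \<in> P" "\<And>n. \<phi> (p n) < d + inverse (real (Suc n))" by metis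
  have \<delta>_le: "s * (1 - s) * \<delta> q q' \<le> (1 - s) * \<phi> q + s * \<phi> q' - d" if "q \<in> P" "q' \<in> P" for q q' s
    using cv[OF that, of s] d_le by force
  have inv_small: "\<exists>M. \<forall>n\<ge>M. inverse (real (Suc n)) < e" if "e > 0" for e :: real
    using LIMSEQ_inverse_real_of_nat that by (auto simp: LIMSEQ_def eventually_sequentially)
  have "convergent (\<lambda>n. L (p n) j)" if j: "j < N" for j
  proof (rule Cauchy_convergent, rule metric_CauchyI)
    fix e :: real assume e: "e > 0"
    obtain M where M: "\<And>n. n \<ge> M \<Longrightarrow> inverse (real (Suc n)) < e\<^sup>2 / 4"
      using inv_small[of "e\<^sup>2 / 4"] e by auto
    show "\<exists>M. \<forall>m\<ge>M. \<forall>n\<ge>M. dist (L (p m) j) (L (p n) j) < e"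
    proof (intro exI allI impI)
      fix m n assume mn: "m \<ge> M" "n \<ge> M"
      have "(cmod (L (p m) j - L (p n) j))\<^sup>2 \<le> vnorm2 N (\<lambda>j. L (p m) j - L (p n) j)"
        using vnorm2_component[OF j] .
      also have "\<dots> \<le> \<delta> (p m) (p n)" using lip p by auto
      also have "\<dots> \<le> 4 * ((1/2) * \<phi> (p m) + (1/2) * \<phi> (p n) - d)"
        using \<delta>_le[OF p(1)[of m] p(1)[of n], of "1/2"] by simp
      also have "\<dots> < e\<^sup>2" using p(2)[of m] p(2)[of n] M[OF mn(1)] M[OF mn(2)] by simp
      finally show "dist (L (p m) j) (L (p n) j) < e"
        using e by (simp add: dist_norm power2_less_imp_less)
    qed
  qed
  then have "\<forall>j. \<exists>y. j < N \<longrightarrow> (\<lambda>n. L (p n) j) \<longlonglongrightarrow> y" unfolding convergent_def by blast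
  then obtain x where x: "\<And>j. j < N \<Longrightarrow> (\<lambda>n. L (p n) j) \<longlonglongrightarrow> x j" by metis
  have lim_phi: "(\<lambda>n. \<phi> (p n)) \<longlonglongrightarrow> d"
  proof (rule tendsto_sandwich[where f = "\<lambda>_. d" and h = "\<lambda>n. d + inverse (real (Suc n))"])
    show "(\<lambda>n. d + inverse (real (Suc n))) \<longlonglongrightarrow> d"
      using tendsto_add[OF tendsto_const[of d] LIMSEQ_inverse_real_of_nat] by simp
  qed (use d_le p in \<open>auto intro!: always_eventually simp: less_imp_le\<close>)
  show ?thesis
  proof
    fix q assume q: "q \<in> P"
    let ?V = "vnorm2 N (\<lambda>j. L q j - x j)"
    (* Compare q with the minimising sequence along the segment with parameter s, then let s tend to 0. *)
    have "z * ?V \<le> \<phi> q" if z: "0 < z" "z < 1" for z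
    proof -
      define s where "s = 1 - z"
      have s: "0 < s" "s < 1" "z = 1 - s" using z by (auto simp: s_def)
      have le: "s * (1 - s) * vnorm2 N (\<lambda>j. L q j - L (p n) j) \<le> s * \<phi> q + (1 - s) * \<phi> (p n) - d" for n
      proof -
        have "s * (1 - s) * vnorm2 N (\<lambda>j. L q j - L (p n) j) \<le> s * (1 - s) * \<delta> q (p n)"
          using lip[OF q p(1)] s by (intro mult_left_mono) auto
        also have "\<dots> \<le> s * \<phi> q + (1 - s) * \<phi> (p n) - d"
          using \<delta>_le[OF q p(1)[of n], of "1 - s"] by (simp add: mult.commute)
        finally show ?thesis .
      qed
      have "s * (1 - s) * ?V \<le> s * \<phi> q + (1 - s) * d - d"
      proof (rule LIMSEQ_le[OF _ _ exI[of _ 0]])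
        show "(\<lambda>n. s * (1 - s) * vnorm2 N (\<lambda>j. L q j - L (p n) j)) \<longlonglongrightarrow> s * (1 - s) * ?V"
          unfolding vnorm2_def by (intro tendsto_intros x) auto
        show "(\<lambda>n. s * \<phi> q + (1 - s) * \<phi> (p n) - d) \<longlonglongrightarrow> s * \<phi> q + (1 - s) * d - d"
          by (intro tendsto_intros lim_phi)
      qed (use le in auto)
      also have "\<dots> \<le> s * \<phi> q" using s d0 by (simp add: algebra_simps)
      finally show ?thesis using s by (simp add: mult.assoc)
    qed
    then show "?V \<le> \<phi> q" by (rule field_le_mult_one_interval)
  qed
qed

type_synonym 'd vseq = "nat^'d \<Rightarrow> nat \<Rightarrow> complex"

definition square_summable :: "(nat^'d \<Rightarrow> real) \<Rightarrow> nat \<Rightarrow> 'd vseq \<Rightarrow> bool" where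
  "square_summable w N u \<longleftrightarrow> (\<lambda>b. w b * vnorm2 N (u b)) summable_on UNIV"

definition sqnorm :: "(nat^'d \<Rightarrow> real) \<Rightarrow> nat \<Rightarrow> 'd vseq \<Rightarrow> real" where
  "sqnorm w N u = infsum (\<lambda>b. w b * vnorm2 N (u b)) UNIV"

lemma has_sum_sqnorm: "square_summable w N u \<Longrightarrow> ((\<lambda>b. w b * vnorm2 N (u b)) has_sum sqnorm w N u) UNIV"
  unfolding square_summable_def sqnorm_def by (rule has_sum_infsum)

lemma sqnormI: "((\<lambda>b. w b * vnorm2 N (u b)) has_sum s) UNIV \<Longrightarrow> square_summable w N u \<and> sqnorm w N u = s"
  unfolding square_summable_def sqnorm_def by (auto simp: has_sum_imp_summable infsumI)

definition shift :: "nat^'d \<Rightarrow> 'd vseq \<Rightarrow> 'd vseq" where "shift m u = (\<lambda>b. u (b + m))"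

definition unit_seq :: "nat^'d \<Rightarrow> nat \<Rightarrow> 'd vseq" where
  "unit_seq b j = (\<lambda>a i. if a = b \<and> i = j then 1 else 0)"

lemma square_summable_scale:
  "square_summable w N u \<Longrightarrow> square_summable w N (\<lambda>b j. c * u b j) \<and>
    sqnorm w N (\<lambda>b j. c * u b j) = (cmod c)\<^sup>2 * sqnorm w N u"
  by (rule sqnormI) (use has_sum_cmult_right[OF has_sum_sqnorm, of w N u "(cmod c)\<^sup>2"] in \<open>simp add: vnorm2_scale mult_ac\<close>)

lemma square_summable_add:
  assumes w: "\<And>b. 0 \<le> w b" and u: "square_summable w N u" and v: "square_summable w N v"
  shows "square_summable w N (\<lambda>b j. u b j + v b j)"
  unfolding square_summable_def
proof (rule summable_on_comparison_test)
  show "(\<lambda>b. 2 * (w b * vnorm2 N (u b)) + 2 * (w b * vnorm2 N (v b))) summable_on UNIV"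
    using u v unfolding square_summable_def by (intro summable_on_add summable_on_cmult_right)
  show "w b * vnorm2 N (\<lambda>j. u b j + v b j) \<le> 2 * (w b * vnorm2 N (u b)) + 2 * (w b * vnorm2 N (v b))" for b
    using mult_left_mono[OF vnorm2_add_le[of N "u b" "v b"] w[of b]] by (simp add: algebra_simps)
qed (use w in auto)

lemma square_summable_lin:
  assumes w: "\<And>b. 0 \<le> w b" and u: "square_summable w N u" and v: "square_summable w N v"
  shows "square_summable w N (\<lambda>b j. c * u b j + v b j)"
  using square_summable_add[OF w square_summable_scale[OF u, THEN conjunct1] v] .

lemma square_summable_diff:
  assumes w: "\<And>b. 0 \<le> w b" and u: "square_summable w N u" and v: "square_summable w N v"
  shows "square_summable w N (\<lambda>b j. u b j - v b j)"
  using square_summable_lin[OF w v u, of "-1"] by simp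

lemma sqnorm_convex:
  assumes w: "\<And>b. 0 \<le> w b" and u: "square_summable w N u" and v: "square_summable w N v"
  shows "sqnorm w N (\<lambda>b j. of_real (1 - s) * u b j + of_real s * v b j)
    = (1 - s) * sqnorm w N u + s * sqnorm w N v - s * (1 - s) * sqnorm w N (\<lambda>b j. u b j - v b j)"
proof (rule sqnormI[THEN conjunct2])
  have "((\<lambda>b. (1 - s) * (w b * vnorm2 N (u b)) + s * (w b * vnorm2 N (v b))
      + - (s * (1 - s)) * (w b * vnorm2 N (\<lambda>j. u b j - v b j))) has_sum
      (1 - s) * sqnorm w N u + s * sqnorm w N v + - (s * (1 - s)) * sqnorm w N (\<lambda>b j. u b j - v b j)) UNIV"
    by (intro has_sum_add has_sum_cmult_right has_sum_sqnorm u v square_summable_diff w)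
  then show "((\<lambda>b. w b * vnorm2 N (\<lambda>j. of_real (1 - s) * u b j + of_real s * v b j)) has_sum
     (1 - s) * sqnorm w N u + s * sqnorm w N v - s * (1 - s) * sqnorm w N (\<lambda>b j. u b j - v b j)) UNIV"
    unfolding vnorm2_convex by (simp add: algebra_simps)
qed

lemma sqnorm_component:
  assumes "\<And>b. 0 \<le> w b" "square_summable w N u"
  shows "w b * vnorm2 N (u b) \<le> sqnorm w N u"
  using finite_sum_le_has_sum[OF has_sum_sqnorm[OF assms(2)], of "{b}"] assms(1) by auto

lemma has_sum_off_zero:
  fixes f :: "nat^'d \<Rightarrow> real"
  shows "(f has_sum s) UNIV \<longleftrightarrow> ((\<lambda>b. if b = 0 then 0 else f b) has_sum s - f 0) UNIV"
proof -
  have *: "((\<lambda>b :: nat^'d. if b = 0 then c else 0) has_sum c) UNIV" for c :: real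
    by (rule has_sum_finite_neutralI[of "{0}"]) auto
  have e1: "(\<lambda>b. f b + (if b = 0 then - f 0 else 0)) = (\<lambda>b. if b = 0 then 0 else f b)" by auto
  have e2: "(\<lambda>b. (if b = 0 then 0 else f b) + (if b = 0 then f 0 else 0)) = f" by auto
  show ?thesis
  proof
    assume "(f has_sum s) UNIV"
    from has_sum_add[OF this *[of "- f 0"]] show "((\<lambda>b. if b = 0 then 0 else f b) has_sum s - f 0) UNIV"
      by (simp add: e1)
  next
    assume "((\<lambda>b. if b = 0 then 0 else f b) has_sum s - f 0) UNIV"
    from has_sum_add[OF this *[of "f 0"]] show "(f has_sum s) UNIV" by (simp add: e2)
  qed
qed

definition off_zero :: "('d::finite) vseq \<Rightarrow> 'd vseq" where
  "off_zero u = (\<lambda>b j. if b = 0 then 0 else u b j)"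

lemma sqnorm_off_zero:
  "square_summable w N u \<longleftrightarrow> square_summable w N (off_zero u)"
  "square_summable w N (off_zero u) \<Longrightarrow> sqnorm w N u = w 0 * vnorm2 N (u 0) + sqnorm w N (off_zero u)"
proof -
  have e: "(\<lambda>b. w b * vnorm2 N (off_zero u b)) = (\<lambda>b. if b = 0 then 0 else w b * vnorm2 N (u b))"
    by (auto simp: off_zero_def fun_eq_iff)
  have s: "((\<lambda>b. w b * vnorm2 N (u b)) has_sum s) UNIV \<longleftrightarrow>
    ((\<lambda>b. w b * vnorm2 N (off_zero u b)) has_sum s - w 0 * vnorm2 N (u 0)) UNIV" for s
    unfolding e by (rule has_sum_off_zero)
  show 1: "square_summable w N u \<longleftrightarrow> square_summable w N (off_zero u)"
  proof
    assume "square_summable w N u"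
    then have "((\<lambda>b. w b * vnorm2 N (u b)) has_sum sqnorm w N u) UNIV" by (rule has_sum_sqnorm)
    then have "((\<lambda>b. w b * vnorm2 N (off_zero u b)) has_sum sqnorm w N u - w 0 * vnorm2 N (u 0)) UNIV"
      by (rule s[THEN iffD1])
    then show "square_summable w N (off_zero u)"
      unfolding square_summable_def by (rule has_sum_imp_summable)
  next
    assume "square_summable w N (off_zero u)"
    then have "((\<lambda>b. w b * vnorm2 N (off_zero u b)) has_sum
        (sqnorm w N (off_zero u) + w 0 * vnorm2 N (u 0)) - w 0 * vnorm2 N (u 0)) UNIV"
      using has_sum_sqnorm by simp
    then have "((\<lambda>b. w b * vnorm2 N (u b)) has_sum sqnorm w N (off_zero u) + w 0 * vnorm2 N (u 0)) UNIV"
      by (rule s[THEN iffD2])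
    then show "square_summable w N u"
      unfolding square_summable_def by (rule has_sum_imp_summable)
  qed
  assume "square_summable w N (off_zero u)"
  then have "square_summable w N u" using 1 by simp
  then have "((\<lambda>b. w b * vnorm2 N (u b)) has_sum sqnorm w N u) UNIV" by (rule has_sum_sqnorm)
  then have "((\<lambda>b. w b * vnorm2 N (off_zero u b)) has_sum sqnorm w N u - w 0 * vnorm2 N (u 0)) UNIV"
    by (rule s[THEN iffD1])
  then have "sqnorm w N (off_zero u) = sqnorm w N u - w 0 * vnorm2 N (u 0)"
    unfolding sqnorm_def by (rule infsumI)
  then show "sqnorm w N u = w 0 * vnorm2 N (u 0) + sqnorm w N (off_zero u)" by simp
qed

lemma shift_shift: "shift a (shift m u) = shift (a + m) u"
  by (simp add: shift_def add.assoc)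

lemma shift_zero [simp]: "shift 0 u = u"
  by (simp add: shift_def)

lemma square_summable_finite_support:
  assumes "finite F" "\<And>b j. b \<notin> F \<Longrightarrow> u b j = 0"
  shows "square_summable w N u" "sqnorm w N u = (\<Sum>b\<in>F. w b * vnorm2 N (u b))"
proof -
  have "u b = (\<lambda>_. 0)" if "b \<notin> F" for b using assms(2)[OF that] by auto
  then have "((\<lambda>b. w b * vnorm2 N (u b)) has_sum (\<Sum>b\<in>F. w b * vnorm2 N (u b))) UNIV"
    by (intro has_sum_finite_neutralI[OF assms(1)]) auto
  from sqnormI[OF this] show "square_summable w N u" "sqnorm w N u = (\<Sum>b\<in>F. w b * vnorm2 N (u b))" by auto
qed

lemma shift_unit_seq: "shift m (unit_seq b j) = (if m \<le> b then unit_seq (b - m) j else (\<lambda>_ _. 0))"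
proof -
  have "a + m = b \<longleftrightarrow> m \<le> b \<and> a = b - m" for a by auto
  then show ?thesis by (auto simp: shift_def unit_seq_def fun_eq_iff)
qed

text \<open>Graphs of contractions that are defined on a shift invariant subspace and commute with all backward
shifts.  A set of pairs is enough, since contractivity makes the value unique.\<close>

definition admissible :: "(nat^'d \<Rightarrow> real) \<Rightarrow> (nat^'d \<Rightarrow> real) \<Rightarrow> nat \<Rightarrow> ('d vseq \<times> 'd vseq) set \<Rightarrow> bool" where
  "admissible kc lc N G \<longleftrightarrow> G \<noteq> {} \<and>
     (\<forall>u v. (u, v) \<in> G \<longrightarrow> square_summable lc N u \<and> square_summable kc N v \<and>
        sqnorm kc N v \<le> sqnorm lc N u \<and> (\<forall>b j. N \<le> j \<longrightarrow> u b j = 0 \<and> v b j = 0)) \<and>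
     (\<forall>c u v u' v'. (u, v) \<in> G \<longrightarrow> (u', v') \<in> G \<longrightarrow>
        (\<lambda>b j. c * u b j + u' b j, \<lambda>b j. c * v b j + v' b j) \<in> G) \<and>
     (\<forall>m u v. (u, v) \<in> G \<longrightarrow> (shift m u, shift m v) \<in> G)"

locale factor_pair =
  fixes kc lc g :: "nat^'d \<Rightarrow> real" and N :: nat
  assumes kpos: "\<And>a. 0 < kc a" and lpos: "\<And>a. 0 < lc a" and fw: "factor_weights kc lc g"
begin

lemma k_nn: "0 \<le> kc a" and l_nn: "0 \<le> lc a" and g_nn: "0 \<le> g a"
  using kpos lpos fw by (auto simp: less_imp_le factor_weights_def)

lemma adm_bound:
  assumes "admissible kc lc N G" "(u, v) \<in> G"
  shows "square_summable lc N u" "square_summable kc N v" "sqnorm kc N v \<le> sqnorm lc N u"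
    "N \<le> j \<Longrightarrow> u b j = 0" "N \<le> j \<Longrightarrow> v b j = 0"
  using assms unfolding admissible_def by blast+

lemma adm_lin:
  assumes "admissible kc lc N G" "(u, v) \<in> G" "(u', v') \<in> G"
  shows "(\<lambda>b j. c * u b j + u' b j, \<lambda>b j. c * v b j + v' b j) \<in> G"
  using assms unfolding admissible_def by blast

lemma adm_diff:
  assumes "admissible kc lc N G" "(u, v) \<in> G" "(u', v') \<in> G"
  shows "(\<lambda>b j. u b j - u' b j, \<lambda>b j. v b j - v' b j) \<in> G"
  using adm_lin[OF assms(1,3,2), of "-1"] by simp

lemma adm_zero:
  assumes "admissible kc lc N G" shows "(\<lambda>b j. 0, \<lambda>b j. 0) \<in> G"
proof -
  obtain u v where "(u, v) \<in> G" using assms unfolding admissible_def by auto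
  from adm_diff[OF assms this this] show ?thesis by simp
qed

lemma adm_scale:
  assumes "admissible kc lc N G" "(u, v) \<in> G"
  shows "(\<lambda>b j. c * u b j, \<lambda>b j. c * v b j) \<in> G"
  using adm_lin[OF assms adm_zero[OF assms(1)]] by simp

lemma adm_add:
  assumes "admissible kc lc N G" "(u, v) \<in> G" "(u', v') \<in> G"
  shows "(\<lambda>b j. u b j + u' b j, \<lambda>b j. v b j + v' b j) \<in> G"
  using adm_lin[OF assms, of 1] by simp

lemma adm_shift:
  assumes "admissible kc lc N G" "(u, v) \<in> G" shows "(shift m u, shift m v) \<in> G"
  using assms unfolding admissible_def by blast

lemma adm_unique:
  assumes a: "admissible kc lc N G" and "(u, v) \<in> G" "(u, v') \<in> G" shows "v = v'"
proof (intro ext)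
  fix b j
  let ?d = "\<lambda>b j. v b j - v' b j"
  have d: "(\<lambda>b j. 0, ?d) \<in> G" using adm_diff[OF a assms(2,3)] by simp
  have "kc b * vnorm2 N (?d b) \<le> sqnorm kc N ?d" using sqnorm_component[OF k_nn adm_bound(2)[OF a d]] .
  also have "\<dots> \<le> 0" using adm_bound(3)[OF a d] by (simp add: sqnorm_def)
  finally have "vnorm2 N (?d b) = 0" using kpos[of b] vnorm2_nonneg[of N "?d b"]
    by (simp add: mult_le_0_iff)
  then show "v b j = v' b j"
    using vnorm2_component[of j N "?d b"] adm_bound(5)[OF a assms(2)] adm_bound(5)[OF a assms(3)]
    by (cases "j < N") auto
qed

lemma weighted_shift_has_sum:
  assumes "square_summable lc N (shift m u)"
  shows "((\<lambda>b. if m \<le> b then g m * lc (b - m) * vnorm2 N (u b) else 0) has_sum g m * sqnorm lc N (shift m u)) UNIV"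
proof -
  have "((\<lambda>a. g m * (lc a * vnorm2 N (u (a + m)))) has_sum g m * sqnorm lc N (shift m u)) UNIV"
    using has_sum_cmult_right[OF has_sum_sqnorm[OF assms], of "g m"] by (simp add: shift_def)
  then have "((\<lambda>b. g m * lc (b - m) * vnorm2 N (u b)) has_sum g m * sqnorm lc N (shift m u)) {b. m \<le> b}"
    by (subst has_sum_reindex_bij_witness[where T = UNIV and j = "\<lambda>b. b - m" and i = "\<lambda>a. a + m"
          and h = "\<lambda>a. g m * (lc a * vnorm2 N (u (a + m)))" and s' = "g m * sqnorm lc N (shift m u)"])
      auto
  then show ?thesis
    by (rule has_sum_cong_neutral[THEN iffD1, rotated -1]) auto
qed

text \<open>The inequality that makes an extension step possible.  For \<open>a \<noteq> 0\<close> one has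
\<open>k\<^sub>a |v\<^sub>a|\<^sup>2 \<le> \<Sum>\<^sub>m g\<^sub>m k\<^sub>a\<^sub>-\<^sub>m |v\<^sub>a|\<^sup>2\<close>.  Summing over \<open>a\<close> gives \<open>\<Sum>\<^sub>m g\<^sub>m \<parallel>shift m v\<parallel>\<^sup>2\<close>, which is at most
\<open>\<Sum>\<^sub>m g\<^sub>m \<parallel>shift m u\<parallel>\<^sup>2\<close> by contractivity on the shifts, and \<open>g * l \<le> l\<close> bounds this by the norm of \<open>u\<close>.\<close>

lemma off_zero_bound:
  assumes u: "square_summable lc N u"
    and sh: "\<And>m. m \<noteq> 0 \<Longrightarrow> square_summable lc N (shift m u) \<and> square_summable kc N (shift m v) \<and>
      sqnorm kc N (shift m v) \<le> sqnorm lc N (shift m u)"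
  shows "square_summable kc N (off_zero v) \<and> sqnorm kc N (off_zero v) \<le> sqnorm lc N (off_zero u)"
proof -
  let ?U = "off_zero u" and ?V = "off_zero v"
  have U: "square_summable lc N ?U" using u sqnorm_off_zero(1) by blast
  have bound: "(\<Sum>a\<in>A. kc a * vnorm2 N (?V a)) \<le> sqnorm lc N ?U" if A: "finite A" for A
  proof -
    define M where "M = {m. m \<noteq> 0 \<and> (\<exists>a\<in>A. m \<le> a)}"
    have "M \<subseteq> (\<Union>a\<in>A. {m. m \<le> a})" by (auto simp: M_def)
    then have M: "finite M" by (rule finite_subset) (use A in auto)
    have inner: "(\<Sum>a\<in>{a\<in>A. m \<le> a}. kc (a - m) * vnorm2 N (v a)) \<le> sqnorm lc N (shift m u)" if m: "m \<noteq> 0" for m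
    proof -
      have inj: "inj_on (\<lambda>a. a - m) {a\<in>A. m \<le> a}"
        by (rule inj_on_inverseI[where g = "\<lambda>a. a + m"]) auto
      have "(\<Sum>a\<in>{a\<in>A. m \<le> a}. kc (a - m) * vnorm2 N (v a))
          = (\<Sum>e\<in>(\<lambda>a. a - m) ` {a\<in>A. m \<le> a}. kc e * vnorm2 N (shift m v e))"
        by (subst sum.reindex[OF inj]) (auto simp: shift_def intro!: sum.cong)
      also have "\<dots> \<le> sqnorm kc N (shift m v)"
        by (rule finite_sum_le_has_sum[OF has_sum_sqnorm]) (use sh[OF m] A k_nn in auto)
      finally show ?thesis using sh[OF m] by linarith
    qed
    have "(\<Sum>a\<in>A. kc a * vnorm2 N (?V a)) \<le> (\<Sum>a\<in>A. \<Sum>m\<in>M. if m \<le> a then g m * (kc (a - m) * vnorm2 N (v a)) else 0)"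
    proof (rule sum_mono)
      fix a assume a: "a \<in> A"
      show "kc a * vnorm2 N (?V a) \<le> (\<Sum>m\<in>M. if m \<le> a then g m * (kc (a - m) * vnorm2 N (v a)) else 0)"
      proof (cases "a = 0")
        case True
        then show ?thesis using k_nn g_nn by (auto simp: off_zero_def intro!: sum_nonneg)
      next
        case False
        have "kc a * vnorm2 N (v a) \<le> conv g kc a * vnorm2 N (v a)"
          using False fw by (intro mult_right_mono) (auto simp: factor_weights_def)
        also have "\<dots> = (\<Sum>m | m \<le> a. g m * (kc (a - m) * vnorm2 N (v a)))"
          by (simp add: conv_def sum_distrib_right mult.assoc)
        also have "\<dots> = (\<Sum>m\<in>M. if m \<le> a then g m * (kc (a - m) * vnorm2 N (v a)) else 0)"
        proof (subst sum.inter_filter[OF M, symmetric], rule sum.mono_neutral_right)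
          have "g 0 = 0" using fw by (simp add: factor_weights_def)
          then show "\<forall>i\<in>{m. m \<le> a} - {m \<in> M. m \<le> a}. g i * (kc (a - i) * vnorm2 N (v a)) = 0"
            using a by (auto simp: M_def)
        qed auto
        finally show ?thesis using False by (simp add: off_zero_def)
      qed
    qed
    also have "\<dots> = (\<Sum>m\<in>M. g m * (\<Sum>a\<in>{a\<in>A. m \<le> a}. kc (a - m) * vnorm2 N (v a)))"
      unfolding sum_distrib_left by (subst sum.swap) (simp add: sum.inter_filter[OF A])
    also have "\<dots> \<le> (\<Sum>m\<in>M. g m * sqnorm lc N (shift m u))"
      by (intro sum_mono mult_left_mono inner g_nn) (auto simp: M_def)
    also have "\<dots> \<le> sqnorm lc N ?U"
    proof (rule has_sum_mono)
      show "((\<lambda>b. \<Sum>m\<in>M. if m \<le> b then g m * lc (b - m) * vnorm2 N (u b) else 0)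
          has_sum (\<Sum>m\<in>M. g m * sqnorm lc N (shift m u))) UNIV"
        using M
      proof (rule finite_subset_induct'[where A = M, OF _ subset_refl])
        fix m F assume "m \<in> M" "finite F" "m \<notin> F"
          and IH: "((\<lambda>b. \<Sum>m\<in>F. if m \<le> b then g m * lc (b - m) * vnorm2 N (u b) else 0)
          has_sum (\<Sum>m\<in>F. g m * sqnorm lc N (shift m u))) UNIV"
        have "square_summable lc N (shift m u)" using sh \<open>m \<in> M\<close> by (auto simp: M_def)
        from has_sum_add[OF weighted_shift_has_sum[OF this] IH]
        show "((\<lambda>b. \<Sum>m\<in>insert m F. if m \<le> b then g m * lc (b - m) * vnorm2 N (u b) else 0)
          has_sum (\<Sum>m\<in>insert m F. g m * sqnorm lc N (shift m u))) UNIV"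
          using \<open>finite F\<close> \<open>m \<notin> F\<close> by simp
      qed simp
      show "((\<lambda>b. lc b * vnorm2 N (?U b)) has_sum sqnorm lc N ?U) UNIV" by (rule has_sum_sqnorm[OF U])
      fix b :: "nat^'d"
      show "(\<Sum>m\<in>M. if m \<le> b then g m * lc (b - m) * vnorm2 N (u b) else 0) \<le> lc b * vnorm2 N (?U b)"
      proof (cases "b = 0")
        case True
        then show ?thesis by (auto simp: off_zero_def M_def intro!: sum_nonpos)
      next
        case False
        have "(\<Sum>m\<in>M. if m \<le> b then g m * lc (b - m) * vnorm2 N (u b) else 0)
           = (\<Sum>m\<in>{m\<in>M. m \<le> b}. g m * lc (b - m) * vnorm2 N (u b))"
          by (rule sum.inter_filter[OF M, symmetric])
        also have "\<dots> \<le> (\<Sum>m | m \<le> b. g m * lc (b - m) * vnorm2 N (u b))"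
          by (rule sum_mono2) (use g_nn l_nn in auto)
        also have "\<dots> = conv g lc b * vnorm2 N (u b)" by (simp add: conv_def sum_distrib_right)
        also have "\<dots> \<le> lc b * vnorm2 N (u b)"
          using fw by (intro mult_right_mono) (auto simp: factor_weights_def)
        finally show ?thesis using False by (simp add: off_zero_def)
      qed
    qed
    finally show ?thesis .
  qed
  have V: "square_summable kc N ?V"
    unfolding square_summable_def
    by (rule nonneg_bounded_partial_sums_imp_summable_on[where C = "sqnorm lc N ?U"])
      (use bound k_nn in \<open>auto intro: eventually_finite_subsets_at_top_weakI\<close>)
  moreover have "sqnorm kc N ?V \<le> sqnorm lc N ?U"
    by (rule has_sum_le_finite_sums[OF has_sum_sqnorm[OF V]]) (use bound in auto)
  ultimately show ?thesis by blast
qed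

text \<open>Every entry of the image of \<open>u0\<close> except the one at \<open>0\<close> is an entry at \<open>0\<close> of the image of a shift of
\<open>u0\<close>.  The entry \<open>- x\<close> at \<open>0\<close> has to satisfy one inequality for each vector of the old domain, and these
inequalities place \<open>x\<close> in a family of balls with a common point.\<close>

lemma extend_one:
  assumes a: "admissible kc lc N G"
    and u0: "square_summable lc N u0" "\<And>b j. N \<le> j \<Longrightarrow> u0 b j = 0"
    and sh: "\<And>m. m \<noteq> 0 \<Longrightarrow> \<exists>v. (shift m u0, v) \<in> G"
  shows "\<exists>G' v0. admissible kc lc N G' \<and> G \<subseteq> G' \<and> (u0, v0) \<in> G'"
proof -
  obtain V where V: "\<And>m. m \<noteq> 0 \<Longrightarrow> (shift m u0, V m) \<in> G" using sh by metis
  have plus_nz: "a + m \<noteq> 0" if "m \<noteq> 0" for a m :: "nat^'d"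
    using that by (auto simp: Finite_Cartesian_Product.vec_eq_iff)
  define w where "w = (\<lambda>a. if a = 0 then (\<lambda>_. 0) else V a 0)"
  have shw: "shift m w = V m" if m: "m \<noteq> 0" for m
  proof
    fix a
    have "(shift (a + m) u0, shift a (V m)) \<in> G"
      using adm_shift[OF a V[OF m], of a] by (simp add: shift_shift)
    from adm_unique[OF a this V[OF plus_nz[OF m]]] have "V (a + m) = shift a (V m)" by simp
    then show "shift m w a = V m a" using plus_nz[OF m] by (simp add: shift_def w_def)
  qed
  have wN: "w b j = 0" if "N \<le> j" for b j
    using adm_bound(5)[OF a V that] by (auto simp: w_def)
  (* Away from 0 the image of every vector of the enlarged domain is forced. *)
  have off: "square_summable kc N (off_zero (\<lambda>b j. v b j + w b j)) \<and>
      sqnorm kc N (off_zero (\<lambda>b j. v b j + w b j)) \<le> sqnorm lc N (off_zero (\<lambda>b j. u b j + u0 b j))"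
    if uv: "(u, v) \<in> G" for u v
  proof (rule off_zero_bound)
    show "square_summable lc N (\<lambda>b j. u b j + u0 b j)"
      by (intro square_summable_add l_nn adm_bound(1)[OF a uv] u0)
    fix m :: "nat^'d" assume m: "m \<noteq> 0"
    have "shift m (\<lambda>b j. v b j + w b j) = (\<lambda>b j. shift m v b j + V m b j)"
      using shw[OF m] by (simp add: shift_def fun_eq_iff)
    moreover have "shift m (\<lambda>b j. u b j + u0 b j) = (\<lambda>b j. shift m u b j + shift m u0 b j)"
      by (simp add: shift_def)
    moreover note adm_add[OF a adm_shift[OF a uv, of m] V[OF m]]
    ultimately have "(shift m (\<lambda>b j. u b j + u0 b j), shift m (\<lambda>b j. v b j + w b j)) \<in> G" by simp
    from adm_bound[OF a this] show "square_summable lc N (shift m (\<lambda>b j. u b j + u0 b j)) \<and>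
        square_summable kc N (shift m (\<lambda>b j. v b j + w b j)) \<and>
        sqnorm kc N (shift m (\<lambda>b j. v b j + w b j)) \<le> sqnorm lc N (shift m (\<lambda>b j. u b j + u0 b j))"
      by blast
  qed
  (* The slack that the contraction inequality for (u + u0, v + w) leaves for the entry at 0. *)
  define \<phi> where "\<phi> = (\<lambda>(u, v). (sqnorm lc N (\<lambda>b j. u b j + u0 b j)
      - sqnorm kc N (off_zero (\<lambda>b j. v b j + w b j))) / kc 0)"
  define \<delta> where "\<delta> = (\<lambda>(u, v) (u', v'). (sqnorm lc N (\<lambda>b j. u b j - u' b j)
      - sqnorm kc N (off_zero (\<lambda>b j. v b j - v' b j))) / kc 0)"
  obtain x where x: "\<And>p. p \<in> G \<Longrightarrow> vnorm2 N (\<lambda>j. snd p 0 j - x j) \<le> \<phi> p"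
  proof (rule hilbert_extension_value[where P = G and \<phi> = \<phi> and \<delta> = \<delta> and L = "\<lambda>p. snd p 0" and N = N])
    show "G \<noteq> {}" using adm_zero[OF a] by auto
    show "0 \<le> \<phi> p" if pG: "p \<in> G" for p
    proof -
      obtain u v where p: "p = (u, v)" and uv: "(u, v) \<in> G" using pG by (cases p) auto
      have s: "square_summable lc N (off_zero (\<lambda>b j. u b j + u0 b j))"
        using square_summable_add[OF l_nn adm_bound(1)[OF a uv] u0(1)] sqnorm_off_zero(1) by blast
      have "sqnorm lc N (off_zero (\<lambda>b j. u b j + u0 b j)) \<le> sqnorm lc N (\<lambda>b j. u b j + u0 b j)"
        unfolding sqnorm_off_zero(2)[OF s] using l_nn[of 0] by simp
      then show ?thesis using off[OF uv] kpos[of 0] by (simp add: \<phi>_def p)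
    qed
    show "\<exists>r\<in>G. \<phi> r = (1 - s) * \<phi> p + s * \<phi> q - s * (1 - s) * \<delta> p q" if pG: "p \<in> G" "q \<in> G" for s p q
    proof -
      obtain u v u' v' where p: "p = (u, v)" "q = (u', v')" and uv: "(u, v) \<in> G" "(u', v') \<in> G"
        using pG by (cases p; cases q) auto
      let ?c = "\<lambda>x y :: 'd vseq. \<lambda>b j. of_real (1 - s) * x b j + of_real s * y b j"
      have r: "(?c u u', ?c v v') \<in> G"
        using adm_lin[OF a uv(1) adm_scale[OF a uv(2)]] .
      have e1: "(\<lambda>b j. ?c u u' b j + u0 b j) = ?c (\<lambda>b j. u b j + u0 b j) (\<lambda>b j. u' b j + u0 b j)"
        by (simp add: fun_eq_iff algebra_simps)
      have e2: "off_zero (\<lambda>b j. ?c v v' b j + w b j)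
          = ?c (off_zero (\<lambda>b j. v b j + w b j)) (off_zero (\<lambda>b j. v' b j + w b j))"
        by (simp add: fun_eq_iff off_zero_def algebra_simps)
      have e3: "(\<lambda>b j. off_zero (\<lambda>b j. v b j + w b j) b j - off_zero (\<lambda>b j. v' b j + w b j) b j)
          = off_zero (\<lambda>b j. v b j - v' b j)"
        by (simp add: fun_eq_iff off_zero_def)
      have "\<phi> (?c u u', ?c v v') = (1 - s) * \<phi> p + s * \<phi> q - s * (1 - s) * \<delta> p q"
        unfolding \<phi>_def \<delta>_def p prod.case e1 e2
        unfolding sqnorm_convex[OF l_nn square_summable_add[OF l_nn adm_bound(1)[OF a uv(1)] u0(1)]
              square_summable_add[OF l_nn adm_bound(1)[OF a uv(2)] u0(1)]]
          sqnorm_convex[OF k_nn off[OF uv(1), THEN conjunct1] off[OF uv(2), THEN conjunct1]] e3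
        using kpos[of 0] by (simp add: field_simps)
      then show ?thesis using r by blast
    qed
    show "vnorm2 N (\<lambda>j. snd p 0 j - snd q 0 j) \<le> \<delta> p q" if pG: "p \<in> G" "q \<in> G" for p q
    proof -
      obtain u v u' v' where p: "p = (u, v)" "q = (u', v')" and uv: "(u, v) \<in> G" "(u', v') \<in> G"
        using pG by (cases p; cases q) auto
      note d = adm_diff[OF a uv]
      have s: "square_summable kc N (off_zero (\<lambda>b j. v b j - v' b j))"
        using adm_bound(2)[OF a d] sqnorm_off_zero(1) by blast
      show ?thesis using adm_bound(3)[OF a d] kpos[of 0] unfolding sqnorm_off_zero(2)[OF s]
        by (simp add: \<delta>_def p field_simps)
    qed
  qed blast
  define v0 where "v0 = (\<lambda>b j. if b = 0 then (if j < N then - x j else 0) else w b j)"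
  have v0w: "off_zero (\<lambda>b j. v b j + v0 b j) = off_zero (\<lambda>b j. v b j + w b j)" for v
    by (auto simp: off_zero_def v0_def fun_eq_iff)
  have main: "square_summable kc N (\<lambda>b j. v b j + v0 b j) \<and>
      sqnorm kc N (\<lambda>b j. v b j + v0 b j) \<le> sqnorm lc N (\<lambda>b j. u b j + u0 b j)"
    if uv: "(u, v) \<in> G" for u v
  proof -
    have s: "square_summable kc N (off_zero (\<lambda>b j. v b j + v0 b j))" using off[OF uv] v0w by simp
    have e: "vnorm2 N (\<lambda>j. v 0 j + v0 0 j) = vnorm2 N (\<lambda>j. v 0 j - x j)"
      by (simp add: vnorm2_def v0_def)
    have "sqnorm kc N (\<lambda>b j. v b j + v0 b j) \<le> sqnorm lc N (\<lambda>b j. u b j + u0 b j)"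
      unfolding sqnorm_off_zero(2)[OF s] e v0w using x[OF uv] kpos[of 0]
      by (simp add: \<phi>_def field_simps)
    then show ?thesis using s sqnorm_off_zero(1) by blast
  qed
  define G' where "G' = {(\<lambda>b j. u b j + t * u0 b j, \<lambda>b j. v b j + t * v0 b j) | t u v. (u, v) \<in> G}"
  have G'I: "(\<lambda>b j. u b j + t * u0 b j, \<lambda>b j. v b j + t * v0 b j) \<in> G'" if "(u, v) \<in> G" for t u v
    using that unfolding G'_def by blast
  have "admissible kc lc N G'"
    unfolding admissible_def
  proof (intro conjI)
    show "G' \<noteq> {}" using G'I[OF adm_zero[OF a], of 0] by auto
    show "\<forall>u v. (u, v) \<in> G' \<longrightarrow> square_summable lc N u \<and> square_summable kc N v \<and>
        sqnorm kc N v \<le> sqnorm lc N u \<and> (\<forall>b j. N \<le> j \<longrightarrow> u b j = 0 \<and> v b j = 0)"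
    proof (intro allI impI)
      fix u' v' assume "(u', v') \<in> G'"
      then obtain t u v where e: "u' = (\<lambda>b j. u b j + t * u0 b j)" "v' = (\<lambda>b j. v b j + t * v0 b j)"
        and uv: "(u, v) \<in> G" unfolding G'_def by auto
      have supp: "\<forall>b j. N \<le> j \<longrightarrow> u' b j = 0 \<and> v' b j = 0"
        using adm_bound(4,5)[OF a uv] u0(2) wN by (auto simp: e v0_def)
      show "square_summable lc N u' \<and> square_summable kc N v' \<and>
        sqnorm kc N v' \<le> sqnorm lc N u' \<and> (\<forall>b j. N \<le> j \<longrightarrow> u' b j = 0 \<and> v' b j = 0)"
      proof (cases "t = 0")
        case True
        then show ?thesis using adm_bound[OF a uv] supp by (simp add: e)
      next
        case False
        have "(\<lambda>b j. inverse t * u b j, \<lambda>b j. inverse t * v b j) \<in> G" by (rule adm_scale[OF a uv])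
        note m = main[OF this]
        have e': "u' = (\<lambda>b j. t * (inverse t * u b j + u0 b j))" "v' = (\<lambda>b j. t * (inverse t * v b j + v0 b j))"
          unfolding e fun_eq_iff using False by (simp_all add: field_simps)
        have "square_summable lc N (\<lambda>b j. inverse t * u b j + u0 b j)"
          by (rule square_summable_lin[OF l_nn adm_bound(1)[OF a uv] u0(1)])
        from square_summable_scale[OF this, of t] square_summable_scale[OF m[THEN conjunct1], of t] m supp
        show ?thesis unfolding e' by (auto intro: mult_left_mono)
      qed
    qed
    show "\<forall>c u v u' v'. (u, v) \<in> G' \<longrightarrow> (u', v') \<in> G' \<longrightarrow>
        (\<lambda>b j. c * u b j + u' b j, \<lambda>b j. c * v b j + v' b j) \<in> G'"
    proof (intro allI impI)
      fix c p1 q1 p2 q2 assume "(p1, q1) \<in> G'" "(p2, q2) \<in> G'"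
      then obtain t u v t' u' v' where e: "p1 = (\<lambda>b j. u b j + t * u0 b j)" "q1 = (\<lambda>b j. v b j + t * v0 b j)"
         "p2 = (\<lambda>b j. u' b j + t' * u0 b j)" "q2 = (\<lambda>b j. v' b j + t' * v0 b j)"
        and uv: "(u, v) \<in> G" "(u', v') \<in> G" unfolding G'_def by auto
      from G'I[OF adm_lin[OF a uv, of c], of "c * t + t'"]
      show "(\<lambda>b j. c * p1 b j + p2 b j, \<lambda>b j. c * q1 b j + q2 b j) \<in> G'"
        unfolding e by (simp add: algebra_simps)
    qed
    show "\<forall>m u v. (u, v) \<in> G' \<longrightarrow> (shift m u, shift m v) \<in> G'"
    proof (intro allI impI)
      fix m u' v' assume uv': "(u', v') \<in> G'"
      then obtain t u v where e: "u' = (\<lambda>b j. u b j + t * u0 b j)" "v' = (\<lambda>b j. v b j + t * v0 b j)"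
        and uv: "(u, v) \<in> G" unfolding G'_def by auto
      show "(shift m u', shift m v') \<in> G'"
      proof (cases "m = 0")
        case True
        then show ?thesis using uv' by simp
      next
        case False
        have "shift m v0 = V m" unfolding shw[OF False, symmetric] using plus_nz[OF False]
          by (simp add: shift_def v0_def)
        then have vv: "shift m v' = (\<lambda>b j. t * V m b j + shift m v b j)"
          unfolding e by (auto simp: shift_def fun_eq_iff)
        have uu: "shift m u' = (\<lambda>b j. t * shift m u0 b j + shift m u b j)"
          unfolding e by (auto simp: shift_def fun_eq_iff)
        from G'I[OF adm_lin[OF a V[OF False] adm_shift[OF a uv, of m], of t], of 0]
        show ?thesis unfolding uu vv by simp
      qed
    qed
  qed
  moreover have "G \<subseteq> G'"
  proof
    fix p assume "p \<in> G"
    then show "p \<in> G'" using G'I[of "fst p" "snd p" 0] by simp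
  qed
  moreover have "(u0, v0) \<in> G'" using G'I[OF adm_zero[OF a], of 1] by simp
  ultimately show ?thesis by blast
qed

lemma admissible_Union:
  assumes "C \<noteq> {}" and ch: "subset.chain {G. admissible kc lc N G \<and> G0 \<subseteq> G} C"
  shows "admissible kc lc N (\<Union>C) \<and> G0 \<subseteq> \<Union>C"
proof -
  have adm: "admissible kc lc N G" "G0 \<subseteq> G" if "G \<in> C" for G
    using ch that unfolding subset_chain_def by auto
  have two: "\<exists>G\<in>C. p \<in> G \<and> q \<in> G" if "p \<in> \<Union>C" "q \<in> \<Union>C" for p q
  proof -
    from that obtain A B where "A \<in> C" "p \<in> A" "B \<in> C" "q \<in> B" by blast
    moreover from this have "A \<subseteq> B \<or> B \<subseteq> A" using ch unfolding subset_chain_def by blast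
    ultimately show ?thesis by blast
  qed
  have "admissible kc lc N (\<Union>C)"
    unfolding admissible_def
  proof (intro conjI allI impI)
    obtain G where "G \<in> C" using assms(1) by auto
    then show "\<Union>C \<noteq> {}" using adm_zero[OF adm(1)] by blast
  next
    fix c u v u' v' assume "(u, v) \<in> \<Union>C" "(u', v') \<in> \<Union>C"
    then obtain G where "G \<in> C" "(u, v) \<in> G" "(u', v') \<in> G" using two by blast
    then show "(\<lambda>b j. c * u b j + u' b j, \<lambda>b j. c * v b j + v' b j) \<in> \<Union>C"
      using adm_lin[OF adm(1)] by blast
  next
    fix m u v assume "(u, v) \<in> \<Union>C"
    then show "(shift m u, shift m v) \<in> \<Union>C" using adm_shift[OF adm(1)] by blast
  qed (auto dest: adm_bound[OF adm(1)])
  then show ?thesis using adm(2) assms(1) by blast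
qed

lemma adm_sum:
  assumes a: "admissible kc lc N G" and "finite I" "\<And>i. i \<in> I \<Longrightarrow> (u i, v i) \<in> G"
  shows "(\<lambda>b j. \<Sum>i\<in>I. t i * u i b j, \<lambda>b j. \<Sum>i\<in>I. t i * v i b j) \<in> G"
  using assms(2,3)
proof (induction I rule: finite_induct)
  case empty
  then show ?case using adm_zero[OF a] by simp
next
  case (insert i I)
  from adm_lin[OF a insert.prems[of i] insert.IH] insert show ?case by simp
qed

text \<open>A maximal admissible graph contains all unit sequences, by induction along the multi-indices, because
the proper shifts of a unit sequence are earlier unit sequences or zero.  The symbol entry \<open>c b i j\<close> is
the entry at \<open>0\<close> of the image of \<open>unit_seq b j\<close>, and commutation with the shifts makes the map Toeplitz.
On the given graph \<open>G0\<close> the map is recovered by truncating \<open>u\<close>, with an error bounded by the tail of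
the norm of \<open>u\<close>.\<close>

theorem admissible_extends_to_symbol:
  assumes a0: "admissible kc lc N G0"
  shows "\<exists>c :: nat^'d \<Rightarrow> nat \<Rightarrow> nat \<Rightarrow> complex.
    (\<forall>F y. finite F \<longrightarrow> (\<Sum>a\<in>F. kc a * vnorm2 N (\<lambda>i. \<Sum>b\<in>F. \<Sum>j<N. if a \<le> b then c (b - a) i j * y b j else 0))
        \<le> (\<Sum>b\<in>F. lc b * vnorm2 N (y b))) \<and>
    (\<forall>u v i. (u, v) \<in> G0 \<longrightarrow> i < N \<longrightarrow> ((\<lambda>b. \<Sum>j<N. c b i j * u b j) has_sum v 0 i) UNIV)"
proof -
  let ?A = "{G. admissible kc lc N G \<and> G0 \<subseteq> G}"
  have "\<exists>M\<in>?A. \<forall>X\<in>?A. M \<subseteq> X \<longrightarrow> X = M"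
    by (rule subset_Zorn_nonempty) (use a0 admissible_Union in auto)
  then obtain M where M: "admissible kc lc N M" "G0 \<subseteq> M"
    and "\<forall>X\<in>?A. M \<subseteq> X \<longrightarrow> X = M" by blast
  then have max: "\<And>X. admissible kc lc N X \<Longrightarrow> M \<subseteq> X \<Longrightarrow> X = M" by auto
  have "\<exists>v. (unit_seq b j, v) \<in> M" if j: "j < N" for b j
  proof (induction b rule: multi_induct)
    case (less b)
    have "\<exists>G' v0. admissible kc lc N G' \<and> M \<subseteq> G' \<and> (unit_seq b j, v0) \<in> G'"
    proof (rule extend_one[OF M(1)])
      show "square_summable lc N (unit_seq b j)"
        by (rule square_summable_finite_support(1)[of "{b}"]) (auto simp: unit_seq_def)
      show "unit_seq b j b' i = 0" if "N \<le> i" for b' i using that j by (auto simp: unit_seq_def)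
      fix m :: "nat^'d" assume m: "m \<noteq> 0"
      show "\<exists>v. (shift m (unit_seq b j), v) \<in> M"
      proof (cases "m \<le> b")
        case True
        have "b - m < b" using True m multi_add_diff[OF True] unfolding multi_less_iff by fastforce
        then show ?thesis using less True by (simp add: shift_unit_seq)
      next
        case False
        then show ?thesis using adm_zero[OF M(1)] by (auto simp: shift_unit_seq)
      qed
    qed
    then show ?case using max by blast
  qed
  note ex = this
  define V where "V = (\<lambda>b j. SOME v. (unit_seq b j, v) \<in> M)"
  have V: "(unit_seq b j, V b j) \<in> M" if "j < N" for b j
    unfolding V_def by (rule someI_ex[OF ex[OF that]])
  define c where "c = (\<lambda>b i j. V b j 0 i)"
  (* Shifting by a reads off the entry at a and turns the unit sequence at b into the one at b - a. *)
  have Vc: "V b j a i = (if a \<le> b then c (b - a) i j else 0)" if j: "j < N" for b j a i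
  proof (cases "a \<le> b")
    case True
    have "(unit_seq (b - a) j, shift a (V b j)) \<in> M"
      using adm_shift[OF M(1) V[OF j, of b], of a] True by (simp add: shift_unit_seq)
    from adm_unique[OF M(1) this V[OF j]] have "shift a (V b j) 0 i = V (b - a) j 0 i" by simp
    then show ?thesis using True by (simp add: shift_def c_def)
  next
    case False
    have "(\<lambda>_ _. 0, shift a (V b j)) \<in> M"
      using adm_shift[OF M(1) V[OF j, of b], of a] False by (simp add: shift_unit_seq)
    from adm_unique[OF M(1) this adm_zero[OF M(1)]] have "shift a (V b j) 0 i = 0" by simp
    then show ?thesis using False by (simp add: shift_def)
  qed
  define trunc where "trunc = (\<lambda>F (y :: 'd vseq) b j. if b \<in> F \<and> j < N then y b j else 0)"
  define T where "T = (\<lambda>F (y :: 'd vseq) a i. \<Sum>b\<in>F. \<Sum>j<N. if a \<le> b then c (b - a) i j * y b j else 0)"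
  have TM: "(trunc F y, T F y) \<in> M" if F: "finite F" for F y
  proof -
    let ?I = "F \<times> {..<N}"
    have "(\<lambda>b j. \<Sum>p\<in>?I. y (fst p) (snd p) * unit_seq (fst p) (snd p) b j,
        \<lambda>b j. \<Sum>p\<in>?I. y (fst p) (snd p) * V (fst p) (snd p) b j) \<in> M"
      by (rule adm_sum[OF M(1)]) (use F V in auto)
    moreover have "(\<lambda>b j. \<Sum>p\<in>?I. y (fst p) (snd p) * unit_seq (fst p) (snd p) b j) = trunc F y"
    proof (intro ext)
      fix b j
      have "(\<Sum>p\<in>?I. y (fst p) (snd p) * unit_seq (fst p) (snd p) b j)
        = (\<Sum>p\<in>?I. if p = (b, j) then y b j else 0)"
        by (rule sum.cong) (auto simp: unit_seq_def)
      also have "\<dots> = trunc F y b j" using F by (auto simp: trunc_def sum.delta)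
      finally show "(\<Sum>p\<in>?I. y (fst p) (snd p) * unit_seq (fst p) (snd p) b j) = trunc F y b j" .
    qed
    moreover have "(\<lambda>b j. \<Sum>p\<in>?I. y (fst p) (snd p) * V (fst p) (snd p) b j) = T F y"
    proof (intro ext)
      fix a i
      show "(\<Sum>p\<in>?I. y (fst p) (snd p) * V (fst p) (snd p) a i) = T F y a i"
        unfolding T_def sum.cartesian_product
        by (rule sum.cong) (auto simp: Vc mult.commute)
    qed
    ultimately show ?thesis by simp
  qed
  have l2: "(\<Sum>a\<in>F. kc a * vnorm2 N (T F y a)) \<le> (\<Sum>b\<in>F. lc b * vnorm2 N (y b))" if F: "finite F" for F y
  proof -
    have "(\<Sum>a\<in>F. kc a * vnorm2 N (T F y a)) \<le> sqnorm kc N (T F y)"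
      by (rule finite_sum_le_has_sum[OF has_sum_sqnorm[OF adm_bound(2)[OF M(1) TM[OF F]]]])
        (use F k_nn in auto)
    also have "\<dots> \<le> sqnorm lc N (trunc F y)" by (rule adm_bound(3)[OF M(1) TM[OF F]])
    also have "\<dots> = (\<Sum>b\<in>F. lc b * vnorm2 N (trunc F y b))"
      by (rule square_summable_finite_support(2)[OF F]) (simp add: trunc_def)
    also have "\<dots> = (\<Sum>b\<in>F. lc b * vnorm2 N (y b))"
      by (rule sum.cong) (auto simp: trunc_def vnorm2_def)
    finally show ?thesis .
  qed
  (* The pair (u - truncation of u, v - its image) is in the graph, so contractivity bounds the error by the tail. *)
  have hs: "((\<lambda>b. \<Sum>j<N. c b i j * u b j) has_sum v 0 i) UNIV" if uv: "(u, v) \<in> G0" and i: "i < N" for u v i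
  proof -
    have uvM: "(u, v) \<in> M" using uv M(2) by auto
    let ?f = "\<lambda>b. lc b * vnorm2 N (u b)"
    have sum: "(?f has_sum sqnorm lc N u) UNIV" by (rule has_sum_sqnorm[OF adm_bound(1)[OF M(1) uvM]])
    have bound: "kc 0 * (cmod (v 0 i - (\<Sum>b\<in>F. \<Sum>j<N. c b i j * u b j)))\<^sup>2 \<le> sqnorm lc N u - sum ?f F"
      if F: "finite F" for F
    proof -
      note d = adm_diff[OF M(1) uvM TM[OF F, of u]]
      have "(cmod (v 0 i - T F u 0 i))\<^sup>2 \<le> vnorm2 N (\<lambda>j. v 0 j - T F u 0 j)"
        using vnorm2_component[OF i, of "\<lambda>j. v 0 j - T F u 0 j"] by simp
      then have "kc 0 * (cmod (v 0 i - T F u 0 i))\<^sup>2 \<le> kc 0 * vnorm2 N (\<lambda>j. v 0 j - T F u 0 j)"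
        by (rule mult_left_mono[OF _ k_nn])
      also have "\<dots> \<le> sqnorm kc N (\<lambda>b j. v b j - T F u b j)"
        by (rule sqnorm_component[OF k_nn adm_bound(2)[OF M(1) d]])
      also have "\<dots> \<le> sqnorm lc N (\<lambda>b j. u b j - trunc F u b j)" by (rule adm_bound(3)[OF M(1) d])
      also have "\<dots> = sqnorm lc N u - sum ?f F"
      proof (rule sqnormI[THEN conjunct2])
        have "((\<lambda>b. if b \<in> F then ?f b else 0) has_sum sum ?f F) UNIV"
          by (rule has_sum_finite_neutralI[OF F]) auto
        from has_sum_add[OF sum has_sum_uminusI[OF this]]
        have "((\<lambda>b. ?f b + - (if b \<in> F then ?f b else 0)) has_sum sqnorm lc N u - sum ?f F) UNIV" by simp
        moreover have "(\<lambda>b. ?f b + - (if b \<in> F then ?f b else 0))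
            = (\<lambda>b. lc b * vnorm2 N (\<lambda>j. u b j - trunc F u b j))"
          by (auto simp: trunc_def vnorm2_def fun_eq_iff)
        ultimately show "((\<lambda>b. lc b * vnorm2 N (\<lambda>j. u b j - trunc F u b j)) has_sum sqnorm lc N u - sum ?f F) UNIV"
          by simp
      qed
      finally show ?thesis by (simp add: T_def)
    qed
    show ?thesis
      unfolding has_sum_def
    proof (rule tendstoI)
      fix e :: real assume e: "e > 0"
      have "\<forall>\<^sub>F F in finite_subsets_at_top UNIV. dist (sum ?f F) (sqnorm lc N u) < kc 0 * e\<^sup>2"
        using sum kpos[of 0] e unfolding has_sum_def by (intro tendstoD) auto
      moreover have "\<forall>\<^sub>F F in finite_subsets_at_top (UNIV :: (nat^'d) set). finite F"
        by (rule eventually_finite_subsets_at_top_weakI)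
      ultimately show "\<forall>\<^sub>F F in finite_subsets_at_top UNIV. dist (\<Sum>b\<in>F. \<Sum>j<N. c b i j * u b j) (v 0 i) < e"
      proof eventually_elim
        case (elim F)
        have "sqnorm lc N u - sum ?f F < kc 0 * e\<^sup>2" using elim(1) by (auto simp: dist_real_def abs_if split: if_splits)
        then have "kc 0 * (cmod (v 0 i - (\<Sum>b\<in>F. \<Sum>j<N. c b i j * u b j)))\<^sup>2 < kc 0 * e\<^sup>2"
          using bound[OF elim(2)] by linarith
        then have "cmod (v 0 i - (\<Sum>b\<in>F. \<Sum>j<N. c b i j * u b j)) < e"
          using kpos[of 0] e by (auto intro: power_less_imp_less_base)
        then show ?case by (simp add: dist_norm norm_minus_commute)
      qed
    qed
  qed
  show ?thesis
    by (rule exI[of _ c]) (use l2 hs in \<open>auto simp: T_def\<close>)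
qed

end

section \<open>Finite differences on small grids\<close>

text \<open>Newton's difference functional \<open>\<Delta>\<^sup>n / n!\<close> at \<open>0\<close>, as weights on the points \<open>0, \<dots>, n\<close>.\<close>

primrec fd_weight1 :: "nat \<Rightarrow> nat \<Rightarrow> real" where
  "fd_weight1 0 j = (if j = 0 then 1 else 0)"
| "fd_weight1 (Suc n) j = ((if j = 0 then 0 else fd_weight1 n (j - 1)) - fd_weight1 n j) / real (Suc n)"

lemma fd_weight1_eq_0: "n < j \<Longrightarrow> fd_weight1 n j = 0"
  by (induction n arbitrary: j) auto

lemma fd_weight1_diag: "fd_weight1 n n \<noteq> 0"
  by (induction n) (auto simp: fd_weight1_eq_0)

lemma fd_weight1_moment:
  "m \<le> n \<Longrightarrow> (\<Sum>j\<le>n. fd_weight1 n j * real j ^ m) = (if m = n then 1 else 0)"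
proof (induction n arbitrary: m)
  case (Suc n)
  have "(\<Sum>j\<le>Suc n. (if j = 0 then 0 else fd_weight1 n (j - 1)) * real j ^ m)
      = (\<Sum>j\<le>n. fd_weight1 n j * (real j + 1) ^ m)"
    by (subst sum.atMost_Suc_shift) (simp add: add.commute)
  moreover have "(\<Sum>j\<le>Suc n. fd_weight1 n j * real j ^ m) = (\<Sum>j\<le>n. fd_weight1 n j * real j ^ m)"
    by (simp add: fd_weight1_eq_0)
  ultimately have "(\<Sum>j\<le>Suc n. fd_weight1 (Suc n) j * real j ^ m)
      = ((\<Sum>j\<le>n. fd_weight1 n j * (real j + 1) ^ m) - (\<Sum>j\<le>n. fd_weight1 n j * real j ^ m)) / real (Suc n)"
    by (simp only: fd_weight1.simps times_divide_eq_left left_diff_distrib sum_subtractf sum_divide_distrib[symmetric] diff_divide_distrib)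
  also have "(\<Sum>j\<le>n. fd_weight1 n j * (real j + 1) ^ m)
      = (\<Sum>j\<le>n. \<Sum>r\<le>m. real (m choose r) * (fd_weight1 n j * real j ^ r))"
    by (simp add: binomial_ring sum_distrib_left mult_ac)
  also have "\<dots> = (\<Sum>r\<le>m. real (m choose r) * (\<Sum>j\<le>n. fd_weight1 n j * real j ^ r))"
    by (subst sum.swap) (simp add: sum_distrib_left)
  also have "\<dots> - (\<Sum>j\<le>n. fd_weight1 n j * real j ^ m)
      = (\<Sum>r<m. real (m choose r) * (\<Sum>j\<le>n. fd_weight1 n j * real j ^ r))"
    by (simp add: lessThan_Suc_atMost[symmetric])
  also have "\<dots> = (\<Sum>r<m. if r = n then real (m choose r) else 0)"
    using Suc by (intro sum.cong) auto
  also have "\<dots> = (if m = Suc n then real (Suc n) else 0)"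
    using Suc.prems by (auto simp: sum.delta)
  finally show ?case by simp
qed simp

definition fd_weight :: "nat^'d \<Rightarrow> nat^'d \<Rightarrow> real" where
  "fd_weight a c = (\<Prod>i\<in>UNIV. fd_weight1 (a $ i) (c $ i))"

definition nat_power :: "nat^'d \<Rightarrow> nat^'d \<Rightarrow> real" where
  "nat_power c b = (\<Prod>i\<in>UNIV. real (c $ i) ^ (b $ i))"

text \<open>The value of the \<open>a\<close>-th difference functional on the monomial with exponent \<open>b\<close>.\<close>

definition fd_moment :: "nat^'d \<Rightarrow> nat^'d \<Rightarrow> real" where
  "fd_moment a b = (\<Sum>c | c \<le> a. fd_weight a c * nat_power c b)"

lemma fd_weight_diag: "fd_weight a a \<noteq> 0"
  by (simp add: fd_weight_def fd_weight1_diag)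

lemma fd_moment_prod: "fd_moment a b = (\<Prod>i\<in>UNIV. \<Sum>j\<le>a $ i. fd_weight1 (a $ i) j * real j ^ (b $ i))"
  unfolding fd_moment_def fd_weight_def nat_power_def prod.distrib[symmetric]
  by (rule sum_prod_multi_le[where f = "\<lambda>i j. fd_weight1 (a $ i) j * real j ^ (b $ i)"])

lemma fd_moment_eq_0: assumes "\<not> a \<le> b" shows "fd_moment a b = 0"
proof -
  obtain i where "b $ i < a $ i" using assms by (auto simp: multi_le_iff not_le)
  then have "(\<Sum>j\<le>a $ i. fd_weight1 (a $ i) j * real j ^ (b $ i)) = 0"
    by (simp add: fd_weight1_moment)
  then show ?thesis unfolding fd_moment_prod by (intro prod_zero) auto
qed

lemma fd_moment_diag [simp]: "fd_moment a a = 1"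
  unfolding fd_moment_prod by (simp add: fd_weight1_moment)

lemma nat_power_le: "c \<le> a \<Longrightarrow> nat_power c b \<le> real (deg a) ^ deg b"
  unfolding nat_power_def power_deg
proof (intro prod_mono conjI power_mono)
  fix i assume "c \<le> a"
  then have "c $ i \<le> a $ i" by (simp add: multi_le_iff)
  also have "a $ i \<le> deg a" unfolding deg_def by (rule member_le_sum) auto
  finally show "real (c $ i) \<le> real (deg a)" by simp
qed auto

lemma nat_power_nonneg [simp]: "0 \<le> nat_power c b"
  by (simp add: nat_power_def prod_nonneg)

lemma fd_moment_bound: "\<bar>fd_moment a b\<bar> \<le> (\<Sum>c | c \<le> a. \<bar>fd_weight a c\<bar>) * real (deg a) ^ deg b"
proof -
  have "\<bar>fd_moment a b\<bar> \<le> (\<Sum>c | c \<le> a. \<bar>fd_weight a c * nat_power c b\<bar>)"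
    unfolding fd_moment_def by (rule sum_abs)
  also have "\<dots> \<le> (\<Sum>c | c \<le> a. \<bar>fd_weight a c\<bar> * real (deg a) ^ deg b)"
    by (intro sum_mono) (auto simp: abs_mult intro!: mult_left_mono nat_power_le)
  finally show ?thesis by (simp add: sum_distrib_right)
qed

text \<open>The difference functionals are triangular, with nonzero diagonal, in terms of the evaluations at
integer points; hence the evaluations are combinations of difference functionals.\<close>

lemma nat_power_spanned: "\<exists>y. (\<forall>a. \<not> a \<le> c \<longrightarrow> y a = 0) \<and> (\<forall>b. nat_power c b = (\<Sum>a | a \<le> c. y a * fd_moment a b))"
proof (induction c rule: multi_induct)
  case (less c)
  then have "\<forall>c'. \<exists>y. c' < c \<longrightarrow> (\<forall>a. \<not> a \<le> c' \<longrightarrow> y a = 0) \<and> (\<forall>b. nat_power c' b = (\<Sum>a | a \<le> c'. y a * fd_moment a b))"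
    by blast
  then obtain Y where Y0: "\<And>c' a. c' < c \<Longrightarrow> \<not> a \<le> c' \<Longrightarrow> Y c' a = 0"
    and Y1: "\<And>c' b. c' < c \<Longrightarrow> nat_power c' b = (\<Sum>a | a \<le> c'. Y c' a * fd_moment a b)" by metis
  define y where "y a = ((if a = c then 1 else 0) - (\<Sum>c' | c' < c. fd_weight c c' * Y c' a)) / fd_weight c c" for a
  have split: "{a. a \<le> c} = insert c {a. a < c}" by (auto simp: multi_less_iff)
  have "nat_power c b = (\<Sum>a | a \<le> c. y a * fd_moment a b)" for b
  proof -
    have "fd_moment c b = fd_weight c c * nat_power c b + (\<Sum>c' | c' < c. fd_weight c c' * nat_power c' b)"
      unfolding fd_moment_def split by (subst sum.insert) auto
    also have "(\<Sum>c' | c' < c. fd_weight c c' * nat_power c' b)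
        = (\<Sum>c' | c' < c. fd_weight c c' * (\<Sum>a | a \<le> c. Y c' a * fd_moment a b))"
    proof (intro sum.cong refl arg_cong[where f = "(*) _"])
      fix c' assume c': "c' \<in> {c'. c' < c}"
      have "(\<Sum>a | a \<le> c'. Y c' a * fd_moment a b) = (\<Sum>a | a \<le> c. Y c' a * fd_moment a b)"
        by (rule sum.mono_neutral_left) (use c' Y0 in \<open>auto intro: order_trans less_imp_le\<close>)
      then show "nat_power c' b = (\<Sum>a | a \<le> c. Y c' a * fd_moment a b)" using Y1 c' by simp
    qed
    also have "\<dots> = (\<Sum>a | a \<le> c. (\<Sum>c' | c' < c. fd_weight c c' * Y c' a) * fd_moment a b)"
      unfolding sum_distrib_left sum_distrib_right by (subst sum.swap) (simp add: mult_ac)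
    finally have "fd_weight c c * nat_power c b
       = fd_moment c b - (\<Sum>a | a \<le> c. (\<Sum>c' | c' < c. fd_weight c c' * Y c' a) * fd_moment a b)" by simp
    also have "fd_moment c b = (\<Sum>a | a \<le> c. (if a = c then 1 else 0) * fd_moment a b)"
      by (simp add: if_distrib[of "\<lambda>x. x * _"] sum.delta cong: if_cong)
    also have "\<dots> - (\<Sum>a | a \<le> c. (\<Sum>c' | c' < c. fd_weight c c' * Y c' a) * fd_moment a b)
        = (\<Sum>a | a \<le> c. fd_weight c c * (y a * fd_moment a b))"
      unfolding sum_subtractf[symmetric] y_def using fd_weight_diag[of c]
      by (intro sum.cong) (auto simp: field_simps)
    finally show ?thesis using fd_weight_diag[of c] by (simp add: sum_distrib_left[symmetric])
  qed
  moreover have "y a = 0" if "\<not> a \<le> c" for a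
  proof -
    have "Y c' a = 0" if "c' < c" for c' using Y0 that \<open>\<not> a \<le> c\<close> by (metis less_imp_le order_trans)
    then show ?thesis using that by (auto simp: y_def)
  qed
  ultimately show ?case by blast
qed

definition grid_point :: "real \<Rightarrow> nat^'d \<Rightarrow> complex^'d" where
  "grid_point \<epsilon> c = (\<chi> i. of_real (\<epsilon> * real (c $ i)))"

lemma monomial_grid_point: "monomial (grid_point \<epsilon> c) b = of_real (\<epsilon> ^ deg b * nat_power c b)"
  by (simp add: monomial_def grid_point_def nat_power_def power_deg power_mult_distrib prod.distrib)

lemma cnj_monomial_grid_point [simp]: "cnj (monomial (grid_point \<epsilon> c) b) = monomial (grid_point \<epsilon> c) b"
  unfolding monomial_grid_point by (rule complex_cnj_complex_of_real)

lemma deg_strict: assumes "a \<le> b" "a \<noteq> b" shows "deg a + 1 \<le> deg b"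
  using deg_less[of a b] assms by (simp add: multi_less_iff)

text \<open>Every index \<open>b \<noteq> a\<close> with \<open>a \<le> b\<close> has degree at least \<open>deg a + 1\<close>, so for small \<open>\<epsilon>\<close> these terms together
are of order \<open>\<epsilon>\<close> to the power \<open>deg a + 1\<close>.  The point is that the constants depend only on \<open>a\<close> and on
the growth of the coefficients.\<close>

lemma geometric_tail_bound:
  fixes C R :: real
  assumes R: "0 \<le> R" and C: "0 \<le> C"
  shows "\<exists>K. \<exists>\<epsilon>0>0. \<forall>\<epsilon> (e :: nat^'d \<Rightarrow> complex) s. 0 < \<epsilon> \<longrightarrow> \<epsilon> \<le> \<epsilon>0 \<longrightarrow> (\<forall>b. cmod (e b) \<le> C * R ^ deg b) \<longrightarrow>
    (\<forall>b. \<not> a \<le> b \<longrightarrow> e b = 0) \<longrightarrow> ((\<lambda>b. of_real (\<epsilon> ^ deg b) * e b) has_sum s) UNIV \<longrightarrow>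
    cmod (s - of_real (\<epsilon> ^ deg a) * e a) \<le> K * \<epsilon> ^ (deg a + 1)"
proof -
  define \<epsilon>0 where "\<epsilon>0 = 1 / (2 * (R + 1))"
  have \<epsilon>0: "\<epsilon>0 > 0" "R * \<epsilon>0 \<le> 1/2" using R by (auto simp: \<epsilon>0_def field_simps)
  define Q where "Q = infsum (\<lambda>b :: nat^'d. (1/2::real) ^ deg b) UNIV"
  have Q: "((\<lambda>b :: nat^'d. (1/2::real) ^ deg b) has_sum Q) UNIV"
    unfolding Q_def by (rule has_sum_infsum[OF summable_geometric_deg]) auto
  define K where "K = C / \<epsilon>0 ^ (deg a + 1) * Q"
  have "cmod (s - of_real (\<epsilon> ^ deg a) * e a) \<le> K * \<epsilon> ^ (deg a + 1)"
    if \<epsilon>: "0 < \<epsilon>" "\<epsilon> \<le> \<epsilon>0" and e: "\<And>b. cmod (e b) \<le> C * R ^ deg b" "\<And>b. \<not> a \<le> b \<Longrightarrow> e b = 0"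
      and s: "((\<lambda>b. of_real (\<epsilon> ^ deg b) * e b) has_sum s) UNIV" for \<epsilon> s and e :: "nat^'d \<Rightarrow> complex"
  proof -
    let ?t = "\<lambda>b. of_real (\<epsilon> ^ deg b) * e b + (if b = a then - (of_real (\<epsilon> ^ deg a) * e a) else 0)"
    have "((\<lambda>b. if b = a then - (of_real (\<epsilon> ^ deg a) * e a) else 0) has_sum - (of_real (\<epsilon> ^ deg a) * e a)) UNIV"
      by (rule has_sum_finite_neutralI[of "{a}"]) auto
    from has_sum_add[OF s this] have t: "(?t has_sum s - of_real (\<epsilon> ^ deg a) * e a) UNIV" by simp
    have le: "cmod (?t b) \<le> C / \<epsilon>0 ^ (deg a + 1) * \<epsilon> ^ (deg a + 1) * (1/2) ^ deg b" for b
    proof (cases "a \<le> b \<and> b \<noteq> a")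
      case True
      have "cmod (?t b) = \<epsilon> ^ deg b * cmod (e b)" using True \<epsilon> by (simp add: norm_mult norm_power)
      also have "\<dots> \<le> \<epsilon> ^ deg b * (C * R ^ deg b)" using e(1) \<epsilon> by (intro mult_left_mono) auto
      also have "\<dots> = C * ((\<epsilon> / \<epsilon>0) ^ deg b * (R * \<epsilon>0) ^ deg b)"
        using \<epsilon>0 by (simp add: power_mult_distrib power_divide)
      also have "\<dots> \<le> C * ((\<epsilon> / \<epsilon>0) ^ (deg a + 1) * (1/2) ^ deg b)"
      proof (intro mult_left_mono mult_mono C power_mono)
        show "(\<epsilon> / \<epsilon>0) ^ deg b \<le> (\<epsilon> / \<epsilon>0) ^ (deg a + 1)"
          using \<epsilon> \<epsilon>0 deg_strict[of a b] True by (intro power_decreasing) auto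
      qed (use \<epsilon> \<epsilon>0 R in auto)
      finally show ?thesis by (simp add: power_divide)
    next
      case False
      then have "?t b = 0" using e(2) by auto
      then show ?thesis using \<epsilon> \<epsilon>0 C by simp
    qed
    have "cmod (s - of_real (\<epsilon> ^ deg a) * e a) \<le> C / \<epsilon>0 ^ (deg a + 1) * \<epsilon> ^ (deg a + 1) * Q"
      by (rule norm_infsum_le[OF t has_sum_cmult_right[OF Q]]) (use le in auto)
    then show ?thesis by (simp add: K_def mult_ac)
  qed
  then show ?thesis using \<epsilon>0(1) by blast
qed

lemma has_sum_finite_sum:
  fixes f :: "'i \<Rightarrow> 'a \<Rightarrow> 'b :: topological_comm_monoid_add"
  assumes "\<And>i. i \<in> I \<Longrightarrow> (f i has_sum s i) A"
  shows "((\<lambda>x. \<Sum>i\<in>I. f i x) has_sum (\<Sum>i\<in>I. s i)) A"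
  using assms by (induction I rule: infinite_finite_induct) (auto intro: has_sum_add)

text \<open>The \<open>a\<close>-th difference annihilates every monomial whose exponent is not above \<open>a\<close>, so the leading term of
the difference of a power series on the grid with mesh \<open>\<epsilon>\<close> is \<open>\<epsilon>\<close> to the power \<open>deg a\<close> times the \<open>a\<close>-th
coefficient.  Uniformity over all series with a given coefficient growth is essential: it is applied
to solutions of interpolation problems that change with \<open>\<epsilon>\<close>.\<close>

lemma finite_difference_extracts_coefficient:
  fixes C R :: real and a :: "nat^'d"
  assumes R: "0 \<le> R" and C: "0 \<le> C"
  shows "\<exists>K. \<exists>\<epsilon>0>0. \<forall>\<epsilon> (d :: nat^'d \<Rightarrow> complex) D. 0 < \<epsilon> \<longrightarrow> \<epsilon> \<le> \<epsilon>0 \<longrightarrow> (\<forall>b. cmod (d b) \<le> C * R ^ deg b) \<longrightarrow>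
    (\<forall>c\<le>a. ((\<lambda>b. d b * monomial (grid_point \<epsilon> c) b) has_sum D c) UNIV) \<longrightarrow>
    cmod ((\<Sum>c | c \<le> a. of_real (fd_weight a c) * D c) - of_real (\<epsilon> ^ deg a) * d a) \<le> K * \<epsilon> ^ (deg a + 1)"
proof -
  define L where "L = (\<Sum>c | c \<le> a. \<bar>fd_weight a c\<bar>)"
  have L: "0 \<le> L" by (simp add: L_def sum_nonneg)
  from geometric_tail_bound[OF mult_nonneg_nonneg[OF R of_nat_0_le_iff[of "deg a"]] mult_nonneg_nonneg[OF C L], of a]
  obtain K \<epsilon>0 where \<epsilon>0: "\<epsilon>0 > 0" and
    K: "\<forall>\<epsilon> (e :: nat^'d \<Rightarrow> complex) s. 0 < \<epsilon> \<longrightarrow> \<epsilon> \<le> \<epsilon>0 \<longrightarrow>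
    (\<forall>b. cmod (e b) \<le> (C * L) * (R * real (deg a)) ^ deg b) \<longrightarrow> (\<forall>b. \<not> a \<le> b \<longrightarrow> e b = 0) \<longrightarrow>
    ((\<lambda>b. of_real (\<epsilon> ^ deg b) * e b) has_sum s) UNIV \<longrightarrow> cmod (s - of_real (\<epsilon> ^ deg a) * e a) \<le> K * \<epsilon> ^ (deg a + 1)"
    by (elim exE conjE) (rule that)
  have "cmod ((\<Sum>c | c \<le> a. of_real (fd_weight a c) * D c) - of_real (\<epsilon> ^ deg a) * d a) \<le> K * \<epsilon> ^ (deg a + 1)"
    if \<epsilon>: "0 < \<epsilon>" "\<epsilon> \<le> \<epsilon>0" and d: "\<And>b. cmod (d b) \<le> C * R ^ deg b"
      and D: "\<And>c. c \<le> a \<Longrightarrow> ((\<lambda>b. d b * monomial (grid_point \<epsilon> c) b) has_sum D c) UNIV" for \<epsilon> D and d :: "nat^'d \<Rightarrow> complex"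
  proof -
    let ?e = "\<lambda>b. d b * of_real (fd_moment a b)"
    have "((\<lambda>b. \<Sum>c | c \<le> a. of_real (fd_weight a c) * (d b * monomial (grid_point \<epsilon> c) b))
        has_sum (\<Sum>c | c \<le> a. of_real (fd_weight a c) * D c)) UNIV"
      by (intro has_sum_finite_sum has_sum_cmult_right D) auto
    also have "(\<lambda>b. \<Sum>c | c \<le> a. of_real (fd_weight a c) * (d b * monomial (grid_point \<epsilon> c) b))
        = (\<lambda>b. of_real (\<epsilon> ^ deg b) * ?e b)"
      by (simp add: monomial_grid_point fd_moment_def sum_distrib_left mult_ac)
    finally have s: "((\<lambda>b. of_real (\<epsilon> ^ deg b) * ?e b) has_sum (\<Sum>c | c \<le> a. of_real (fd_weight a c) * D c)) UNIV" .
    have "cmod (?e b) \<le> (C * L) * (R * real (deg a)) ^ deg b" for b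
    proof -
      have "cmod (?e b) \<le> (C * R ^ deg b) * (L * real (deg a) ^ deg b)"
        unfolding norm_mult norm_of_real L_def using R C
        by (intro mult_mono d fd_moment_bound) auto
      then show ?thesis by (simp add: power_mult_distrib mult_ac)
    qed
    then have "cmod ((\<Sum>c | c \<le> a. of_real (fd_weight a c) * D c) - of_real (\<epsilon> ^ deg a) * ?e a) \<le> K * \<epsilon> ^ (deg a + 1)"
      by (intro K[rule_format, OF \<epsilon> _ _ s]) (auto simp: fd_moment_eq_0)
    then show ?thesis by simp
  qed
  then show ?thesis using \<epsilon>0 by blast
qed

lemma norm_grid_point_le:
  assumes "c \<le> a" "0 \<le> \<epsilon>" shows "cmod (grid_point \<epsilon> c $ i) \<le> \<epsilon> * real (deg a)"
proof -
  have "c $ i \<le> a $ i" using assms by (simp add: multi_le_iff)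
  also have "\<dots> \<le> deg a" unfolding deg_def by (rule member_le_sum) auto
  finally show ?thesis using assms by (simp add: grid_point_def norm_mult mult_left_mono)
qed

lemma polydisc_in_ball:
  assumes "r > 0"
  shows "\<exists>s>0. \<forall>z :: complex^'d. (\<forall>i. cmod (z $ i) \<le> s) \<longrightarrow> z \<in> ball 0 r"
proof (intro exI conjI allI impI)
  let ?s = "r / (2 * real CARD('d))"
  show "?s > 0" using assms by simp
  fix z :: "complex^'d" assume z: "\<forall>i. cmod (z $ i) \<le> ?s"
  have "norm z \<le> (\<Sum>i\<in>UNIV. cmod (z $ i))" unfolding norm_vec_def by (rule L2_set_le_sum) auto
  also have "\<dots> \<le> (\<Sum>i\<in>(UNIV::'d set). ?s)" using z by (intro sum_mono) auto
  also have "\<dots> < r" using assms by simp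
  finally show "z \<in> ball 0 r" by simp
qed

lemma power_series_coefficient_bound:
  fixes d :: "nat^'d \<Rightarrow> complex"
  assumes s: "0 < s" and hs: "((\<lambda>b. d b * monomial (\<chi> i. of_real s) b) has_sum S) UNIV"
  shows "\<exists>C\<ge>0. \<forall>b. cmod (d b) \<le> C * (1 / s) ^ deg b"
proof -
  have "(\<lambda>b. cmod (d b * monomial (\<chi> i. of_real s) b)) summable_on UNIV"
    using has_sum_imp_summable[OF hs] unfolding summable_on_iff_abs_summable_on_complex .
  then obtain C where C: "((\<lambda>b. cmod (d b) * s ^ deg b) has_sum C) UNIV"
    using s by (auto simp: summable_on_def norm_mult norm_monomial power_deg)
  have "0 \<le> C" using C by (rule has_sum_nonneg) (use s in auto)
  moreover have "cmod (d b) \<le> C * (1 / s) ^ deg b" for b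
    using finite_sum_le_has_sum[OF C, of "{b}"] s by (simp add: power_divide field_simps)
  ultimately show ?thesis by blast
qed

lemma power_series_coefficient_eq_0:
  fixes d :: "nat^'d \<Rightarrow> complex"
  assumes r: "r > 0" and hs: "\<And>z. z \<in> ball 0 r \<Longrightarrow> ((\<lambda>b. d b * monomial z b) has_sum 0) UNIV"
  shows "d a = 0"
proof -
  obtain s where s: "0 < s" "\<And>z :: complex^'d. (\<And>i. cmod (z $ i) \<le> s) \<Longrightarrow> z \<in> ball 0 r"
    using polydisc_in_ball[OF r] by blast
  obtain C where C: "0 \<le> C" "\<And>b. cmod (d b) \<le> C * (1 / s) ^ deg b"
    using power_series_coefficient_bound[OF s(1) hs[OF s(2)]] s(1) by auto
  have s0: "0 \<le> 1 / s" using s(1) by simp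
  from finite_difference_extracts_coefficient[OF s0 C(1), of a]
  obtain K \<epsilon>0 where \<epsilon>0: "\<epsilon>0 > 0" and K: "\<forall>\<epsilon> (d :: nat^'d \<Rightarrow> complex) D. 0 < \<epsilon> \<longrightarrow> \<epsilon> \<le> \<epsilon>0 \<longrightarrow> (\<forall>b. cmod (d b) \<le> C * (1 / s) ^ deg b) \<longrightarrow>
    (\<forall>c\<le>a. ((\<lambda>b. d b * monomial (grid_point \<epsilon> c) b) has_sum D c) UNIV) \<longrightarrow>
    cmod ((\<Sum>c | c \<le> a. of_real (fd_weight a c) * D c) - of_real (\<epsilon> ^ deg a) * d a) \<le> K * \<epsilon> ^ (deg a + 1)"
    by (elim exE conjE) (rule that)
  define \<epsilon>1 where "\<epsilon>1 = min \<epsilon>0 (s / (real (deg a) + 1))"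
  have \<epsilon>1: "\<epsilon>1 > 0" using \<epsilon>0 s(1) by (simp add: \<epsilon>1_def)
  have le: "cmod (d a) \<le> K * \<epsilon>" if \<epsilon>: "0 < \<epsilon>" "\<epsilon> \<le> \<epsilon>1" for \<epsilon>
  proof -
    have "((\<lambda>b. d b * monomial (grid_point \<epsilon> c) b) has_sum 0) UNIV" if c: "c \<le> a" for c
    proof (rule hs[OF s(2)])
      fix i
      have "\<epsilon> * real (deg a) \<le> \<epsilon> * (real (deg a) + 1)" using \<epsilon> by simp
      also have "\<dots> \<le> s" using \<epsilon> by (simp add: \<epsilon>1_def field_simps)
      finally show "cmod (grid_point \<epsilon> c $ i) \<le> s"
        using norm_grid_point_le[OF c, of \<epsilon> i] \<epsilon> by simp
    qed
    then have "cmod ((\<Sum>c | c \<le> a. of_real (fd_weight a c) * 0) - of_real (\<epsilon> ^ deg a) * d a) \<le> K * \<epsilon> ^ (deg a + 1)"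
      using K[rule_format, of \<epsilon> d "\<lambda>_. 0"] \<epsilon> C by (auto simp: \<epsilon>1_def)
    then have "\<epsilon> ^ deg a * cmod (d a) \<le> \<epsilon> ^ deg a * (K * \<epsilon>)"
      using \<epsilon> by (simp add: norm_mult norm_power mult_ac)
    then show ?thesis using \<epsilon> by (simp add: mult_le_cancel_left_pos)
  qed
  have "((\<lambda>\<epsilon>. K * \<epsilon>) \<longlongrightarrow> K * 0) (at_right 0)" by (intro tendsto_intros)
  moreover have "\<forall>\<^sub>F \<epsilon> in at_right 0. cmod (d a) \<le> K * \<epsilon>"
    using eventually_at_right_less[of 0] eventually_at_right[OF \<epsilon>1] by (auto intro!: exI[of _ \<epsilon>1] le simp: eventually_at_right[OF \<epsilon>1] \<epsilon>1)
  ultimately have "cmod (d a) \<le> K * 0"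
    by (intro tendsto_lowerbound[of _ "K * 0" "at_right 0"]) auto
  then show ?thesis by simp
qed

text \<open>In the coordinates \<open>Z a = \<epsilon>^deg a Y a\<close>, where \<open>Y\<close> are the coefficients of \<open>\<Sum>\<^sub>c x\<^sub>c \<cdot> (evaluation at c)\<close>
with respect to the difference functionals, the \<open>b\<close>-th term of the quadratic form is \<open>h b |Z b|\<^sup>2\<close> up to an
error of order \<open>\<epsilon>\<close> if \<open>b \<in> F\<close>, and all terms with \<open>b \<notin> F\<close> together are of order \<open>\<epsilon>\<^sup>2\<close>.  Hence the signs
of \<open>h\<close> on \<open>F\<close> decide.\<close>

lemma jet_positivity:
  fixes h :: "nat^'d \<Rightarrow> real"
  assumes F: "finite F" "co_invariant F" and pos: "\<And>b. b \<in> F \<Longrightarrow> 0 < h b"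
    and R: "0 \<le> R" and C: "0 \<le> C" and hb: "\<And>b. \<bar>h b\<bar> \<le> C * R ^ deg b"
  shows "\<exists>\<epsilon>0>0. \<forall>\<epsilon> (x :: nat^'d \<Rightarrow> complex) q. 0 < \<epsilon> \<longrightarrow> \<epsilon> \<le> \<epsilon>0 \<longrightarrow>
    ((\<lambda>b. h b * (\<epsilon> ^ deg b * cmod (\<Sum>c\<in>F. x c * of_real (nat_power c b)))\<^sup>2) has_sum q) UNIV \<longrightarrow> 0 \<le> q"
proof -
  define L where "L = (\<Sum>a\<in>F. \<Sum>c | c \<le> a. \<bar>fd_weight a c\<bar>)"
  define A where "A = (\<Sum>a\<in>F. real (deg a))"
  define D where "D = (\<Sum>a\<in>F. deg a)"
  define m where "m = Min (h ` F)"
  define \<epsilon>0 where "\<epsilon>0 = 1 / (2 * (A + 1) * (R + 1))"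
  define Q where "Q = infsum (\<lambda>b :: nat^'d. (1/2::real) ^ deg b) UNIV"
  define G where "G = real (card F) * L / \<epsilon>0 ^ (D + 1)"
  have Fne: "F \<noteq> {}" using F(2) by (simp add: co_invariant_def)
  have L0: "0 \<le> L" and A0: "0 \<le> A" by (auto simp: L_def A_def intro!: sum_nonneg)
  have m: "0 < m" "\<And>b. b \<in> F \<Longrightarrow> m \<le> h b" using F(1) Fne pos by (auto simp: m_def)
  have "1 * 1 \<le> (A + 1) * (R + 1)" using A0 R by (intro mult_mono) auto
  then have "1 \<le> 2 * (A + 1) * (R + 1)" by linarith
  then have \<epsilon>0: "0 < \<epsilon>0" "\<epsilon>0 \<le> 1" unfolding \<epsilon>0_def by (auto intro: divide_le_eq_1_pos[THEN iffD2])
  have small: "R * (A * \<epsilon>0)\<^sup>2 \<le> 1 / 2"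
  proof -
    have "A / (A + 1) \<le> 1" "R / (R + 1) \<le> 1" using A0 R by auto
    have "R * (A * \<epsilon>0)\<^sup>2 = (1/4) * ((A / (A + 1))\<^sup>2 * ((R / (R + 1)) * (1 / (R + 1))))"
    proof -
      have "\<epsilon>0 = 1 / 2 * (1 / (A + 1)) * (1 / (R + 1))" by (simp add: \<epsilon>0_def)
      then show ?thesis by (simp only: power2_eq_square times_divide_eq_right times_divide_eq_left
            mult_1_right mult_1_left mult_ac divide_divide_eq_left)
    qed
    also have "\<dots> \<le> (1/4) * (1 * (1 * 1))"
      using A0 R by (intro mult_left_mono mult_mono power_le_one) auto
    finally show ?thesis by simp
  qed
  have Q: "((\<lambda>b :: nat^'d. (1/2::real) ^ deg b) has_sum Q) UNIV"
    unfolding Q_def by (rule has_sum_infsum[OF summable_geometric_deg]) auto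
  have Q0: "0 \<le> Q" using Q by (rule has_sum_nonneg) auto
  have G0: "0 \<le> G" unfolding G_def using L0 \<epsilon>0 by simp
  define K where "K = C * G\<^sup>2 * Q"
  have K0: "0 \<le> K" unfolding K_def using C Q0 by simp
  define \<epsilon>1 where "\<epsilon>1 = min \<epsilon>0 (sqrt (m / (2 * (K + 1))))"
  have \<epsilon>1: "0 < \<epsilon>1" using \<epsilon>0 m K0 by (simp add: \<epsilon>1_def)
  have "0 \<le> q" if \<epsilon>: "0 < \<epsilon>" "\<epsilon> \<le> \<epsilon>1"
    and q: "((\<lambda>b. h b * (\<epsilon> ^ deg b * cmod (\<Sum>c\<in>F. x c * of_real (nat_power c b)))\<^sup>2) has_sum q) UNIV"
    for \<epsilon> q and x :: "nat^'d \<Rightarrow> complex"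
  proof -
    have \<epsilon>': "\<epsilon> \<le> \<epsilon>0" "\<epsilon> \<le> 1" using \<epsilon> \<epsilon>0 by (auto simp: \<epsilon>1_def)
    have "\<epsilon> \<le> sqrt (m / (2 * (K + 1)))" using \<epsilon> by (simp add: \<epsilon>1_def)
    then have "\<epsilon>\<^sup>2 \<le> (sqrt (m / (2 * (K + 1))))\<^sup>2" using \<epsilon>(1) by (intro power_mono) auto
    also have "\<dots> = m / (2 * (K + 1))" using m K0 by simp
    finally have "\<epsilon>\<^sup>2 * (2 * (K + 1)) \<le> m" using K0 by (simp add: pos_le_divide_eq)
    moreover have "\<epsilon>\<^sup>2 * (2 * K) \<le> \<epsilon>\<^sup>2 * (2 * (K + 1))" by (intro mult_left_mono) auto
    ultimately have \<epsilon>K: "\<epsilon>\<^sup>2 * K \<le> m / 2" by simp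
    obtain y :: "nat^'d \<Rightarrow> nat^'d \<Rightarrow> real" where y: "\<And>c a. \<not> a \<le> c \<Longrightarrow> y c a = 0"
      "\<And>c b. nat_power c b = (\<Sum>a | a \<le> c. y c a * fd_moment a b)"
      using nat_power_spanned by metis
    define Y where "Y a = (\<Sum>c\<in>F. x c * of_real (y c a))" for a
    define X where "X b = (\<Sum>c\<in>F. x c * of_real (nat_power c b))" for b
    have X: "X b = (\<Sum>a\<in>F. Y a * of_real (fd_moment a b))" for b
    proof -
      have "X b = (\<Sum>c\<in>F. \<Sum>a\<in>F. x c * of_real (y c a * fd_moment a b))"
        unfolding X_def
      proof (intro sum.cong refl)
        fix c assume c: "c \<in> F"
        have "(\<Sum>a | a \<le> c. y c a * fd_moment a b) = (\<Sum>a\<in>F. y c a * fd_moment a b)"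
          by (rule sum.mono_neutral_left) (use F c y(1) in \<open>auto simp: co_invariant_def\<close>)
        then show "x c * of_real (nat_power c b) = (\<Sum>a\<in>F. x c * of_real (y c a * fd_moment a b))"
          using y(2)[of c b] by (simp add: sum_distrib_left)
      qed
      then show ?thesis unfolding Y_def sum_distrib_right by (subst sum.swap) (simp add: mult_ac)
    qed
    define Z where "Z a = of_real (\<epsilon> ^ deg a) * Y a" for a
    define S where "S = (\<Sum>a\<in>F. (cmod (Z a))\<^sup>2)"
    define E where "E b = (\<Sum>a\<in>F - {b}. of_real (\<epsilon> ^ deg b) * (Y a * of_real (fd_moment a b)))" for b
    have S0: "0 \<le> S" unfolding S_def by (simp add: sum_nonneg)
    have ZS: "cmod (Z a) \<le> sqrt S" if "a \<in> F" for a
      unfolding S_def using F(1) that by (intro real_le_rsqrt member_le_sum) auto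
    (* The diagonal moments are 1, so Z b is the main part and E b collects the off-diagonal moments. *)
    have split: "of_real (\<epsilon> ^ deg b) * X b = (if b \<in> F then Z b else 0) + E b" for b
    proof (cases "b \<in> F")
      case True
      then show ?thesis unfolding X sum_distrib_left E_def Z_def using F(1) by (simp add: sum.remove)
    qed (simp add: X sum_distrib_left E_def)
    have E: "cmod (E b) \<le> \<epsilon> * G * (A * \<epsilon>0) ^ deg b * sqrt S" for b
    proof -
      have "cmod (E b) \<le> (\<Sum>a\<in>F - {b}. cmod (of_real (\<epsilon> ^ deg b) * (Y a * of_real (fd_moment a b))))"
        unfolding E_def by (rule norm_sum)
      also have "\<dots> \<le> (\<Sum>a\<in>F - {b}. \<epsilon> * (L / \<epsilon>0 ^ (D + 1)) * (A * \<epsilon>0) ^ deg b * sqrt S)"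
      proof (rule sum_mono)
        fix a assume a: "a \<in> F - {b}"
        show "cmod (of_real (\<epsilon> ^ deg b) * (Y a * of_real (fd_moment a b)))
          \<le> \<epsilon> * (L / \<epsilon>0 ^ (D + 1)) * (A * \<epsilon>0) ^ deg b * sqrt S"
        proof (cases "a \<le> b")
          case False
          then show ?thesis using \<epsilon> \<epsilon>0 L0 A0 S0 by (simp add: fd_moment_eq_0)
        next
          case True
          with a have lt: "deg a + 1 \<le> deg b" by (intro deg_strict) auto
          have aD: "deg a \<le> D" unfolding D_def using F(1) a by (intro member_le_sum) auto
          have "\<bar>fd_moment a b\<bar> \<le> (\<Sum>c | c \<le> a. \<bar>fd_weight a c\<bar>) * real (deg a) ^ deg b" by (rule fd_moment_bound)
          also have "\<dots> \<le> L * A ^ deg b"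
          proof (intro mult_mono power_mono)
            show "(\<Sum>c | c \<le> a. \<bar>fd_weight a c\<bar>) \<le> L" unfolding L_def
              using F(1) a by (intro member_le_sum[of a F "\<lambda>a. \<Sum>c | c \<le> a. \<bar>fd_weight a c\<bar>"]) (auto intro: sum_nonneg)
            show "real (deg a) \<le> A" unfolding A_def using F(1) a by (intro member_le_sum) auto
          qed (use L0 in auto)
          finally have mom: "\<bar>fd_moment a b\<bar> \<le> L * A ^ deg b" .
          obtain n where n: "deg b = deg a + 1 + n" using le_Suc_ex[OF lt] by blast
          have "\<epsilon> ^ Suc n = \<epsilon> * \<epsilon> ^ n" by simp
          also have "\<dots> \<le> \<epsilon> * \<epsilon>0 ^ n" using \<epsilon> \<epsilon>' by (intro mult_left_mono power_mono) auto
          also have "\<epsilon>0 ^ n = \<epsilon>0 ^ deg b / \<epsilon>0 ^ (deg a + 1)"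
            using \<epsilon>0 by (simp add: n power_add)
          also have "\<epsilon> * \<dots> \<le> \<epsilon> * (\<epsilon>0 ^ deg b / \<epsilon>0 ^ (D + 1))"
            using \<epsilon> \<epsilon>0 aD by (intro mult_left_mono divide_left_mono power_decreasing) auto
          finally have eps: "\<epsilon> ^ Suc n \<le> \<epsilon> * (\<epsilon>0 ^ deg b / \<epsilon>0 ^ (D + 1))" .
          have "cmod (of_real (\<epsilon> ^ deg b) * (Y a * of_real (fd_moment a b))) = \<epsilon> ^ Suc n * (cmod (Z a) * \<bar>fd_moment a b\<bar>)"
            using \<epsilon>(1) by (simp add: Z_def norm_mult norm_power power_add n)
          also have "\<dots> \<le> \<epsilon> * (\<epsilon>0 ^ deg b / \<epsilon>0 ^ (D + 1)) * (sqrt S * (L * A ^ deg b))"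
            using a \<epsilon> \<epsilon>0 S0 by (intro mult_mono eps ZS mom) auto
          finally show ?thesis by (simp add: power_mult_distrib mult_ac)
        qed
      qed
      also have "\<dots> = real (card (F - {b})) * (\<epsilon> * (L / \<epsilon>0 ^ (D + 1)) * (A * \<epsilon>0) ^ deg b * sqrt S)" by simp
      also have "\<dots> \<le> real (card F) * (\<epsilon> * (L / \<epsilon>0 ^ (D + 1)) * (A * \<epsilon>0) ^ deg b * sqrt S)"
        using F(1) \<epsilon> \<epsilon>0 L0 A0 S0 by (intro mult_right_mono) (auto intro!: card_mono)
      finally show ?thesis by (simp add: G_def mult_ac)
    qed
    have hE: "\<bar>h b\<bar> * (cmod (E b))\<^sup>2 \<le> \<epsilon>\<^sup>2 * (C * G\<^sup>2 * S) * (1/2) ^ deg b" for b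
    proof -
      have "\<bar>h b\<bar> * (cmod (E b))\<^sup>2 \<le> (C * R ^ deg b) * (\<epsilon> * G * (A * \<epsilon>0) ^ deg b * sqrt S)\<^sup>2"
        using E[of b] C R by (intro mult_mono hb power_mono) auto
      also have "\<dots> = \<epsilon>\<^sup>2 * (C * G\<^sup>2 * S) * (R * (A * \<epsilon>0)\<^sup>2) ^ deg b"
        using S0 by (simp add: power_mult_distrib power_mult[symmetric] mult.commute[of 2] mult_ac)
      also have "\<dots> \<le> \<epsilon>\<^sup>2 * (C * G\<^sup>2 * S) * (1/2) ^ deg b"
        using small C R S0 by (intro mult_left_mono power_mono) auto
      finally show ?thesis .
    qed
    have "m / 2 * S + - (\<epsilon>\<^sup>2 * (C * G\<^sup>2 * S) * Q) \<le> q"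
    proof (rule has_sum_mono[OF _ q])
      have "((\<lambda>b. if b \<in> F then m / 2 * (cmod (Z b))\<^sup>2 else 0) has_sum m / 2 * S) UNIV"
        by (rule has_sum_finite_neutralI[OF F(1)]) (auto simp: S_def sum_distrib_left)
      moreover have "((\<lambda>b :: nat^'d. - (\<epsilon>\<^sup>2 * (C * G\<^sup>2 * S) * (1/2) ^ deg b)) has_sum - (\<epsilon>\<^sup>2 * (C * G\<^sup>2 * S) * Q)) UNIV"
        by (intro has_sum_uminusI has_sum_cmult_right Q)
      ultimately show "((\<lambda>b. (if b \<in> F then m / 2 * (cmod (Z b))\<^sup>2 else 0) + - (\<epsilon>\<^sup>2 * (C * G\<^sup>2 * S) * (1/2) ^ deg b))
          has_sum (m / 2 * S + - (\<epsilon>\<^sup>2 * (C * G\<^sup>2 * S) * Q))) UNIV" by (rule has_sum_add)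
      fix b :: "nat^'d"
      have e: "\<epsilon> ^ deg b * cmod (\<Sum>c\<in>F. x c * of_real (nat_power c b)) = cmod ((if b \<in> F then Z b else 0) + E b)"
        unfolding split[symmetric] X_def[symmetric] using \<epsilon>(1) by (simp add: norm_mult norm_power)
      show "(if b \<in> F then m / 2 * (cmod (Z b))\<^sup>2 else 0) + - (\<epsilon>\<^sup>2 * (C * G\<^sup>2 * S) * (1/2) ^ deg b)
          \<le> h b * (\<epsilon> ^ deg b * cmod (\<Sum>c\<in>F. x c * of_real (nat_power c b)))\<^sup>2"
      proof (cases "b \<in> F")
        case True
        have "(cmod (Z b))\<^sup>2 = (cmod ((Z b + E b) + - E b))\<^sup>2" by simp
        also have "\<dots> \<le> 2 * (cmod (Z b + E b))\<^sup>2 + 2 * (cmod (E b))\<^sup>2"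
          using cmod_add_sq_le[of "Z b + E b" "- E b"] by simp
        finally have "h b * ((cmod (Z b))\<^sup>2 / 2) \<le> h b * ((cmod (Z b + E b))\<^sup>2 + (cmod (E b))\<^sup>2)"
          using pos[OF True] by (intro mult_left_mono) auto
        moreover have "m / 2 * (cmod (Z b))\<^sup>2 \<le> h b * ((cmod (Z b))\<^sup>2 / 2)"
          using mult_right_mono[OF m(2)[OF True], of "(cmod (Z b))\<^sup>2"] by simp
        moreover have "h b * (cmod (E b))\<^sup>2 \<le> \<epsilon>\<^sup>2 * (C * G\<^sup>2 * S) * (1/2) ^ deg b"
          using hE[of b] pos[OF True] by simp
        ultimately show ?thesis unfolding e using True by (simp add: distrib_left)
      next
        case False
        have "- (\<bar>h b\<bar> * (cmod (E b))\<^sup>2) \<le> h b * (cmod (E b))\<^sup>2"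
          using mult_right_mono[of "- \<bar>h b\<bar>" "h b" "(cmod (E b))\<^sup>2"] by simp
        then show ?thesis unfolding e using False hE[of b] by simp
      qed
    qed
    moreover have "\<epsilon>\<^sup>2 * (C * G\<^sup>2 * S) * Q \<le> m / 2 * S"
      using mult_right_mono[OF \<epsilon>K S0] by (simp add: K_def mult_ac)
    ultimately show ?thesis by simp
  qed
  then show ?thesis using \<epsilon>1 by blast
qed

section \<open>The expansion of a diagonal kernel on the whole domain\<close>

text \<open>Holomorphy along complex lines is all that the identity theorem uses, and it is preserved by
locally uniformly convergent power series and by restriction without any work on derivatives.\<close>

definition line_holomorphic :: "(complex^'d \<Rightarrow> complex) \<Rightarrow> (complex^'d) set \<Rightarrow> bool" where
  "line_holomorphic \<phi> V \<longleftrightarrow> (\<forall>x y. (\<lambda>t. \<phi> (x + t *s y)) holomorphic_on {t. x + t *s y \<in> V})"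

lemma has_derivative_line: "((\<lambda>t. x + t *s y) has_derivative (\<lambda>h. h *s y)) (at t)" for y :: "complex^'d"
proof -
  have "bounded_linear (\<lambda>t. t *s y)"
  proof (rule bounded_linear_intro[where K = "norm y"])
    show "norm (t *s y) \<le> norm t * norm y" for t
      unfolding norm_vec_def by (simp add: norm_mult L2_set_right_distrib[symmetric])
  qed (simp_all add: Finite_Cartesian_Product.vec_eq_iff algebra_simps)
  then show ?thesis by (auto intro!: derivative_eq_intros bounded_linear_imp_has_derivative)
qed

lemma continuous_line: "continuous_on S (\<lambda>t. x + t *s y)" for y :: "complex^'d"
  by (rule has_derivative_continuous_on[where f' = "\<lambda>_ h. h *s y"])
    (rule has_derivative_at_withinI[OF has_derivative_line])

lemma open_line_preimage: "open V \<Longrightarrow> open {t. x + t *s y \<in> V}" for V :: "(complex^'d) set"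
  using open_vimage[OF _ continuous_line, of V x y] by (simp add: vimage_def)

text \<open>In a convex set every point is joined to a point of \<open>U\<close> by a complex line that meets the set in a
connected piece, on which the identity theorem in one variable applies.\<close>

lemma line_holomorphic_identity:
  assumes V: "open V" "convex V" and \<phi>: "line_holomorphic \<phi> V"
    and U: "open U" "U \<noteq> {}" "U \<subseteq> V" "\<And>z. z \<in> U \<Longrightarrow> \<phi> z = 0" and y: "y \<in> V"
  shows "\<phi> y = 0"
proof -
  obtain x where x: "x \<in> U" using U by auto
  let ?l = "\<lambda>t. x + t *s (y - x)"
  let ?S = "{t. ?l t \<in> V}" and ?U = "{t. ?l t \<in> U}"
  have "convex ?S"
    unfolding convex_def
  proof (intro ballI allI impI, unfold mem_Collect_eq)
    fix s t u v assume s: "?l s \<in> V" and t: "?l t \<in> V" and uv: "0 \<le> u" "0 \<le> v" "u + v = (1::real)"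
    have "?l (u *\<^sub>R s + v *\<^sub>R t) = u *\<^sub>R ?l s + v *\<^sub>R ?l t"
    proof -
      have "v = 1 - u" using uv by simp
      then show ?thesis
        by (simp only: Finite_Cartesian_Product.vec_eq_iff vector_add_component vector_scaleR_component
            vector_smult_component vector_minus_component) (simp add: scaleR_conv_of_real algebra_simps)
    qed
    then show "?l (u *\<^sub>R s + v *\<^sub>R t) \<in> V" using V(2) s t uv unfolding convex_def by simp
  qed
  then have con: "connected ?S" by (rule convex_connected)
  have "(\<lambda>t. \<phi> (?l t)) 1 = 0"
  proof (rule analytic_continuation[of "\<lambda>t. \<phi> (?l t)" ?S ?U 0 1])
    show "(\<lambda>t. \<phi> (?l t)) holomorphic_on ?S" using \<phi> unfolding line_holomorphic_def by blast
    show "open ?S" by (rule open_line_preimage[OF V(1)])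
    show "connected ?S" by (rule con)
    show "?U \<subseteq> ?S" using U by auto
    show "0 \<in> ?S" using x U by auto
    show "0 islimpt ?U" 
      by (rule interior_limit_point) (subst interior_open[OF open_line_preimage[OF U(1)]], use x in simp)
    show "1 \<in> ?S" using y by simp
  qed (use U in auto)
  then show ?thesis by simp
qed

lemma identity_theorem_several:
  assumes \<Omega>: "open \<Omega>" "connected \<Omega>"
    and loc: "\<And>p. p \<in> \<Omega> \<Longrightarrow> \<exists>V. open V \<and> convex V \<and> p \<in> V \<and> V \<subseteq> \<Omega> \<and> line_holomorphic \<phi> V"
    and U: "open U" "U \<noteq> {}" "U \<subseteq> \<Omega>" "\<And>z. z \<in> U \<Longrightarrow> \<phi> z = 0" and y: "y \<in> \<Omega>"
  shows "\<phi> y = 0"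
proof -
  (* The interior of the zero set is closed relative to the domain. *)
  define E where "E = interior {z. \<phi> z = 0}"
  have cl: "p \<in> E" if p: "p \<in> \<Omega>" "p \<in> closure E" for p
  proof -
    obtain V where V: "open V" "convex V" "p \<in> V" "line_holomorphic \<phi> V" using loc[OF p(1)] by blast
    have ne: "V \<inter> E \<noteq> {}" using p(2) V unfolding closure_iff_nhds_not_empty by blast
    have "\<phi> z = 0" if "z \<in> V" for z
      by (rule line_holomorphic_identity[OF V(1,2,4) _ ne _ _ that])
        (use interior_subset[of "{z. \<phi> z = 0}"] V in \<open>auto simp: E_def\<close>)
    then have "V \<subseteq> E" unfolding E_def using V(1) by (intro interior_maximal) auto
    then show ?thesis using V by auto
  qed
  have "U \<subseteq> E" unfolding E_def using U by (intro interior_maximal) auto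
  moreover have "E \<inter> \<Omega> = {} \<or> - closure E \<inter> \<Omega> = {}"
    by (rule connectedD[OF \<Omega>(2)]) (use cl closure_subset[of E] in \<open>auto simp: E_def\<close>)
  ultimately have "y \<in> closure E" using U y by blast
  then have "y \<in> E" by (rule cl[OF y])
  then show ?thesis using interior_subset by (auto simp: E_def)
qed

lemma line_holomorphic_diff:
  "line_holomorphic \<phi> V \<Longrightarrow> line_holomorphic \<psi> V \<Longrightarrow> line_holomorphic (\<lambda>z. \<phi> z - \<psi> z) V"
  unfolding line_holomorphic_def by (intro allI holomorphic_on_diff) auto

lemma holomorphic_several_imp_line_holomorphic:
  assumes "holomorphic_several f \<Omega>" "V \<subseteq> \<Omega>" shows "line_holomorphic f V"
  unfolding line_holomorphic_def holomorphic_on_def field_differentiable_def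
proof (intro allI ballI)
  fix x y t assume "t \<in> {t. x + t *s y \<in> V}"
  then obtain D where D: "(f has_derivative D) (at (x + t *s y))" "\<And>c v. D (c *s v) = c * D v"
    using assms unfolding holomorphic_several_def by blast
  have "((\<lambda>t. f (x + t *s y)) has_derivative (\<lambda>h. D (h *s y))) (at t)"
    using diff_chain_at[OF has_derivative_line D(1)] by (simp add: o_def)
  then have "((\<lambda>t. f (x + t *s y)) has_field_derivative D y) (at t)"
  proof -
    have "(\<lambda>h. D (h *s y)) = (*) (D y)" by (simp add: fun_eq_iff D(2))
    then show "((\<lambda>t. f (x + t *s y)) has_derivative (\<lambda>h. D (h *s y))) (at t) \<Longrightarrow> ?thesis"
      unfolding has_field_derivative_def by simp
  qed
  then show "\<exists>f'. ((\<lambda>t. f (x + t *s y)) has_field_derivative f') (at t within {t. x + t *s y \<in> V})"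
    by (blast intro: has_field_derivative_at_within)
qed

lemma line_holomorphic_power_series:
  fixes e :: "nat^'d \<Rightarrow> complex"
  assumes V: "open V" and M: "M summable_on UNIV" and le: "\<And>z b. z \<in> V \<Longrightarrow> cmod (e b * monomial z b) \<le> M b"
  shows "line_holomorphic (\<lambda>z. infsum (\<lambda>b. e b * monomial z b) UNIV) V"
  unfolding line_holomorphic_def
proof (intro allI)
  fix x y :: "complex^'d"
  let ?S = "{t. x + t *s y \<in> V}" and ?f = "\<lambda>b t. e b * monomial (x + t *s y) b"
  let ?g = "\<lambda>t. infsum (\<lambda>b. ?f b t) UNIV"
  have op: "open ?S" by (rule open_line_preimage[OF V])
  have hol: "(\<lambda>t. \<Sum>b\<in>X. ?f b t) holomorphic_on A" for X A
    unfolding monomial_def by (intro holomorphic_intros) (simp, intro holomorphic_intros)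
  show "?g holomorphic_on ?S"
  proof (subst holomorphic_on_open[OF op], intro ballI)
    fix t assume t: "t \<in> ?S"
    obtain r where r: "r > 0" "cball t r \<subseteq> ?S" using op t open_contains_cball by blast
    have "uniform_limit (cball t r) (\<lambda>X t. \<Sum>b\<in>X. ?f b t) ?g (finite_subsets_at_top UNIV)"
      by (rule Weierstrass_m_test_general[OF _ M]) (use le r in auto)
    then have "?g holomorphic_on ball t r"
      by (rule holomorphic_uniform_limit[rotated])
        (auto intro: always_eventually hol holomorphic_on_imp_continuous_on[OF hol])
    then show "\<exists>f'. (?g has_field_derivative f') (at t)"
      using r(1) by (auto simp: holomorphic_on_open)
  qed
qed

lemma is_kernel_sum_nonneg:
  assumes k: "is_kernel X k" and I: "finite I" and p: "\<And>i. i \<in> I \<Longrightarrow> p i \<in> X"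
  shows "0 \<le> (\<Sum>i\<in>I. \<Sum>j\<in>I. cnj (x i) * k (p i) (p j) * x j)"
proof -
  obtain e where e: "bij_betw e {..<card I} I" using ex_bij_betw_nat_finite[OF I] by (auto simp: atLeast0LessThan)
  have "psd_on {..<card I} (\<lambda>i j. k (p (e i)) (p (e j)))"
    using k p bij_betwE[OF e] unfolding is_kernel_def by auto
  then have "0 \<le> (\<Sum>i<card I. \<Sum>j<card I. cnj (x (e i)) * k (p (e i)) (p (e j)) * x (e j))"
    unfolding psd_on_def by (auto dest: spec[of _ "x \<circ> e"])
  also have "\<dots> = (\<Sum>i\<in>I. \<Sum>j<card I. cnj (x i) * k (p i) (p (e j)) * x (e j))"
    by (rule sum.reindex_bij_betw[OF e])
  also have "\<dots> = (\<Sum>i\<in>I. \<Sum>j\<in>I. cnj (x i) * k (p i) (p j) * x j)"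
    by (intro sum.cong refl sum.reindex_bij_betw[OF e])
  finally show ?thesis .
qed

lemma is_kernel_hermitian:
  assumes k: "is_kernel X k" and z: "z \<in> X" "w \<in> X" shows "k w z = cnj (k z w)"
proof -
  have form: "0 \<le> (\<Sum>i<2::nat. \<Sum>j<2. cnj (x i) * k ([z, w] ! i) ([z, w] ! j) * x j)" for x
  proof (rule is_kernel_sum_nonneg[OF k])
    fix i :: nat assume "i \<in> {..<2}"
    then show "[z, w] ! i \<in> X" using z by (cases i) (auto simp: less_Suc_eq)
  qed simp
  have "0 \<le> k z z" "0 \<le> k w w"
    using form[of "\<lambda>i. if i = 0 then 1 else 0"] form[of "\<lambda>i. if i = 0 then 0 else 1"]
    by (simp_all add: numeral_2_eq_2)
  then have im: "Im (k z z) = 0" "Im (k w w) = 0" by (auto simp: less_eq_complex_def)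
  have 1: "Im (k z w) + Im (k w z) = 0"
    using form[of "\<lambda>_. 1"] im by (simp add: numeral_2_eq_2 less_eq_complex_def)
  have 2: "Re (k z w) - Re (k w z) = 0"
    using form[of "\<lambda>i. if i = 0 then 1 else \<i>"] im by (simp add: numeral_2_eq_2 less_eq_complex_def)
  show ?thesis using 1 2 by (simp add: complex_eq_iff)
qed
text \<open>The series converges at a diagonal point with equal nonzero coordinates.\<close>

lemma diagonal_coefficient_bound:
  fixes f :: "complex^'d \<Rightarrow> complex^'d \<Rightarrow> complex" and fc :: "nat^'d \<Rightarrow> real"
  assumes r: "0 < r" and hs: "\<And>z w. z \<in> ball 0 r \<Longrightarrow> w \<in> ball 0 r \<Longrightarrow>
      ((\<lambda>a. of_real (fc a) * monomial z a * cnj (monomial w a)) has_sum f z w) UNIV"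
  shows "\<exists>C R. 0 \<le> C \<and> 0 \<le> R \<and> (\<forall>b. \<bar>fc b\<bar> \<le> C * R ^ deg b)"
proof -
  obtain s where s: "0 < s" "\<And>z :: complex^'d. (\<And>i. cmod (z $ i) \<le> s) \<Longrightarrow> z \<in> ball 0 r"
    using polydisc_in_ball[OF r] by blast
  let ?p = "(\<chi> i. complex_of_real s) :: complex^'d"
  have p: "?p \<in> ball 0 r" using s(2)[of ?p] s(1) by simp
  have m: "monomial ?p b = of_real (s ^ deg b)" for b :: "nat^'d" by (simp add: monomial_def power_deg)
  have "((\<lambda>b. of_real (fc b * s ^ deg b) * monomial ?p b) has_sum f ?p ?p) UNIV"
    using hs[OF p p] by (simp add: m mult_ac)
  from power_series_coefficient_bound[OF s(1) this]
  obtain C where C: "0 \<le> C" "\<And>b. cmod (of_real (fc b * s ^ deg b)) \<le> C * (1 / s) ^ deg b" by blast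
  have "\<bar>fc b\<bar> \<le> C * (1 / s / s) ^ deg b" for b
  proof -
    have "\<bar>fc b\<bar> * s ^ deg b \<le> C * (1 / s) ^ deg b"
      using C(2)[of b] s(1) unfolding norm_of_real by (simp add: abs_mult)
    then show ?thesis using s(1) by (simp add: power_divide field_simps)
  qed
  then show ?thesis using C(1) s(1) by (intro exI[of _ C] exI[of _ "1 / s / s"]) auto
qed

lemma nonneg_of_small_perturbation:
  fixes x :: real
  assumes "0 < e" "\<And>\<epsilon>. 0 < \<epsilon> \<Longrightarrow> \<epsilon> \<le> e \<Longrightarrow> 0 \<le> x + c * \<epsilon> + c' * \<epsilon>\<^sup>2" shows "0 \<le> x"
proof -
  have "((\<lambda>\<epsilon>. x + c * \<epsilon> + c' * \<epsilon>\<^sup>2) \<longlongrightarrow> x + c * 0 + c' * 0\<^sup>2) (at_right 0)" by (intro tendsto_intros)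
  moreover have "\<forall>\<^sub>F \<epsilon> in at_right 0. 0 \<le> x + c * \<epsilon> + c' * \<epsilon>\<^sup>2"
    using assms by (auto simp: eventually_at_right[OF assms(1)] intro!: exI[of _ e])
  ultimately show ?thesis by (auto dest: tendsto_lowerbound)
qed

text \<open>The matrix with the entries \<open>f(z,z)\<close>, \<open>f\<^sub>a z\<^sup>a\<close>, its conjugate, and \<open>f\<^sub>a\<close> is the Gram matrix of the
evaluation at \<open>z\<close> and the functional that takes the \<open>a\<close>-th Taylor coefficient at \<open>0\<close>.  It is the limit
of Gram matrices of evaluations, with the Taylor coefficient replaced by a finite difference on a
small grid, hence positive.  Testing it on \<open>(\<tau>, 1)\<close> with \<open>\<tau> = - z\<^sup>a / |z\<^sup>a|\<^sup>2\<close> gives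
\<open>f(z,z) / |z\<^sup>a|\<^sup>2 - f\<^sub>a \<ge> 0\<close>.\<close>

lemma kernel_dominates_monomials:
  fixes f :: "complex^'d \<Rightarrow> complex^'d \<Rightarrow> complex" and fc :: "nat^'d \<Rightarrow> real"
  assumes k: "is_kernel \<Omega> f" and r: "0 < r" "ball 0 r \<subseteq> \<Omega>" and pos: "\<And>a. 0 < fc a"
    and hs: "\<And>z w. z \<in> ball 0 r \<Longrightarrow> w \<in> ball 0 r \<Longrightarrow>
      ((\<lambda>a. of_real (fc a) * monomial z a * cnj (monomial w a)) has_sum f z w) UNIV"
    and z: "z \<in> \<Omega>" and \<rho>: "0 < \<rho>" "\<rho> \<le> r"
    and hz: "\<And>w. w \<in> ball 0 \<rho> \<Longrightarrow> ((\<lambda>a. of_real (fc a) * monomial z a * cnj (monomial w a)) has_sum f z w) UNIV"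
  shows "fc a * (cmod (monomial z a))\<^sup>2 \<le> Re (f z z)"
proof (cases "monomial z a = 0")
  case True
  have "0 \<le> (\<Sum>i\<in>{()}. \<Sum>j\<in>{()}. cnj 1 * f z z * 1)"
    by (rule is_kernel_sum_nonneg[OF k, where p = "\<lambda>_. z" and x = "\<lambda>_. 1"]) (use z in auto)
  then show ?thesis using True by (simp add: less_eq_complex_def)
next
  case False
  define m where "m = (cmod (monomial z a))\<^sup>2"
  have m: "m > 0" using False by (simp add: m_def)
  define \<tau> where "\<tau> = - monomial z a / of_real m"
  define d where "d b = of_real (fc b) * monomial z b" for b
  obtain s where s: "0 < s" "\<And>z :: complex^'d. (\<And>i. cmod (z $ i) \<le> s) \<Longrightarrow> z \<in> ball 0 \<rho>"
    using polydisc_in_ball[OF \<rho>(1)] by blast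
  obtain C1 R1 where C1: "0 \<le> C1" "0 \<le> R1" "\<And>b. cmod (d b) \<le> C1 * R1 ^ deg b"
  proof -
    let ?p = "\<chi> i. complex_of_real s"
    have "((\<lambda>a. d a * monomial ?p a) has_sum f z ?p) UNIV"
      using hz[OF s(2), of ?p] s(1) by (simp add: d_def monomial_def)
    from power_series_coefficient_bound[OF s(1) this] obtain C where
      "0 \<le> C" "\<And>b. cmod (d b) \<le> C * (1 / s) ^ deg b" by blast
    then show ?thesis using s(1) by (intro that[of C "1 / s"]) auto
  qed
  obtain C2 R2 where C2: "0 \<le> C2" "0 \<le> R2" "\<And>b. \<bar>fc b\<bar> \<le> C2 * R2 ^ deg b"
    using diagonal_coefficient_bound[OF r(1) hs] by blast
  from finite_difference_extracts_coefficient[OF C1(2,1), of a]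
  obtain K1 e1 where e1: "e1 > 0" and K1: "\<forall>\<epsilon> (d :: nat^'d \<Rightarrow> complex) D. 0 < \<epsilon> \<longrightarrow> \<epsilon> \<le> e1 \<longrightarrow> (\<forall>b. cmod (d b) \<le> C1 * R1 ^ deg b) \<longrightarrow>
    (\<forall>c\<le>a. ((\<lambda>b. d b * monomial (grid_point \<epsilon> c) b) has_sum D c) UNIV) \<longrightarrow>
    cmod ((\<Sum>c | c \<le> a. of_real (fd_weight a c) * D c) - of_real (\<epsilon> ^ deg a) * d a) \<le> K1 * \<epsilon> ^ (deg a + 1)"
    by (elim exE conjE) (rule that)
  define L where "L = (\<Sum>c | c \<le> a. \<bar>fd_weight a c\<bar>)"
  define C3 where "C3 = C2 * L\<^sup>2"
  define R3 where "R3 = R2 * (real (deg a))\<^sup>2"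
  have C3: "0 \<le> C3" "0 \<le> R3" using C2 by (auto simp: C3_def R3_def)
  from geometric_tail_bound[OF C3(2,1), of a]
  obtain K2 e2 where e2: "e2 > 0" and K2: "\<forall>\<epsilon> (e :: nat^'d \<Rightarrow> complex) s. 0 < \<epsilon> \<longrightarrow> \<epsilon> \<le> e2 \<longrightarrow> (\<forall>b. cmod (e b) \<le> C3 * R3 ^ deg b) \<longrightarrow>
    (\<forall>b. \<not> a \<le> b \<longrightarrow> e b = 0) \<longrightarrow> ((\<lambda>b. of_real (\<epsilon> ^ deg b) * e b) has_sum s) UNIV \<longrightarrow>
    cmod (s - of_real (\<epsilon> ^ deg a) * e a) \<le> K2 * \<epsilon> ^ (deg a + 1)"
    by (elim exE conjE) (rule that)
  define e0 where "e0 = min e1 (min (sqrt e2) (s / (real (deg a) + 1)))"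
  have e0: "e0 > 0" using e1 e2 s(1) by (simp add: e0_def)
  have "0 \<le> (cmod \<tau>)\<^sup>2 * Re (f z z) + 2 * Re (cnj \<tau> * d a) + fc a + (2 * cmod \<tau> * K1) * \<epsilon> + K2 * \<epsilon>\<^sup>2"
    if \<epsilon>: "0 < \<epsilon>" "\<epsilon> \<le> e0" for \<epsilon>
  proof -
    have gp: "grid_point \<epsilon> c \<in> ball 0 \<rho>" if c: "c \<le> a" for c
    proof (rule s(2))
      fix i
      have "\<epsilon> * real (deg a) \<le> \<epsilon> * (real (deg a) + 1)" using \<epsilon> by simp
      also have "\<dots> \<le> s" using \<epsilon> by (simp add: e0_def field_simps)
      finally show "cmod (grid_point \<epsilon> c $ i) \<le> s" using norm_grid_point_le[OF c, of \<epsilon> i] \<epsilon> by simp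
    qed
    have gpr: "grid_point \<epsilon> c \<in> ball 0 r" "grid_point \<epsilon> c \<in> \<Omega>" if c: "c \<le> a" for c
      using gp[OF c] \<rho>(2) r(2) by auto
    let ?A = "{c. c \<le> a}"
    define P where "P = (\<Sum>c\<in>?A. of_real (fd_weight a c) * f z (grid_point \<epsilon> c))"
    define B where "B = (\<Sum>c\<in>?A. \<Sum>c'\<in>?A. of_real (fd_weight a c * fd_weight a c') * f (grid_point \<epsilon> c) (grid_point \<epsilon> c'))"
    have P: "cmod (P - of_real (\<epsilon> ^ deg a) * d a) \<le> K1 * \<epsilon> ^ (deg a + 1)"
      unfolding P_def
    proof (rule K1[rule_format])
      show "((\<lambda>b. d b * monomial (grid_point \<epsilon> c) b) has_sum f z (grid_point \<epsilon> c)) UNIV" if "c \<le> a" for c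
        using hz[OF gp[OF that]] by (simp add: d_def)
    qed (use \<epsilon> C1 in \<open>auto simp: e0_def\<close>)
    have B: "cmod (B - of_real ((\<epsilon>\<^sup>2) ^ deg a) * of_real (fc a * (fd_moment a a)\<^sup>2)) \<le> K2 * (\<epsilon>\<^sup>2) ^ (deg a + 1)"
    proof (rule K2[rule_format, of "\<epsilon>\<^sup>2" "\<lambda>b. of_real (fc b * (fd_moment a b)\<^sup>2)" B])
      have "\<epsilon>\<^sup>2 \<le> (sqrt e2)\<^sup>2" using \<epsilon> by (intro power_mono) (auto simp: e0_def)
      then show "\<epsilon>\<^sup>2 \<le> e2" using e2 by simp
      show "cmod (of_real (fc b * (fd_moment a b)\<^sup>2)) \<le> C3 * R3 ^ deg b" for b
      proof -
        have "cmod (of_real (fc b * (fd_moment a b)\<^sup>2)) = \<bar>fc b\<bar> * \<bar>fd_moment a b\<bar>\<^sup>2"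
          unfolding norm_of_real by (simp add: abs_mult)
        also have "\<dots> \<le> (C2 * R2 ^ deg b) * (L * real (deg a) ^ deg b)\<^sup>2"
          unfolding L_def using C2 by (intro mult_mono power_mono fd_moment_bound) auto
        also have "\<dots> = C3 * R3 ^ deg b"
          by (simp add: C3_def R3_def power_mult_distrib power_mult[symmetric] mult_ac)
        finally show ?thesis .
      qed
      have "((\<lambda>b. \<Sum>c\<in>?A. \<Sum>c'\<in>?A. of_real (fd_weight a c * fd_weight a c') *
          (of_real (fc b) * monomial (grid_point \<epsilon> c) b * cnj (monomial (grid_point \<epsilon> c') b))) has_sum B) UNIV"
        unfolding B_def by (intro has_sum_finite_sum has_sum_cmult_right hs gpr) auto
      also have "(\<lambda>b. \<Sum>c\<in>?A. \<Sum>c'\<in>?A. of_real (fd_weight a c * fd_weight a c') *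
          (of_real (fc b) * monomial (grid_point \<epsilon> c) b * cnj (monomial (grid_point \<epsilon> c') b)))
        = (\<lambda>b. of_real ((\<epsilon>\<^sup>2) ^ deg b) * of_real (fc b * (fd_moment a b)\<^sup>2))"
      proof
        fix b
        have "(fd_moment a b)\<^sup>2 = (\<Sum>c\<in>?A. \<Sum>c'\<in>?A. (fd_weight a c * nat_power c b) * (fd_weight a c' * nat_power c' b))"
          by (simp add: fd_moment_def power2_eq_square sum_product)
        then show "(\<Sum>c\<in>?A. \<Sum>c'\<in>?A. of_real (fd_weight a c * fd_weight a c') *
          (of_real (fc b) * monomial (grid_point \<epsilon> c) b * cnj (monomial (grid_point \<epsilon> c') b)))
        = of_real ((\<epsilon>\<^sup>2) ^ deg b) * of_real (fc b * (fd_moment a b)\<^sup>2)"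
          by (simp add: monomial_grid_point sum_distrib_left power_mult[symmetric] power2_eq_square
              power_mult_distrib mult_ac)
      qed
      finally show "((\<lambda>b. of_real ((\<epsilon>\<^sup>2) ^ deg b) * complex_of_real (fc b * (fd_moment a b)\<^sup>2)) has_sum B) UNIV" .
    qed (use \<epsilon> in \<open>auto simp: fd_moment_eq_0\<close>)
    define t where "t = of_real (\<epsilon> ^ deg a) * \<tau>"
    (* The point None stands for z, the points Some c for the grid. *)
    let ?p = "case_option z (grid_point \<epsilon>)" and ?x = "case_option t (\<lambda>c. of_real (fd_weight a c))"
    have "0 \<le> (\<Sum>i\<in>insert None (Some ` ?A). \<Sum>j\<in>insert None (Some ` ?A). cnj (?x i) * f (?p i) (?p j) * ?x j)"
      by (rule is_kernel_sum_nonneg[OF k]) (use gpr z in auto)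
    also have "\<dots> = cnj t * f z z * t + cnj t * P + t * (\<Sum>c\<in>?A. of_real (fd_weight a c) * f (grid_point \<epsilon> c) z) + B"
      by (simp add: sum.reindex P_def B_def sum.distrib sum_distrib_left mult_ac)
    also have "(\<Sum>c\<in>?A. of_real (fd_weight a c) * f (grid_point \<epsilon> c) z) = cnj P"
      unfolding P_def cnj_sum using is_kernel_hermitian[OF k z gpr(2)] by (intro sum.cong) auto
    finally have q: "0 \<le> Re (cnj t * f z z * t + cnj t * P + t * cnj P + B)" by (simp add: less_eq_complex_def)
    have tt: "Re (cnj t * f z z * t) = (cmod t)\<^sup>2 * Re (f z z)"
    proof -
      have "cnj t * f z z * t = (t * cnj t) * f z z" by (simp add: mult_ac)
      also have "t * cnj t = of_real ((cmod t)\<^sup>2)" using complex_norm_square[of t] by simp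
      finally have e: "cnj t * f z z * t = of_real ((cmod t)\<^sup>2) * f z z" .
      show ?thesis unfolding e by simp
    qed
    have tP: "Re (cnj t * P + t * cnj P) = 2 * Re (cnj t * P)" by (simp add: algebra_simps)
    have q': "0 \<le> (cmod t)\<^sup>2 * Re (f z z) + 2 * Re (cnj t * P) + Re B"
    proof -
      have "Re (cnj t * f z z * t + cnj t * P + t * cnj P + B)
          = Re (cnj t * f z z * t) + Re (cnj t * P + t * cnj P) + Re B" by (simp only: plus_complex.sel)
      then show ?thesis using q tt tP by linarith
    qed
    have "Re (cnj t * P) - Re (cnj t * (of_real (\<epsilon> ^ deg a) * d a)) \<le> cmod (cnj t * (P - of_real (\<epsilon> ^ deg a) * d a))"
      using complex_Re_le_cmod[of "cnj t * (P - of_real (\<epsilon> ^ deg a) * d a)"] by (simp add: right_diff_distrib)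
    also have "\<dots> \<le> cmod t * (K1 * \<epsilon> ^ (deg a + 1))"
      unfolding norm_mult complex_mod_cnj by (intro mult_left_mono P) auto
    finally have 1: "Re (cnj t * P) \<le> \<epsilon> ^ deg a * \<epsilon> ^ deg a * (Re (cnj \<tau> * d a) + cmod \<tau> * K1 * \<epsilon>)"
      using \<epsilon> by (simp add: t_def norm_mult norm_power algebra_simps)
    have "Re B - \<epsilon> ^ deg a * \<epsilon> ^ deg a * fc a \<le> K2 * (\<epsilon>\<^sup>2) ^ (deg a + 1)"
    proof -
      have "Re B - \<epsilon> ^ deg a * \<epsilon> ^ deg a * fc a = Re (B - of_real ((\<epsilon>\<^sup>2) ^ deg a) * of_real (fc a * (fd_moment a a)\<^sup>2))"
        by (simp add: power2_eq_square power_mult_distrib)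
      also have "\<dots> \<le> K2 * (\<epsilon>\<^sup>2) ^ (deg a + 1)" using B complex_Re_le_cmod order_trans by blast
      finally show ?thesis .
    qed
    then have 2: "Re B \<le> \<epsilon> ^ deg a * \<epsilon> ^ deg a * (fc a + K2 * \<epsilon>\<^sup>2)"
      by (simp add: power2_eq_square power_mult_distrib algebra_simps)
    have 3: "(cmod t)\<^sup>2 * Re (f z z) = \<epsilon> ^ deg a * \<epsilon> ^ deg a * ((cmod \<tau>)\<^sup>2 * Re (f z z))"
      using \<epsilon> by (simp add: t_def norm_mult norm_power power2_eq_square algebra_simps)
    let ?X = "(cmod \<tau>)\<^sup>2 * Re (f z z) + 2 * (Re (cnj \<tau> * d a) + cmod \<tau> * K1 * \<epsilon>) + (fc a + K2 * \<epsilon>\<^sup>2)"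
    have h: "0 \<le> \<epsilon> ^ deg a * \<epsilon> ^ deg a * ?X"
      using q' 1 2 3 by (simp add: distrib_left)
    have "0 \<le> ?X"
    proof (rule ccontr)
      assume "\<not> 0 \<le> ?X"
      then have "\<epsilon> ^ deg a * \<epsilon> ^ deg a * ?X < 0" using \<epsilon>(1) by (intro mult_pos_neg) auto
      then show False using h by simp
    qed
    then show ?thesis by (simp add: distrib_left mult.assoc)
  qed
  from nonneg_of_small_perturbation[OF e0 this]
  have "0 \<le> (cmod \<tau>)\<^sup>2 * Re (f z z) + 2 * Re (cnj \<tau> * d a) + fc a" by simp
  moreover have "(cmod \<tau>)\<^sup>2 = 1 / m"
    using m by (simp add: \<tau>_def norm_divide power_divide m_def[symmetric]) (simp add: power2_eq_square)
  moreover have "cnj \<tau> * d a = - of_real (fc a)"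
  proof -
    have "cnj \<tau> * d a = - (cnj (monomial z a) * monomial z a) * of_real (fc a) / of_real m"
      by (simp add: \<tau>_def d_def)
    also have "cnj (monomial z a) * monomial z a = of_real m"
      unfolding m_def complex_norm_square by (simp only: mult.commute)
    finally show ?thesis using m by simp
  qed
  ultimately have "fc a \<le> Re (f z z) / m" by simp
  then show ?thesis using m by (simp add: field_simps m_def)
qed

lemma prod_le_sum_squares:
  fixes x y :: real
  assumes "0 \<le> x" "0 \<le> y" shows "x * y \<le> x\<^sup>2 + y\<^sup>2"
proof -
  have "2 * (x * y) \<le> x\<^sup>2 + y\<^sup>2" using sum_squares_bound[of x y] by (simp add: mult.assoc)
  then show ?thesis using mult_nonneg_nonneg[OF assms] by linarith
qed

lemma convex_coordinate_polydisc: "convex {z :: complex^'d. \<forall>i. cmod (z $ i) < \<rho> i}"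
proof -
  have "{z :: complex^'d. \<forall>i. cmod (z $ i) < \<rho> i} = (\<Inter>i. (\<lambda>z. z $ i) -` ball 0 (\<rho> i))" by auto
  moreover have "convex (\<Inter>i. (\<lambda>z :: complex^'d. z $ i) -` ball 0 (\<rho> i))"
    by (intro convex_INT convex_linear_vimage convex_ball bounded_linear.linear bounded_linear_vec_nth)
  ultimately show ?thesis by simp
qed

lemma open_coordinate_polydisc: "open {z :: complex^'d. \<forall>i. cmod (z $ i) < \<rho> i}"
proof -
  have "{z :: complex^'d. \<forall>i. cmod (z $ i) < \<rho> i} = (\<Inter>i. {z. cmod (z $ i) < \<rho> i})" by auto
  moreover have "open (\<Inter>i. {z :: complex^'d. cmod (z $ i) < \<rho> i})"
    by (intro open_INT ballI open_Collect_less continuous_intros) auto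
  ultimately show ?thesis by simp
qed

lemma point_with_nonzero_coordinates:
  assumes U: "open U" and p: "p \<in> U"
  shows "\<exists>q\<in>U. \<forall>i. (q :: complex^'d) $ i \<noteq> 0"
proof -
  obtain e where e: "0 < e" "ball p e \<subseteq> U" using U p open_contains_ball by blast
  obtain s where s: "0 < s" "\<And>z :: complex^'d. (\<And>i. cmod (z $ i) \<le> s) \<Longrightarrow> z \<in> ball 0 e"
    using polydisc_in_ball[OF e(1)] by blast
  have "infinite {0<..<s}" using s(1) by simp
  moreover have "finite (range (\<lambda>i. - Re (p $ i)))" by simp
  ultimately have "\<exists>t. t \<in> {0<..<s} \<and> t \<notin> range (\<lambda>i. - Re (p $ i))"
    by (meson finite_subset subsetI)
  then obtain t where t: "0 < t" "t < s" "t \<notin> range (\<lambda>i. - Re (p $ i))" by auto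
  let ?q = "p + (\<chi> i. of_real t)"
  have "(\<chi> i. of_real t) \<in> ball (0 :: complex^'d) e" using t by (intro s(2)) simp
  then have "?q \<in> U" using e(2) by (auto simp: dist_norm)
  moreover have "?q $ i \<noteq> 0" for i
  proof
    assume "?q $ i = 0"
    then have "Re (?q $ i) = 0" by simp
    then have "t = - Re (p $ i)" by simp
    then show False using t(3) by blast
  qed
  ultimately show ?thesis by blast
qed

text \<open>There are three steps.  By an open-closed argument, for each \<open>z\<close> in the domain the expansion holds for
all \<open>w\<close> near \<open>0\<close>.  This is enough to compare the kernel with its coefficients:
\<open>f\<^sub>a |z\<^sup>a|\<^sup>2 \<le> f(z,z)\<close> at every point, and applying this at \<open>(1 + \<eta>) z\<close> yields square summability at \<open>z\<close>.
The series then converges everywhere, and the identity theorem in \<open>w\<close> shows that its sum is \<open>f(z,w)\<close>.\<close>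

theorem diagonal_kernel_expansion:
  fixes f :: "complex^'d \<Rightarrow> complex^'d \<Rightarrow> complex"
  assumes \<Omega>: "open \<Omega>" "connected \<Omega>" "0 \<in> \<Omega>" and diag: "diagonal_holomorphic_kernel \<Omega> f fc"
    and zw: "z \<in> \<Omega>" "w \<in> \<Omega>"
  shows "((\<lambda>a. of_real (fc a) * monomial z a * cnj (monomial w a)) has_sum f z w) UNIV"
proof -
  have k: "is_kernel \<Omega> f" and pos: "\<And>a. 0 < fc a"
    and h1: "\<And>w. w \<in> \<Omega> \<Longrightarrow> holomorphic_several (\<lambda>z. f z w) \<Omega>"
    and h2: "\<And>z. z \<in> \<Omega> \<Longrightarrow> holomorphic_several (\<lambda>w. cnj (f z w)) \<Omega>"
    using diag unfolding diagonal_holomorphic_kernel_def by auto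
  obtain r where r: "0 < r" "ball 0 r \<subseteq> \<Omega>" and hs': "\<forall>z\<in>ball 0 r. \<forall>w\<in>ball 0 r.
      ((\<lambda>a. of_real (fc a) * monomial z a * cnj (monomial w a)) has_sum f z w) UNIV"
    using diag unfolding diagonal_holomorphic_kernel_def by (elim conjE exE) (rule that)
  note hs = hs'[rule_format]
  let ?t = "\<lambda>z w a. of_real (fc a) * monomial z a * cnj (monomial w a)"
  define A where "A \<rho> = {z \<in> \<Omega>. \<forall>w\<in>ball 0 \<rho>. (?t z w has_sum f z w) UNIV}" for \<rho> :: real
  define E where "E = (\<Union>\<rho>\<in>{0<..r}. interior (A \<rho>))"
  have "ball 0 r \<subseteq> interior (A r)" using r hs by (intro interior_maximal) (auto simp: A_def)
  then have 0: "0 \<in> E" using r(1) unfolding E_def by force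
  have cl: "p \<in> E" if p: "p \<in> \<Omega>" "p \<in> closure E" for p
  proof -
    obtain e where e: "0 < e" "ball p e \<subseteq> \<Omega>" using \<Omega>(1) p(1) open_contains_ball by blast
    (* So small that p lies in the polydisc with radii 2 |p2 i| for every p2 within distance delta without zero coordinates. *)
    define \<delta> where "\<delta> = Min (insert (e / 8) ((\<lambda>i. cmod (p $ i) / 8) ` {i. p $ i \<noteq> 0}))"
    have \<delta>: "0 < \<delta>" using e(1) by (auto simp: \<delta>_def)
    have \<delta>2: "\<delta> \<le> e / 8" and \<delta>3: "\<And>i. p $ i \<noteq> 0 \<Longrightarrow> \<delta> \<le> cmod (p $ i) / 8"
      unfolding \<delta>_def by (rule Min_le, simp, blast)+
    obtain p1 where p1: "p1 \<in> E" "dist p1 p < \<delta>" using p(2) \<delta> unfolding closure_approachable by blast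
    then obtain \<rho> where \<rho>: "0 < \<rho>" "\<rho> \<le> r" "p1 \<in> interior (A \<rho>)" by (auto simp: E_def)
    have "\<exists>q\<in>interior (A \<rho>) \<inter> ball p \<delta>. \<forall>i. (q :: complex^'d) $ i \<noteq> 0"
      by (rule point_with_nonzero_coordinates[OF open_Int[OF open_interior open_ball], of p1])
        (use \<rho>(3) p1(2) in \<open>auto simp: dist_commute\<close>)
    then obtain p2 :: "complex^'d" where p2': "p2 \<in> interior (A \<rho>) \<inter> ball p \<delta>" "\<forall>i. p2 $ i \<noteq> 0" by blast
    note p2 = p2'(1) p2'(2)[rule_format]
    have p2A: "p2 \<in> A \<rho>" using p2 interior_subset by blast
    have big: "cmod (p $ i) < 2 * cmod (p2 $ i)" for i
    proof (cases "p $ i = 0")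
      case True
      then show ?thesis using p2(2)[of i] by simp
    next
      case False
      have "cmod ((p - p2) $ i) \<le> norm (p - p2)" by (rule Finite_Cartesian_Product.norm_nth_le)
      also have "\<dots> < \<delta>" using p2(1) by (simp add: dist_norm)
      finally have "cmod (p $ i) - cmod (p2 $ i) < \<delta>" using norm_triangle_ineq2[of "p $ i" "p2 $ i"] by simp
      moreover have "0 < cmod (p $ i)" using False by simp
      ultimately show ?thesis using \<delta>3[OF False] by linarith
    qed
    define V where "V = ball p e \<inter> {z. \<forall>i. cmod (z $ i) < 2 * cmod (p2 $ i)}"
    have V: "open V" "convex V" "p \<in> V" "V \<subseteq> \<Omega>" "p2 \<in> V"
      using e \<delta>2 big p2 unfolding V_def
      by (auto intro!: open_Int open_coordinate_polydisc convex_Int convex_coordinate_polydisc)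
    (* The factor 2 gained in z is paid for in w: the terms at (2 p2, w) are those at (p2, 2 w). *)
    have "V \<subseteq> A (\<rho> / 2)"
    proof
      fix y assume y: "y \<in> V"
      have "(?t y w has_sum f y w) UNIV" if w: "w \<in> ball 0 (\<rho> / 2)" for w
      proof -
        let ?e = "\<lambda>a. of_real (fc a) * cnj (monomial w a)"
        define M where "M a = cmod (?t p2 (2 *s w) a)" for a
        have "norm (2 *s w) = 2 * norm w"
          unfolding norm_vec_def by (simp add: norm_mult L2_set_right_distrib[symmetric])
        then have w2: "2 *s w \<in> ball 0 \<rho>" and w\<rho>: "w \<in> ball 0 \<rho>"
          using w norm_ge_zero[of w] by (simp_all del: norm_ge_zero)
        have w\<Omega>: "w \<in> \<Omega>" using w\<rho> \<rho>(2) r(2) by auto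
        have M: "M summable_on UNIV"
          using p2A w2 has_sum_imp_summable unfolding A_def M_def summable_on_iff_abs_summable_on_complex[symmetric] by blast
        have le: "cmod (?e a * monomial z a) \<le> M a" if z: "z \<in> V" for z a
        proof -
          have "cmod (z $ i) \<le> cmod ((2 *s p2) $ i)" for i
            using z by (auto simp: V_def norm_mult less_imp_le)
          then have "cmod (monomial z a) \<le> cmod (monomial (2 *s p2) a)" by (rule norm_monomial_mono)
          then have "\<bar>fc a\<bar> * cmod (monomial w a) * cmod (monomial z a)
              \<le> \<bar>fc a\<bar> * cmod (monomial w a) * cmod (monomial (2 *s p2) a)"
            by (intro mult_left_mono) auto
          then show ?thesis by (simp add: M_def monomial_scale norm_mult norm_power mult_ac)
        qed
        have sum: "(\<lambda>a. ?e a * monomial z a) summable_on UNIV" if "z \<in> V" for z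
          unfolding summable_on_iff_abs_summable_on_complex
          by (rule summable_on_comparison_test[OF M]) (use le[OF that] in auto)
        have eq: "f z w - infsum (\<lambda>a. ?e a * monomial z a) UNIV = 0" if "z \<in> interior (A \<rho>)" for z
        proof -
          have "z \<in> A \<rho>" using that interior_subset by blast
          then have "((\<lambda>a. ?e a * monomial z a) has_sum f z w) UNIV" using w\<rho> by (simp add: A_def mult_ac)
          then show ?thesis by (simp add: infsumI)
        qed
        have "f y w - infsum (\<lambda>a. ?e a * monomial y a) UNIV = 0"
        proof (rule line_holomorphic_identity[OF V(1,2) _ _ _ _ _ y, where U = "V \<inter> interior (A \<rho>)"])
          show "line_holomorphic (\<lambda>z. f z w - infsum (\<lambda>a. ?e a * monomial z a) UNIV) V"
            by (intro line_holomorphic_diff holomorphic_several_imp_line_holomorphic[OF h1[OF w\<Omega>] V(4)]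
                line_holomorphic_power_series[OF V(1) M le])
        qed (use V p2 eq in auto)
        then have "((\<lambda>a. ?e a * monomial y a) has_sum f y w) UNIV" using has_sum_infsum[OF sum[OF y]] by simp
        then show ?thesis by (simp add: mult_ac)
      qed
      then show "y \<in> A (\<rho> / 2)" using y V(4) by (auto simp: A_def)
    qed
    then have "p \<in> interior (A (\<rho> / 2))" using V interior_maximal by blast
    then show ?thesis unfolding E_def using \<rho> by (intro UN_I[of "\<rho> / 2"]) auto
  qed
  have "E \<inter> \<Omega> = {} \<or> - closure E \<inter> \<Omega> = {}"
    by (rule connectedD[OF \<Omega>(2)]) (use cl closure_subset[of E] in \<open>auto simp: E_def\<close>)
  then have \<Omega>E: "\<Omega> \<subseteq> E" using 0 \<Omega>(3) cl by blast
  have near: "\<exists>\<rho>. 0 < \<rho> \<and> \<rho> \<le> r \<and> (\<forall>w\<in>ball 0 \<rho>. (?t z w has_sum f z w) UNIV)" if z: "z \<in> \<Omega>" for z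
  proof -
    obtain \<rho> where "\<rho> \<in> {0<..r}" "z \<in> interior (A \<rho>)" using subsetD[OF \<Omega>E z] unfolding E_def by blast
    moreover from this have "z \<in> A \<rho>" using interior_subset by blast
    ultimately show ?thesis unfolding A_def by (intro exI[of _ \<rho>]) auto
  qed
  have dom: "fc a * (cmod (monomial z a))\<^sup>2 \<le> Re (f z z)" if z: "z \<in> \<Omega>" for z a
    using near[OF z] kernel_dominates_monomials[OF k r pos hs z] by blast
  have sq: "(\<lambda>a. fc a * (cmod (monomial z a))\<^sup>2) summable_on UNIV" if z: "z \<in> \<Omega>" for z
  proof -
    obtain e where e: "0 < e" "ball z e \<subseteq> \<Omega>" using \<Omega>(1) z open_contains_ball by blast
    define \<eta> where "\<eta> = (e / 2) / (norm z + 1)"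
    have np: "norm z + 1 > 0" using norm_ge_zero[of z] by linarith
    have \<eta>: "0 < \<eta>" using e np by (simp add: \<eta>_def)
    have "(1 + \<eta>) *\<^sub>R z \<in> ball z e"
    proof -
      have "dist z ((1 + \<eta>) *\<^sub>R z) = \<eta> * norm z" using \<eta> by (simp add: dist_norm scaleR_left_distrib)
      also have "\<dots> \<le> \<eta> * (norm z + 1)" using \<eta> by simp
      also have "\<eta> * (norm z + 1) = e / 2"
      proof -
        have "norm z + 1 \<noteq> 0" using np by linarith
        then show ?thesis unfolding \<eta>_def by (rule nonzero_eq_divide_eq[THEN iffD1]) simp
      qed
      also have "e / 2 < e" using e by simp
      finally show ?thesis by simp
    qed
    then have z': "(1 + \<eta>) *\<^sub>R z \<in> \<Omega>" using e by blast
    let ?q = "(1 / (1 + \<eta>))\<^sup>2" and ?C = "Re (f ((1 + \<eta>) *\<^sub>R z) ((1 + \<eta>) *\<^sub>R z))"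
    have "1 / (1 + \<eta>) < 1" "0 \<le> 1 / (1 + \<eta>)" using \<eta> by simp_all
    then have q: "0 \<le> ?q" "?q < 1" using power_strict_mono[of "1 / (1 + \<eta>)" 1 2] by simp_all
    have "(\<lambda>a :: nat^'d. ?C * ?q ^ deg a) summable_on UNIV"
      by (intro summable_on_cmult_right summable_geometric_deg q)
    then show ?thesis
    proof (rule summable_on_comparison_test)
      fix a
      have "(1 + \<eta>) *\<^sub>R z = of_real (1 + \<eta>) *s z"
        by (simp only: Finite_Cartesian_Product.vec_eq_iff vector_scaleR_component vector_smult_component)
            (simp add: scaleR_conv_of_real)
      then have "cmod (monomial ((1 + \<eta>) *\<^sub>R z) a) = (1 + \<eta>) ^ deg a * cmod (monomial z a)"
        using \<eta> by (simp only: monomial_scale norm_mult norm_power norm_of_real abs_of_pos add_pos_pos zero_less_one)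
      with dom[OF z', of a] have le: "fc a * ((1 + \<eta>) ^ deg a * cmod (monomial z a))\<^sup>2 \<le> ?C" by simp
      have one: "?q ^ deg a * ((1 + \<eta>) ^ deg a)\<^sup>2 = 1"
        using \<eta> by (simp add: power_divide power_mult[symmetric] mult.commute)
      have "fc a * (cmod (monomial z a))\<^sup>2 = (?q ^ deg a * ((1 + \<eta>) ^ deg a)\<^sup>2) * (fc a * (cmod (monomial z a))\<^sup>2)"
        unfolding one by simp
      also have "\<dots> = ?q ^ deg a * (fc a * ((1 + \<eta>) ^ deg a * cmod (monomial z a))\<^sup>2)"
        by (simp only: power_mult_distrib mult_ac)
      also have "\<dots> \<le> ?q ^ deg a * ?C" by (rule mult_left_mono[OF le]) simp
      finally show "fc a * (cmod (monomial z a))\<^sup>2 \<le> ?C * ?q ^ deg a" by (simp only: mult.commute)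
    qed (use pos in \<open>auto simp: less_imp_le\<close>)
  qed
  have abs: "(\<lambda>a. cmod (?t z w a)) summable_on UNIV" if "z \<in> \<Omega>" "w \<in> \<Omega>" for z w
  proof (rule summable_on_comparison_test[OF summable_on_add[OF sq[OF that(1)] sq[OF that(2)]]])
    fix a
    have "cmod (monomial z a) * cmod (monomial w a) \<le> (cmod (monomial z a))\<^sup>2 + (cmod (monomial w a))\<^sup>2"
      by (intro prod_le_sum_squares) auto
    then show "cmod (?t z w a) \<le> fc a * (cmod (monomial z a))\<^sup>2 + fc a * (cmod (monomial w a))\<^sup>2"
      using mult_left_mono[of _ _ "fc a"] pos[of a] by (simp add: norm_mult mult.assoc distrib_left[symmetric])
  qed simp
  let ?e = "\<lambda>a. of_real (fc a) * cnj (monomial z a)"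
  have "cnj (f z w) - infsum (\<lambda>a. ?e a * monomial w a) UNIV = 0"
  proof -
    obtain \<rho> where \<rho>: "0 < \<rho>" "\<rho> \<le> r" "\<And>w. w \<in> ball 0 \<rho> \<Longrightarrow> (?t z w has_sum f z w) UNIV"
      using near[OF zw(1)] by blast
    show ?thesis
    proof (rule identity_theorem_several[OF \<Omega>(1,2) _ _ _ _ _ zw(2), where U = "ball 0 \<rho>"])
      show "cnj (f z w) - infsum (\<lambda>a. ?e a * monomial w a) UNIV = 0" if "w \<in> ball 0 \<rho>" for w
      proof -
        have "((\<lambda>a. cnj (?t z w a)) has_sum cnj (f z w)) UNIV" using \<rho>(3)[OF that] by (simp only: has_sum_cnj_iff)
        then show ?thesis by (simp add: infsumI)
      qed
      fix p assume p: "p \<in> \<Omega>"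
      obtain e where e: "0 < e" "ball p e \<subseteq> \<Omega>" using \<Omega>(1) p open_contains_ball by blast
      obtain s where s: "0 < s" "\<And>z :: complex^'d. (\<And>i. cmod (z $ i) \<le> s) \<Longrightarrow> z \<in> ball 0 e"
        using polydisc_in_ball[OF e(1)] by blast
      (* Moving every coordinate outwards gives a point p' of the domain whose polydisc contains p. *)
      define u where "u = (\<chi> i. of_real s * (if p $ i = 0 then 1 else sgn (p $ i)))"
      define p' where "p' = p + u"
      have "u \<in> ball 0 e" by (rule s(2)) (use s(1) in \<open>simp add: u_def norm_mult norm_sgn\<close>)
      then have p': "p' \<in> \<Omega>" using e(2) by (auto simp: p'_def dist_norm)
      have big: "cmod (p $ i) < cmod (p' $ i)" for i
      proof (cases "p $ i = 0")
        case False
        then have "p' $ i = of_real (1 + s / cmod (p $ i)) * p $ i"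
          by (simp add: p'_def u_def sgn_div_norm scaleR_conv_of_real divide_simps algebra_simps)
        then have "cmod (p' $ i) = (1 + s / cmod (p $ i)) * cmod (p $ i)"
          using s(1) by (simp only: norm_mult norm_of_real) (simp add: add_nonneg_nonneg)
        also have "\<dots> = cmod (p $ i) + s" using False by (simp add: field_simps)
        finally show ?thesis using s(1) by simp
      qed (use s(1) in \<open>simp add: p'_def u_def\<close>)
      define V where "V = ball p e \<inter> {z. \<forall>i. cmod (z $ i) < cmod (p' $ i)}"
      have V: "open V" "convex V" "p \<in> V" "V \<subseteq> \<Omega>" using e big unfolding V_def
        by (auto intro!: open_Int open_coordinate_polydisc convex_Int convex_coordinate_polydisc)
      have "line_holomorphic (\<lambda>w. cnj (f z w) - infsum (\<lambda>a. ?e a * monomial w a) UNIV) V"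
      proof (intro line_holomorphic_diff holomorphic_several_imp_line_holomorphic[OF h2[OF zw(1)] V(4)]
                line_holomorphic_power_series[OF V(1) abs[OF zw(1) p']])
        fix w b assume w: "w \<in> V"
        have "cmod (monomial w b) \<le> cmod (monomial p' b)"
          using w by (intro norm_monomial_mono) (auto simp: V_def less_imp_le)
        then show "cmod (?e b * monomial w b) \<le> cmod (?t z p' b)"
          unfolding norm_mult complex_mod_cnj by (intro mult_left_mono) auto
      qed
      then show "\<exists>V. open V \<and> convex V \<and> p \<in> V \<and> V \<subseteq> \<Omega> \<and>
          line_holomorphic (\<lambda>w. cnj (f z w) - infsum (\<lambda>a. ?e a * monomial w a) UNIV) V"
        using V by blast
    qed (use \<rho> r in auto)
  qed
  then have "infsum (\<lambda>a. ?e a * monomial w a) UNIV = cnj (f z w)" by (simp only: right_minus_eq)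
  moreover have "(\<lambda>a. ?e a * monomial w a) = (\<lambda>a. cnj (?t z w a))" by (rule ext) simp
  ultimately have "infsum (\<lambda>a. cnj (?t z w a)) UNIV = cnj (f z w)" by (simp only:)
  then have "infsum (?t z w) UNIV = f z w" by (simp only: infsum_cnj complex_cnj_cancel_iff)
  moreover have "?t z w summable_on UNIV"
    using abs[OF zw] unfolding summable_on_iff_abs_summable_on_complex .
  ultimately show ?thesis by (simp add: has_sum_iff)
qed

section \<open>Uniqueness of reproducing kernel Hilbert spaces\<close>

text \<open>The linear span of the kernel functions, generated by adding one multiple at a time.\<close>

inductive_set kernel_span :: "'a set \<Rightarrow> ('a \<Rightarrow> 'a \<Rightarrow> complex) \<Rightarrow> ('a \<Rightarrow> complex) set" for X k where
  zero: "(\<lambda>_. 0) \<in> kernel_span X k"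
| step: "g \<in> kernel_span X k \<Longrightarrow> w \<in> X \<Longrightarrow> (\<lambda>x. c * (if x \<in> X then k x w else 0) + g x) \<in> kernel_span X k"

lemma kernel_span_add:
  "f \<in> kernel_span X k \<Longrightarrow> g \<in> kernel_span X k \<Longrightarrow> (\<lambda>x. f x + g x) \<in> kernel_span X k"
proof (induction rule: kernel_span.induct)
  case (step h w c)
  from kernel_span.step[OF step.IH[OF step.prems] step.hyps(2), of c] show ?case by (simp add: add.assoc)
qed simp

lemma kernel_span_scale:
  "f \<in> kernel_span X k \<Longrightarrow> (\<lambda>x. a * f x) \<in> kernel_span X k"
proof (induction rule: kernel_span.induct)
  case (step h w c)
  from kernel_span.step[OF step.IH step.hyps(2), of "a * c"] show ?case by (simp add: distrib_left mult.assoc)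
qed (simp add: kernel_span.zero)

context rkhs
begin

abbreviation kf :: "'a \<Rightarrow> 'a \<Rightarrow> complex" where "kf w \<equiv> (\<lambda>z. if z \<in> X then k z w else 0)"

definition nrm2 :: "('a \<Rightarrow> complex) \<Rightarrow> real" where "nrm2 f = Re (ip f f)"

lemma diff_mem: "f \<in> H \<Longrightarrow> g \<in> H \<Longrightarrow> (\<lambda>x. f x - g x) \<in> H"
  using add_mem[OF _ scale_mem[of g "-1"], of f] by simp

lemma ip_lin:
  assumes "f \<in> H" "g \<in> H" "h \<in> H"
  shows "ip (\<lambda>x. a * f x + b * g x) h = a * ip f h + b * ip g h"
  using ip_add[OF scale_mem[OF assms(1), of a] scale_mem[OF assms(2), of b] assms(3)] assms
  by (simp add: ip_scale)

lemma ip_lin_right: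
  assumes "f \<in> H" "g \<in> H" "h \<in> H"
  shows "ip h (\<lambda>x. a * f x + b * g x) = cnj a * ip h f + cnj b * ip h g"
proof -
  have "(\<lambda>x. a * f x + b * g x) \<in> H" using assms add_mem scale_mem by auto
  from ip_cnj[OF this assms(3)] show ?thesis
    using assms by (simp add: ip_lin ip_cnj[of f h] ip_cnj[of g h])
qed

lemma nrm2_nonneg: "f \<in> H \<Longrightarrow> 0 \<le> nrm2 f"
  using ip_nonneg unfolding nrm2_def less_eq_complex_def by auto

lemma nrm2_lin:
  assumes "f \<in> H" "g \<in> H"
  shows "nrm2 (\<lambda>x. a * f x + b * g x) = (cmod a)\<^sup>2 * nrm2 f + (cmod b)\<^sup>2 * nrm2 g + 2 * Re (a * cnj b * ip f g)"
proof -
  have m: "(\<lambda>x. a * f x + b * g x) \<in> H" using assms add_mem scale_mem by auto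
  have r: "Im (ip h h) = 0" if "h \<in> H" for h using ip_nonneg[OF that] by (simp add: less_eq_complex_def)
  have "ip (\<lambda>x. a * f x + b * g x) (\<lambda>x. a * f x + b * g x)
      = (a * cnj a) * ip f f + (b * cnj b) * ip g g + (a * cnj b * ip f g + cnj (a * cnj b * ip f g))"
    unfolding ip_lin[OF assms m] ip_lin_right[OF assms assms(1)] ip_lin_right[OF assms assms(2)]
    using ip_cnj[OF assms] by (simp add: algebra_simps)
  also have "a * cnj a = of_real ((cmod a)\<^sup>2)" by (rule complex_norm_square[symmetric])
  also have "b * cnj b = of_real ((cmod b)\<^sup>2)" by (rule complex_norm_square[symmetric])
  finally have e: "ip (\<lambda>x. a * f x + b * g x) (\<lambda>x. a * f x + b * g x)
      = of_real ((cmod a)\<^sup>2) * ip f f + of_real ((cmod b)\<^sup>2) * ip g g + (a * cnj b * ip f g + cnj (a * cnj b * ip f g))" .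
  define c where "c = a * cnj b * ip f g"
  show ?thesis unfolding nrm2_def e c_def[symmetric] by simp
qed

lemma nrm2_scale: "f \<in> H \<Longrightarrow> nrm2 (\<lambda>x. a * f x) = (cmod a)\<^sup>2 * nrm2 f"
  using nrm2_lin[of f f a 0] by simp

lemma nrm2_convex:
  assumes "f \<in> H" "g \<in> H"
  shows "nrm2 (\<lambda>x. of_real (1 - s) * f x + of_real s * g x)
     = (1 - s) * nrm2 f + s * nrm2 g - s * (1 - s) * nrm2 (\<lambda>x. f x - g x)"
proof -
  have e1: "nrm2 (\<lambda>x. f x - g x) = nrm2 f + nrm2 g - 2 * Re (ip f g)"
    using nrm2_lin[OF assms, of 1 "-1"] by simp
  have e2: "nrm2 (\<lambda>x. of_real (1 - s) * f x + of_real s * g x)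
      = (1 - s)\<^sup>2 * nrm2 f + s\<^sup>2 * nrm2 g + 2 * ((1 - s) * s * Re (ip f g))"
    unfolding nrm2_lin[OF assms] norm_of_real by (simp add: of_real_mult[symmetric] del: of_real_mult of_real_diff)
  show ?thesis unfolding e1 e2 by (simp add: power2_eq_square algebra_simps)
qed

lemma nrm2_add_le:
  assumes "f \<in> H" "g \<in> H" "0 < s" "s < 1"
  shows "nrm2 (\<lambda>x. f x + g x) \<le> nrm2 f / (1 - s) + nrm2 g / s"
proof -
  let ?f = "\<lambda>x. of_real (1 / (1 - s)) * f x" and ?g = "\<lambda>x. of_real (1 / s) * g x"
  have fg: "?f \<in> H" "?g \<in> H" by (rule scale_mem[OF assms(1)], rule scale_mem[OF assms(2)])
  have "(\<lambda>x. of_real (1 - s) * ?f x + of_real s * ?g x) = (\<lambda>x. f x + g x)"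
    using assms by (simp add: fun_eq_iff mult.assoc[symmetric] of_real_mult[symmetric] del: of_real_mult of_real_diff of_real_divide)
  with nrm2_convex[OF fg, of s]
  have "nrm2 (\<lambda>x. f x + g x) = (1 - s) * nrm2 ?f + s * nrm2 ?g - s * (1 - s) * nrm2 (\<lambda>x. ?f x - ?g x)" by simp
  also have "\<dots> \<le> (1 - s) * nrm2 ?f + s * nrm2 ?g"
    using nrm2_nonneg[OF diff_mem[OF fg]] assms by simp
  also have "(1 - s) * nrm2 ?f = nrm2 f / (1 - s)"
    unfolding nrm2_scale[OF assms(1)] norm_of_real using assms by (simp add: power2_eq_square)
  also have "s * nrm2 ?g = nrm2 g / s"
    unfolding nrm2_scale[OF assms(2)] norm_of_real using assms by (simp add: power2_eq_square)
  finally show ?thesis .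
qed

lemma span_subset: "f \<in> kernel_span X k \<Longrightarrow> f \<in> H"
proof (induction rule: kernel_span.induct)
  case (step g w c)
  from add_mem[OF scale_mem[OF kernel_mem[OF step.hyps(2)]] step.IH] show ?case .
qed (rule zero_mem)

text \<open>If moving from \<open>h\<close> along the kernel function of \<open>w\<close> cannot lower the squared norm below \<open>d\<close>, and the
squared norm is close to \<open>d\<close>, then \<open>h w = \<langle>h, k\<^sub>w\<rangle>\<close> is small.  The best multiple of \<open>k\<^sub>w\<close> would divide by
its squared norm; dividing by \<open>\<parallel>k\<^sub>w\<parallel>\<^sup>2 + 1\<close> avoids a case distinction.\<close>

lemma evaluation_estimate:
  assumes h: "h \<in> H" and w: "w \<in> X" and low: "\<And>c. d \<le> nrm2 (\<lambda>x. h x - c * kf w x)"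
  shows "(cmod (h w))\<^sup>2 \<le> (nrm2 (kf w) + 1) * (nrm2 h - d)"
proof -
  define K where "K = nrm2 (kf w)"
  have K: "0 \<le> K" unfolding K_def by (rule nrm2_nonneg[OF kernel_mem[OF w]])
  define t where "t = 1 / (K + 1)"
  have t: "0 < t" "t * K \<le> 1" using K by (auto simp: t_def field_simps)
  have "d \<le> nrm2 (\<lambda>x. 1 * h x + (- (of_real t * h w)) * kf w x)"
    using low[of "of_real t * h w"] by simp
  also have "\<dots> = nrm2 h + t\<^sup>2 * (cmod (h w))\<^sup>2 * K - 2 * t * (cmod (h w))\<^sup>2"
  proof -
    have "cnj (h w) * h w = of_real ((cmod (h w))\<^sup>2)"
      unfolding complex_norm_square by (simp only: mult.commute)
    then have "1 * cnj (- (of_real t * h w)) * ip h (kf w) = of_real (- t * (cmod (h w))\<^sup>2)"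
      using reproducing[OF h w] by (simp add: mult.assoc)
    then show ?thesis unfolding nrm2_lin[OF h kernel_mem[OF w]] K_def[symmetric]
      by (simp only: Re_complex_of_real) (simp add: norm_mult power_mult_distrib)
  qed
  finally have "t * (cmod (h w))\<^sup>2 * (2 - t * K) \<le> nrm2 h - d" by (simp add: power2_eq_square algebra_simps)
  moreover have "t * (cmod (h w))\<^sup>2 * 1 \<le> t * (cmod (h w))\<^sup>2 * (2 - t * K)"
    using t by (intro mult_left_mono) auto
  ultimately have "t * (cmod (h w))\<^sup>2 \<le> nrm2 h - d" by simp
  then show ?thesis using K by (simp add: t_def K_def[symmetric] field_simps)
qed

lemma evaluation_bound:
  assumes "h \<in> H" "w \<in> X" shows "(cmod (h w))\<^sup>2 \<le> (nrm2 (kf w) + 1) * nrm2 h"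
  using evaluation_estimate[OF assms, of 0] nrm2_nonneg[OF diff_mem[OF assms(1) scale_mem[OF kernel_mem[OF assms(2)]]]]
  by simp

lemma norm_limit_imp_pointwise:
  assumes p: "\<And>n. p n \<in> H" and f: "f \<in> H" and lim: "(\<lambda>n. nrm2 (\<lambda>x. p n x - f x)) \<longlonglongrightarrow> 0" and w: "w \<in> X"
  shows "(\<lambda>n. p n w) \<longlonglongrightarrow> f w"
proof -
  have "(\<lambda>n. (cmod (p n w - f w))\<^sup>2) \<longlonglongrightarrow> 0"
  proof (rule tendsto_sandwich[where f = "\<lambda>_. 0" and h = "\<lambda>n. (nrm2 (kf w) + 1) * nrm2 (\<lambda>x. p n x - f x)"])
    show "(\<lambda>n. (nrm2 (kf w) + 1) * nrm2 (\<lambda>x. p n x - f x)) \<longlonglongrightarrow> 0"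
      using tendsto_mult_left[OF lim] by simp
  qed (use evaluation_bound[OF diff_mem[OF p f] w] in auto)
  then have "(\<lambda>n. sqrt ((cmod (p n w - f w))\<^sup>2)) \<longlonglongrightarrow> sqrt 0" by (rule tendsto_real_sqrt)
  then have "(\<lambda>n. cmod (p n w - f w)) \<longlonglongrightarrow> 0" by simp
  then show ?thesis by (rule LIM_zero_cancel[OF tendsto_norm_zero_cancel])
qed

lemma cauchy_imp_limit:
  assumes p: "\<And>n. p n \<in> H"
    and cau: "\<And>e. e > 0 \<Longrightarrow> \<exists>M. \<forall>m\<ge>M. \<forall>n\<ge>M. nrm2 (\<lambda>x. p m x - p n x) < e"
  shows "\<exists>f\<in>H. (\<lambda>n. nrm2 (\<lambda>x. p n x - f x)) \<longlonglongrightarrow> 0"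
proof -
  have "\<exists>f\<in>H. (\<lambda>n. sqrt (Re (ip (\<lambda>x. p n x - f x) (\<lambda>x. p n x - f x)))) \<longlonglongrightarrow> 0"
  proof (rule complete[OF p])
    fix e :: real assume e: "e > 0"
    then obtain M where M: "\<forall>m\<ge>M. \<forall>n\<ge>M. nrm2 (\<lambda>x. p m x - p n x) < e\<^sup>2" using cau[of "e\<^sup>2"] by auto
    show "\<exists>M. \<forall>m\<ge>M. \<forall>n\<ge>M. sqrt (Re (ip (\<lambda>x. p m x - p n x) (\<lambda>x. p m x - p n x))) < e"
      by (rule exI[of _ M]) (use M e in \<open>auto simp: nrm2_def intro!: real_less_lsqrt\<close>)
  qed
  then obtain f where f: "f \<in> H" "(\<lambda>n. sqrt (nrm2 (\<lambda>x. p n x - f x))) \<longlonglongrightarrow> 0"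
    unfolding nrm2_def by blast
  have "(\<lambda>n. (sqrt (nrm2 (\<lambda>x. p n x - f x)))\<^sup>2) \<longlonglongrightarrow> 0\<^sup>2" by (intro tendsto_power f)
  moreover have "(sqrt (nrm2 (\<lambda>x. p n x - f x)))\<^sup>2 = nrm2 (\<lambda>x. p n x - f x)" for n
    using nrm2_nonneg[OF diff_mem[OF p f(1)]] by simp
  ultimately show ?thesis using f(1) by auto
qed

text \<open>A minimising sequence for the distance of \<open>f\<close> to the span converges to some \<open>g\<close>, and \<open>f - g\<close> vanishes
at every point, because near-minimality makes \<open>f - p\<^sub>n\<close> almost orthogonal to each kernel function.\<close>

lemma span_dense:
  assumes f: "f \<in> H"
  shows "\<exists>p. (\<forall>n. p n \<in> kernel_span X k) \<and> (\<lambda>n. nrm2 (\<lambda>x. p n x - f x)) \<longlonglongrightarrow> 0"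
proof -
  let ?S = "kernel_span X k"
  let ?\<phi> = "\<lambda>g. nrm2 (\<lambda>x. f x - g x)"
  define d where "d = Inf (?\<phi> ` ?S)"
  have ne: "?S \<noteq> {}" using kernel_span.zero by blast
  have bdd: "bdd_below (?\<phi> ` ?S)"
    using nrm2_nonneg[OF diff_mem[OF f span_subset]] by (auto intro: bdd_belowI[of _ 0])
  have d_le: "d \<le> ?\<phi> g" if "g \<in> ?S" for g unfolding d_def using bdd that by (auto intro: cInf_lower)
  have "\<exists>g\<in>?S. ?\<phi> g < d + inverse (real (Suc n))" for n
  proof -
    have "Inf (?\<phi> ` ?S) < d + inverse (real (Suc n))" by (simp add: d_def)
    then show ?thesis using cInf_less_iff[of "?\<phi> ` ?S"] ne bdd by auto
  qed
  then obtain p where p: "\<And>n. p n \<in> ?S" "\<And>n. ?\<phi> (p n) < d + inverse (real (Suc n))" by metis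
  note pH = span_subset[OF p(1)]
  have inv_small: "\<exists>M. \<forall>n\<ge>M. inverse (real (Suc n)) < e" if "e > 0" for e :: real
    using LIMSEQ_inverse_real_of_nat that by (auto simp: LIMSEQ_def eventually_sequentially)
  have "\<exists>g\<in>H. (\<lambda>n. nrm2 (\<lambda>x. p n x - g x)) \<longlonglongrightarrow> 0"
  proof (rule cauchy_imp_limit[OF pH])
    fix e :: real assume "e > 0"
    then obtain M where M: "\<And>n. n \<ge> M \<Longrightarrow> inverse (real (Suc n)) < e / 4" using inv_small[of "e / 4"] by auto
    have "nrm2 (\<lambda>x. p m x - p n x) < e" if mn: "m \<ge> M" "n \<ge> M" for m n
    proof -
      let ?g = "\<lambda>x. of_real (1 - 1/2) * p n x + of_real (1/2) * p m x"
      have g: "?g \<in> ?S" by (intro kernel_span_add kernel_span_scale p)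
      have e1: "(\<lambda>x. f x - ?g x) = (\<lambda>x. of_real (1 - 1/2) * (f x - p n x) + of_real (1/2) * (f x - p m x))"
        by (simp add: fun_eq_iff field_simps)
      have e2: "(\<lambda>x. (f x - p n x) - (f x - p m x)) = (\<lambda>x. p m x - p n x)" by (simp add: fun_eq_iff)
      have "d \<le> (1 - 1/2) * ?\<phi> (p n) + 1/2 * ?\<phi> (p m) - 1/2 * (1 - 1/2) * nrm2 (\<lambda>x. p m x - p n x)"
        using d_le[OF g] unfolding e1 nrm2_convex[OF diff_mem[OF f pH] diff_mem[OF f pH]] e2 .
      then show ?thesis using p(2)[of m] p(2)[of n] M[OF mn(1)] M[OF mn(2)] by simp
    qed
    then show "\<exists>M. \<forall>m\<ge>M. \<forall>n\<ge>M. nrm2 (\<lambda>x. p m x - p n x) < e" by blast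
  qed
  then obtain g where g: "g \<in> H" "(\<lambda>n. nrm2 (\<lambda>x. p n x - g x)) \<longlonglongrightarrow> 0" by blast
  have "f w = g w" for w
  proof (cases "w \<in> X")
    case False
    then show ?thesis using supported[OF f] supported[OF g(1)] by simp
  next
    case True
    have le: "(cmod (f w - p n w))\<^sup>2 \<le> (nrm2 (kf w) + 1) * inverse (real (Suc n))" for n
    proof -
      have "(cmod (f w - p n w))\<^sup>2 \<le> (nrm2 (kf w) + 1) * (?\<phi> (p n) - d)"
      proof (rule evaluation_estimate[OF diff_mem[OF f pH] True])
        fix c
        have "(\<lambda>x. p n x + c * kf w x) \<in> ?S"
          using kernel_span.step[OF p(1) True, of c n] by (simp add: add.commute)
        from d_le[OF this] show "d \<le> nrm2 (\<lambda>x. f x - p n x - c * kf w x)" by (simp add: diff_diff_eq)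
      qed
      also have "\<dots> \<le> (nrm2 (kf w) + 1) * inverse (real (Suc n))"
        using p(2)[of n] nrm2_nonneg[OF kernel_mem[OF True]] by (intro mult_left_mono) auto
      finally show ?thesis .
    qed
    have "(\<lambda>n. (cmod (f w - p n w))\<^sup>2) \<longlonglongrightarrow> 0"
    proof (rule tendsto_sandwich[where f = "\<lambda>_. 0" and h = "\<lambda>n. (nrm2 (kf w) + 1) * inverse (real (Suc n))"])
      show "(\<lambda>n. (nrm2 (kf w) + 1) * inverse (real (Suc n))) \<longlonglongrightarrow> 0"
        using tendsto_mult_left[OF LIMSEQ_inverse_real_of_nat] by simp
    qed (use le in auto)
    then have "(\<lambda>n. sqrt ((cmod (f w - p n w))\<^sup>2)) \<longlonglongrightarrow> sqrt 0" by (rule tendsto_real_sqrt)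
    then have "(\<lambda>n. cmod (p n w - f w)) \<longlonglongrightarrow> 0" by (simp add: norm_minus_commute)
    then have "(\<lambda>n. p n w) \<longlonglongrightarrow> f w" by (rule LIM_zero_cancel[OF tendsto_norm_zero_cancel])
    then show ?thesis using norm_limit_imp_pointwise[OF pH g True] LIMSEQ_unique by blast
  qed
  then have "f = g" by auto
  then show ?thesis using p(1) g(2) by blast
qed

end

text \<open>On the span of the kernel functions both inner products are computed from the kernel, so a sequence
from the span that converges to \<open>f\<close> in the first space is Cauchy in the second; its limit there has the
same values as \<open>f\<close>.  The norms are compared up to a factor \<open>z < 1\<close>, which avoids square roots of norms.\<close>

lemma rkhs_unique_le:
  assumes 1: "rkhs X k H1 ip1" and 2: "rkhs X k H2 ip2" and f: "f \<in> H1"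
  shows "f \<in> H2 \<and> rkhs.nrm2 ip2 f \<le> rkhs.nrm2 ip1 f"
proof -
  interpret A: rkhs X k H1 ip1 by (rule 1)
  interpret B: rkhs X k H2 ip2 by (rule 2)
  have same: "ip1 g h = ip2 g h" if g: "g \<in> kernel_span X k" and h: "h \<in> kernel_span X k" for g h
    using g
  proof (induction rule: kernel_span.induct)
    case zero
    show ?case
      using A.ip_scale[OF A.zero_mem A.span_subset[OF h], of 0] B.ip_scale[OF B.zero_mem B.span_subset[OF h], of 0] by simp
  next
    case (step g w c)
    have "ip1 (A.kf w) h = cnj (h w)"
      unfolding A.ip_cnj[OF A.span_subset[OF h] A.kernel_mem[OF step.hyps(2)]]
      using A.reproducing[OF A.span_subset[OF h] step.hyps(2)] by simp
    moreover have "ip2 (A.kf w) h = cnj (h w)"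
      unfolding B.ip_cnj[OF B.span_subset[OF h] B.kernel_mem[OF step.hyps(2)]]
      using B.reproducing[OF B.span_subset[OF h] step.hyps(2)] by simp
    ultimately show ?case
      using A.ip_lin[OF A.kernel_mem[OF step.hyps(2)] A.span_subset[OF step.hyps(1)] A.span_subset[OF h], of c 1]
        B.ip_lin[OF B.kernel_mem[OF step.hyps(2)] B.span_subset[OF step.hyps(1)] B.span_subset[OF h], of c 1] step.IH
      by simp
  qed
  have sameN: "A.nrm2 g = B.nrm2 g" if "g \<in> kernel_span X k" for g
    using same[OF that that] by (simp add: A.nrm2_def B.nrm2_def)
  obtain p where p: "\<And>n. p n \<in> kernel_span X k" and lim: "(\<lambda>n. A.nrm2 (\<lambda>x. p n x - f x)) \<longlonglongrightarrow> 0"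
    using A.span_dense[OF f] by blast
  have diffS: "(\<lambda>x. p m x - p n x) \<in> kernel_span X k" for m n
    using kernel_span_add[OF p[of m] kernel_span_scale[OF p[of n], of "-1"]] by simp
  have "\<exists>g\<in>H2. (\<lambda>n. B.nrm2 (\<lambda>x. p n x - g x)) \<longlonglongrightarrow> 0"
  proof (rule B.cauchy_imp_limit[OF B.span_subset[OF p]])
    fix e :: real assume e: "e > 0"
    then obtain M where M: "\<And>n. n \<ge> M \<Longrightarrow> A.nrm2 (\<lambda>x. p n x - f x) < e / 4"
      using lim order_tendstoD(2)[of _ 0 sequentially "e / 4"] by (auto simp: eventually_sequentially)
    have "B.nrm2 (\<lambda>x. p m x - p n x) < e" if mn: "m \<ge> M" "n \<ge> M" for m n
    proof -
      let ?a = "\<lambda>x. p m x - f x" and ?b = "\<lambda>x. (-1) * (p n x - f x)"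
      have ab: "?a \<in> H1" "(\<lambda>x. p n x - f x) \<in> H1" "?b \<in> H1"
        by (intro A.diff_mem A.scale_mem A.span_subset[OF p] f)+
      have "(\<lambda>x. ?a x + ?b x) = (\<lambda>x. p m x - p n x)" by simp
      then have "A.nrm2 (\<lambda>x. p m x - p n x) \<le> A.nrm2 ?a / (1 - 1/2) + A.nrm2 ?b / (1/2)"
        using A.nrm2_add_le[OF ab(1,3), of "1/2"] by simp
      also have "A.nrm2 ?b = A.nrm2 (\<lambda>x. p n x - f x)" unfolding A.nrm2_scale[OF ab(2)] by simp
      finally show ?thesis using M[OF mn(1)] M[OF mn(2)] sameN[OF diffS] by simp
    qed
    then show "\<exists>M. \<forall>m\<ge>M. \<forall>n\<ge>M. B.nrm2 (\<lambda>x. p m x - p n x) < e" by blast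
  qed
  then obtain g where g: "g \<in> H2" and limB: "(\<lambda>n. B.nrm2 (\<lambda>x. p n x - g x)) \<longlonglongrightarrow> 0" by blast
  have "f w = g w" for w
  proof (cases "w \<in> X")
    case True
    show ?thesis
      using A.norm_limit_imp_pointwise[OF A.span_subset[OF p] f lim True]
        B.norm_limit_imp_pointwise[OF B.span_subset[OF p] g limB True] LIMSEQ_unique by blast
  qed (use A.supported[OF f] B.supported[OF g] in simp)
  then have fg: "f = g" by auto
  have fB: "f \<in> H2" using g fg by simp
  have "z * B.nrm2 f \<le> A.nrm2 f" if z: "0 < z" "z < 1" for z
  proof -
    define s where "s = 1 - sqrt z"
    have s: "0 < s" "s < 1" "(1 - s) * (1 - s) = z" using z by (auto simp: s_def)
    have le: "B.nrm2 f \<le> (A.nrm2 f / (1 - s) + A.nrm2 (\<lambda>x. p n x - f x) / s) / (1 - s) + B.nrm2 (\<lambda>x. p n x - f x) / s" for n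
    proof -
      have pB: "p n \<in> H2" and pA: "p n \<in> H1" using A.span_subset B.span_subset p by auto
      have "B.nrm2 (\<lambda>x. p n x + (-1) * (p n x - f x)) \<le> B.nrm2 (p n) / (1 - s) + B.nrm2 (\<lambda>x. (-1) * (p n x - f x)) / s"
        by (intro B.nrm2_add_le B.scale_mem B.diff_mem pB fB s)
      moreover have "B.nrm2 (\<lambda>x. (-1) * (p n x - f x)) = B.nrm2 (\<lambda>x. p n x - f x)"
        unfolding B.nrm2_scale[OF B.diff_mem[OF pB fB]] by simp
      moreover have "A.nrm2 (\<lambda>x. f x + (p n x - f x)) \<le> A.nrm2 f / (1 - s) + A.nrm2 (\<lambda>x. p n x - f x) / s"
        by (intro A.nrm2_add_le A.diff_mem pA f s)
      ultimately show ?thesis using s sameN[OF p[of n]] divide_right_mono[of "A.nrm2 (p n)" _ "1 - s"] by force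
    qed
    have "B.nrm2 f \<le> (A.nrm2 f / (1 - s) + 0 / s) / (1 - s) + 0 / s"
    proof (rule LIMSEQ_le_const)
      show "(\<lambda>n. (A.nrm2 f / (1 - s) + A.nrm2 (\<lambda>x. p n x - f x) / s) / (1 - s) + B.nrm2 (\<lambda>x. p n x - f x) / s)
          \<longlonglongrightarrow> (A.nrm2 f / (1 - s) + 0 / s) / (1 - s) + 0 / s"
        using s limB fg by (intro tendsto_intros lim) auto
    qed (use le in auto)
    then have "B.nrm2 f \<le> A.nrm2 f / z" using s by simp
    then show ?thesis using z by (simp add: field_simps)
  qed
  then have "B.nrm2 f \<le> A.nrm2 f" by (rule field_le_mult_one_interval)
  then show ?thesis using fB by simp
qed

theorem rkhs_unique:
  assumes "rkhs X k H1 ip1" "rkhs X k H2 ip2"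
  shows "H1 = H2" "f \<in> H1 \<Longrightarrow> Re (ip1 f f) = Re (ip2 f f)"
proof -
  show "H1 = H2" using rkhs_unique_le[OF assms] rkhs_unique_le[OF assms(2,1)] by blast
  then show "f \<in> H1 \<Longrightarrow> Re (ip1 f f) = Re (ip2 f f)"
    using rkhs_unique_le[OF assms, of f] rkhs_unique_le[OF assms(2,1), of f]
    by (auto simp: rkhs.nrm2_def[OF assms(1)] rkhs.nrm2_def[OF assms(2)])
qed

section \<open>The Hilbert space of a diagonal kernel\<close>

text \<open>The radius \<open>r\<close> only records that the set is a neighbourhood of \<open>0\<close>, which makes coefficients unique.\<close>

locale diagonal_kernel =
  fixes X :: "(complex^'d) set" and f :: "complex^'d \<Rightarrow> complex^'d \<Rightarrow> complex" and fc :: "nat^'d \<Rightarrow> real" and r :: real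
  assumes r_pos: "0 < r" and ball_sub: "ball 0 r \<subseteq> X" and fc_pos: "\<And>a. 0 < fc a"
    and expansion: "\<And>z w. z \<in> X \<Longrightarrow> w \<in> X \<Longrightarrow>
      ((\<lambda>a. of_real (fc a) * monomial z a * cnj (monomial w a)) has_sum f z w) UNIV"
begin

definition ell2 :: "(nat^'d \<Rightarrow> complex) \<Rightarrow> bool" where
  "ell2 u \<longleftrightarrow> (\<lambda>a. fc a * (cmod (u a))\<^sup>2) summable_on UNIV"

definition ell2_sq :: "(nat^'d \<Rightarrow> complex) \<Rightarrow> real" where
  "ell2_sq u = infsum (\<lambda>a. fc a * (cmod (u a))\<^sup>2) UNIV"

text \<open>With the factor \<open>fc a\<close> inside the series, the coefficients of the kernel function at \<open>w\<close> are
\<open>cnj (w\<^sup>a)\<close> and the squared norm of the series is \<open>\<Sum> fc a |u a|\<^sup>2\<close>.\<close>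

definition ser :: "(nat^'d \<Rightarrow> complex) \<Rightarrow> complex^'d \<Rightarrow> complex" where
  "ser u z = (if z \<in> X then infsum (\<lambda>a. of_real (fc a) * u a * monomial z a) UNIV else 0)"

lemma ell2_monomials: "z \<in> X \<Longrightarrow> ell2 (\<lambda>a. cnj (monomial z a))"
proof -
  assume z: "z \<in> X"
  have "((\<lambda>a. of_real (fc a * (cmod (monomial z a))\<^sup>2)) has_sum f z z) UNIV"
    using expansion[OF z z] by (simp add: complex_norm_square mult.assoc del: of_real_power)
  then have "((\<lambda>a. Re (of_real (fc a * (cmod (monomial z a))\<^sup>2))) has_sum Re (f z z)) UNIV" by (rule has_sum_Re)
  then show ?thesis unfolding ell2_def by (auto intro: has_sum_imp_summable)
qed

lemma ell2_add: assumes "ell2 u" "ell2 v" shows "ell2 (\<lambda>a. u a + v a)"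
  unfolding ell2_def
proof (rule summable_on_comparison_test)
  show "(\<lambda>a. 2 * (fc a * (cmod (u a))\<^sup>2) + 2 * (fc a * (cmod (v a))\<^sup>2)) summable_on UNIV"
    using assms unfolding ell2_def by (intro summable_on_add summable_on_cmult_right)
  show "fc a * (cmod (u a + v a))\<^sup>2 \<le> 2 * (fc a * (cmod (u a))\<^sup>2) + 2 * (fc a * (cmod (v a))\<^sup>2)" for a
    using mult_left_mono[OF cmod_add_sq_le[of "u a" "v a"], of "fc a"] fc_pos[of a] by (simp add: distrib_left)
qed (use fc_pos in \<open>auto simp: less_imp_le\<close>)

lemma ell2_scale: "ell2 u \<Longrightarrow> ell2 (\<lambda>a. c * u a)"
  unfolding ell2_def
  using summable_on_cmult_right[of "\<lambda>a. fc a * (cmod (u a))\<^sup>2" UNIV "(cmod c)\<^sup>2"]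
  by (simp add: norm_mult power_mult_distrib mult_ac)

lemma ell2_diff: "ell2 u \<Longrightarrow> ell2 v \<Longrightarrow> ell2 (\<lambda>a. u a - v a)"
  using ell2_add[of u "\<lambda>a. -1 * v a"] ell2_scale[of v "-1"] by simp

lemma ell2_product_summable:
  assumes "ell2 u" "ell2 v" shows "(\<lambda>a. of_real (fc a) * u a * v a) summable_on UNIV"
  unfolding summable_on_iff_abs_summable_on_complex
proof (rule summable_on_comparison_test)
  show "(\<lambda>a. fc a * (cmod (u a))\<^sup>2 + fc a * (cmod (v a))\<^sup>2) summable_on UNIV"
    using assms unfolding ell2_def by (intro summable_on_add)
  fix a
  have "cmod (u a) * cmod (v a) \<le> (cmod (u a))\<^sup>2 + (cmod (v a))\<^sup>2"
    by (intro prod_le_sum_squares) auto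
  then show "cmod (of_real (fc a) * u a * v a) \<le> fc a * (cmod (u a))\<^sup>2 + fc a * (cmod (v a))\<^sup>2"
    using mult_left_mono[of _ _ "fc a"] fc_pos[of a] by (simp add: norm_mult mult.assoc distrib_left[symmetric])
qed simp

lemma ell2_cnj: "ell2 (\<lambda>a. cnj (u a)) \<longleftrightarrow> ell2 u"
  by (simp add: ell2_def)

lemma ser_has_sum:
  assumes "ell2 u" "z \<in> X" shows "((\<lambda>a. of_real (fc a) * u a * monomial z a) has_sum ser u z) UNIV"
proof -
  have "ell2 (monomial z)" using ell2_monomials[OF assms(2)] ell2_cnj[of "monomial z"] by simp
  from has_sum_infsum[OF ell2_product_summable[OF assms(1) this]] show ?thesis using assms(2) by (simp add: ser_def)
qed

lemma ser_lin:
  assumes "ell2 u" "ell2 v" shows "ser (\<lambda>a. c * u a + v a) = (\<lambda>z. c * ser u z + ser v z)"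
proof
  fix z
  show "ser (\<lambda>a. c * u a + v a) z = c * ser u z + ser v z"
  proof (cases "z \<in> X")
    case True
    have "((\<lambda>a. c * (of_real (fc a) * u a * monomial z a) + of_real (fc a) * v a * monomial z a)
        has_sum c * ser u z + ser v z) UNIV"
      by (intro has_sum_add has_sum_cmult_right ser_has_sum assms True)
    moreover have "((\<lambda>a. of_real (fc a) * (c * u a + v a) * monomial z a) has_sum ser (\<lambda>a. c * u a + v a) z) UNIV"
      by (intro ser_has_sum ell2_add ell2_scale assms True)
    ultimately show ?thesis by (intro has_sum_unique) (auto simp: algebra_simps)
  qed (simp add: ser_def)
qed

lemma series_coefficients_unique:
  assumes "\<And>z. z \<in> X \<Longrightarrow> ((\<lambda>a. d a * monomial z a) has_sum s z) UNIV"
    "\<And>z. z \<in> X \<Longrightarrow> ((\<lambda>a. d' a * monomial z a) has_sum s z) UNIV"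
  shows "d a = d' a"
proof -
  have "(\<lambda>a. d a - d' a) a = 0"
  proof (rule power_series_coefficient_eq_0[OF r_pos])
    fix z :: "complex^'d" assume "z \<in> ball 0 r"
    then have z: "z \<in> X" using ball_sub by auto
    from has_sum_add[OF assms(1)[OF z] has_sum_uminusI[OF assms(2)[OF z]]]
    show "((\<lambda>a. (d a - d' a) * monomial z a) has_sum 0) UNIV" by (simp add: left_diff_distrib)
  qed
  then show ?thesis by simp
qed

lemma ser_inj: assumes "ell2 u" "ell2 v" "ser u = ser v" shows "u = v"
proof
  fix a
  have "of_real (fc a) * u a = of_real (fc a) * v a"
    by (rule series_coefficients_unique[of "\<lambda>a. of_real (fc a) * u a" "ser u" "\<lambda>a. of_real (fc a) * v a"])
      (use ser_has_sum[OF assms(1)] ser_has_sum[OF assms(2)] assms(3) in auto)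
  then show "u a = v a" using fc_pos[of a] by simp
qed

definition coef :: "(complex^'d \<Rightarrow> complex) \<Rightarrow> nat^'d \<Rightarrow> complex" where
  "coef h = (THE u. ell2 u \<and> ser u = h)"

lemma coef_ser: "ell2 u \<Longrightarrow> coef (ser u) = u"
  unfolding coef_def by (rule the_equality) (auto intro: ser_inj)

definition ser_space :: "(complex^'d \<Rightarrow> complex) set" where "ser_space = ser ` {u. ell2 u}"

definition ser_ip :: "(complex^'d \<Rightarrow> complex) \<Rightarrow> (complex^'d \<Rightarrow> complex) \<Rightarrow> complex" where
  "ser_ip g h = infsum (\<lambda>a. of_real (fc a) * coef g a * cnj (coef h a)) UNIV"

lemma ser_ip_has_sum:
  assumes "ell2 u" "ell2 v"
  shows "((\<lambda>a. of_real (fc a) * u a * cnj (v a)) has_sum ser_ip (ser u) (ser v)) UNIV"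
  unfolding ser_ip_def coef_ser[OF assms(1)] coef_ser[OF assms(2)]
  by (rule has_sum_infsum[OF ell2_product_summable]) (use assms ell2_cnj in auto)

lemma ser_ip_self: assumes "ell2 u" shows "ser_ip (ser u) (ser u) = of_real (ell2_sq u)"
proof (rule has_sum_unique[OF ser_ip_has_sum[OF assms assms]])
  have "((\<lambda>a. of_real (fc a * (cmod (u a))\<^sup>2) :: complex) has_sum of_real (ell2_sq u)) UNIV"
    unfolding has_sum_of_real_iff ell2_sq_def by (rule has_sum_infsum) (use assms in \<open>simp add: ell2_def\<close>)
  then show "((\<lambda>a. of_real (fc a) * u a * cnj (u a)) has_sum of_real (ell2_sq u)) UNIV"
    by (simp add: complex_norm_square mult.assoc del: of_real_power)
qed

lemma ell2_complete:
  assumes u: "\<And>n. ell2 (u n)"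
    and cau: "\<And>e. e > 0 \<Longrightarrow> \<exists>M. \<forall>m\<ge>M. \<forall>n\<ge>M. ell2_sq (\<lambda>a. u m a - u n a) < e"
  shows "\<exists>v. ell2 v \<and> (\<lambda>n. ell2_sq (\<lambda>a. u n a - v a)) \<longlonglongrightarrow> 0"
proof -
  have hs: "((\<lambda>a. fc a * (cmod (u m a - u n a))\<^sup>2) has_sum ell2_sq (\<lambda>a. u m a - u n a)) UNIV" for m n
    using ell2_diff[OF u u, of m n] unfolding ell2_sq_def ell2_def by (rule has_sum_infsum)
  have "convergent (\<lambda>n. u n a)" for a
  proof (rule Cauchy_convergent, rule metric_CauchyI)
    fix e :: real assume e: "e > 0"
    then obtain M where M: "\<And>m n. m \<ge> M \<Longrightarrow> n \<ge> M \<Longrightarrow> ell2_sq (\<lambda>a. u m a - u n a) < fc a * e\<^sup>2"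
      using cau[of "fc a * e\<^sup>2"] fc_pos[of a] by auto
    have "dist (u m a) (u n a) < e" if mn: "m \<ge> M" "n \<ge> M" for m n
    proof -
      have "fc a * (cmod (u m a - u n a))\<^sup>2 \<le> ell2_sq (\<lambda>a. u m a - u n a)"
        using finite_sum_le_has_sum[OF hs[of m n], of "{a}"] fc_pos by (auto simp: less_imp_le)
      then have "fc a * (cmod (u m a - u n a))\<^sup>2 < fc a * e\<^sup>2" using M[OF mn] by linarith
      then show ?thesis using fc_pos[of a] e by (auto simp: dist_norm intro: power_less_imp_less_base)
    qed
    then show "\<exists>M. \<forall>m\<ge>M. \<forall>n\<ge>M. dist (u m a) (u n a) < e" by blast
  qed
  then have "\<forall>a. \<exists>y. (\<lambda>n. u n a) \<longlonglongrightarrow> y" unfolding convergent_def by blast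
  then obtain v where v: "\<And>a. (\<lambda>n. u n a) \<longlonglongrightarrow> v a" by metis
  have fin: "(\<Sum>a\<in>F. fc a * (cmod (u m a - v a))\<^sup>2) \<le> e"
    if F: "finite F" and m: "\<And>n. n \<ge> M \<Longrightarrow> ell2_sq (\<lambda>a. u m a - u n a) < e" for F M m e
  proof (rule LIMSEQ_le_const2)
    show "(\<lambda>n. \<Sum>a\<in>F. fc a * (cmod (u m a - u n a))\<^sup>2) \<longlonglongrightarrow> (\<Sum>a\<in>F. fc a * (cmod (u m a - v a))\<^sup>2)"
      by (intro tendsto_intros v)
    have "(\<Sum>a\<in>F. fc a * (cmod (u m a - u n a))\<^sup>2) \<le> e" if "n \<ge> M" for n
      using finite_sum_le_has_sum[OF hs[of m n], of F] F m[OF that] fc_pos by (force simp: less_imp_le)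
    then show "\<exists>N. \<forall>n\<ge>N. (\<Sum>a\<in>F. fc a * (cmod (u m a - u n a))\<^sup>2) \<le> e" by blast
  qed
  have l2: "ell2 (\<lambda>a. u m a - v a) \<and> ell2_sq (\<lambda>a. u m a - v a) \<le> e"
    if m: "\<And>n. n \<ge> M \<Longrightarrow> ell2_sq (\<lambda>a. u m a - u n a) < e" for M m e
  proof -
    have s: "ell2 (\<lambda>a. u m a - v a)"
      unfolding ell2_def
      by (rule nonneg_bounded_partial_sums_imp_summable_on[where C = e])
        (use fin[OF _ m] fc_pos in \<open>auto intro: eventually_finite_subsets_at_top_weakI simp: less_imp_le\<close>)
    have "ell2_sq (\<lambda>a. u m a - v a) \<le> e"
      unfolding ell2_sq_def by (rule infsum_le_finite_sums) (use s fin[OF _ m] in \<open>auto simp: ell2_def\<close>)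
    then show ?thesis using s by blast
  qed
  obtain M1 where M1: "\<And>m n. m \<ge> M1 \<Longrightarrow> n \<ge> M1 \<Longrightarrow> ell2_sq (\<lambda>a. u m a - u n a) < 1"
    using cau[of 1] by auto
  have "ell2 (\<lambda>a. u M1 a - (u M1 a - v a))" using ell2_diff[OF u l2[OF M1, THEN conjunct1]] by blast
  then have "ell2 v" by simp
  moreover have "(\<lambda>n. ell2_sq (\<lambda>a. u n a - v a)) \<longlonglongrightarrow> 0"
  proof (rule tendstoI)
    fix e :: real assume e: "e > 0"
    obtain M where M: "\<And>m n. m \<ge> M \<Longrightarrow> n \<ge> M \<Longrightarrow> ell2_sq (\<lambda>a. u m a - u n a) < e / 2"
      using cau[of "e / 2"] e by auto
    have "dist (ell2_sq (\<lambda>a. u m a - v a)) 0 < e" if m: "m \<ge> M" for m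
    proof -
      have "ell2_sq (\<lambda>a. u m a - v a) \<le> e / 2" using l2[OF M[OF m]] by blast
      moreover have "0 \<le> ell2_sq (\<lambda>a. u m a - v a)" unfolding ell2_sq_def
        using fc_pos by (intro infsum_nonneg) (auto simp: less_imp_le)
      ultimately show ?thesis using e by simp
    qed
    then show "\<forall>\<^sub>F n in sequentially. dist (ell2_sq (\<lambda>a. u n a - v a)) 0 < e"
      unfolding eventually_sequentially by blast
  qed
  ultimately show ?thesis by blast
qed

lemma ser_diff: "ell2 u \<Longrightarrow> ell2 v \<Longrightarrow> ser (\<lambda>a. u a - v a) = (\<lambda>z. ser u z - ser v z)"
  using ser_lin[of v u "-1"] by simp

theorem rkhs_ser_space: "rkhs X f ser_space ser_ip"
proof
  fix g x assume "g \<in> ser_space" "x \<notin> X"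
  then show "g x = 0" by (auto simp: ser_space_def ser_def)
next
  have "ser (\<lambda>_. 0) = (\<lambda>_. 0)" by (simp add: ser_def fun_eq_iff)
  moreover have "ell2 (\<lambda>_. 0)" by (simp add: ell2_def)
  ultimately show "(\<lambda>_. 0) \<in> ser_space" unfolding ser_space_def by force
next
  fix g h assume "g \<in> ser_space" "h \<in> ser_space"
  then obtain u v where uv: "ell2 u" "ell2 v" "g = ser u" "h = ser v" by (auto simp: ser_space_def)
  then have "(\<lambda>x. g x + h x) = ser (\<lambda>a. u a + v a)" using ser_lin[OF uv(1,2), of 1] by simp
  then show "(\<lambda>x. g x + h x) \<in> ser_space" using ell2_add[OF uv(1,2)] by (auto simp: ser_space_def)
next
  fix c g assume "g \<in> ser_space"
  then obtain u where u: "ell2 u" "g = ser u" by (auto simp: ser_space_def)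
  have z: "ell2 (\<lambda>_. 0)" "ser (\<lambda>_. 0) = (\<lambda>_. 0)" by (simp_all add: ell2_def ser_def fun_eq_iff)
  have "(\<lambda>x. c * g x) = ser (\<lambda>a. c * u a)" using ser_lin[OF u(1) z(1), of c] u z by simp
  then show "(\<lambda>x. c * g x) \<in> ser_space" using ell2_scale[OF u(1)] by (auto simp: ser_space_def)
next
  fix g h l assume "g \<in> ser_space" "h \<in> ser_space" "l \<in> ser_space"
  then obtain u v w where uv: "ell2 u" "ell2 v" "ell2 w" "g = ser u" "h = ser v" "l = ser w" by (auto simp: ser_space_def)
  then have e: "(\<lambda>x. g x + h x) = ser (\<lambda>a. u a + v a)" using ser_lin[OF uv(1,2), of 1] by simp
  from has_sum_add[OF ser_ip_has_sum[OF uv(1,3)] ser_ip_has_sum[OF uv(2,3)]]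
  have "((\<lambda>a. of_real (fc a) * (u a + v a) * cnj (w a)) has_sum ser_ip g l + ser_ip h l) UNIV"
    using uv by (simp add: algebra_simps)
  then show "ser_ip (\<lambda>x. g x + h x) l = ser_ip g l + ser_ip h l"
    unfolding e using ser_ip_has_sum[OF ell2_add[OF uv(1,2)] uv(3)] uv(6) has_sum_unique by blast
next
  fix c g l assume "g \<in> ser_space" "l \<in> ser_space"
  then obtain u w where uv: "ell2 u" "ell2 w" "g = ser u" "l = ser w" by (auto simp: ser_space_def)
  have z: "ell2 (\<lambda>_. 0)" "ser (\<lambda>_. 0) = (\<lambda>_. 0)" by (simp_all add: ell2_def ser_def fun_eq_iff)
  have e: "(\<lambda>x. c * g x) = ser (\<lambda>a. c * u a)" using ser_lin[OF uv(1) z(1), of c] uv z by simp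
  from has_sum_cmult_right[OF ser_ip_has_sum[OF uv(1,2)], of c]
  have "((\<lambda>a. of_real (fc a) * (c * u a) * cnj (w a)) has_sum c * ser_ip g l) UNIV"
    using uv by (simp add: mult_ac)
  then show "ser_ip (\<lambda>x. c * g x) l = c * ser_ip g l"
    unfolding e using ser_ip_has_sum[OF ell2_scale[OF uv(1)] uv(2)] uv(4) has_sum_unique by blast
next
  fix g h assume "g \<in> ser_space" "h \<in> ser_space"
  show "ser_ip h g = cnj (ser_ip g h)"
    unfolding ser_ip_def infsum_cnj[symmetric] by (simp add: mult_ac)
next
  fix g assume "g \<in> ser_space"
  then obtain u where u: "ell2 u" "g = ser u" by (auto simp: ser_space_def)
  have "0 \<le> ell2_sq u" unfolding ell2_sq_def using fc_pos by (intro infsum_nonneg) (auto simp: less_imp_le)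
  then show "0 \<le> ser_ip g g" using ser_ip_self[OF u(1)] u(2) by (simp add: less_eq_complex_def)
next
  fix g assume "g \<in> ser_space" and 0: "ser_ip g g = 0"
  then obtain u where u: "ell2 u" "g = ser u" by (auto simp: ser_space_def)
  have "ell2_sq u = 0" using 0 ser_ip_self[OF u(1)] u(2) by simp
  then have "((\<lambda>a. fc a * (cmod (u a))\<^sup>2) has_sum 0) UNIV"
    using u(1) unfolding ell2_sq_def ell2_def by (metis has_sum_infsum)
  then have "fc a * (cmod (u a))\<^sup>2 = 0" for a
    by (rule nonneg_has_sum_le_0D) (use fc_pos in \<open>auto simp: less_imp_le\<close>)
  then have "u a = 0" for a using fc_pos[of a] by (metis mult_eq_0_iff norm_eq_zero order_less_irrefl power_eq_0_iff)
  then show "g = (\<lambda>_. 0)" unfolding u(2) by (simp add: ser_def fun_eq_iff)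
next
  fix s :: "nat \<Rightarrow> complex^'d \<Rightarrow> complex"
  assume s: "\<And>n. s n \<in> ser_space" and cau: "\<And>e. e > 0 \<Longrightarrow> \<exists>M. \<forall>m\<ge>M. \<forall>n\<ge>M.
            sqrt (Re (ser_ip (\<lambda>x. s m x - s n x) (\<lambda>x. s m x - s n x))) < e"
  have "\<forall>n. \<exists>u. ell2 u \<and> s n = ser u" using s by (auto simp: ser_space_def)
  then obtain u where u: "\<And>n. ell2 (u n)" "\<And>n. s n = ser (u n)" by metis
  have N: "Re (ser_ip (\<lambda>x. s n x - ser v x) (\<lambda>x. s n x - ser v x)) = ell2_sq (\<lambda>a. u n a - v a)" if "ell2 v" for n v
    unfolding u(2) ser_diff[OF u(1) that, symmetric] ser_ip_self[OF ell2_diff[OF u(1) that]] by simp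
  have "\<exists>v. ell2 v \<and> (\<lambda>n. ell2_sq (\<lambda>a. u n a - v a)) \<longlonglongrightarrow> 0"
  proof (rule ell2_complete[OF u(1)])
    fix e :: real assume e: "e > 0"
    obtain M where M: "\<And>m n. m \<ge> M \<Longrightarrow> n \<ge> M \<Longrightarrow> sqrt (ell2_sq (\<lambda>a. u m a - u n a)) < sqrt e"
      using cau[of "sqrt e"] e unfolding u(2)[of _] N[OF u(1), unfolded u(2)] by auto
    then show "\<exists>M. \<forall>m\<ge>M. \<forall>n\<ge>M. ell2_sq (\<lambda>a. u m a - u n a) < e" by (auto simp: real_sqrt_less_iff)
  qed
  then obtain v where v: "ell2 v" "(\<lambda>n. ell2_sq (\<lambda>a. u n a - v a)) \<longlonglongrightarrow> 0" by blast
  from tendsto_real_sqrt[OF v(2)]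
  have "(\<lambda>n. sqrt (Re (ser_ip (\<lambda>x. s n x - ser v x) (\<lambda>x. s n x - ser v x)))) \<longlonglongrightarrow> 0"
    unfolding N[OF v(1)] by simp
  then show "\<exists>f\<in>ser_space. (\<lambda>n. sqrt (Re (ser_ip (\<lambda>x. s n x - f x) (\<lambda>x. s n x - f x)))) \<longlonglongrightarrow> 0"
    using v(1) by (auto simp: ser_space_def)
next
  fix w assume w: "w \<in> X"
  have k: "(\<lambda>z. if z \<in> X then f z w else 0) = ser (\<lambda>a. cnj (monomial w a))"
  proof
    fix z
    show "(if z \<in> X then f z w else 0) = ser (\<lambda>a. cnj (monomial w a)) z"
    proof (cases "z \<in> X")
      case True
      have "((\<lambda>a. of_real (fc a) * cnj (monomial w a) * monomial z a) has_sum f z w) UNIV"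
        using expansion[OF True w] by (simp add: mult_ac)
      then show ?thesis using True by (simp add: ser_def infsumI)
    qed (simp add: ser_def)
  qed
  show "(\<lambda>z. if z \<in> X then f z w else 0) \<in> ser_space"
    unfolding k using ell2_monomials[OF w] by (auto simp: ser_space_def)
  fix g assume "g \<in> ser_space"
  then obtain u where u: "ell2 u" "g = ser u" by (auto simp: ser_space_def)
  show "ser_ip g (\<lambda>z. if z \<in> X then f z w else 0) = g w"
    unfolding k u(2)
    by (rule has_sum_unique[OF ser_ip_has_sum[OF u(1) ell2_monomials[OF w]]])
      (use ser_has_sum[OF u(1) w] in simp)
qed

lemma rkhs_chosen: "rkhs X f (rkhs_carrier X f) (rkhs_inner X f)"
proof -
  have "(\<lambda>(H, ip). rkhs X f H ip) (rkhs_of X f)"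
    unfolding rkhs_of_def by (rule someI[of _ "(ser_space, ser_ip)"]) (simp add: rkhs_ser_space)
  then show ?thesis by (simp add: rkhs_carrier_def rkhs_inner_def case_prod_beta)
qed

theorem mem_rkhs_carrier_iff: "h \<in> rkhs_carrier X f \<longleftrightarrow> (\<exists>u. ell2 u \<and> h = ser u)"
  using rkhs_unique(1)[OF rkhs_chosen rkhs_ser_space] by (auto simp: ser_space_def)

theorem rkhs_norm_ser:
  assumes "ell2 u" shows "Re (rkhs_inner X f (ser u) (ser u)) = ell2_sq u"
proof -
  have "ser u \<in> rkhs_carrier X f" using assms mem_rkhs_carrier_iff by blast
  from rkhs_unique(2)[OF rkhs_chosen rkhs_ser_space this] show ?thesis by (simp add: ser_ip_self[OF assms])
qed

end

section \<open>Symbols and contractive multipliers\<close>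

text \<open>With \<open>w = A\<^sup>* x\<close> one has \<open>\<parallel>w\<parallel>\<^sup>2 = \<langle>x, A w\<rangle> \<le> (\<parallel>x\<parallel>\<^sup>2 + \<parallel>A w\<parallel>\<^sup>2) / 2 \<le> (\<parallel>x\<parallel>\<^sup>2 + \<parallel>w\<parallel>\<^sup>2) / 2\<close>.\<close>

lemma contraction_on_adjoint:
  assumes "contraction_on S A" shows "contraction_on S (\<lambda>p q. cnj (A q p))"
  unfolding contraction_on_def
proof
  fix x :: "'a \<Rightarrow> complex"
  define w where "w p = (\<Sum>q\<in>S. cnj (A q p) * x q)" for p
  define v where "v q = (\<Sum>p\<in>S. A q p * w p)" for q
  have "(\<Sum>p\<in>S. w p * cnj (w p)) = (\<Sum>p\<in>S. \<Sum>q\<in>S. cnj (A q p) * x q * cnj (w p))"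
    by (subst w_def) (simp add: sum_distrib_right)
  also have "\<dots> = (\<Sum>q\<in>S. x q * cnj (v q))"
    unfolding v_def cnj_sum sum_distrib_left by (subst sum.swap) (simp add: mult_ac)
  finally have e: "of_real (\<Sum>p\<in>S. (cmod (w p))\<^sup>2) = (\<Sum>q\<in>S. x q * cnj (v q))"
    by (simp add: complex_norm_square[symmetric])
  have "(\<Sum>p\<in>S. (cmod (w p))\<^sup>2) = Re (\<Sum>q\<in>S. x q * cnj (v q))" unfolding e[symmetric] by simp
  also have "\<dots> \<le> cmod (\<Sum>q\<in>S. x q * cnj (v q))" by (rule complex_Re_le_cmod)
  also have "\<dots> \<le> (\<Sum>q\<in>S. cmod (x q * cnj (v q)))" by (rule norm_sum)
  also have "\<dots> = (\<Sum>q\<in>S. cmod (x q) * cmod (v q))" by (simp add: norm_mult)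
  also have "\<dots> \<le> (\<Sum>q\<in>S. ((cmod (x q))\<^sup>2 + (cmod (v q))\<^sup>2) / 2)"
  proof (rule sum_mono)
    fix q
    show "cmod (x q) * cmod (v q) \<le> ((cmod (x q))\<^sup>2 + (cmod (v q))\<^sup>2) / 2"
      using sum_squares_bound[of "cmod (x q)" "cmod (v q)"] by simp
  qed
  also have "\<dots> = ((\<Sum>q\<in>S. (cmod (x q))\<^sup>2) + (\<Sum>q\<in>S. (cmod (v q))\<^sup>2)) / 2"
    by (simp add: sum.distrib sum_divide_distrib[symmetric])
  also have "\<dots> \<le> ((\<Sum>q\<in>S. (cmod (x q))\<^sup>2) + (\<Sum>p\<in>S. (cmod (w p))\<^sup>2)) / 2"
    using assms unfolding contraction_on_def v_def by (simp add: divide_right_mono)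
  finally show "(\<Sum>p\<in>S. (cmod (\<Sum>q\<in>S. cnj (A q p) * x q))\<^sup>2) \<le> (\<Sum>q\<in>S. (cmod (x q))\<^sup>2)"
    by (simp add: w_def)
qed

definition symbol_matrix :: "(nat^'d \<Rightarrow> real) \<Rightarrow> (nat^'d \<Rightarrow> real) \<Rightarrow> (nat^'d \<Rightarrow> nat \<Rightarrow> nat \<Rightarrow> complex) \<Rightarrow>
    (nat^'d) \<times> nat \<Rightarrow> (nat^'d) \<times> nat \<Rightarrow> complex" where
  "symbol_matrix kc lc c p q =
     (if fst p \<le> fst q then of_real (sqrt (kc (fst p) / lc (fst q))) * c (fst q - fst p) (snd p) (snd q) else 0)"

lemma block_contraction_symbol_matrix:
  assumes F: "co_invariant F" and c: "\<And>a. a \<in> F \<Longrightarrow> c a \<in> carrier_mat J J"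
  shows "block_contraction F J (caratheodory_block J kc lc c)
    \<longleftrightarrow> contraction_on (F \<times> {..<J}) (symbol_matrix kc lc (\<lambda>a i j. c a $$ (i, j)))"
proof -
  have "block_entry (caratheodory_block J kc lc c) p q = symbol_matrix kc lc (\<lambda>a i j. c a $$ (i, j)) p q"
    if "p \<in> F \<times> {..<J}" "q \<in> F \<times> {..<J}" for p q
  proof (cases "fst p \<le> fst q")
    case True
    have "fst q - fst p \<in> F" using F that multi_diff_le[of "fst q" "fst p"] unfolding co_invariant_def by auto
    from c[OF this] show ?thesis using True that
      by (auto simp: block_entry_def caratheodory_block_def symbol_matrix_def)
  next
    case False
    then show ?thesis using that by (auto simp: block_entry_def caratheodory_block_def symbol_matrix_def)
  qed
  then show ?thesis unfolding block_contraction_def contraction_on_def by (simp cong: sum.cong)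
qed

lemma of_real_sqrt_mult_self: "0 \<le> x \<Longrightarrow> complex_of_real (sqrt x) * complex_of_real (sqrt x) = of_real x"
  by (simp only: of_real_mult[symmetric] real_sqrt_mult_self abs_of_nonneg)

locale weights =
  fixes kc lc :: "nat^'d \<Rightarrow> real"
  assumes kcp: "\<And>a. 0 < kc a" and lcp: "\<And>a. 0 < lc a"
begin

text \<open>The square roots in the matrix are absorbed by passing from \<open>y b\<close> to \<open>sqrt (lc b) y b\<close>; what remains is
the backward Toeplitz operator between weighted spaces.\<close>

lemma symbol_contraction_iff:
  assumes F: "finite F"
  shows "contraction_on (F \<times> {..<N}) (symbol_matrix kc lc c) \<longleftrightarrow>
    (\<forall>y. (\<Sum>a\<in>F. kc a * vnorm2 N (\<lambda>i. \<Sum>b\<in>F. \<Sum>j<N. if a \<le> b then c (b - a) i j * y b j else 0))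
        \<le> (\<Sum>b\<in>F. lc b * vnorm2 N (y b)))" (is "?L \<longleftrightarrow> (\<forall>y. ?P y)" is "_ \<longleftrightarrow> ?R")
proof -
  let ?S = "F \<times> {..<N}"
  let ?x = "\<lambda>y p. of_real (sqrt (lc (fst p))) * (y :: nat^'d \<Rightarrow> nat \<Rightarrow> complex) (fst p) (snd p)"
  have 1: "(\<Sum>q\<in>?S. (cmod (?x y q))\<^sup>2) = (\<Sum>b\<in>F. lc b * vnorm2 N (y b))" for y
    unfolding sum.cartesian_product[symmetric] case_prod_beta vnorm2_def sum_distrib_left
    using lcp[THEN less_imp_le] by (simp add: sum.cartesian_product case_prod_beta norm_mult power_mult_distrib)
  have 2: "(\<Sum>p\<in>?S. (cmod (\<Sum>q\<in>?S. symbol_matrix kc lc c p q * ?x y q))\<^sup>2)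
     = (\<Sum>a\<in>F. kc a * vnorm2 N (\<lambda>i. \<Sum>b\<in>F. \<Sum>j<N. if a \<le> b then c (b - a) i j * y b j else 0))" for y
  proof -
    define X where "X a i = (\<Sum>b\<in>F. \<Sum>j<N. if a \<le> b then c (b - a) i j * y b j else 0)" for a i
    have "(\<Sum>q\<in>?S. symbol_matrix kc lc c p q * ?x y q) = of_real (sqrt (kc (fst p))) * X (fst p) (snd p)" for p
    proof -
      have "sqrt (lc b) \<noteq> 0" for b using lcp[of b] by simp
      then show ?thesis
        unfolding X_def sum.cartesian_product sum_distrib_left
        by (intro sum.cong refl) (auto simp: symbol_matrix_def real_sqrt_divide)
    qed
    then have "(\<Sum>p\<in>?S. (cmod (\<Sum>q\<in>?S. symbol_matrix kc lc c p q * ?x y q))\<^sup>2)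
        = (\<Sum>p\<in>?S. kc (fst p) * (cmod (X (fst p) (snd p)))\<^sup>2)"
      using kcp[THEN less_imp_le] by (simp add: norm_mult power_mult_distrib)
    also have "\<dots> = (\<Sum>a\<in>F. kc a * vnorm2 N (X a))"
      by (simp add: vnorm2_def sum_distrib_left sum.cartesian_product case_prod_beta)
    finally show ?thesis by (simp add: X_def[abs_def])
  qed
  show ?thesis
  proof
    assume L: ?L
    show ?R
    proof
      fix y
      from L[unfolded contraction_on_def, rule_format, of "?x y"]
      show "?P y" by (simp only: 1 2)
    qed
  next
    assume R: ?R
    show ?L unfolding contraction_on_def
    proof
      fix x :: "(nat^'d) \<times> nat \<Rightarrow> complex"
      define y where "y b j = x (b, j) / of_real (sqrt (lc b))" for b j
      have xq: "of_real (sqrt (lc (fst q))) * y (fst q) (snd q) = x q" for q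
        using lcp[of "fst q"] by (simp add: y_def)
      show "(\<Sum>p\<in>?S. (cmod (\<Sum>q\<in>?S. symbol_matrix kc lc c p q * x q))\<^sup>2) \<le> (\<Sum>q\<in>?S. (cmod (x q))\<^sup>2)"
        using R[rule_format, of y] unfolding 1[symmetric] 2[symmetric] xq .
    qed
  qed
qed

text \<open>The coefficients of \<open>\<Phi> f\<close> in the space of the second kernel, if \<open>u\<close> are the coefficients of \<open>f\<close> in the
space of the first and \<open>\<Phi>(z) = \<Sum> z\<^sup>a c\<^sub>a\<^sup>*\<close>.\<close>

definition mult_coef :: "(nat^'d \<Rightarrow> nat \<Rightarrow> nat \<Rightarrow> complex) \<Rightarrow> nat \<Rightarrow> (nat^'d \<Rightarrow> nat \<Rightarrow> complex) \<Rightarrow> nat^'d \<Rightarrow> nat \<Rightarrow> complex" where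
  "mult_coef c N u b j = (\<Sum>a | a \<le> b. \<Sum>i<N. of_real (kc a) * u a i * cnj (c (b - a) i j)) / of_real (lc b)"

text \<open>The same rescaling for the adjoint matrix, which belongs to multiplication of power series; on a
co-invariant index set the truncated matrix computes the coefficients of the product exactly.\<close>

lemma adjoint_symbol_contraction_iff:
  assumes F: "finite F" "co_invariant F"
  shows "contraction_on (F \<times> {..<N}) (\<lambda>p q. cnj (symbol_matrix kc lc c q p)) \<longleftrightarrow>
    (\<forall>u. (\<Sum>b\<in>F. lc b * vnorm2 N (mult_coef c N u b)) \<le> (\<Sum>a\<in>F. kc a * vnorm2 N (u a)))" (is "?L \<longleftrightarrow> (\<forall>u. ?P u)" is "_ \<longleftrightarrow> ?R")
proof -
  let ?S = "F \<times> {..<N}"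
  let ?x = "\<lambda>y p. of_real (sqrt (kc (fst p))) * (y :: nat^'d \<Rightarrow> nat \<Rightarrow> complex) (fst p) (snd p)"
  have 1: "(\<Sum>q\<in>?S. (cmod (?x y q))\<^sup>2) = (\<Sum>b\<in>F. kc b * vnorm2 N (y b))" for y
    unfolding sum.cartesian_product[symmetric] case_prod_beta vnorm2_def sum_distrib_left
    using kcp[THEN less_imp_le] by (simp add: sum.cartesian_product case_prod_beta norm_mult power_mult_distrib)
  have 2: "(\<Sum>p\<in>?S. (cmod (\<Sum>q\<in>?S. cnj (symbol_matrix kc lc c q p) * ?x u q))\<^sup>2)
     = (\<Sum>b\<in>F. lc b * vnorm2 N (mult_coef c N u b))" for u
  proof -
    have e: "(\<Sum>q\<in>?S. cnj (symbol_matrix kc lc c q (b, j)) * ?x u q) = of_real (sqrt (lc b)) * mult_coef c N u b j"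
      if b: "b \<in> F" for b j
    proof -
      have "complex_of_real (sqrt (lc b)) \<noteq> 0" using lcp[of b] by simp
      then have ll: "of_real (sqrt (lc b)) / of_real (lc b) = (1 / of_real (sqrt (lc b)) :: complex)"
        using of_real_sqrt_mult_self[of "lc b"] lcp[of b] by (simp add: field_simps)
      have "(\<Sum>q\<in>?S. cnj (symbol_matrix kc lc c q (b, j)) * ?x u q)
         = (\<Sum>a\<in>F. \<Sum>i<N. if a \<le> b then of_real (kc a) * u a i * cnj (c (b - a) i j) / of_real (sqrt (lc b)) else 0)"
        unfolding sum.cartesian_product
      proof (intro sum.cong refl)
        fix p assume "p \<in> ?S"
        have "of_real (sqrt (kc (fst p))) * of_real (sqrt (kc (fst p))) = (of_real (kc (fst p)) :: complex)"
          using kcp[of "fst p"] by (intro of_real_sqrt_mult_self) simp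
        then show "cnj (symbol_matrix kc lc c p (b, j)) * ?x u p = (case p of (a, i) \<Rightarrow>
            if a \<le> b then of_real (kc a) * u a i * cnj (c (b - a) i j) / of_real (sqrt (lc b)) else 0)"
          by (auto simp: symbol_matrix_def real_sqrt_divide case_prod_beta mult_ac)
      qed
      also have "\<dots> = (\<Sum>a | a \<le> b. \<Sum>i<N. of_real (kc a) * u a i * cnj (c (b - a) i j) / of_real (sqrt (lc b)))"
        by (rule sum.mono_neutral_cong_right) (use F b in \<open>auto simp: co_invariant_def\<close>)
      also have "\<dots> = of_real (sqrt (lc b)) * mult_coef c N u b j"
        unfolding mult_coef_def times_divide_eq_right times_divide_eq_left[symmetric] ll
        by (simp add: sum_divide_distrib[symmetric])
      finally show ?thesis .
    qed
    have "(\<Sum>p\<in>?S. (cmod (\<Sum>q\<in>?S. cnj (symbol_matrix kc lc c q p) * ?x u q))\<^sup>2)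
        = (\<Sum>p\<in>?S. lc (fst p) * (cmod (mult_coef c N u (fst p) (snd p)))\<^sup>2)"
    proof (intro sum.cong refl)
      fix p assume "p \<in> ?S"
      then have "(\<Sum>q\<in>?S. cnj (symbol_matrix kc lc c q p) * ?x u q)
          = of_real (sqrt (lc (fst p))) * mult_coef c N u (fst p) (snd p)"
        using e[of "fst p" "snd p"] by auto
      then show "(cmod (\<Sum>q\<in>?S. cnj (symbol_matrix kc lc c q p) * ?x u q))\<^sup>2
          = lc (fst p) * (cmod (mult_coef c N u (fst p) (snd p)))\<^sup>2"
        using lcp[of "fst p"] by (simp only: norm_mult power_mult_distrib) simp
    qed
    also have "\<dots> = (\<Sum>b\<in>F. lc b * vnorm2 N (mult_coef c N u b))"
      by (simp add: vnorm2_def sum_distrib_left sum.cartesian_product case_prod_beta)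
    finally show ?thesis .
  qed
  show ?thesis
  proof
    assume L: ?L
    show ?R
    proof
      fix y
      from L[unfolded contraction_on_def, rule_format, of "?x y"]
      show "?P y" by (simp only: 1 2)
    qed
  next
    assume R: ?R
    show ?L unfolding contraction_on_def
    proof
      fix x :: "(nat^'d) \<times> nat \<Rightarrow> complex"
      define y where "y b j = x (b, j) / of_real (sqrt (kc b))" for b j
      have xq: "of_real (sqrt (kc (fst q))) * y (fst q) (snd q) = x q" for q
        using kcp[of "fst q"] by (simp add: y_def)
      show "(\<Sum>p\<in>?S. (cmod (\<Sum>q\<in>?S. cnj (symbol_matrix kc lc c q p) * x q))\<^sup>2) \<le> (\<Sum>q\<in>?S. (cmod (x q))\<^sup>2)"
        using R[rule_format, of y] unfolding 1[symmetric] 2[symmetric] xq .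
    qed
  qed
qed

definition contractive_symbol :: "nat \<Rightarrow> (nat^'d \<Rightarrow> nat \<Rightarrow> nat \<Rightarrow> complex) \<Rightarrow> bool" where
  "contractive_symbol N c \<longleftrightarrow>
     (\<forall>F. finite F \<longrightarrow> co_invariant F \<longrightarrow> contraction_on (F \<times> {..<N}) (symbol_matrix kc lc c))"

lemma contractive_symbol_iff_dual:
  "contractive_symbol N c \<longleftrightarrow> (\<forall>F u. finite F \<longrightarrow> co_invariant F \<longrightarrow>
     (\<Sum>b\<in>F. lc b * vnorm2 N (mult_coef c N u b)) \<le> (\<Sum>a\<in>F. kc a * vnorm2 N (u a)))"
proof -
  have "contraction_on S A \<longleftrightarrow> contraction_on S (\<lambda>p q. cnj (A q p))" for S and A :: "(nat^'d) \<times> nat \<Rightarrow> (nat^'d) \<times> nat \<Rightarrow> complex"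
    using contraction_on_adjoint[of S A] contraction_on_adjoint[of S "\<lambda>p q. cnj (A q p)"] by auto
  then show ?thesis unfolding contractive_symbol_def using adjoint_symbol_contraction_iff[of _ N c] by blast
qed

lemma contractive_symbol_primal:
  assumes "contractive_symbol N c" "finite F" "co_invariant F"
  shows "(\<Sum>a\<in>F. kc a * vnorm2 N (\<lambda>i. \<Sum>b\<in>F. \<Sum>j<N. if a \<le> b then c (b - a) i j * y b j else 0))
        \<le> (\<Sum>b\<in>F. lc b * vnorm2 N (y b))"
  using assms symbol_contraction_iff[OF assms(2), of N c] unfolding contractive_symbol_def by blast

text \<open>The contraction inequality for the unit vector at \<open>(b, j)\<close>.\<close>

lemma contractive_symbol_column:
  assumes c: "contractive_symbol N c" and j: "j < N"
  shows "(\<Sum>a | a \<le> b. kc a * (\<Sum>i<N. (cmod (c (b - a) i j))\<^sup>2)) \<le> lc b"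
proof -
  let ?F = "{a. a \<le> b}" and ?y = "\<lambda>b' j'. if b' = b \<and> j' = j then 1 else 0 :: complex"
  have "(\<Sum>b'\<in>?F. \<Sum>j'<N. if a \<le> b' then c (b' - a) i j' * ?y b' j' else 0) = c (b - a) i j" if "a \<le> b" for a i
  proof -
    have "(\<Sum>b'\<in>?F. \<Sum>j'<N. if a \<le> b' then c (b' - a) i j' * ?y b' j' else 0)
        = (\<Sum>b'\<in>?F. if b' = b then (\<Sum>j'<N. if j' = j then c (b - a) i j else 0) else 0)"
    proof (intro sum.cong refl)
      fix b'
      show "(\<Sum>j'<N. if a \<le> b' then c (b' - a) i j' * ?y b' j' else 0)
          = (if b' = b then (\<Sum>j'<N. if j' = j then c (b - a) i j else 0) else 0)"
      proof (cases "b' = b")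
        case True
        have "(if a \<le> b then c (b - a) i j' * ?y b j' else 0) = (if j' = j then c (b - a) i j else 0)" for j'
          using that by simp
        then show ?thesis by (simp only: True) simp
      qed simp
    qed
    also have "\<dots> = c (b - a) i j" using j by (simp add: sum.delta)
    finally show ?thesis .
  qed
  then have "(\<Sum>a\<in>?F. kc a * vnorm2 N (\<lambda>i. \<Sum>b'\<in>?F. \<Sum>j'<N. if a \<le> b' then c (b' - a) i j' * ?y b' j' else 0))
     = (\<Sum>a | a \<le> b. kc a * (\<Sum>i<N. (cmod (c (b - a) i j))\<^sup>2))"
    by (intro sum.cong) (auto simp: vnorm2_def)
  moreover have "(\<Sum>b'\<in>?F. lc b' * vnorm2 N (?y b')) = lc b"
  proof -
    have "(\<Sum>b'\<in>?F. lc b' * vnorm2 N (?y b')) = (\<Sum>b'\<in>?F. if b' = b then lc b else 0)"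
    proof (intro sum.cong refl)
      fix b'
      have "(\<Sum>j'<N. (cmod (?y b j'))\<^sup>2) = (\<Sum>j'<N. if j' = j then 1 else 0)" by (intro sum.cong) auto
      then show "lc b' * vnorm2 N (?y b') = (if b' = b then lc b else 0)"
        using j by (auto simp: vnorm2_def sum.delta)
    qed
    then show ?thesis by (simp add: sum.delta)
  qed
  ultimately show ?thesis using contractive_symbol_primal[OF c finite_multi_le[of b] co_invariant_le[of b], where y = ?y] by (simp only:)
qed

end

locale diagonal_pair = K: diagonal_kernel X k kc r1 + L: diagonal_kernel X l lc r2
  for X :: "(complex^'d) set" and k l kc lc r1 r2
begin

sublocale weights kc lc
  by unfold_locales (rule K.fc_pos, rule L.fc_pos)

text \<open>The entries are transposed and conjugated, in accordance with \<open>\<Phi>(z) = \<Sum> z\<^sup>a c\<^sub>a\<^sup>*\<close>.\<close>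

definition symbol_series :: "nat \<Rightarrow> (nat^'d \<Rightarrow> nat \<Rightarrow> nat \<Rightarrow> complex) \<Rightarrow> (complex^'d \<Rightarrow> complex mat) \<Rightarrow> bool" where
  "symbol_series N c \<Phi> \<longleftrightarrow> (\<forall>z\<in>X. \<Phi> z \<in> carrier_mat N N \<and>
     (\<forall>p<N. \<forall>q<N. ((\<lambda>a. monomial z a * cnj (c a q p)) has_sum \<Phi> z $$ (p, q)) UNIV))"

lemma is_power_series_iff:
  assumes "\<And>a. c a \<in> carrier_mat N N" "\<And>z. z \<in> X \<Longrightarrow> \<Phi> z \<in> carrier_mat N N"
  shows "is_power_series X N c \<Phi> \<longleftrightarrow> symbol_series N (\<lambda>a i j. c a $$ (i, j)) \<Phi>"
proof -
  have "(monomial z a \<cdot>\<^sub>m mat_adjoint (c a)) $$ (i, j) = monomial z a * cnj (c a $$ (j, i))" if "i < N" "j < N" for z a i j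
    using assms(1)[of a] that by (simp add: mat_adjoint_def mat_of_rows_def)
  then show ?thesis unfolding is_power_series_def symbol_series_def using assms(2) by auto
qed

definition vec_ser :: "nat \<Rightarrow> (nat^'d \<Rightarrow> nat \<Rightarrow> complex) \<Rightarrow> complex^'d \<Rightarrow> complex Matrix.vec" where
  "vec_ser N u = (\<lambda>z. Matrix.vec N (\<lambda>i. K.ser (\<lambda>a. u a i) z))"

lemma vec_ser_mem: "(\<And>i. i < N \<Longrightarrow> K.ell2 (\<lambda>a. u a i)) \<Longrightarrow> vec_ser N u \<in> rkhs_tensor X k N"
  unfolding rkhs_tensor_def vec_ser_def using K.mem_rkhs_carrier_iff by auto

lemma vec_ser_norm:
  assumes "\<And>i. i < N \<Longrightarrow> K.ell2 (\<lambda>a. u a i)"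
  shows "tensor_norm X k N (vec_ser N u) = sqrt (\<Sum>i<N. K.ell2_sq (\<lambda>a. u a i))"
  unfolding tensor_norm_def vec_ser_def using assms by (simp add: K.rkhs_norm_ser)

lemma tensor_cases:
  assumes "f \<in> rkhs_tensor X k N"
  obtains u where "\<And>i. i < N \<Longrightarrow> K.ell2 (\<lambda>a. u a i)" "f = vec_ser N u"
proof -
  have f: "\<And>x. f x \<in> carrier_vec N" "\<And>i. i < N \<Longrightarrow> \<exists>u. K.ell2 u \<and> (\<lambda>x. vec_index (f x) i) = K.ser u"
    using assms unfolding rkhs_tensor_def by (auto simp: K.mem_rkhs_carrier_iff)
  define w where "w i = (SOME u. K.ell2 u \<and> (\<lambda>x. vec_index (f x) i) = K.ser u)" for i
  have w: "K.ell2 (w i)" "(\<lambda>x. vec_index (f x) i) = K.ser (w i)" if "i < N" for i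
    using someI_ex[OF f(2)[OF that]] unfolding w_def by auto
  have "f = vec_ser N (\<lambda>a i. w i a)"
  proof
    fix x
    show "f x = vec_ser N (\<lambda>a i. w i a) x"
      by (rule eq_vecI) (use f(1)[of x] w(2)[THEN fun_cong, of _ x] in \<open>auto simp: vec_ser_def\<close>)
  qed
  then show ?thesis using that[of "\<lambda>a i. w i a"] w(1) by blast
qed

lemma tensor_l_component:
  assumes "f \<in> rkhs_tensor X l N" "j < N"
  shows "\<exists>w. L.ell2 w \<and> (\<lambda>x. vec_index (f x) j) = L.ser w"
  using assms unfolding rkhs_tensor_def by (auto simp: L.mem_rkhs_carrier_iff)

lemma product_series:
  assumes \<Phi>: "symbol_series N c \<Phi>" and u: "\<And>i. i < N \<Longrightarrow> K.ell2 (\<lambda>a. u a i)" and z: "z \<in> X" and j: "j < N"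
  shows "((\<lambda>b. of_real (lc b) * mult_coef c N u b j * monomial z b) has_sum vec_index (mult_op X N \<Phi> (vec_ser N u) z) j) UNIV"
proof -
  have \<Phi>z: "\<Phi> z \<in> carrier_mat N N" using \<Phi> z unfolding symbol_series_def by blast
  have e: "vec_index (mult_op X N \<Phi> (vec_ser N u) z) j = (\<Sum>i<N. K.ser (\<lambda>a. u a i) z * \<Phi> z $$ (j, i))"
    using \<Phi>z j z by (simp add: mult_op_def vec_ser_def scalar_prod_def mult.commute lessThan_atLeast0)
  have "((\<lambda>b. \<Sum>i<N. \<Sum>a | a \<le> b. (of_real (kc a) * u a i * monomial z a) * (monomial z (b - a) * cnj (c (b - a) i j)))
      has_sum (\<Sum>i<N. K.ser (\<lambda>a. u a i) z * \<Phi> z $$ (j, i))) UNIV"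
  proof (intro has_sum_finite_sum has_sum_convolution)
    fix i assume "i \<in> {..<N}"
    then show "((\<lambda>a. of_real (kc a) * u a i * monomial z a) has_sum K.ser (\<lambda>a. u a i) z) UNIV"
      and "((\<lambda>a. monomial z a * cnj (c a i j)) has_sum \<Phi> z $$ (j, i)) UNIV"
      using K.ser_has_sum[OF u z] \<Phi> z j unfolding symbol_series_def by auto
  qed
  moreover have "(\<Sum>i<N. \<Sum>a | a \<le> b. (of_real (kc a) * u a i * monomial z a) * (monomial z (b - a) * cnj (c (b - a) i j)))
      = of_real (lc b) * mult_coef c N u b j * monomial z b" for b
  proof -
    have "lc b \<noteq> 0" using lcp[of b] by simp
    then have "of_real (lc b) * mult_coef c N u b j * monomial z b
      = (\<Sum>a | a \<le> b. \<Sum>i<N. of_real (kc a) * u a i * cnj (c (b - a) i j) * monomial z b)"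
      by (simp add: mult_coef_def sum_distrib_right)
    also have "\<dots> = (\<Sum>a | a \<le> b. \<Sum>i<N. (of_real (kc a) * u a i * monomial z a) * (monomial z (b - a) * cnj (c (b - a) i j)))"
    proof (intro sum.cong refl)
      fix a i assume "a \<in> {a. a \<le> b}"
      then have "monomial z b = monomial z a * monomial z (b - a)"
        using monomial_add[of z a "b - a"] by simp
      then show "of_real (kc a) * u a i * cnj (c (b - a) i j) * monomial z b
        = (of_real (kc a) * u a i * monomial z a) * (monomial z (b - a) * cnj (c (b - a) i j))" by simp
    qed
    finally show ?thesis by (subst sum.swap) simp
  qed
  ultimately show ?thesis unfolding e by simp
qed

lemma down_closure:
  assumes "finite (F :: (nat^'d) set)" "F \<noteq> {}"
  shows "finite {a. \<exists>b\<in>F. a \<le> b}" "co_invariant {a. \<exists>b\<in>F. a \<le> b}" "F \<subseteq> {a. \<exists>b\<in>F. a \<le> b}"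
proof -
  have "{a. \<exists>b\<in>F. a \<le> b} = (\<Union>b\<in>F. {a. a \<le> b})" by auto
  then show "finite {a. \<exists>b\<in>F. a \<le> b}" using assms by simp
  show "F \<subseteq> {a. \<exists>b\<in>F. a \<le> b}" by auto
  then show "co_invariant {a. \<exists>b\<in>F. a \<le> b}" using assms unfolding co_invariant_def by (auto intro: order_trans)
qed

text \<open>The inequalities for finite co-invariant sets of indices bound all finite partial sums, since every
finite set has a finite downward closure.\<close>

lemma contractive_symbol_image:
  assumes c: "contractive_symbol N c" and u: "\<And>i. i < N \<Longrightarrow> K.ell2 (\<lambda>a. u a i)"
  shows "\<And>j. j < N \<Longrightarrow> L.ell2 (\<lambda>b. mult_coef c N u b j)"
    "(\<Sum>j<N. L.ell2_sq (\<lambda>b. mult_coef c N u b j)) \<le> (\<Sum>i<N. K.ell2_sq (\<lambda>a. u a i))"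
proof -
  let ?B = "\<Sum>i<N. K.ell2_sq (\<lambda>a. u a i)"
  have su: "((\<lambda>a. kc a * vnorm2 N (u a)) has_sum ?B) UNIV"
  proof -
    have "((\<lambda>a. \<Sum>i<N. kc a * (cmod (u a i))\<^sup>2) has_sum ?B) UNIV"
      using u unfolding K.ell2_sq_def K.ell2_def by (intro has_sum_finite_sum has_sum_infsum) auto
    then show ?thesis by (simp add: vnorm2_def sum_distrib_left)
  qed
  have fin: "(\<Sum>b\<in>F. lc b * vnorm2 N (mult_coef c N u b)) \<le> ?B" if F: "finite F" for F
  proof (cases "F = {}")
    case True
    then show ?thesis using has_sum_nonneg[OF su] kcp by (simp add: less_imp_le)
  next
    case False
    note D = down_closure[OF F False]
    let ?D = "{a. \<exists>b\<in>F. a \<le> b}"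
    have "(\<Sum>b\<in>F. lc b * vnorm2 N (mult_coef c N u b)) \<le> (\<Sum>b\<in>?D. lc b * vnorm2 N (mult_coef c N u b))"
      using D lcp by (intro sum_mono2) (auto simp: less_imp_le)
    also have "\<dots> \<le> (\<Sum>a\<in>?D. kc a * vnorm2 N (u a))"
      using c D(1,2) unfolding contractive_symbol_iff_dual by blast
    also have "\<dots> \<le> ?B" by (rule finite_sum_le_has_sum[OF su]) (use D kcp in \<open>auto simp: less_imp_le\<close>)
    finally show ?thesis .
  qed
  have s: "(\<lambda>b. lc b * vnorm2 N (mult_coef c N u b)) summable_on UNIV"
    by (rule nonneg_bounded_partial_sums_imp_summable_on[where C = ?B])
      (use fin lcp in \<open>auto intro: eventually_finite_subsets_at_top_weakI simp: less_imp_le\<close>)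
  show e: "L.ell2 (\<lambda>b. mult_coef c N u b j)" if "j < N" for j
    unfolding L.ell2_def
    by (rule summable_on_comparison_test[OF s])
      (use lcp vnorm2_component[OF that] in \<open>auto simp: less_imp_le intro!: mult_left_mono\<close>)
  have "((\<lambda>b. \<Sum>j<N. lc b * (cmod (mult_coef c N u b j))\<^sup>2) has_sum (\<Sum>j<N. L.ell2_sq (\<lambda>b. mult_coef c N u b j))) UNIV"
    using e unfolding L.ell2_sq_def L.ell2_def by (intro has_sum_finite_sum has_sum_infsum) auto
  then have "((\<lambda>b. lc b * vnorm2 N (mult_coef c N u b)) has_sum (\<Sum>j<N. L.ell2_sq (\<lambda>b. mult_coef c N u b j))) UNIV"
    by (simp add: vnorm2_def sum_distrib_left)
  then show "(\<Sum>j<N. L.ell2_sq (\<lambda>b. mult_coef c N u b j)) \<le> ?B"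
    by (rule has_sum_le_finite_sums) (use fin in auto)
qed

lemma mult_op_vec_ser:
  assumes \<Phi>: "symbol_series N c \<Phi>" and u: "\<And>i. i < N \<Longrightarrow> K.ell2 (\<lambda>a. u a i)"
    and w: "\<And>j. j < N \<Longrightarrow> L.ell2 (\<lambda>b. mult_coef c N u b j)"
  shows "j < N \<Longrightarrow> (\<lambda>x. vec_index (mult_op X N \<Phi> (vec_ser N u) x) j) = L.ser (\<lambda>b. mult_coef c N u b j)"
proof
  fix x assume j: "j < N"
  show "vec_index (mult_op X N \<Phi> (vec_ser N u) x) j = L.ser (\<lambda>b. mult_coef c N u b j) x"
  proof (cases "x \<in> X")
    case True
    show ?thesis using has_sum_unique[OF product_series[OF \<Phi> u True j] L.ser_has_sum[OF w[OF j] True]] by simp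
  next
    case False
    then show ?thesis using j by (simp add: mult_op_def L.ser_def)
  qed
qed

theorem contractive_symbol_imp_multiplier:
  assumes c: "contractive_symbol N c" and \<Phi>: "symbol_series N c \<Phi>"
  shows "contractive_multiplier X k l N \<Phi>"
proof -
  have car: "\<Phi> x \<in> carrier_mat N N" if "x \<in> X" for x using \<Phi> that unfolding symbol_series_def by blast
  have main: "mult_op X N \<Phi> f \<in> rkhs_tensor X l N \<and> tensor_norm X l N (mult_op X N \<Phi> f) \<le> tensor_norm X k N f"
    if f: "f \<in> rkhs_tensor X k N" for f
  proof -
    obtain u where u: "\<And>i. i < N \<Longrightarrow> K.ell2 (\<lambda>a. u a i)" and fu: "f = vec_ser N u" using tensor_cases[OF f] by blast
    have w: "L.ell2 (\<lambda>b. mult_coef c N u b j)" if "j < N" for j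
      by (rule contractive_symbol_image(1)[OF c u that])
    have le: "(\<Sum>j<N. L.ell2_sq (\<lambda>b. mult_coef c N u b j)) \<le> (\<Sum>i<N. K.ell2_sq (\<lambda>a. u a i))"
      by (rule contractive_symbol_image(2)[OF c u])
    have comp: "(\<lambda>x. vec_index (mult_op X N \<Phi> (vec_ser N u) x) j) = L.ser (\<lambda>b. mult_coef c N u b j)" if "j < N" for j
      by (rule mult_op_vec_ser[OF \<Phi> u w that])
    have "mult_op X N \<Phi> f x \<in> carrier_vec N" for x
      using mult_mat_vec_carrier[OF car, of x "f x"] f unfolding mult_op_def rkhs_tensor_def by auto
    moreover have "(\<lambda>x. vec_index (mult_op X N \<Phi> f x) j) \<in> rkhs_carrier X l" if "j < N" for j
      unfolding fu L.mem_rkhs_carrier_iff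
      by (rule exI[of _ "\<lambda>b. mult_coef c N u b j"]) (intro conjI w[OF that] comp[OF that])
    ultimately have "mult_op X N \<Phi> f \<in> rkhs_tensor X l N" unfolding rkhs_tensor_def by blast
    moreover have "tensor_norm X l N (mult_op X N \<Phi> f) = sqrt (\<Sum>j<N. L.ell2_sq (\<lambda>b. mult_coef c N u b j))"
      unfolding tensor_norm_def fu
    proof (intro arg_cong[where f = sqrt] sum.cong refl)
      fix j assume "j \<in> {..<N}"
      then have j: "j < N" by simp
      show "Re (rkhs_inner X l (\<lambda>x. vec_index (mult_op X N \<Phi> (vec_ser N u) x) j)
          (\<lambda>x. vec_index (mult_op X N \<Phi> (vec_ser N u) x) j)) = L.ell2_sq (\<lambda>b. mult_coef c N u b j)"
        unfolding comp[OF j] by (rule L.rkhs_norm_ser[OF w[OF j]])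
    qed
    moreover have "tensor_norm X k N f = sqrt (\<Sum>i<N. K.ell2_sq (\<lambda>a. u a i))"
      unfolding fu by (rule vec_ser_norm[OF u])
    ultimately show ?thesis using le by simp
  qed
  show ?thesis
    unfolding contractive_multiplier_def multiplier_def multiplier_norm_def
  proof (intro conjI ballI SUP_least)
    fix f assume "f \<in> {f \<in> rkhs_tensor X k N. tensor_norm X k N f \<le> 1}"
    then have f: "f \<in> rkhs_tensor X k N" and le: "tensor_norm X k N f \<le> 1" by auto
    have "tensor_norm X l N (mult_op X N \<Phi> f) \<le> 1" using conjunct2[OF main[OF f]] le by linarith
    then show "ereal (tensor_norm X l N (mult_op X N \<Phi> f)) \<le> 1" by simp
  next
    fix x assume "x \<in> X" then show "\<Phi> x \<in> carrier_mat N N" by (rule car)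
  next
    fix f assume "f \<in> rkhs_tensor X k N"
    then show "mult_op X N \<Phi> f \<in> rkhs_tensor X l N" using main by blast
  qed
qed

lemma ell2_sq_scale: "K.ell2_sq (\<lambda>a. c * u a) = (cmod c)\<^sup>2 * K.ell2_sq u" "L.ell2_sq (\<lambda>a. c * u a) = (cmod c)\<^sup>2 * L.ell2_sq u"
  unfolding K.ell2_sq_def L.ell2_sq_def infsum_cmult_right'[symmetric]
  by (simp_all add: norm_mult power_mult_distrib mult_ac)

lemma ser_scale: "K.ser (\<lambda>a. c * u a) z = c * K.ser u z" "L.ser (\<lambda>a. c * u a) z = c * L.ser u z"
  unfolding K.ser_def L.ser_def by (simp_all add: infsum_cmult_right'[symmetric] mult_ac)

text \<open>The norm of a multiplier is a supremum over the unit ball, so \<open>u\<close> is scaled into it.  Dividing by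
\<open>sqrt (\<parallel>u\<parallel>\<^sup>2 + e)\<close> also covers \<open>u = 0\<close>.\<close>

lemma contractive_multiplierD:
  assumes \<Phi>: "contractive_multiplier X k l N \<Phi>" and u: "\<And>i. i < N \<Longrightarrow> K.ell2 (\<lambda>a. u a i)"
  shows "\<exists>w. (\<forall>j<N. L.ell2 (w j) \<and> (\<lambda>x. vec_index (mult_op X N \<Phi> (vec_ser N u) x) j) = L.ser (w j)) \<and>
    (\<Sum>j<N. L.ell2_sq (w j)) \<le> (\<Sum>i<N. K.ell2_sq (\<lambda>a. u a i))"
proof -
  have car: "\<Phi> x \<in> carrier_mat N N" if "x \<in> X" for x
    using \<Phi> that unfolding contractive_multiplier_def multiplier_def by blast
  have mem: "mult_op X N \<Phi> f \<in> rkhs_tensor X l N" if "f \<in> rkhs_tensor X k N" for f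
    using \<Phi> that unfolding contractive_multiplier_def multiplier_def by blast
  have "\<exists>w. L.ell2 w \<and> (\<lambda>x. vec_index (mult_op X N \<Phi> (vec_ser N u) x) j) = L.ser w" if "j < N" for j
    by (rule tensor_l_component[OF mem[OF vec_ser_mem[OF u]] that])
  then have "\<forall>j. \<exists>w. j < N \<longrightarrow> L.ell2 w \<and> (\<lambda>x. vec_index (mult_op X N \<Phi> (vec_ser N u) x) j) = L.ser w" by blast
  from choice[OF this] obtain w where
    w: "\<And>j. j < N \<Longrightarrow> L.ell2 (w j)" "\<And>j. j < N \<Longrightarrow> (\<lambda>x. vec_index (mult_op X N \<Phi> (vec_ser N u) x) j) = L.ser (w j)"
    by blast
  let ?n = "\<Sum>i<N. K.ell2_sq (\<lambda>a. u a i)" and ?W = "\<Sum>j<N. L.ell2_sq (w j)"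
  have n0: "0 \<le> ?n" unfolding K.ell2_sq_def using kcp by (intro sum_nonneg infsum_nonneg) (auto simp: less_imp_le)
  have "?W \<le> ?n + e" if e: "0 < e" for e
  proof -
    define s where "s = sqrt (?n + e)"
    have s: "0 < s" "s\<^sup>2 = ?n + e" using n0 e by (simp_all add: s_def)
    define c0 where "c0 = complex_of_real (1 / s)"
    let ?c = "c0"
    let ?u = "\<lambda>a i. ?c * u a i"
    have cs: "(cmod ?c)\<^sup>2 = 1 / s\<^sup>2" using s(1) unfolding c0_def norm_of_real by (simp add: power_divide)
    have u': "K.ell2 (\<lambda>a. ?u a i)" if "i < N" for i by (rule K.ell2_scale[OF u[OF that]])
    have "tensor_norm X k N (vec_ser N ?u) = sqrt (\<Sum>i<N. K.ell2_sq (\<lambda>a. ?u a i))"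
      by (rule vec_ser_norm[OF u'])
    also have "(\<Sum>i<N. K.ell2_sq (\<lambda>a. ?u a i)) = ?n / s\<^sup>2"
      unfolding ell2_sq_scale cs by (simp add: sum_divide_distrib)
    finally have n1: "tensor_norm X k N (vec_ser N ?u) = sqrt (?n / s\<^sup>2)" .
    have le1: "tensor_norm X k N (vec_ser N ?u) \<le> 1"
      unfolding n1 using s e n0 by (simp add: s(2))
    have "ereal (tensor_norm X l N (mult_op X N \<Phi> (vec_ser N ?u))) \<le> multiplier_norm X k l N \<Phi>"
      unfolding multiplier_norm_def by (rule SUP_upper) (use le1 vec_ser_mem[where u = ?u, OF u'] in auto)
    also have "\<dots> \<le> 1" using \<Phi> unfolding contractive_multiplier_def by blast
    finally have le2: "tensor_norm X l N (mult_op X N \<Phi> (vec_ser N ?u)) \<le> 1" by simp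
    have comp: "(\<lambda>x. vec_index (mult_op X N \<Phi> (vec_ser N ?u) x) j) = L.ser (\<lambda>b. ?c * w j b)" if j: "j < N" for j
    proof
      fix x
      have "vec_index (mult_op X N \<Phi> (vec_ser N ?u) x) j = ?c * vec_index (mult_op X N \<Phi> (vec_ser N u) x) j"
      proof (cases "x \<in> X")
        case True
        then show ?thesis using car[OF True] j
          by (simp add: mult_op_def vec_ser_def scalar_prod_def ser_scale sum_distrib_left mult_ac)
      qed (use j in \<open>simp add: mult_op_def\<close>)
      then show "vec_index (mult_op X N \<Phi> (vec_ser N ?u) x) j = L.ser (\<lambda>b. ?c * w j b) x"
        using fun_cong[OF w(2)[OF j], of x] unfolding ser_scale by simp
    qed
    have "tensor_norm X l N (mult_op X N \<Phi> (vec_ser N ?u)) = sqrt (\<Sum>j<N. L.ell2_sq (\<lambda>b. ?c * w j b))"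
      unfolding tensor_norm_def using comp L.rkhs_norm_ser[OF L.ell2_scale[OF w(1)]]
      by (intro arg_cong[where f = sqrt] sum.cong) auto
    also have "(\<Sum>j<N. L.ell2_sq (\<lambda>b. ?c * w j b)) = ?W / s\<^sup>2"
      unfolding ell2_sq_scale cs by (simp add: sum_divide_distrib)
    finally have W1: "?W / s\<^sup>2 \<le> 1" using le2 by simp
    have "0 < s\<^sup>2" using s(1) by simp
    with W1 have "?W \<le> 1 * s\<^sup>2" by (simp only: pos_divide_le_eq)
    then show ?thesis unfolding s(2) by simp
  qed
  then have "?W \<le> ?n" by (rule field_le_epsilon)
  then show ?thesis using w by blast
qed

text \<open>Comparing coefficients in the product of \<open>\<Phi>\<close> with a finitely supported series shows that the
contractivity of \<open>\<Phi>\<close> bounds the adjoint of each finite section of the symbol matrix.\<close>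

theorem contractive_multiplier_imp_symbol:
  assumes \<Phi>: "contractive_multiplier X k l N \<Phi>" and c: "symbol_series N c \<Phi>"
  shows "contractive_symbol N c"
  unfolding contractive_symbol_iff_dual
proof (intro allI impI)
  fix F :: "(nat^'d) set" and u :: "nat^'d \<Rightarrow> nat \<Rightarrow> complex" assume F: "finite F" "co_invariant F"
  define u' where "u' a i = (if a \<in> F then u a i else 0)" for a i
  have fin: "((\<lambda>a. kc a * (cmod (u' a i))\<^sup>2) has_sum (\<Sum>a\<in>F. kc a * (cmod (u a i))\<^sup>2)) UNIV" for i
    by (rule has_sum_finite_neutralI[OF F(1)]) (auto simp: u'_def)
  then have u': "K.ell2 (\<lambda>a. u' a i)" "K.ell2_sq (\<lambda>a. u' a i) = (\<Sum>a\<in>F. kc a * (cmod (u a i))\<^sup>2)" for i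
    unfolding K.ell2_def K.ell2_sq_def by (auto intro: has_sum_imp_summable infsumI)
  from contractive_multiplierD[where u = u', OF \<Phi> u'(1)]
  obtain w where w': "\<forall>j<N. L.ell2 (w j) \<and> (\<lambda>x. vec_index (mult_op X N \<Phi> (vec_ser N u') x) j) = L.ser (w j)"
    and le: "(\<Sum>j<N. L.ell2_sq (w j)) \<le> (\<Sum>i<N. K.ell2_sq (\<lambda>a. u' a i))"
    by (elim exE conjE) (rule that)
  have w: "L.ell2 (w j)" "(\<lambda>x. vec_index (mult_op X N \<Phi> (vec_ser N u') x) j) = L.ser (w j)" if "j < N" for j
    using w' that by simp_all
  have wm: "w j b = mult_coef c N u b j" if j: "j < N" and b: "b \<in> F" for j b
  proof -
    have "of_real (lc b) * w j b = of_real (lc b) * mult_coef c N u' b j"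
    proof (rule L.series_coefficients_unique[where d = "\<lambda>b. of_real (lc b) * w j b" and d' = "\<lambda>b. of_real (lc b) * mult_coef c N u' b j"])
      fix z assume z: "z \<in> X"
      show "((\<lambda>b. of_real (lc b) * w j b * monomial z b) has_sum L.ser (w j) z) UNIV"
        by (rule L.ser_has_sum[OF w(1)[OF j] z])
      show "((\<lambda>b. of_real (lc b) * mult_coef c N u' b j * monomial z b) has_sum L.ser (w j) z) UNIV"
        using product_series[where u = u', OF c u'(1) z j] fun_cong[OF w(2)[OF j], of z] by simp
    qed
    then have "w j b = mult_coef c N u' b j" using lcp[of b] by simp
    also have "\<dots> = mult_coef c N u b j"
      unfolding mult_coef_def using F(2) b by (intro arg_cong2[where f = "(/)"] sum.cong refl) (auto simp: u'_def co_invariant_def)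
    finally show ?thesis .
  qed
  have "(\<Sum>b\<in>F. lc b * vnorm2 N (mult_coef c N u b)) = (\<Sum>j<N. \<Sum>b\<in>F. lc b * (cmod (mult_coef c N u b j))\<^sup>2)"
    unfolding vnorm2_def sum_distrib_left by (rule sum.swap)
  also have "\<dots> \<le> (\<Sum>j<N. L.ell2_sq (w j))"
  proof (rule sum_mono)
    fix j assume "j \<in> {..<N}"
    then have j: "j < N" by simp
    have "(\<Sum>b\<in>F. lc b * (cmod (mult_coef c N u b j))\<^sup>2) = (\<Sum>b\<in>F. lc b * (cmod (w j b))\<^sup>2)"
      using wm[OF j] by simp
    also have "\<dots> \<le> L.ell2_sq (w j)"
      unfolding L.ell2_sq_def by (rule finite_sum_le_infsum) (use w(1)[OF j] F lcp in \<open>auto simp: L.ell2_def less_imp_le\<close>)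
    finally show "(\<Sum>b\<in>F. lc b * (cmod (mult_coef c N u b j))\<^sup>2) \<le> L.ell2_sq (w j)" .
  qed
  also note le
  also have "(\<Sum>i<N. K.ell2_sq (\<lambda>a. u' a i)) = (\<Sum>a\<in>F. kc a * vnorm2 N (u a))"
    unfolding u'(2) vnorm2_def sum_distrib_left by (rule sum.swap)
  finally show "(\<Sum>b\<in>F. lc b * vnorm2 N (mult_coef c N u b)) \<le> (\<Sum>a\<in>F. kc a * vnorm2 N (u a))" .
qed

text \<open>The coefficients of the constant function with value the \<open>q\<close>-th unit vector; it produces the columns of
a multiplier.\<close>

definition const_coef :: "nat \<Rightarrow> nat^'d \<Rightarrow> nat \<Rightarrow> complex" where
  "const_coef q a i = (if a = 0 \<and> i = q then 1 / of_real (kc 0) else 0)"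

lemma const_coef_ell2: "K.ell2 (\<lambda>a. const_coef q a i)"
  unfolding K.ell2_def
  by (rule has_sum_imp_summable[OF has_sum_finite_neutralI[where B = "{0}"]]) (auto simp: const_coef_def)

lemma const_coef_ser: "z \<in> X \<Longrightarrow> K.ser (\<lambda>a. const_coef q a i) z = (if i = q then 1 else 0)"
proof -
  assume z: "z \<in> X"
  have "((\<lambda>a. of_real (kc a) * const_coef q a i * monomial z a) has_sum (if i = q then 1 else 0)) UNIV"
    by (rule has_sum_finite_neutralI[where B = "{0}"]) (use kcp[of 0] in \<open>auto simp: const_coef_def\<close>)
  then show ?thesis using z by (simp add: K.ser_def infsumI)
qed

lemma mult_coef_const:
  assumes "q < N" shows "of_real (lc b) * mult_coef c N (const_coef q) b j = cnj (c b q j)"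
proof -
  have "(\<Sum>a | a \<le> b. \<Sum>i<N. of_real (kc a) * const_coef q a i * cnj (c (b - a) i j))
      = (\<Sum>a | a \<le> b. if a = 0 then cnj (c b q j) else 0)"
  proof (intro sum.cong refl)
    fix a
    have "(\<Sum>i<N. of_real (kc a) * const_coef q a i * cnj (c (b - a) i j)) = (\<Sum>i<N. if i = q then (if a = 0 then cnj (c b q j) else 0) else 0)"
      using kcp[of 0] by (intro sum.cong refl) (auto simp: const_coef_def)
    then show "(\<Sum>i<N. of_real (kc a) * const_coef q a i * cnj (c (b - a) i j)) = (if a = 0 then cnj (c b q j) else 0)"
      using assms by simp
  qed
  then show ?thesis using lcp[of b] by (simp add: mult_coef_def)
qed

theorem contractive_symbol_series_exists:
  assumes c: "contractive_symbol N c" shows "\<exists>\<Phi>. symbol_series N c \<Phi>"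
proof -
  define \<Phi> where "\<Phi> z = Matrix.mat N N (\<lambda>(p, q). L.ser (\<lambda>b. mult_coef c N (const_coef q) b p) z)" for z
  have "((\<lambda>a. monomial z a * cnj (c a q p)) has_sum \<Phi> z $$ (p, q)) UNIV" if z: "z \<in> X" and pq: "p < N" "q < N" for z p q
    using L.ser_has_sum[OF contractive_symbol_image(1)[where u = "const_coef q", OF c const_coef_ell2 pq(1)] z] pq
    unfolding mult_coef_const[OF pq(2)] by (simp add: \<Phi>_def mult.commute)
  then show ?thesis unfolding symbol_series_def by (intro exI[of _ \<Phi>]) (auto simp: \<Phi>_def)
qed

theorem contractive_multiplier_has_symbol:
  assumes \<Phi>: "contractive_multiplier X k l N \<Phi>" shows "\<exists>c. symbol_series N c \<Phi>"
proof -
  have car: "\<Phi> x \<in> carrier_mat N N" if "x \<in> X" for x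
    using \<Phi> that unfolding contractive_multiplier_def multiplier_def by blast
  have "\<exists>w. \<forall>p<N. L.ell2 (w p) \<and> (\<lambda>x. vec_index (mult_op X N \<Phi> (vec_ser N (const_coef q)) x) p) = L.ser (w p)" for q
    using contractive_multiplierD[where u = "const_coef q", OF \<Phi> const_coef_ell2] by blast
  then have "\<forall>q. \<exists>w. \<forall>p<N. L.ell2 (w p) \<and> (\<lambda>x. vec_index (mult_op X N \<Phi> (vec_ser N (const_coef q)) x) p) = L.ser (w p)" by blast
  from choice[OF this] obtain w where w: "\<And>q p. p < N \<Longrightarrow> L.ell2 (w q p) \<and>
     (\<lambda>x. vec_index (mult_op X N \<Phi> (vec_ser N (const_coef q)) x) p) = L.ser (w q p)" by blast
  have "((\<lambda>a. monomial z a * cnj (cnj (of_real (lc a) * w q p a))) has_sum \<Phi> z $$ (p, q)) UNIV"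
    if z: "z \<in> X" and pq: "p < N" "q < N" for z p q
  proof -
    have "L.ser (w q p) z = vec_index (mult_op X N \<Phi> (vec_ser N (const_coef q)) z) p"
      using fun_cong[OF w[OF pq(1), of q, THEN conjunct2], of z] by simp
    also have "\<dots> = (\<Sum>i<N. \<Phi> z $$ (p, i) * (if i = q then 1 else 0))"
      using car[OF z] z pq by (simp add: mult_op_def vec_ser_def scalar_prod_def const_coef_ser lessThan_atLeast0)
    also have "\<dots> = (\<Sum>i<N. if i = q then \<Phi> z $$ (p, i) else 0)" by (intro sum.cong) auto
    also have "\<dots> = \<Phi> z $$ (p, q)" using pq by simp
    finally show ?thesis using L.ser_has_sum[OF w[OF pq(1), of q, THEN conjunct1] z] by (simp add: mult_ac)
  qed
  then show ?thesis unfolding symbol_series_def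
    by (intro exI[of _ "\<lambda>a q p. cnj (of_real (lc a) * w q p a)"]) (use car in auto)
qed

end

section \<open>Consequences of the row condition\<close>

text \<open>Quadratic forms of the kernel matrix of finitely many points are norms of sequences of monomials.\<close>

lemma (in diagonal_kernel) gram_has_sum:
  assumes z: "\<And>i. i < n \<Longrightarrow> z i \<in> X"
  shows "((\<lambda>b. of_real (fc b * vnorm2 N (\<lambda>j. \<Sum>i<n. cnj (monomial (z i) b) * \<eta> i j))) has_sum
    (\<Sum>j<N. \<Sum>i<n. \<Sum>i'<n. cnj (\<eta> i j) * f (z i) (z i') * \<eta> i' j)) UNIV"
proof -
  have "((\<lambda>b. \<Sum>j<N. \<Sum>i<n. \<Sum>i'<n. cnj (\<eta> i j) * (of_real (fc b) * monomial (z i) b * cnj (monomial (z i') b)) * \<eta> i' j) has_sum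
    (\<Sum>j<N. \<Sum>i<n. \<Sum>i'<n. cnj (\<eta> i j) * f (z i) (z i') * \<eta> i' j)) UNIV"
    by (intro has_sum_finite_sum has_sum_cmult_left has_sum_cmult_right expansion z) auto
  moreover have "(\<Sum>j<N. \<Sum>i<n. \<Sum>i'<n. cnj (\<eta> i j) * (of_real (fc b) * monomial (z i) b * cnj (monomial (z i') b)) * \<eta> i' j)
    = of_real (fc b * vnorm2 N (\<lambda>j. \<Sum>i<n. cnj (monomial (z i) b) * \<eta> i j))" for b
  proof -
    have "of_real ((cmod (\<Sum>i<n. cnj (monomial (z i) b) * \<eta> i j))\<^sup>2)
      = (\<Sum>i<n. \<Sum>i'<n. (monomial (z i) b * cnj (\<eta> i j)) * (cnj (monomial (z i') b) * \<eta> i' j))" for j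
      unfolding complex_norm_square cnj_sum sum_product by (subst sum.swap) (simp add: mult_ac)
    then show ?thesis
      by (simp add: vnorm2_def sum_distrib_left mult_ac del: of_real_power)
  qed
  ultimately show ?thesis by simp
qed

context diagonal_pair
begin

lemma row_imp_symbol_extension:
  assumes row: "row_condition kc lc" and G0: "admissible kc lc N G0"
  shows "\<exists>c. contractive_symbol N c \<and>
    (\<forall>u v i. (u, v) \<in> G0 \<longrightarrow> i < N \<longrightarrow> ((\<lambda>b. \<Sum>j<N. c b i j * u b j) has_sum v 0 i) UNIV)"
proof -
  interpret factor_pair kc lc "greedy kc" N
    by unfold_locales (rule kcp, rule lcp, rule row_condition_imp_factor_weights[OF kcp row])
  from admissible_extends_to_symbol[OF G0] obtain c where
    1: "\<forall>F y. finite F \<longrightarrow> (\<Sum>a\<in>F. kc a * vnorm2 N (\<lambda>i. \<Sum>b\<in>F. \<Sum>j<N. if a \<le> b then c (b - a) i j * y b j else 0))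
        \<le> (\<Sum>b\<in>F. lc b * vnorm2 N (y b))" and
    2: "\<forall>u v i. (u, v) \<in> G0 \<longrightarrow> i < N \<longrightarrow> ((\<lambda>b. \<Sum>j<N. c b i j * u b j) has_sum v 0 i) UNIV"
    by (elim exE conjE) (rule that)
  have "contractive_symbol N c"
    unfolding contractive_symbol_def
  proof (intro allI impI)
    fix F :: "(nat^'d) set" assume F: "finite F"
    show "contraction_on (F \<times> {..<N}) (symbol_matrix kc lc c)"
      unfolding symbol_contraction_iff[OF F] using 1 F by blast
  qed
  then show ?thesis using 2 by blast
qed

text \<open>For contractive data on \<open>F\<close> the backward Toeplitz map on the sequences supported in \<open>F\<close> is admissible,
and the values on the unit sequences show that the extended symbol agrees with the data on \<open>F\<close>.  The
converse direction is the restriction of a contractive symbol to \<open>F\<close>.\<close>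

lemma caratheodory_if_row_condition:
  assumes row: "row_condition kc lc" shows "complete_caratheodory_pair X k l kc lc"
  unfolding complete_caratheodory_pair_def
proof (intro allI impI)
  fix J F and c :: "nat^'d \<Rightarrow> complex mat"
  assume J: "1 \<le> J" and F: "finite F" "co_invariant F" and c: "\<forall>a\<in>F. c a \<in> carrier_mat J J"
  note bc = block_contraction_symbol_matrix[where c = c and kc = kc and lc = lc, OF F(2) c[rule_format]]
  show "block_contraction F J (caratheodory_block J kc lc c) \<longleftrightarrow>
         (\<exists>c' \<Phi>. (\<forall>a. c' a \<in> carrier_mat J J) \<and> (\<forall>a\<in>F. c' a = c a) \<and>
            is_power_series X J c' \<Phi> \<and> contractive_multiplier X k l J \<Phi>)"
  proof
    assume "\<exists>c' \<Phi>. (\<forall>a. c' a \<in> carrier_mat J J) \<and> (\<forall>a\<in>F. c' a = c a) \<and>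
            is_power_series X J c' \<Phi> \<and> contractive_multiplier X k l J \<Phi>"
    then obtain c' \<Phi> where c': "\<And>a. c' a \<in> carrier_mat J J" "\<And>a. a \<in> F \<Longrightarrow> c' a = c a"
      and \<Phi>: "is_power_series X J c' \<Phi>" "contractive_multiplier X k l J \<Phi>" by blast
    have car: "\<Phi> z \<in> carrier_mat J J" if "z \<in> X" for z
      using \<Phi>(2) that unfolding contractive_multiplier_def multiplier_def by blast
    have "contractive_symbol J (\<lambda>a i j. c' a $$ (i, j))"
      by (rule contractive_multiplier_imp_symbol[OF \<Phi>(2) is_power_series_iff[THEN iffD1, OF c'(1) car \<Phi>(1)]])
    then have "contraction_on (F \<times> {..<J}) (symbol_matrix kc lc (\<lambda>a i j. c' a $$ (i, j)))"
      using F unfolding contractive_symbol_def by blast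
    then have "block_contraction F J (caratheodory_block J kc lc c')"
      by (rule block_contraction_symbol_matrix[where c = c', OF F(2) c'(1), THEN iffD2])
    moreover have "block_entry (caratheodory_block J kc lc c') p q = block_entry (caratheodory_block J kc lc c) p q"
      if "p \<in> F \<times> {..<J}" "q \<in> F \<times> {..<J}" for p q
    proof -
      have "fst q - fst p \<in> F" using F(2) that multi_diff_le[of "fst q" "fst p"] unfolding co_invariant_def by auto
      then show ?thesis using c'(2) by (simp add: block_entry_def caratheodory_block_def)
    qed
    ultimately show "block_contraction F J (caratheodory_block J kc lc c)"
      unfolding block_contraction_def contraction_on_def by (simp cong: sum.cong)
  next
    assume "block_contraction F J (caratheodory_block J kc lc c)"
    then have contr: "(\<Sum>a\<in>F. kc a * vnorm2 J (\<lambda>i. \<Sum>b\<in>F. \<Sum>j<J. if a \<le> b then c (b - a) $$ (i, j) * y b j else 0))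
        \<le> (\<Sum>b\<in>F. lc b * vnorm2 J (y b))" for y
      using bc symbol_contraction_iff[OF F(1), of J "\<lambda>a i j. c a $$ (i, j)"] by blast
    (* Indices a + g outside F contribute nothing, since u vanishes there. *)
    define T where "T u a i = (if i < J then \<Sum>g\<in>F. \<Sum>j<J. c g $$ (i, j) * u (a + g) j else 0)" for u :: "'d vseq" and a i
    define G0 where "G0 = {(u, T u) | u. \<forall>b j. (b \<notin> F \<or> J \<le> j) \<longrightarrow> u b j = 0}"
    have Tsum: "T u a i = (\<Sum>b\<in>F. \<Sum>j<J. if a \<le> b then c (b - a) $$ (i, j) * u b j else 0)"
      if u: "\<And>b j. b \<notin> F \<or> J \<le> j \<Longrightarrow> u b j = 0" and i: "i < J" for u a i
    proof -
      have "T u a i = (\<Sum>g\<in>{g\<in>F. a + g \<in> F}. \<Sum>j<J. c g $$ (i, j) * u (a + g) j)"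
        using i unfolding T_def by (simp, intro sum.mono_neutral_right) (use F u in auto)
      also have "\<dots> = (\<Sum>b\<in>{b\<in>F. a \<le> b}. \<Sum>j<J. c (b - a) $$ (i, j) * u b j)"
        by (rule sum.reindex_bij_witness[where i = "\<lambda>b. b - a" and j = "\<lambda>g. a + g"])
          (use F(2) multi_diff_le in \<open>auto simp: co_invariant_def\<close>)
      also have "\<dots> = (\<Sum>b\<in>F. \<Sum>j<J. if a \<le> b then c (b - a) $$ (i, j) * u b j else 0)"
        by (rule sum.mono_neutral_cong_left) (use F in auto)
      finally show ?thesis .
    qed
    have "admissible kc lc J G0"
      unfolding admissible_def
    proof (intro conjI)
      show "G0 \<noteq> {}" unfolding G0_def by (auto intro!: exI[of _ "\<lambda>_ _. 0"])
      show "\<forall>u v. (u, v) \<in> G0 \<longrightarrow> square_summable lc J u \<and> square_summable kc J v \<and>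
        sqnorm kc J v \<le> sqnorm lc J u \<and> (\<forall>b j. J \<le> j \<longrightarrow> u b j = 0 \<and> v b j = 0)"
      proof (intro allI impI)
        fix u v assume "(u, v) \<in> G0"
        then have v: "v = T u" and u: "\<And>b j. b \<notin> F \<or> J \<le> j \<Longrightarrow> u b j = 0" unfolding G0_def by auto
        have v0: "v a i = 0" if "a \<notin> F" for a i
          using that F(2) unfolding v T_def by (auto intro!: sum.neutral u simp: co_invariant_def)
        have "vnorm2 J (v a) = vnorm2 J (\<lambda>i. \<Sum>b\<in>F. \<Sum>j<J. if a \<le> b then c (b - a) $$ (i, j) * u b j else 0)" for a
          unfolding vnorm2_def v using Tsum[OF u] by simp
        then have "sqnorm kc J v \<le> sqnorm lc J u"
          using contr[of u]
          by (simp add: square_summable_finite_support(2)[OF F(1)] u v0)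
        then show "square_summable lc J u \<and> square_summable kc J v \<and>
          sqnorm kc J v \<le> sqnorm lc J u \<and> (\<forall>b j. J \<le> j \<longrightarrow> u b j = 0 \<and> v b j = 0)"
          using square_summable_finite_support(1)[OF F(1)] u v0 by (auto simp: v T_def)
      qed
      show "\<forall>d u v u' v'. (u, v) \<in> G0 \<longrightarrow> (u', v') \<in> G0 \<longrightarrow>
        (\<lambda>b j. d * u b j + u' b j, \<lambda>b j. d * v b j + v' b j) \<in> G0"
      proof (intro allI impI)
        fix d u v u' v' assume uv: "(u, v) \<in> G0" "(u', v') \<in> G0"
        then have "(\<lambda>b j. d * v b j + v' b j) = T (\<lambda>b j. d * u b j + u' b j)"
          unfolding G0_def by (auto simp: T_def fun_eq_iff sum.distrib sum_distrib_left algebra_simps)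
        then show "(\<lambda>b j. d * u b j + u' b j, \<lambda>b j. d * v b j + v' b j) \<in> G0"
          using uv unfolding G0_def by auto
      qed
      show "\<forall>m u v. (u, v) \<in> G0 \<longrightarrow> (shift m u, shift m v) \<in> G0"
      proof (intro allI impI)
        fix m u v assume uv: "(u, v) \<in> G0"
        have "shift m (T u) = T (shift m u)" by (simp add: shift_def T_def fun_eq_iff add_ac)
        moreover have "b + m \<notin> F" if "b \<notin> F" for b using F(2) that multi_le_add(1)[of b m] unfolding co_invariant_def by blast
        ultimately show "(shift m u, shift m v) \<in> G0" using uv unfolding G0_def by (auto simp: shift_def)
      qed
    qed
    from row_imp_symbol_extension[OF row this] obtain c2 where c2: "contractive_symbol J c2"
      and hs: "\<And>u v i. (u, v) \<in> G0 \<Longrightarrow> i < J \<Longrightarrow> ((\<lambda>b. \<Sum>j<J. c2 b i j * u b j) has_sum v 0 i) UNIV" by blast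
    have eq: "c2 b i j = c b $$ (i, j)" if b: "b \<in> F" and ij: "i < J" "j < J" for b i j
    proof -
      have "(unit_seq b j, T (unit_seq b j)) \<in> G0" unfolding G0_def using b ij by (auto simp: unit_seq_def)
      from hs[OF this ij(1)]
      have "((\<lambda>b'. \<Sum>j'<J. c2 b' i j' * unit_seq b j b' j') has_sum T (unit_seq b j) 0 i) UNIV" .
      moreover have "(\<Sum>j'<J. w j' * unit_seq b j b' j') = (if b' = b then w j else 0)" for b' and w :: "nat \<Rightarrow> complex"
      proof -
        have "(\<Sum>j'<J. w j' * unit_seq b j b' j') = (\<Sum>j'<J. if j' = j then (if b' = b then w j else 0) else 0)"
          by (intro sum.cong) (auto simp: unit_seq_def)
        then show ?thesis using ij by simp
      qed
      ultimately have "((\<lambda>b'. if b' = b then c2 b' i j else 0) has_sum (\<Sum>g\<in>F. if g = b then c g $$ (i, j) else 0)) UNIV"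
        using ij by (simp add: T_def)
      moreover have "((\<lambda>b'. if b' = b then c2 b' i j else 0) has_sum c2 b i j) UNIV"
        by (rule has_sum_finite_neutralI[of "{b}"]) auto
      ultimately show ?thesis using has_sum_unique b F(1) by fastforce
    qed
    define c' where "c' a = (if a \<in> F then c a else Matrix.mat J J (\<lambda>(i, j). c2 a i j))" for a
    have c'c: "c' a \<in> carrier_mat J J" for a using c by (auto simp: c'_def)
    have ent: "c' a $$ (i, j) = c2 a i j" if "i < J" "j < J" for a i j using eq that by (auto simp: c'_def)
    obtain \<Phi> where \<Phi>: "symbol_series J c2 \<Phi>" using contractive_symbol_series_exists[OF c2] by blast
    have "symbol_series J (\<lambda>a i j. c' a $$ (i, j)) \<Phi>" using \<Phi> ent unfolding symbol_series_def by simp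
    moreover have "\<Phi> z \<in> carrier_mat J J" if "z \<in> X" for z using \<Phi> that unfolding symbol_series_def by blast
    ultimately have "is_power_series X J c' \<Phi>" by (intro is_power_series_iff[where c = c', THEN iffD2] c'c)
    moreover have "contractive_multiplier X k l J \<Phi>" by (rule contractive_symbol_imp_multiplier[OF c2 \<Phi>])
    ultimately show "\<exists>c' \<Phi>. (\<forall>a. c' a \<in> carrier_mat J J) \<and> (\<forall>a\<in>F. c' a = c a) \<and>
            is_power_series X J c' \<Phi> \<and> contractive_multiplier X k l J \<Phi>"
      using c'c by (intro exI[of _ c'] exI[of _ \<Phi>]) (auto simp: c'_def)
  qed
qed

end

text \<open>The Pick matrix is thus positive iff the map that sends the combination of kernel functions of \<open>l\<close> with
coefficients \<open>x\<close> to the one of \<open>k\<close> with coefficients \<open>Y\<close> is contractive.\<close>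

lemma pick_block_form:
  fixes x :: "nat \<times> nat \<Rightarrow> complex" and lz kz :: "nat \<Rightarrow> nat \<Rightarrow> complex"
  assumes W: "\<And>i. i < n \<Longrightarrow> W i \<in> carrier_mat N N"
  defines "Y \<equiv> \<lambda>i j. \<Sum>q<N. cnj (W i $$ (q, j)) * x (i, q)"
  shows "(\<Sum>p\<in>{..<n} \<times> {..<N}. \<Sum>q\<in>{..<n} \<times> {..<N}. cnj (x p) *
      block_entry (\<lambda>i j. lz i j \<cdot>\<^sub>m 1\<^sub>m N - kz i j \<cdot>\<^sub>m (W i * mat_adjoint (W j))) p q * x q)
    = (\<Sum>j<N. \<Sum>i<n. \<Sum>i'<n. cnj (x (i, j)) * lz i i' * x (i', j))
    - (\<Sum>j<N. \<Sum>i<n. \<Sum>i'<n. cnj (Y i j) * kz i i' * Y i' j)"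
proof -
  let ?B = "\<lambda>i j. lz i j \<cdot>\<^sub>m 1\<^sub>m N - kz i j \<cdot>\<^sub>m (W i * mat_adjoint (W j))"
  define T where "T i p i' q j = cnj (x (i, p)) * (kz i i' * (W i $$ (p, j) * cnj (W i' $$ (q, j)))) * x (i', q)" for i p i' q j
  have ent: "cnj (x (i, p)) * block_entry ?B (i, p) (i', q) * x (i', q)
      = (if q = p then cnj (x (i, p)) * lz i i' * x (i', p) else 0) - (\<Sum>j<N. T i p i' q j)"
    if "i < n" "i' < n" "p < N" "q < N" for i i' p q
  proof -
    have "(W i * mat_adjoint (W i')) $$ (p, q) = (\<Sum>j<N. W i $$ (p, j) * cnj (W i' $$ (q, j)))"
      using W[OF that(1)] W[OF that(2)] that
      by (simp add: scalar_prod_def mat_adjoint_def mat_of_rows_def lessThan_atLeast0)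
    then have "block_entry ?B (i, p) (i', q)
        = (if q = p then lz i i' else 0) - kz i i' * (\<Sum>j<N. W i $$ (p, j) * cnj (W i' $$ (q, j)))"
      using W[OF that(1)] W[OF that(2)] that by (simp add: block_entry_def mat_adjoint_def)
    moreover have "(\<Sum>j<N. T i p i' q j)
        = cnj (x (i, p)) * (kz i i' * (\<Sum>j<N. W i $$ (p, j) * cnj (W i' $$ (q, j)))) * x (i', q)"
      unfolding T_def sum_distrib_left sum_distrib_right ..
    ultimately show ?thesis by (simp only: left_diff_distrib right_diff_distrib) simp
  qed
  have "(\<Sum>p\<in>{..<n} \<times> {..<N}. \<Sum>q\<in>{..<n} \<times> {..<N}. cnj (x p) * block_entry ?B p q * x q)
      = (\<Sum>i<n. \<Sum>p<N. \<Sum>i'<n. \<Sum>q<N. cnj (x (i, p)) * block_entry ?B (i, p) (i', q) * x (i', q))"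
    by (simp only: sum.cartesian_product')
  also have "\<dots> = (\<Sum>i<n. \<Sum>p<N. \<Sum>i'<n. \<Sum>q<N.
      (if q = p then cnj (x (i, p)) * lz i i' * x (i', p) else 0) - (\<Sum>j<N. T i p i' q j))"
    by (intro sum.cong refl ent) auto
  also have "\<dots> = (\<Sum>i<n. \<Sum>p<N. \<Sum>i'<n. cnj (x (i, p)) * lz i i' * x (i', p))
      - (\<Sum>i<n. \<Sum>p<N. \<Sum>i'<n. \<Sum>q<N. \<Sum>j<N. T i p i' q j)"
    by (simp add: sum_subtractf)
  also have "(\<Sum>i<n. \<Sum>p<N. \<Sum>i'<n. cnj (x (i, p)) * lz i i' * x (i', p))
      = (\<Sum>j<N. \<Sum>i<n. \<Sum>i'<n. cnj (x (i, j)) * lz i i' * x (i', j))"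
    by (rule sum.swap)
  also have "(\<Sum>i<n. \<Sum>p<N. \<Sum>i'<n. \<Sum>q<N. \<Sum>j<N. T i p i' q j)
      = (\<Sum>j<N. \<Sum>i<n. \<Sum>i'<n. \<Sum>p<N. \<Sum>q<N. T i p i' q j)"
    unfolding sum.cartesian_product
    by (rule sum.reindex_bij_witness[where i = "\<lambda>(j, i, i', p, q). (i, p, i', q, j)"
          and j = "\<lambda>(i, p, i', q, j). (j, i, i', p, q)"]) auto
  also have "\<dots> = (\<Sum>j<N. \<Sum>i<n. \<Sum>i'<n. cnj (Y i j) * kz i i' * Y i' j)"
    by (simp add: T_def Y_def sum_distrib_left sum_distrib_right mult_ac)
  finally show ?thesis .
qed

context diagonal_pair
begin

text \<open>The sequences \<open>cnj (z\<^sub>i\<^sup>b) \<xi>\<^sub>i\<close> are eigenvectors of the backward shifts.  Positivity of the Pick matrix says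
that replacing \<open>\<xi>\<^sub>i\<close> by \<open>W\<^sub>i\<^sup>* \<xi>\<^sub>i\<close> is contractive, which gives an admissible graph; evaluating the extended
symbol on unit vectors \<open>\<xi>\<close> returns the prescribed values.\<close>

lemma pick_if_row_condition:
  assumes row: "row_condition kc lc" shows "complete_pick_pair X k l"
  unfolding complete_pick_pair_def
proof (intro allI impI)
  fix n N :: nat and z :: "nat \<Rightarrow> complex^'d" and W :: "nat \<Rightarrow> complex mat"
  assume z0: "\<forall>i<n. z i \<in> X" and W0: "\<forall>i<n. W i \<in> carrier_mat N N"
    and psd: "block_psd {..<n} N (\<lambda>i j. l (z i) (z j) \<cdot>\<^sub>m 1\<^sub>m N - k (z i) (z j) \<cdot>\<^sub>m (W i * mat_adjoint (W j)))"
  have z: "\<And>i. i < n \<Longrightarrow> z i \<in> X" and W: "\<And>i. i < n \<Longrightarrow> W i \<in> carrier_mat N N" using z0 W0 by auto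
  define U where "U \<xi> b j = (if j < N then \<Sum>i<n. cnj (monomial (z i) b) * \<xi> i j else 0)"
    for \<xi> :: "nat \<Rightarrow> nat \<Rightarrow> complex" and b :: "nat^'d" and j
  define H where "H \<xi> i j = (\<Sum>q<N. cnj (W i $$ (q, j)) * \<xi> i q)" for \<xi> :: "nat \<Rightarrow> nat \<Rightarrow> complex" and i j
  define G0 where "G0 = {(U \<xi>, U (H \<xi>)) | \<xi>. True}"
  have vU: "vnorm2 N (U \<xi> b) = vnorm2 N (\<lambda>j. \<Sum>i<n. cnj (monomial (z i) b) * \<xi> i j)" for \<xi> b
    by (simp add: vnorm2_def U_def)
  have Ul: "square_summable lc N (U \<xi>) \<and>
      sqnorm lc N (U \<xi>) = Re (\<Sum>j<N. \<Sum>i<n. \<Sum>i'<n. cnj (\<xi> i j) * l (z i) (z i') * \<xi> i' j)" for \<xi>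
    by (rule sqnormI) (use has_sum_Re[OF L.gram_has_sum[where z = z and n = n, OF z]] in \<open>simp only: vU Re_complex_of_real\<close>)
  have Uk: "square_summable kc N (U \<xi>) \<and>
      sqnorm kc N (U \<xi>) = Re (\<Sum>j<N. \<Sum>i<n. \<Sum>i'<n. cnj (\<xi> i j) * k (z i) (z i') * \<xi> i' j)" for \<xi>
    by (rule sqnormI) (use has_sum_Re[OF K.gram_has_sum[where z = z and n = n, OF z]] in \<open>simp only: vU Re_complex_of_real\<close>)
  have le: "sqnorm kc N (U (H \<xi>)) \<le> sqnorm lc N (U \<xi>)" for \<xi>
  proof -
    let ?x = "\<lambda>p. \<xi> (fst p) (snd p)"
    have "0 \<le> (\<Sum>p\<in>{..<n} \<times> {..<N}. \<Sum>q\<in>{..<n} \<times> {..<N}. cnj (?x p) *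
      block_entry (\<lambda>i j. l (z i) (z j) \<cdot>\<^sub>m 1\<^sub>m N - k (z i) (z j) \<cdot>\<^sub>m (W i * mat_adjoint (W j))) p q * ?x q)"
      using psd unfolding block_psd_def psd_on_def by (rule spec)
    also have "\<dots> = (\<Sum>j<N. \<Sum>i<n. \<Sum>i'<n. cnj (\<xi> i j) * l (z i) (z i') * \<xi> i' j)
        - (\<Sum>j<N. \<Sum>i<n. \<Sum>i'<n. cnj (H \<xi> i j) * k (z i) (z i') * H \<xi> i' j)"
      using pick_block_form[of n W N ?x "\<lambda>i j. l (z i) (z j)" "\<lambda>i j. k (z i) (z j)", OF W]
      by (simp only: fst_conv snd_conv H_def)
    finally show ?thesis using Ul[of \<xi>] Uk[of "H \<xi>"] by (simp only: less_eq_complex_def) simp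
  qed
  have "admissible kc lc N G0"
    unfolding admissible_def
  proof (intro conjI)
    show "G0 \<noteq> {}" unfolding G0_def by blast
    show "\<forall>u v. (u, v) \<in> G0 \<longrightarrow> square_summable lc N u \<and> square_summable kc N v \<and>
        sqnorm kc N v \<le> sqnorm lc N u \<and> (\<forall>b j. N \<le> j \<longrightarrow> u b j = 0 \<and> v b j = 0)"
      unfolding G0_def using Ul Uk le by (auto simp: U_def)
    show "\<forall>d u v u' v'. (u, v) \<in> G0 \<longrightarrow> (u', v') \<in> G0 \<longrightarrow>
        (\<lambda>b j. d * u b j + u' b j, \<lambda>b j. d * v b j + v' b j) \<in> G0"
    proof (intro allI impI)
      fix d u v u' v' assume "(u, v) \<in> G0" "(u', v') \<in> G0"
      then obtain \<xi> \<xi>' where e: "u = U \<xi>" "v = U (H \<xi>)" "u' = U \<xi>'" "v' = U (H \<xi>')" unfolding G0_def by blast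
      let ?\<xi> = "\<lambda>i j. d * \<xi> i j + \<xi>' i j"
      have lin: "(\<lambda>b j. d * U \<eta> b j + U \<eta>' b j) = U (\<lambda>i j. d * \<eta> i j + \<eta>' i j)" for \<eta> \<eta>'
        by (simp add: U_def fun_eq_iff sum.distrib sum_distrib_left algebra_simps)
      have "(\<lambda>i j. d * H \<xi> i j + H \<xi>' i j) = H ?\<xi>"
        by (simp add: H_def fun_eq_iff sum.distrib sum_distrib_left algebra_simps)
      then show "(\<lambda>b j. d * u b j + u' b j, \<lambda>b j. d * v b j + v' b j) \<in> G0"
        unfolding e lin G0_def by auto
    qed
    show "\<forall>m u v. (u, v) \<in> G0 \<longrightarrow> (shift m u, shift m v) \<in> G0"
    proof (intro allI impI)
      fix m u v assume "(u, v) \<in> G0"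
      then obtain \<xi> where e: "u = U \<xi>" "v = U (H \<xi>)" unfolding G0_def by blast
      have sh: "shift m (U \<eta>) = U (\<lambda>i j. cnj (monomial (z i) m) * \<eta> i j)" for \<eta>
        by (simp add: U_def shift_def fun_eq_iff monomial_add mult_ac)
      have "(\<lambda>i j. cnj (monomial (z i) m) * H \<xi> i j) = H (\<lambda>i j. cnj (monomial (z i) m) * \<xi> i j)"
        by (simp add: H_def fun_eq_iff sum_distrib_left mult_ac)
      then show "(shift m u, shift m v) \<in> G0" unfolding e sh G0_def by auto
    qed
  qed
  from row_imp_symbol_extension[OF row this] obtain c where c: "contractive_symbol N c"
    and hs: "\<And>\<xi> i. i < N \<Longrightarrow> ((\<lambda>b. \<Sum>j<N. c b i j * U \<xi> b j) has_sum U (H \<xi>) 0 i) UNIV"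
    unfolding G0_def by blast
  obtain \<Phi> where \<Phi>: "symbol_series N c \<Phi>" using contractive_symbol_series_exists[OF c] by blast
  have "\<Phi> (z i) = W i" if i: "i < n" for i
  proof (rule eq_matI)
    have car: "\<Phi> (z i) \<in> carrier_mat N N" using \<Phi> z[OF i] unfolding symbol_series_def by blast
    then show "dim_row (\<Phi> (z i)) = dim_row (W i)" "dim_col (\<Phi> (z i)) = dim_col (W i)" using W[OF i] by auto
    fix p q assume "p < dim_row (W i)" "q < dim_col (W i)"
    then have pq: "p < N" "q < N" using W[OF i] by auto
    define \<xi> :: "nat \<Rightarrow> nat \<Rightarrow> complex" where "\<xi> i' j = (if i' = i then if j = p then 1 else 0 else 0)" for i' j
    have "(\<Sum>j<N. c b q j * U \<xi> b j) = c b q p * cnj (monomial (z i) b)" for b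
    proof -
      have "U \<xi> b j = (if j = p then cnj (monomial (z i) b) else 0)" if "j < N" for j
        using that i by (simp add: U_def \<xi>_def if_distrib[where f = "(*) _"] cong: if_cong)
      then have "(\<Sum>j<N. c b q j * U \<xi> b j) = (\<Sum>j<N. if j = p then c b q p * cnj (monomial (z i) b) else 0)"
        by (intro sum.cong) auto
      then show ?thesis using pq by simp
    qed
    moreover have "U (H \<xi>) 0 q = cnj (W i $$ (p, q))"
    proof -
      have "H \<xi> i' q = (if i' = i then cnj (W i $$ (p, q)) else 0)" for i'
        using pq by (simp add: H_def \<xi>_def if_distrib[where f = "(*) _"] cong: if_cong)
      then show ?thesis using pq i by (simp add: U_def)
    qed
    ultimately have "((\<lambda>b. c b q p * cnj (monomial (z i) b)) has_sum cnj (W i $$ (p, q))) UNIV"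
      using hs[OF pq(2), of \<xi>] by simp
    from has_sum_cnj_iff[THEN iffD2, OF this]
    have "((\<lambda>a. monomial (z i) a * cnj (c a q p)) has_sum W i $$ (p, q)) UNIV" by (simp add: mult.commute)
    moreover have "((\<lambda>a. monomial (z i) a * cnj (c a q p)) has_sum \<Phi> (z i) $$ (p, q)) UNIV"
      using \<Phi> z[OF i] pq unfolding symbol_series_def by blast
    ultimately show "\<Phi> (z i) $$ (p, q) = W i $$ (p, q)" by (rule has_sum_unique[rotated])
  qed
  then show "\<exists>\<Phi>. contractive_multiplier X k l N \<Phi> \<and> (\<forall>i<n. \<Phi> (z i) = W i)"
    using contractive_symbol_imp_multiplier[OF c \<Phi>] by blast
qed

section \<open>Necessity of the row condition\<close>

text \<open>The estimate for one column without the term at \<open>b\<close> itself; it involves only symbol entries with index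
below \<open>b\<close>, so it is a necessary condition on data prescribed there.\<close>

lemma contractive_symbol_row:
  assumes c: "contractive_symbol N c" and j: "j < N"
  shows "(\<Sum>a | a < b. (\<Sum>i<N. (cmod (c a i j))\<^sup>2) * kc (b - a)) \<le> lc b"
proof -
  have "(\<Sum>a | a < b. (\<Sum>i<N. (cmod (c a i j))\<^sup>2) * kc (b - a)) \<le> (\<Sum>a | a \<le> b. (\<Sum>i<N. (cmod (c a i j))\<^sup>2) * kc (b - a))"
    by (rule sum_mono2) (use kcp in \<open>auto simp: multi_less_iff less_imp_le intro!: mult_nonneg_nonneg sum_nonneg\<close>)
  also have "\<dots> = (\<Sum>a | a \<le> b. kc a * (\<Sum>i<N. (cmod (c (b - a) i j))\<^sup>2))"
    by (rule sum.reindex_bij_witness[where i = "\<lambda>a. b - a" and j = "\<lambda>a. b - a"]) auto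
  finally show ?thesis using contractive_symbol_column[OF c j, of b] by linarith
qed

text \<open>The data \<open>c a = sqrt (t a) E\<close>, with a matrix unit \<open>E\<close> in the column \<open>0\<close> and a row \<open>\<sigma> a\<close> of its own, keeps
the contributions of different \<open>a\<close> orthogonal.  Therefore the squared norm of the image of \<open>y\<close> is exactly
\<open>\<Sum>\<^sub>b (t * k)\<^sub>b |y b 0|\<^sup>2\<close>, and contractivity of the data is the premise of the row condition.\<close>

lemma row_condition_if_caratheodory:
  assumes cara: "complete_caratheodory_pair X k l kc lc" shows "row_condition kc lc"
  unfolding row_condition_def
proof (intro allI impI)
  fix b :: "nat^'d" and t :: "nat^'d \<Rightarrow> real"
  assume t0: "\<forall>c<b. 0 \<le> t c \<and> conv t kc c \<le> lc c"
  show "(\<Sum>a | a < b. t a * kc (b - a)) \<le> lc b"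
  proof (cases "b = 0")
    case True
    then have "{a. a < b} = {}" by (auto simp: multi_less_iff)
    then show ?thesis using lcp[of b] by (simp add: less_imp_le)
  next
    case False
    define F where "F = {a. a < b}"
    have F: "finite F" "co_invariant F" using co_invariant_less[OF False] by (auto simp: F_def)
    have t: "0 \<le> t a" "conv t kc a \<le> lc a" if "a \<in> F" for a using t0 that by (auto simp: F_def)
    define J where "J = card F"
    have J: "1 \<le> J" using F co_invariant_zero[OF F(2)] unfolding J_def by (metis One_nat_def Suc_leI card_gt_0_iff empty_iff)
    obtain \<sigma> where \<sigma>: "bij_betw \<sigma> F {..<J}" using ex_bij_betw_finite_nat[OF F(1)] by (auto simp: J_def atLeast0LessThan)
    have \<sigma>J: "\<sigma> a < J" if "a \<in> F" for a using bij_betwE[OF \<sigma>] that by auto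
    have \<sigma>i: "\<sigma> a = \<sigma> a' \<longleftrightarrow> a = a'" if "a \<in> F" "a' \<in> F" for a a'
      using bij_betw_imp_inj_on[OF \<sigma>] that by (auto dest: inj_onD)
    define c where "c a = Matrix.mat J J (\<lambda>(i, j). if j = 0 \<and> i = \<sigma> a then complex_of_real (sqrt (t a)) else 0)" for a
    have cc: "c a \<in> carrier_mat J J" for a by (simp add: c_def)
    have ce: "c a $$ (i, j) = (if j = 0 then if i = \<sigma> a then of_real (sqrt (t a)) else 0 else 0)" if "i < J" "j < J" for a i j
      using that by (simp add: c_def)
    have "(\<Sum>a\<in>F. kc a * vnorm2 J (\<lambda>i. \<Sum>b'\<in>F. \<Sum>j<J. if a \<le> b' then c (b' - a) $$ (i, j) * y b' j else 0))
        \<le> (\<Sum>b'\<in>F. lc b' * vnorm2 J (y b'))" for y :: "nat^'d \<Rightarrow> nat \<Rightarrow> complex"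
    proof -
      have col: "(\<Sum>b'\<in>F. \<Sum>j<J. if a \<le> b' then c (b' - a) $$ (\<sigma> e, j) * y b' j else 0)
          = (if a + e \<in> F then of_real (sqrt (t e)) * y (a + e) 0 else 0)" if a: "a \<in> F" and e: "e \<in> F" for a e
      proof -
        have "(\<Sum>j<J. if a \<le> b' then c (b' - a) $$ (\<sigma> e, j) * y b' j else 0)
            = (if b' = a + e then of_real (sqrt (t e)) * y (a + e) 0 else 0)" if b': "b' \<in> F" for b'
        proof (cases "a \<le> b'")
          case True
          have dF: "b' - a \<in> F" using F(2) b' multi_diff_le[of b' a] unfolding co_invariant_def by blast
          have "(\<Sum>j<J. if a \<le> b' then c (b' - a) $$ (\<sigma> e, j) * y b' j else 0)
              = (\<Sum>j<J. if j = 0 then (if e = b' - a then of_real (sqrt (t e)) * y b' 0 else 0) else 0)"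
            using True ce[OF \<sigma>J[OF e]] \<sigma>i[OF e dF] by (intro sum.cong) auto
          moreover have "e = b' - a \<longleftrightarrow> b' = a + e" using True by auto
          ultimately show ?thesis using J by auto
        qed auto
        then have "(\<Sum>b'\<in>F. \<Sum>j<J. if a \<le> b' then c (b' - a) $$ (\<sigma> e, j) * y b' j else 0)
            = (\<Sum>b'\<in>F. if b' = a + e then of_real (sqrt (t e)) * y (a + e) 0 else 0)" by (rule sum.cong[OF refl])
        then show ?thesis using F(1) by simp
      qed
      have "vnorm2 J (\<lambda>i. \<Sum>b'\<in>F. \<Sum>j<J. if a \<le> b' then c (b' - a) $$ (i, j) * y b' j else 0)
          = (\<Sum>e\<in>F. if a + e \<in> F then t e * (cmod (y (a + e) 0))\<^sup>2 else 0)" if a: "a \<in> F" for a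
        unfolding vnorm2_def
        by (subst sum.reindex_bij_betw[OF \<sigma>, symmetric], intro sum.cong refl, subst col[OF a])
          (use t in \<open>auto simp: norm_mult power_mult_distrib\<close>)
      then have "(\<Sum>a\<in>F. kc a * vnorm2 J (\<lambda>i. \<Sum>b'\<in>F. \<Sum>j<J. if a \<le> b' then c (b' - a) $$ (i, j) * y b' j else 0))
          = (\<Sum>a\<in>F. \<Sum>e\<in>F. if a + e \<in> F then t e * kc a * (cmod (y (a + e) 0))\<^sup>2 else 0)"
        by (intro sum.cong refl) (auto simp: sum_distrib_left intro!: sum.cong)
      also have "\<dots> = (\<Sum>(a, e)\<in>{(a, e). a + e \<in> F}. t e * kc a * (cmod (y (a + e) 0))\<^sup>2)"
        unfolding sum.cartesian_product
        by (rule sum.mono_neutral_cong_right)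
          (use F multi_le_add in \<open>auto simp: co_invariant_def split: if_splits\<close>)
      also have "\<dots> = (\<Sum>(b', e)\<in>Sigma F (\<lambda>b'. {e. e \<le> b'}). t e * kc (b' - e) * (cmod (y b' 0))\<^sup>2)"
        by (rule sum.reindex_bij_witness[where i = "\<lambda>(b', e). (b' - e, e)" and j = "\<lambda>(a, e). (a + e, e)"]) auto
      also have "\<dots> = (\<Sum>b'\<in>F. conv t kc b' * (cmod (y b' 0))\<^sup>2)"
        using F(1) by (simp add: sum.Sigma[symmetric] conv_def sum_distrib_right)
      also have "\<dots> \<le> (\<Sum>b'\<in>F. lc b' * vnorm2 J (y b'))"
        using t(2) lcp vnorm2_component[of 0 J] J by (intro sum_mono mult_mono) (auto simp: less_imp_le)
      finally show ?thesis .
    qed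
    then have "contraction_on (F \<times> {..<J}) (symbol_matrix kc lc (\<lambda>a i j. c a $$ (i, j)))"
      unfolding symbol_contraction_iff[OF F(1)] by blast
    then have "block_contraction F J (caratheodory_block J kc lc c)"
      by (rule block_contraction_symbol_matrix[where c = c, OF F(2) cc, THEN iffD2])
    from cara[unfolded complete_caratheodory_pair_def, rule_format, OF J F cc, THEN iffD1, OF this]
    obtain c' \<Phi> where c'0: "\<forall>a. c' a \<in> carrier_mat J J" "\<forall>a\<in>F. c' a = c a"
      and \<Phi>: "is_power_series X J c' \<Phi>" "contractive_multiplier X k l J \<Phi>"
      by (elim exE conjE) (rule that)
    have c': "\<And>a. c' a \<in> carrier_mat J J" "\<And>a. a \<in> F \<Longrightarrow> c' a = c a" using c'0 by auto
    have car: "\<Phi> z \<in> carrier_mat J J" if "z \<in> X" for z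
      using \<Phi>(2) that unfolding contractive_multiplier_def multiplier_def by blast
    have "contractive_symbol J (\<lambda>a i j. c' a $$ (i, j))"
      by (rule contractive_multiplier_imp_symbol[OF \<Phi>(2) is_power_series_iff[THEN iffD1, OF c'(1) car \<Phi>(1)]])
    from contractive_symbol_row[OF this, of 0 b] J
    have "(\<Sum>a\<in>F. (\<Sum>i<J. (cmod (c' a $$ (i, 0)))\<^sup>2) * kc (b - a)) \<le> lc b" by (simp add: F_def)
    moreover have "(\<Sum>i<J. (cmod (c' a $$ (i, 0)))\<^sup>2) = t a" if a: "a \<in> F" for a
    proof -
      have "(\<Sum>i<J. (cmod (c' a $$ (i, 0)))\<^sup>2) = (\<Sum>i<J. if i = \<sigma> a then t a else 0)"
        using J t(1)[OF a] by (intro sum.cong) (auto simp: c'(2)[OF a] ce)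
      then show ?thesis using \<sigma>J[OF a] by simp
    qed
    ultimately show ?thesis by (simp add: F_def)
  qed
qed

end

lemma has_sum_complex_of_real:
  assumes "((\<lambda>x. complex_of_real (g x)) has_sum Q) A"
  shows "(g has_sum Re Q) A" "Im Q = 0"
proof -
  show "(g has_sum Re Q) A" using has_sum_Re[OF assms] by simp
  from has_sum_Im[OF assms] have "((\<lambda>x. 0) has_sum Im Q) A" by simp
  then show "Im Q = 0" by (rule has_sum_unique) simp
qed

text \<open>The value at the grid point \<open>\<epsilon> e i\<close> of the polynomial row with entries \<open>sqrt (t (e q)) z\<^sup>e\<^sup>q\<close>, completed by
zero rows to a square matrix.\<close>

definition grid_matrix :: "(nat^'d \<Rightarrow> real) \<Rightarrow> nat \<Rightarrow> (nat \<Rightarrow> nat^'d) \<Rightarrow> real \<Rightarrow> nat \<Rightarrow> complex mat" where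
  "grid_matrix t J e \<epsilon> i = Matrix.mat J J (\<lambda>(p, q).
     if p = 0 then of_real (sqrt (t (e q))) * monomial (grid_point \<epsilon> (e i)) (e q) else 0)"

context diagonal_pair
begin

lemma geometric_bounds:
  "\<exists>C R. 0 \<le> C \<and> 1 \<le> R \<and> (\<forall>b. kc b \<le> C * R ^ deg b \<and> lc b \<le> C * R ^ deg b)"
proof -
  obtain C1 R1 where 1: "0 \<le> C1" "0 \<le> R1" "\<And>b. \<bar>kc b\<bar> \<le> C1 * R1 ^ deg b"
    using diagonal_coefficient_bound[OF K.r_pos K.expansion] K.ball_sub by (metis subsetD)
  obtain C2 R2 where 2: "0 \<le> C2" "0 \<le> R2" "\<And>b. \<bar>lc b\<bar> \<le> C2 * R2 ^ deg b"
    using diagonal_coefficient_bound[OF L.r_pos L.expansion] L.ball_sub by (metis subsetD)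
  define R where "R = max 1 (max R1 R2)"
  have R: "1 \<le> R" "R1 \<le> R" "R2 \<le> R" by (auto simp: R_def)
  have m: "A * B ^ deg b \<le> (C1 + C2) * R ^ deg b" if "0 \<le> A" "A \<le> C1 + C2" "0 \<le> B" "B \<le> R" for A B and b :: "nat^'d"
    using that R by (intro mult_mono power_mono) auto
  have "kc b \<le> (C1 + C2) * R ^ deg b \<and> lc b \<le> (C1 + C2) * R ^ deg b" for b
    using 1(3)[of b] 2(3)[of b] m[of C1 R1 b] m[of C2 R2 b] 1 2 R by linarith
  then show ?thesis using 1 2 R by (intro exI[of _ "C1 + C2"] exI[of _ R]) auto
qed

text \<open>The term \<open>a = 0\<close> of the column estimate gives \<open>k\<^sub>0 |c\<^sub>g|\<^sup>2 \<le> l\<^sub>g\<close>, and the coefficients of a kernel grow at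
most geometrically.  The bound is the same for all contractive symbols.\<close>

lemma symbol_coefficient_bound:
  "\<exists>C R. 0 \<le> C \<and> 1 \<le> R \<and> (\<forall>N c g i j. contractive_symbol N c \<longrightarrow> i < N \<longrightarrow> j < N \<longrightarrow> cmod (c g i j) \<le> C * R ^ deg g)"
proof -
  obtain C R where C: "0 \<le> C" and R: "1 \<le> R" and b: "\<And>g. lc g \<le> C * R ^ deg g"
    using geometric_bounds by blast
  have "cmod (c g i j) \<le> (1 + C / kc 0) * R ^ deg g" if c: "contractive_symbol N c" and ij: "i < N" "j < N" for N c g i j
  proof -
    have "kc 0 * (\<Sum>i<N. (cmod (c g i j))\<^sup>2) \<le> (\<Sum>a | a \<le> g. kc a * (\<Sum>i<N. (cmod (c (g - a) i j))\<^sup>2))"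
      using member_le_sum[of 0 "{a. a \<le> g}" "\<lambda>a. kc a * (\<Sum>i<N. (cmod (c (g - a) i j))\<^sup>2)"] kcp
      by (simp add: less_imp_le sum_nonneg)
    also have "\<dots> \<le> lc g" by (rule contractive_symbol_column[OF c ij(2)])
    finally have "kc 0 * (\<Sum>i<N. (cmod (c g i j))\<^sup>2) \<le> lc g" .
    moreover have "(cmod (c g i j))\<^sup>2 \<le> (\<Sum>i<N. (cmod (c g i j))\<^sup>2)" using ij(1) by (intro member_le_sum) auto
    then have "kc 0 * (cmod (c g i j))\<^sup>2 \<le> kc 0 * (\<Sum>i<N. (cmod (c g i j))\<^sup>2)" using kcp[of 0] by (intro mult_left_mono) auto
    ultimately have "kc 0 * (cmod (c g i j))\<^sup>2 \<le> C * R ^ deg g" using b[of g] by linarith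
    then have sq: "(cmod (c g i j))\<^sup>2 \<le> C / kc 0 * R ^ deg g" using kcp[of 0] by (simp add: field_simps)
    have "0 \<le> (cmod (c g i j) - 1)\<^sup>2" by simp
    then have "2 * cmod (c g i j) \<le> (cmod (c g i j))\<^sup>2 + 1" by (simp add: power2_diff)
    then have "cmod (c g i j) \<le> 1 + (cmod (c g i j))\<^sup>2" using norm_ge_zero[of "c g i j"] by linarith
    also have "\<dots> \<le> 1 * R ^ deg g + C / kc 0 * R ^ deg g" using sq one_le_power[OF R, of "deg g"] by (intro add_mono) simp_all
    finally show ?thesis by (simp add: distrib_right)
  qed
  then show ?thesis using C R kcp[of 0] by (intro exI[of _ "1 + C / kc 0"] exI[of _ R]) (auto simp: less_imp_le)
qed

text \<open>In terms of the sums \<open>S b\<close> over the grid points, the first row of the Pick form is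
\<open>\<Sum>\<^sub>b (l\<^sub>b - (t * k)\<^sub>b) |S b|\<^sup>2\<close>, where \<open>t\<close> is extended by zero outside \<open>F\<close>.  The coefficients are positive on
\<open>F\<close>, so for small \<open>\<epsilon>\<close> the form is nonnegative.  The other rows contribute only the form of the kernel
\<open>l\<close>, because the corresponding rows of the values are zero.\<close>

lemma grid_pick_matrix_psd:
  fixes t :: "nat^'d \<Rightarrow> real"
  assumes F: "finite F" "co_invariant F" and t: "\<And>a. a \<in> F \<Longrightarrow> 0 \<le> t a"
    and strict: "\<And>a. a \<in> F \<Longrightarrow> conv t kc a < lc a" and e: "bij_betw e {..<J} F"
  shows "\<exists>\<epsilon>0>0. \<forall>\<epsilon>. 0 < \<epsilon> \<longrightarrow> \<epsilon> \<le> \<epsilon>0 \<longrightarrow> (\<forall>a\<in>F. grid_point \<epsilon> a \<in> X) \<and>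
    block_psd {..<J} J (\<lambda>i j. l (grid_point \<epsilon> (e i)) (grid_point \<epsilon> (e j)) \<cdot>\<^sub>m 1\<^sub>m J
      - k (grid_point \<epsilon> (e i)) (grid_point \<epsilon> (e j)) \<cdot>\<^sub>m (grid_matrix t J e \<epsilon> i * mat_adjoint (grid_matrix t J e \<epsilon> j)))"
proof -
  define h where "h b = lc b - (\<Sum>a\<in>F. if a \<le> b then t a * kc (b - a) else 0)" for b
  have eF: "e i \<in> F" if "i < J" for i using bij_betwE[OF e] that by auto
  have J: "0 < J" using bij_betw_same_card[OF e] F co_invariant_zero[OF F(2)] by (metis card_gt_0_iff card_lessThan empty_iff)
  have hpos: "0 < h b" if b: "b \<in> F" for b
  proof -
    have "(\<Sum>a\<in>F. if a \<le> b then t a * kc (b - a) else 0) = conv t kc b"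
      unfolding conv_def by (rule sum.mono_neutral_cong_right) (use F b in \<open>auto simp: co_invariant_def\<close>)
    then show ?thesis using strict[OF b] by (simp add: h_def)
  qed
  obtain C R where C: "0 \<le> C" and R: "1 \<le> R" and kb: "\<And>b. kc b \<le> C * R ^ deg b" and lb: "\<And>b. lc b \<le> C * R ^ deg b"
    using geometric_bounds by blast
  have T0: "0 \<le> (\<Sum>a\<in>F. t a)" by (rule sum_nonneg[OF t])
  have hb: "\<bar>h b\<bar> \<le> (C + (\<Sum>a\<in>F. t a) * C) * R ^ deg b" for b
  proof -
    have "(\<Sum>a\<in>F. if a \<le> b then t a * kc (b - a) else 0) \<le> (\<Sum>a\<in>F. t a * (C * R ^ deg b))"
    proof (rule sum_mono)
      fix a assume a: "a \<in> F"
      have "kc (b - a) \<le> C * R ^ deg (b - a)" by (rule kb)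
      also have "\<dots> \<le> C * R ^ deg b" using C R by (intro mult_left_mono power_increasing deg_mono) auto
      finally have "t a * kc (b - a) \<le> t a * (C * R ^ deg b)" using t[OF a] by (rule mult_left_mono)
      then show "(if a \<le> b then t a * kc (b - a) else 0) \<le> t a * (C * R ^ deg b)" using t[OF a] C R by simp
    qed
    moreover have "0 \<le> (\<Sum>a\<in>F. if a \<le> b then t a * kc (b - a) else 0)"
      using t kcp by (intro sum_nonneg) (auto simp: less_imp_le)
    ultimately show ?thesis using lb[of b] lcp[of b] unfolding h_def
      by (simp add: sum_distrib_right[symmetric] distrib_right mult.assoc)
  qed
  from jet_positivity[OF F hpos _ _ hb] C R T0 obtain \<epsilon>1 where \<epsilon>1: "0 < \<epsilon>1" and
    jet: "\<forall>\<epsilon> (x :: nat^'d \<Rightarrow> complex) q. 0 < \<epsilon> \<longrightarrow> \<epsilon> \<le> \<epsilon>1 \<longrightarrow>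
      ((\<lambda>b. h b * (\<epsilon> ^ deg b * cmod (\<Sum>c\<in>F. x c * of_real (nat_power c b)))\<^sup>2) has_sum q) UNIV \<longrightarrow> 0 \<le> q" by auto
  obtain s where s: "0 < s" "\<And>z :: complex^'d. (\<And>i. cmod (z $ i) \<le> s) \<Longrightarrow> z \<in> ball 0 r1"
    using polydisc_in_ball[OF K.r_pos] by blast
  obtain top where top: "\<And>a. a \<in> F \<Longrightarrow> a \<le> top" using finite_imp_multi_bound[OF F(1)] by blast
  define \<epsilon>0 where "\<epsilon>0 = min \<epsilon>1 (s / (real (deg top) + 1))"
  show ?thesis
  proof (intro exI[of _ \<epsilon>0] conjI allI impI ballI)
    show "0 < \<epsilon>0" using \<epsilon>1 s(1) by (simp add: \<epsilon>0_def)
    fix \<epsilon> :: real assume \<epsilon>: "0 < \<epsilon>" "\<epsilon> \<le> \<epsilon>0"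
    show X: "grid_point \<epsilon> a \<in> X" if "a \<in> F" for a
    proof -
      have "cmod (grid_point \<epsilon> a $ i) \<le> s" for i
      proof -
        have "cmod (grid_point \<epsilon> a $ i) \<le> \<epsilon> * real (deg top)" using norm_grid_point_le[OF top[OF that]] \<epsilon> by simp
        also have "\<dots> \<le> \<epsilon> * (real (deg top) + 1)" using \<epsilon> by simp
        also have "\<dots> \<le> s" using \<epsilon> by (simp add: \<epsilon>0_def field_simps)
        finally show ?thesis .
      qed
      then show ?thesis using s(2) K.ball_sub by blast
    qed
    let ?z = "\<lambda>i. grid_point \<epsilon> (e i)" and ?W = "grid_matrix t J e \<epsilon>"
    show "block_psd {..<J} J (\<lambda>i j. l (?z i) (?z j) \<cdot>\<^sub>m 1\<^sub>m J - k (?z i) (?z j) \<cdot>\<^sub>m (?W i * mat_adjoint (?W j)))"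
      unfolding block_psd_def psd_on_def
    proof
      fix x :: "nat \<times> nat \<Rightarrow> complex"
      (* The grid points are real, so conjugation can be dropped and multiplying by a monomial shifts S. *)
      define S where "S b = (\<Sum>i<J. monomial (?z i) b * x (i, 0))" for b
      define Y where "Y i j = of_real (sqrt (t (e j))) * monomial (?z i) (e j) * x (i, 0)" for i j
      have Y: "(\<Sum>q<J. cnj (?W i $$ (q, j)) * x (i, q)) = Y i j" if "i < J" "j < J" for i j
      proof -
        have "(\<Sum>q<J. cnj (?W i $$ (q, j)) * x (i, q)) = (\<Sum>q<J. if q = 0 then Y i j else 0)"
          using that by (intro sum.cong) (auto simp: grid_matrix_def Y_def)
        then show ?thesis using J by simp
      qed
      define QL where "QL = (\<Sum>j<J. \<Sum>i<J. \<Sum>i'<J. cnj (x (i, j)) * l (?z i) (?z i') * x (i', j))"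
      define QK where "QK = (\<Sum>j<J. \<Sum>i<J. \<Sum>i'<J. cnj (Y i j) * k (?z i) (?z i') * Y i' j)"
      have zX: "?z i \<in> X" if "i < J" for i using X eF that by blast
      have form: "(\<Sum>p\<in>{..<J} \<times> {..<J}. \<Sum>q\<in>{..<J} \<times> {..<J}. cnj (x p) *
          block_entry (\<lambda>i j. l (?z i) (?z j) \<cdot>\<^sub>m 1\<^sub>m J - k (?z i) (?z j) \<cdot>\<^sub>m (?W i * mat_adjoint (?W j))) p q * x q) = QL - QK"
        unfolding QL_def QK_def
        by (rule trans[OF pick_block_form[where lz = "\<lambda>i j. l (?z i) (?z j)" and kz = "\<lambda>i j. k (?z i) (?z j)"]])
          (auto simp: grid_matrix_def[of t J e \<epsilon>] Y[symmetric] intro!: arg_cong2[where f = "(-)"] sum.cong)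
      have gl: "((\<lambda>b. complex_of_real (lc b * vnorm2 J (\<lambda>j. \<Sum>i<J. cnj (monomial (?z i) b) * x (i, j)))) has_sum QL) UNIV"
        using L.gram_has_sum[where z = ?z and n = J and N = J and \<eta> = "\<lambda>i j. x (i, j)", OF zX] unfolding QL_def .
      have gk: "((\<lambda>b. complex_of_real (kc b * vnorm2 J (\<lambda>j. \<Sum>i<J. cnj (monomial (?z i) b) * Y i j))) has_sum QK) UNIV"
        using K.gram_has_sum[where z = ?z and n = J and N = J and \<eta> = Y, OF zX] unfolding QK_def .
      have "(\<Sum>i<J. cnj (monomial (?z i) b) * Y i j) = of_real (sqrt (t (e j))) * S (b + e j)" for b j
        by (simp add: Y_def S_def sum_distrib_left monomial_add mult_ac)
      then have "vnorm2 J (\<lambda>j. \<Sum>i<J. cnj (monomial (?z i) b) * Y i j) = (\<Sum>j<J. t (e j) * (cmod (S (b + e j)))\<^sup>2)" for b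
        using t[OF eF] unfolding vnorm2_def by (intro sum.cong) (auto simp: norm_mult power_mult_distrib)
      also have "(\<Sum>j<J. t (e j) * (cmod (S (b + e j)))\<^sup>2) = (\<Sum>a\<in>F. t a * (cmod (S (b + a)))\<^sup>2)" for b
        by (rule sum.reindex_bij_betw[OF e, of "\<lambda>a. t a * (cmod (S (b + a)))\<^sup>2"])
      finally have gk': "((\<lambda>b. kc b * (\<Sum>a\<in>F. t a * (cmod (S (b + a)))\<^sup>2)) has_sum Re QK) UNIV"
        using has_sum_complex_of_real(1)[OF gk] by simp
      have nn: "0 \<le> kc b * (t a * (cmod (S (b + a)))\<^sup>2)" if "a \<in> F" for a b
        using t[OF that] kcp[of b] by (simp add: less_imp_le)
      define sa where "sa a = infsum (\<lambda>b. kc b * (t a * (cmod (S (b + a)))\<^sup>2)) UNIV" for a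
      have sa: "((\<lambda>b. kc b * (t a * (cmod (S (b + a)))\<^sup>2)) has_sum sa a) UNIV" if a: "a \<in> F" for a
        unfolding sa_def
      proof (rule has_sum_infsum, rule summable_on_comparison_test[OF has_sum_imp_summable[OF gk']])
        fix b :: "nat^'d"
        show "kc b * (t a * (cmod (S (b + a)))\<^sup>2) \<le> kc b * (\<Sum>a\<in>F. t a * (cmod (S (b + a)))\<^sup>2)"
          using member_le_sum[OF a, of "\<lambda>a. t a * (cmod (S (b + a)))\<^sup>2"] t F(1) kcp[of b]
          by (intro mult_left_mono) auto
      qed (rule nn[OF a])
      have QK: "Re QK = (\<Sum>a\<in>F. sa a)"
        using has_sum_unique[OF gk'] has_sum_finite_sum[where I = F and s = sa, OF sa] by (simp add: sum_distrib_left)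
      have sh: "((\<lambda>b. if a \<le> b then t a * kc (b - a) * (cmod (S b))\<^sup>2 else 0) has_sum sa a) UNIV" if a: "a \<in> F" for a
      proof -
        have "((\<lambda>b. t a * kc (b - a) * (cmod (S b))\<^sup>2) has_sum sa a) {b. a \<le> b}"
          by (subst has_sum_reindex_bij_witness[where T = UNIV and j = "\<lambda>b. b - a" and i = "\<lambda>b. b + a"
                and h = "\<lambda>b. kc b * (t a * (cmod (S (b + a)))\<^sup>2)" and s' = "sa a"])
            (use sa[OF a] in auto)
        then show ?thesis by (subst (asm) has_sum_cong_neutral[where T = UNIV]) auto
      qed
      have comp: "lc b * (cmod (S b))\<^sup>2 \<le> lc b * vnorm2 J (\<lambda>j. \<Sum>i<J. cnj (monomial (?z i) b) * x (i, j))" for b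
        using vnorm2_component[OF J, of "\<lambda>j. \<Sum>i<J. cnj (monomial (?z i) b) * x (i, j)"] lcp[of b]
        by (simp add: S_def)
      have "(\<lambda>b. lc b * (cmod (S b))\<^sup>2) summable_on UNIV"
        by (rule summable_on_comparison_test[OF has_sum_imp_summable[OF has_sum_complex_of_real(1)[OF gl]]])
          (use comp lcp in \<open>auto simp: less_imp_le\<close>)
      then obtain sl where sl: "((\<lambda>b. lc b * (cmod (S b))\<^sup>2) has_sum sl) UNIV" by (auto simp: summable_on_def)
      have sl_le: "sl \<le> Re QL" by (rule has_sum_mono[OF sl has_sum_complex_of_real(1)[OF gl]]) (rule comp)
      from has_sum_add[OF sl has_sum_uminusI[OF has_sum_finite_sum[where I = F and s = sa, OF sh]]]
      have hS: "((\<lambda>b. h b * (cmod (S b))\<^sup>2) has_sum sl - Re QK) UNIV"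
        by (simp add: h_def QK left_diff_distrib sum_distrib_right if_distrib[where f = "\<lambda>x. x * _"] cong: if_cong)
      have S: "(cmod (S b))\<^sup>2 = (\<epsilon> ^ deg b * cmod (\<Sum>c\<in>F. x (the_inv_into {..<J} e c, 0) * of_real (nat_power c b)))\<^sup>2" for b
      proof -
        have "(\<Sum>c\<in>F. x (the_inv_into {..<J} e c, 0) * of_real (nat_power c b))
            = (\<Sum>i<J. x (i, 0) * complex_of_real (nat_power (e i) b))"
          by (subst sum.reindex_bij_betw[OF e, symmetric])
            (simp add: the_inv_into_f_f[OF bij_betw_imp_inj_on[OF e]])
        then have "S b = of_real (\<epsilon> ^ deg b) * (\<Sum>c\<in>F. x (the_inv_into {..<J} e c, 0) * of_real (nat_power c b))"
          unfolding S_def monomial_grid_point by (simp add: sum_distrib_left mult_ac)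
        then show ?thesis using \<epsilon> by (simp only: norm_mult norm_of_real) simp
      qed
      have "0 \<le> sl - Re QK"
        by (rule jet[rule_format, OF \<epsilon>(1) _ hS[unfolded S]]) (use \<epsilon> in \<open>simp add: \<epsilon>0_def\<close>)
      then show "0 \<le> (\<Sum>p\<in>{..<J} \<times> {..<J}. \<Sum>q\<in>{..<J} \<times> {..<J}. cnj (x p) *
          block_entry (\<lambda>i j. l (?z i) (?z j) \<cdot>\<^sub>m 1\<^sub>m J - k (?z i) (?z j) \<cdot>\<^sub>m (?W i * mat_adjoint (?W j))) p q * x q)"
        unfolding form using sl_le has_sum_complex_of_real(2)[OF gl] has_sum_complex_of_real(2)[OF gk]
        by (simp add: less_eq_complex_def)
    qed
  qed
qed

text \<open>For each small \<open>\<epsilon>\<close> there is a contractive symbol whose series takes the values of the polynomial row at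
the grid points.  The difference between the series and the polynomial vanishes on the grid, so its
coefficients with index in \<open>F\<close> are of order \<open>\<epsilon>\<close>.  Inserting this in the column estimate and letting
\<open>\<epsilon>\<close> tend to \<open>0\<close> gives the claim.\<close>

lemma row_condition_if_pick_strict:
  fixes t :: "nat^'d \<Rightarrow> real"
  assumes pick: "complete_pick_pair X k l" and b: "b \<noteq> 0"
    and t0: "\<And>c. c < b \<Longrightarrow> 0 \<le> t c \<and> conv t kc c < lc c"
  shows "(\<Sum>a | a < b. t a * kc (b - a)) \<le> lc b"
proof -
  define F where "F = {a. a < b}"
  have F: "finite F" "co_invariant F" using co_invariant_less[OF b] by (auto simp: F_def)
  have t: "0 \<le> t a" "conv t kc a < lc a" if "a \<in> F" for a using t0 that by (auto simp: F_def)
  define J where "J = card F"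
  have J: "1 \<le> J" using F co_invariant_zero[OF F(2)] unfolding J_def by (metis One_nat_def Suc_leI card_gt_0_iff empty_iff)
  obtain e where e: "bij_betw e {..<J} F" using ex_bij_betw_nat_finite[OF F(1)] by (auto simp: J_def atLeast0LessThan)
  obtain \<epsilon>0 where \<epsilon>0: "0 < \<epsilon>0" and psd: "\<And>\<epsilon>. 0 < \<epsilon> \<Longrightarrow> \<epsilon> \<le> \<epsilon>0 \<Longrightarrow> (\<forall>a\<in>F. grid_point \<epsilon> a \<in> X) \<and>
    block_psd {..<J} J (\<lambda>i j. l (grid_point \<epsilon> (e i)) (grid_point \<epsilon> (e j)) \<cdot>\<^sub>m 1\<^sub>m J
      - k (grid_point \<epsilon> (e i)) (grid_point \<epsilon> (e j)) \<cdot>\<^sub>m (grid_matrix t J e \<epsilon> i * mat_adjoint (grid_matrix t J e \<epsilon> j)))"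
    using grid_pick_matrix_psd[OF F t e] by blast
  obtain C R where C: "0 \<le> C" and R: "1 \<le> R"
    and cb: "\<And>N c g i j. contractive_symbol N c \<Longrightarrow> i < N \<Longrightarrow> j < N \<Longrightarrow> cmod (c g i j) \<le> C * R ^ deg g"
    using symbol_coefficient_bound by blast
  have R0: "0 \<le> R" using R by simp
  define \<tau> where "\<tau> a = the_inv_into {..<J} e a" for a
  have \<tau>: "\<tau> a < J" "e (\<tau> a) = a" if "a \<in> F" for a
    using that the_inv_into_into[OF bij_betw_imp_inj_on[OF e], of a "{..<J}"] f_the_inv_into_f_bij_betw[OF e, of a]
      bij_betw_imp_surj_on[OF e] by (auto simp: \<tau>_def)
  have "\<forall>a. \<exists>K \<delta>. a \<in> F \<longrightarrow> 0 < \<delta> \<and> (\<forall>\<epsilon> c \<Phi>. 0 < \<epsilon> \<longrightarrow> \<epsilon> \<le> \<delta> \<longrightarrow> \<epsilon> \<le> \<epsilon>0 \<longrightarrow> contractive_symbol J c \<longrightarrow>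
      symbol_series J c \<Phi> \<longrightarrow> (\<forall>i<J. \<Phi> (grid_point \<epsilon> (e i)) = grid_matrix t J e \<epsilon> i) \<longrightarrow>
      sqrt (t a) \<le> cmod (c a (\<tau> a) 0) + K * \<epsilon>)"
  proof
    fix a :: "nat^'d"
    show "\<exists>K \<delta>. a \<in> F \<longrightarrow> 0 < \<delta> \<and> (\<forall>\<epsilon> c \<Phi>. 0 < \<epsilon> \<longrightarrow> \<epsilon> \<le> \<delta> \<longrightarrow> \<epsilon> \<le> \<epsilon>0 \<longrightarrow> contractive_symbol J c \<longrightarrow>
      symbol_series J c \<Phi> \<longrightarrow> (\<forall>i<J. \<Phi> (grid_point \<epsilon> (e i)) = grid_matrix t J e \<epsilon> i) \<longrightarrow>
      sqrt (t a) \<le> cmod (c a (\<tau> a) 0) + K * \<epsilon>)"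
    proof (cases "a \<in> F")
      case True
      define C' where "C' = C + sqrt (t a)"
      have C': "0 \<le> C'" using C t(1)[OF True] by (simp add: C'_def)
      from finite_difference_extracts_coefficient[OF R0 C', of a]
      obtain K \<delta> where \<delta>: "0 < \<delta>" and K: "\<forall>\<epsilon> (d :: nat^'d \<Rightarrow> complex) D. 0 < \<epsilon> \<longrightarrow> \<epsilon> \<le> \<delta> \<longrightarrow>
        (\<forall>b. cmod (d b) \<le> C' * R ^ deg b) \<longrightarrow>
        (\<forall>c\<le>a. ((\<lambda>b. d b * monomial (grid_point \<epsilon> c) b) has_sum D c) UNIV) \<longrightarrow>
        cmod ((\<Sum>c | c \<le> a. of_real (fd_weight a c) * D c) - of_real (\<epsilon> ^ deg a) * d a) \<le> K * \<epsilon> ^ (deg a + 1)"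
        by (elim exE conjE) (rule that)
      have key: "sqrt (t a) \<le> cmod (c a (\<tau> a) 0) + K * \<epsilon>"
        if \<epsilon>: "0 < \<epsilon>" "\<epsilon> \<le> \<delta>" "\<epsilon> \<le> \<epsilon>0" and c: "contractive_symbol J c" and \<Phi>: "symbol_series J c \<Phi>"
          and val: "\<forall>i<J. \<Phi> (grid_point \<epsilon> (e i)) = grid_matrix t J e \<epsilon> i" for \<epsilon> c \<Phi>
      proof -
        (* The coefficients of the series minus those of the polynomial; tau a is the entry that belongs to a. *)
        define d where "d b' = cnj (c b' (\<tau> a) 0) - (if b' = a then complex_of_real (sqrt (t a)) else 0)" for b'
        have "cmod (d b') \<le> C' * R ^ deg b'" for b'
        proof -
          have "cmod (d b') \<le> cmod (c b' (\<tau> a) 0) + cmod (if b' = a then complex_of_real (sqrt (t a)) else 0)"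
            unfolding d_def using norm_triangle_ineq4[of "cnj (c b' (\<tau> a) 0)"] by simp
          also have "\<dots> \<le> C * R ^ deg b' + sqrt (t a) * R ^ deg b'"
          proof (rule add_mono)
            show "cmod (c b' (\<tau> a) 0) \<le> C * R ^ deg b'" using cb[OF c] \<tau>(1)[OF True] J by simp
            have "sqrt (t a) * 1 \<le> sqrt (t a) * R ^ deg b'" using R t(1)[OF True] by (intro mult_left_mono) auto
            then show "cmod (if b' = a then complex_of_real (sqrt (t a)) else 0) \<le> sqrt (t a) * R ^ deg b'"
              using R0 t(1)[OF True] by (cases "b' = a") auto
          qed
          finally show ?thesis by (simp add: C'_def distrib_right)
        qed
        moreover have "((\<lambda>b'. d b' * monomial (grid_point \<epsilon> x) b') has_sum 0) UNIV" if x: "x \<le> a" for x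
        proof -
          have xF: "x \<in> F" using F(2) True x unfolding co_invariant_def by blast
          let ?z = "grid_point \<epsilon> x"
          have z: "?z \<in> X" using psd[OF \<epsilon>(1,3)] xF by blast
          have "\<Phi> ?z = grid_matrix t J e \<epsilon> (\<tau> x)" using val[rule_format, OF \<tau>(1)[OF xF]] \<tau>(2)[OF xF] by simp
          then have "\<Phi> ?z $$ (0, \<tau> a) = of_real (sqrt (t a)) * monomial ?z a"
            using J \<tau>[OF xF] \<tau>[OF True] by (simp add: grid_matrix_def)
          moreover have "((\<lambda>b'. monomial ?z b' * cnj (c b' (\<tau> a) 0)) has_sum \<Phi> ?z $$ (0, \<tau> a)) UNIV"
            using \<Phi> z J \<tau>(1)[OF True] unfolding symbol_series_def by simp
          ultimately have "((\<lambda>b'. monomial ?z b' * cnj (c b' (\<tau> a) 0)) has_sum of_real (sqrt (t a)) * monomial ?z a) UNIV" by simp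
          moreover have "((\<lambda>b'. if b' = a then of_real (sqrt (t a)) * monomial ?z a else 0)
              has_sum of_real (sqrt (t a)) * monomial ?z a) UNIV"
            by (rule has_sum_finite_neutralI[of "{a}"]) auto
          ultimately have "((\<lambda>b'. monomial ?z b' * cnj (c b' (\<tau> a) 0)
              + - (if b' = a then of_real (sqrt (t a)) * monomial ?z a else 0))
              has_sum of_real (sqrt (t a)) * monomial ?z a + - (of_real (sqrt (t a)) * monomial ?z a)) UNIV"
            by (intro has_sum_add has_sum_uminusI)
          moreover have "monomial ?z b' * cnj (c b' (\<tau> a) 0) + - (if b' = a then of_real (sqrt (t a)) * monomial ?z a else 0)
              = d b' * monomial ?z b'" for b'
            by (simp add: d_def algebra_simps)
          ultimately show ?thesis by simp
        qed
        ultimately have "cmod ((\<Sum>c | c \<le> a. of_real (fd_weight a c) * 0) - of_real (\<epsilon> ^ deg a) * d a) \<le> K * \<epsilon> ^ (deg a + 1)"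
          using K[rule_format, of \<epsilon> d "\<lambda>_. 0"] \<epsilon> by blast
        then have "\<epsilon> ^ deg a * cmod (d a) \<le> \<epsilon> ^ deg a * (K * \<epsilon>)"
          using \<epsilon> by (simp add: norm_mult norm_power mult_ac)
        then have "cmod (d a) \<le> K * \<epsilon>" using \<epsilon> by (simp add: mult_le_cancel_left_pos)
        moreover have "sqrt (t a) \<le> cmod (c a (\<tau> a) 0) + cmod (d a)"
        proof -
          have "complex_of_real (sqrt (t a)) = cnj (c a (\<tau> a) 0) - d a" by (simp add: d_def)
          then have "cmod (complex_of_real (sqrt (t a))) \<le> cmod (c a (\<tau> a) 0) + cmod (d a)"
            using norm_triangle_ineq4[of "cnj (c a (\<tau> a) 0)" "d a"] by simp
          then show ?thesis using t(1)[OF True] by simp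
        qed
        ultimately show ?thesis by simp
      qed
      show ?thesis
        by (intro exI[of _ K] exI[of _ \<delta>] impI conjI allI, rule \<delta>, rule key; assumption)
    qed blast
  qed
  from choice[OF this] obtain K where "\<forall>a. \<exists>\<delta>. a \<in> F \<longrightarrow> 0 < \<delta> \<and> (\<forall>\<epsilon> c \<Phi>. 0 < \<epsilon> \<longrightarrow> \<epsilon> \<le> \<delta> \<longrightarrow> \<epsilon> \<le> \<epsilon>0 \<longrightarrow> contractive_symbol J c \<longrightarrow>
      symbol_series J c \<Phi> \<longrightarrow> (\<forall>i<J. \<Phi> (grid_point \<epsilon> (e i)) = grid_matrix t J e \<epsilon> i) \<longrightarrow>
      sqrt (t a) \<le> cmod (c a (\<tau> a) 0) + K a * \<epsilon>)" ..
  from choice[OF this] obtain \<delta> where \<delta>0: "\<forall>a. a \<in> F \<longrightarrow> 0 < \<delta> a \<and> (\<forall>\<epsilon> c \<Phi>. 0 < \<epsilon> \<longrightarrow> \<epsilon> \<le> \<delta> a \<longrightarrow> \<epsilon> \<le> \<epsilon>0 \<longrightarrow> contractive_symbol J c \<longrightarrow>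
      symbol_series J c \<Phi> \<longrightarrow> (\<forall>i<J. \<Phi> (grid_point \<epsilon> (e i)) = grid_matrix t J e \<epsilon> i) \<longrightarrow>
      sqrt (t a) \<le> cmod (c a (\<tau> a) 0) + K a * \<epsilon>)" ..
  have \<delta>: "0 < \<delta> a" if "a \<in> F" for a using \<delta>0 that by blast
  define \<epsilon>1 where "\<epsilon>1 = Min (insert \<epsilon>0 (\<delta> ` F))"
  have \<epsilon>1: "0 < \<epsilon>1" "\<epsilon>1 \<le> \<epsilon>0" "\<And>a. a \<in> F \<Longrightarrow> \<epsilon>1 \<le> \<delta> a" using F(1) \<epsilon>0 \<delta> by (auto simp: \<epsilon>1_def)
  define A where "A = (\<Sum>a | a < b. t a * kc (b - a))"
  define B where "B = (\<Sum>a | a < b. 2 * sqrt (t a) * K a * kc (b - a))"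
  have "0 \<le> (lc b - A) + B * \<epsilon> + 0 * \<epsilon>\<^sup>2" if \<epsilon>: "0 < \<epsilon>" "\<epsilon> \<le> \<epsilon>1" for \<epsilon>
  proof -
    have \<epsilon>': "\<epsilon> \<le> \<epsilon>0" using \<epsilon> \<epsilon>1 by linarith
    have zX: "\<forall>i<J. grid_point \<epsilon> (e i) \<in> X" using psd[OF \<epsilon>(1) \<epsilon>'] bij_betwE[OF e] by auto
    have Wc: "\<forall>i<J. grid_matrix t J e \<epsilon> i \<in> carrier_mat J J" by (simp add: grid_matrix_def)
    from pick[unfolded complete_pick_pair_def, rule_format, OF J J, of "\<lambda>i. grid_point \<epsilon> (e i)" "grid_matrix t J e \<epsilon>"]
      zX Wc psd[OF \<epsilon>(1) \<epsilon>']
    obtain \<Phi> where \<Phi>: "contractive_multiplier X k l J \<Phi>" and val: "\<forall>i<J. \<Phi> (grid_point \<epsilon> (e i)) = grid_matrix t J e \<epsilon> i"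
      by blast
    obtain c where c: "symbol_series J c \<Phi>" using contractive_multiplier_has_symbol[OF \<Phi>] by blast
    note cs = contractive_multiplier_imp_symbol[OF \<Phi> c]
    have "A - B * \<epsilon> = (\<Sum>a | a < b. (t a - 2 * sqrt (t a) * (K a * \<epsilon>)) * kc (b - a))"
      unfolding A_def B_def sum_distrib_right sum_subtractf[symmetric]
      by (intro sum.cong) (simp_all add: algebra_simps)
    also have "\<dots> \<le> (\<Sum>a | a < b. (\<Sum>i<J. (cmod (c a i 0))\<^sup>2) * kc (b - a))"
    proof (rule sum_mono)
      fix a assume "a \<in> {a. a < b}"
      then have a: "a \<in> F" by (simp add: F_def)
      have s: "sqrt (t a) \<le> cmod (c a (\<tau> a) 0) + K a * \<epsilon>"
        using \<delta>0[rule_format, OF a, THEN conjunct2, rule_format, OF \<epsilon>(1) _ \<epsilon>' cs c] val \<epsilon> \<epsilon>1(3)[OF a] by auto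
      define x where "x = cmod (c a (\<tau> a) 0)"
      have "2 * sqrt (t a) * (sqrt (t a) - x) \<le> 2 * sqrt (t a) * (K a * \<epsilon>)"
        using s t(1)[OF a] by (intro mult_left_mono) (auto simp: x_def)
      moreover have "0 \<le> (sqrt (t a) - x)\<^sup>2" by simp
      moreover have "sqrt (t a) * sqrt (t a) = t a" using t(1)[OF a] by simp
      (* t a - 2 sqrt (t a) (sqrt (t a) - x) = x^2 - (sqrt (t a) - x)^2 is at most x^2. *)
      ultimately have "t a - 2 * sqrt (t a) * (K a * \<epsilon>) \<le> x\<^sup>2"
        by (simp add: power2_diff power2_eq_square[of "sqrt (t a)"] right_diff_distrib mult.assoc)
      also have "\<dots> \<le> (\<Sum>i<J. (cmod (c a i 0))\<^sup>2)"
        unfolding x_def using member_le_sum[of "\<tau> a" "{..<J}" "\<lambda>i. (cmod (c a i 0))\<^sup>2"] \<tau>(1)[OF a] by simp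
      finally show "(t a - 2 * sqrt (t a) * (K a * \<epsilon>)) * kc (b - a) \<le> (\<Sum>i<J. (cmod (c a i 0))\<^sup>2) * kc (b - a)"
        using kcp[of "b - a"] by (intro mult_right_mono) auto
    qed
    also have "\<dots> \<le> lc b" using contractive_symbol_row[OF cs, of 0 b] J by simp
    finally show ?thesis by simp
  qed
  from nonneg_of_small_perturbation[OF \<epsilon>1(1) this] show ?thesis by (simp add: A_def)
qed

text \<open>Scaling \<open>t\<close> by a factor \<open>s < 1\<close> makes the inequalities strict.\<close>

lemma row_condition_if_pick:
  assumes pick: "complete_pick_pair X k l" shows "row_condition kc lc"
  unfolding row_condition_def
proof (intro allI impI)
  fix b :: "nat^'d" and t :: "nat^'d \<Rightarrow> real"
  assume t: "\<forall>c<b. 0 \<le> t c \<and> conv t kc c \<le> lc c"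
  show "(\<Sum>a | a < b. t a * kc (b - a)) \<le> lc b"
  proof (cases "b = 0")
    case True
    then have "{a. a < b} = {}" by (auto simp: multi_less_iff)
    then show ?thesis using lcp[of b] by (simp add: less_imp_le)
  next
    case False
    have "s * (\<Sum>a | a < b. t a * kc (b - a)) \<le> lc b" if s: "0 < s" "s < 1" for s
    proof -
      have "(\<Sum>a | a < b. (s * t a) * kc (b - a)) \<le> lc b"
      proof (rule row_condition_if_pick_strict[OF pick False])
        fix c assume c: "c < b"
        have "conv (\<lambda>a. s * t a) kc c = s * conv t kc c" by (simp add: conv_def sum_distrib_left mult.assoc)
        also have "\<dots> \<le> s * lc c" using t c s by (intro mult_left_mono) auto
        also have "\<dots> < lc c" using s lcp[of c] by simp
        finally show "0 \<le> s * t c \<and> conv (\<lambda>a. s * t a) kc c < lc c" using t c s by auto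
      qed
      then show ?thesis by (simp add: sum_distrib_left mult.assoc)
    qed
    then show ?thesis by (rule field_le_mult_one_interval)
  qed
qed

theorem pick_iff_caratheodory: "complete_pick_pair X k l \<longleftrightarrow> complete_caratheodory_pair X k l kc lc"
  using row_condition_if_pick pick_if_row_condition row_condition_if_caratheodory caratheodory_if_row_condition by blast

end

theorem theorem1p7:
  fixes \<Omega> :: "(complex^'d) set"
    and k l :: "complex^'d \<Rightarrow> complex^'d \<Rightarrow> complex"
    and kc lc :: "nat^'d \<Rightarrow> real"
  assumes "open \<Omega>" and "connected \<Omega>" and "0 \<in> \<Omega>"
    and "diagonal_holomorphic_kernel \<Omega> k kc"
    and "diagonal_holomorphic_kernel \<Omega> l lc"
  shows "complete_pick_pair \<Omega> k l \<longleftrightarrow> complete_caratheodory_pair \<Omega> k l kc lc"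
proof -
  have ex: "\<exists>r. diagonal_kernel \<Omega> f fc r" if f: "diagonal_holomorphic_kernel \<Omega> f fc"
    for f :: "complex^'d \<Rightarrow> complex^'d \<Rightarrow> complex" and fc
  proof -
    from f obtain r where "0 < r" "ball 0 r \<subseteq> \<Omega>" "\<And>a. 0 < fc a"
      unfolding diagonal_holomorphic_kernel_def by blast
    then have "diagonal_kernel \<Omega> f fc r"
      using diagonal_kernel_expansion[OF assms(1-3) f] by unfold_locales
    then show ?thesis by blast
  qed
  obtain r1 r2 where r1: "diagonal_kernel \<Omega> k kc r1" and r2: "diagonal_kernel \<Omega> l lc r2"
    using ex[OF assms(4)] ex[OF assms(5)] by blast
  interpret diagonal_pair \<Omega> k l kc lc r1 r2
    by (rule diagonal_pair.intro[OF r1 r2])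
  show ?thesis by (rule pick_iff_caratheodory)
qed

end
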